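(* Let $\nu\ge 3$, $r\ge 2$, let $\mathcal{D}$ be the quasi-symmetric Siegel domain of type III$_{\nu,r}$, let $G$ be the universal covering group of $\mathrm{Aut}_{hol}(\mathcal{D})^o$, and let $B$ be a maximal connected triangular Lie subgroup of $G$. Let $c_1,c_1'\in(\mathfrak{z}_1^* )_{\mathbb{C}}$, $c_2,c_2'\in(\mathfrak{z}_2^* )_{\mathbb{C}}$, and let $(\Theta_2,V^{\Theta_2})$, $(\Theta_2',V^{\Theta_2'})$ be irreducible unitary representations of $SU(r)$. If $\pi_{c_1,c_2,\Theta_2}$ and $\pi_{c_1',c_2',\Theta_2'}$ are unitarizable, then the following conditions are equivalent: 1. $\pi_{c_1,c_2,\Theta_2}\simeq\pi_{c_1',c_2',\Theta_2'}$ (as unitary representations of $G$); 2. $\tau_{c_1}|_B\simeq\tau_{c_1'}|_B$ (as unitary representations of $B$), $c_2=c_2'$, and $\Theta_2\simeq\Theta_2'$.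
   Context: Domain: $\Omega\subset\mathrm{Sym}_\nu(\mathbb{R})$ is the set of positive-definite matrices, $Q(U,V):=(U\,\overline{{}^tV}+\overline{V}\,{}^tU)/4$ for $U,V\in\mathrm{Mat}_{\nu,r}(\mathbb{C})$, and $$\mathcal{D}:=\{(Z,V)\in\mathrm{Sym}_\nu(\mathbb{C})\times\mathrm{Mat}_{\nu,r}(\mathbb{C})\mid \mathrm{Im}\,Z-Q(V,V)\in\Omega\}.$$ $\mathrm{Aut}_{hol}(\mathcal{D})^o$ is the identity component of its holomorphic automorphism group. Lie algebra: for $T\in\mathfrak{gl}(\nu,\mathbb{R})$, $K\in\mathfrak{u}(r)$, $V\in\mathrm{Mat}_{\nu,r}(\mathbb{C})$, $U\in\mathrm{Sym}_\nu(\mathbb{R})$ put $$\iota(T,K,V,U)=\begin{pmatrix}\mathrm{Re}K&0&-\mathrm{Im}K&\mathrm{Re}\,{}^tV\\ \mathrm{Im}V&T&\mathrm{Re}V&U\\ \mathrm{Im}K&0&\mathrm{Re}K&-\mathrm{Im}\,{}^tV\\ 0&0&0&-{}^tT\end{pmatrix}\in\mathrm{Mat}_{2(\nu+r)}(\mathbb{R}),$$ and let $\widetilde{\mathfrak{g}}$ be the linear Lie algebra of all such matrices. $\mathrm{Lie}(\mathrm{Aut}_{hol}(\mathcal{D}))$ is identified with $\widetilde{\mathfrak{g}}$ so that $\iota(T,0,0,0)$, $\iota(0,K,0,0)$, $\iota(0,0,V_0,0)$, $\iota(0,0,0,U)$ exponentiate respectively to the automorphisms $(Z,V)\mapsto(e^TZ\,{}^t(e^T),e^TV)$;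 $(Z,V)\mapsto(Z,Ve^{-K})$; $(Z,V)\mapsto(Z+2iQ(V,V_0)+iQ(V_0,V_0),V+V_0)$; $(Z,V)\mapsto(Z+U,V)$. $G$ is the connected, simply connected Lie group with Lie algebra $\widetilde{\mathfrak{g}}$, and $p:G\to\mathrm{Aut}_{hol}(\mathcal{D})^o$ is the covering homomorphism. A connected Lie subgroup of $G$ is triangular if its adjoint action on $\widetilde{\mathfrak{g}}$ is simultaneously triangularizable over $\mathbb{R}$; $B$ is maximal among such subgroups. Projections and characters: $\mathfrak{z}_1:=\{\iota(aI_\nu,0,0,0)\mid a\in\mathbb{R}\}$ is the center of $\{\iota(T,0,0,0)\mid T\in\mathfrak{gl}(\nu,\mathbb{R})\}$, and $\mathfrak{z}_2:=\{\iota(0,iaI_r,0,0)\mid a\in\mathbb{R}\}$ is the center of $\{\iota(0,K,0,0)\mid K\in\mathfrak{u}(r)\}$. The maps $p_{1,1}:G\to\exp(\mathfrak{z}_1)\simeq\mathbb{R}$, $p_{2,1}:G\to\exp(\mathfrak{z}_2)\simeq\mathbb{R}$ (subgroups of the simply connected group $G$) and $p_2:G\to SU(r)$ are the natural projection homomorphisms, with differentials $\iota(T,K,V,U)\mapsto\iota(\tfrac{\mathrm{tr}\,T}{\nu}I_\nu,0,0,0)$, $\iota(T,K,V,U)\mapsto\iota(0,\tfrac{\mathrm{tr}\,K}{r}I_r,0,0)$ and $\iota(T,K,V,U)\mapsto K-\tfrac{\mathrm{tr}\,K}{r}I_r$. For a complex-valued linear form $c_k\in(\mathfrak{z}_k^*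 )_{\mathbb{C}}$, $(\exp x)^{c_k}:=e^{\langle c_k,x\rangle}$ for $x\in\mathfrak{z}_k$. Representations: $\Gamma^{hol}(\mathcal{D},\mathcal{D}\times W)$ is the space of holomorphic functions $\mathcal{D}\to W$. $\pi_{c_1,c_2,\Theta_2}$ is the representation of $G$ on $\Gamma^{hol}(\mathcal{D},\mathcal{D}\times V^{\Theta_2})$ given by $$\pi_{c_1,c_2,\Theta_2}(g)f(z)=(p_{1,1}(g))^{c_1}(p_{2,1}(g))^{c_2}\Theta_2(p_2(g))f(p(g^{-1})z),$$ and, for $c\in(\mathfrak{z}_1^* )_{\mathbb{C}}$, $\tau_c$ is the representation of $G$ on $\Gamma^{hol}(\mathcal{D},\mathcal{D}\times\mathbb{C})$ given by $\tau_c(g)f(z)=(p_{1,1}(g))^{c}f(p(g^{-1})z)$. Unitarization: such a representation is unitarizable if there is a nonzero $G$-invariant Hilbert space contained in, and continuously embedded in, the space of holomorphic functions (topology of uniform convergence on compact sets) on which $G$ acts unitarily; the resulting unitary representation is called a unitarization. It is irreducible and unique up to equivalence, and $\pi_{c_1,c_2,\Theta_2}$ unitarizable implies $\tau_{c_1}$ unitarizable. Convention: the same symbol denotes the representation and its unitarization, so in conditions 1 and 2 the symbols $\pi_{c_1,c_2,\Theta_2}$ and $\tau_{c_1}$ (and their primed versions) denote the unitarizations, $\tau_{c_1}|_B$ is the restriction of the unitarization to $B$, and $\simeq$ is unitary equivalence. *)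

theory Defs
  imports "HOL-Analysis.Analysis" "HOL-Algebra.Bij" "HOL-Algebra.Generated_Groups"
begin

section \<open>Complex normed vector spaces and holomorphic maps\<close>

class complex_normed_vector = real_normed_vector +
  fixes scaleC :: "complex \<Rightarrow> 'a \<Rightarrow> 'a"  (infixr "*\<^sub>C" 75)
  assumes scaleC_add_right: "c *\<^sub>C (x + y) = c *\<^sub>C x + c *\<^sub>C y"
    and scaleC_add_left: "(c + d) *\<^sub>C x = c *\<^sub>C x + d *\<^sub>C x"
    and scaleC_scaleC: "c *\<^sub>C d *\<^sub>C x = (c * d) *\<^sub>C x"
    and scaleC_of_real: "complex_of_real a *\<^sub>C x = a *\<^sub>R x"
    and norm_scaleC: "norm (c *\<^sub>C x) = cmod c * norm x"

instantiation complex :: complex_normed_vector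
begin
definition scaleC_complex :: "complex \<Rightarrow> complex \<Rightarrow> complex"
  where "c *\<^sub>C z = c * z"
instance
  by standard (simp_all add: scaleC_complex_def algebra_simps norm_mult scaleR_conv_of_real)
end

instantiation vec :: (complex_normed_vector, finite) complex_normed_vector
begin
definition scaleC_vec :: "complex \<Rightarrow> ('a, 'b) vec \<Rightarrow> ('a, 'b) vec"
  where "c *\<^sub>C x = (\<chi> i. c *\<^sub>C (x $ i))"
instance
  by standard
    (simp_all add: scaleC_vec_def vec_eq_iff scaleC_add_right scaleC_add_left scaleC_scaleC
      scaleC_of_real norm_vec_def norm_scaleC L2_set_right_distrib)
end

instantiation prod :: (complex_normed_vector, complex_normed_vector) complex_normed_vector
begin
definition scaleC_prod :: "complex \<Rightarrow> 'a \<times> 'b \<Rightarrow> 'a \<times> 'b"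
  where "c *\<^sub>C x = (c *\<^sub>C fst x, c *\<^sub>C snd x)"
instance
proof
  fix c :: complex and x :: "'a \<times> 'b"
  have "sqrt ((cmod c * a)\<^sup>2 + (cmod c * b)\<^sup>2) = cmod c * sqrt (a\<^sup>2 + b\<^sup>2)" for a b :: real
    by (simp add: power_mult_distrib flip: distrib_left add: real_sqrt_mult)
  then show "norm (c *\<^sub>C x) = cmod c * norm x"
    by (simp add: scaleC_prod_def norm_prod_def norm_scaleC)
qed (auto simp: scaleC_prod_def prod_eq_iff scaleC_add_right scaleC_add_left scaleC_scaleC
      scaleC_of_real)
end

text \<open>Complex differentiability in several variables. The set \<open>D\<close> need only be open in a complex
  linear subspace of the ambient type (below: symmetric matrices in the first component), which
  is why the derivative is taken within \<open>D\<close>.\<close>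

definition holomorphic_map_on ::
    "('a::complex_normed_vector \<Rightarrow> 'b::complex_normed_vector) \<Rightarrow> 'a set \<Rightarrow> bool"
  where "holomorphic_map_on f D \<longleftrightarrow>
    (\<forall>z\<in>D. \<exists>F. (f has_derivative F) (at z within D) \<and> (\<forall>c x. F (c *\<^sub>C x) = c *\<^sub>C F x))"

text \<open>Functions on \<open>D\<close> are extended by zero, so that the pointwise operations of the whole function
  type are the vector space operations.\<close>

definition holomorphic_functions ::
    "'a::complex_normed_vector set \<Rightarrow> ('a \<Rightarrow> 'b::complex_normed_vector) set"
  where "holomorphic_functions D = {f. holomorphic_map_on f D \<and> (\<forall>z. z \<notin> D \<longrightarrow> f z = 0)}"


section \<open>The holomorphic automorphism group of a domain\<close>

definition Aut_hol :: "'a::complex_normed_vector set \<Rightarrow> ('a \<Rightarrow> 'a) set"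
  where "Aut_hol D =
    {f \<in> Bij D. holomorphic_map_on f D \<and> holomorphic_map_on (inv_into D f) D}"

definition Aut_hol_topology :: "'a::complex_normed_vector set \<Rightarrow> ('a \<Rightarrow> 'a) topology"
  where "Aut_hol_topology D =
    topology_generated_by
      {{f \<in> Aut_hol D. f ` K \<subseteq> U} |K U. compact K \<and> K \<subseteq> D \<and> open U}"

definition Aut_hol_0 :: "'a::complex_normed_vector set \<Rightarrow> ('a \<Rightarrow> 'a) set"
  where "Aut_hol_0 D = connected_component_of_set (Aut_hol_topology D) (\<lambda>z\<in>D. z)"


section \<open>Universal covering groups\<close>

definition topological_group :: "('g, 'b) monoid_scheme \<Rightarrow> 'g topology \<Rightarrow> bool"
  where "topological_group G T \<longleftrightarrow>
    group G \<and> topspace T = carrier G \<and>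
    continuous_map (prod_topology T T) T (\<lambda>(g, h). g \<otimes>\<^bsub>G\<^esub> h) \<and>
    continuous_map T T (\<lambda>g. inv\<^bsub>G\<^esub> g)"

definition simply_connected_space :: "'a topology \<Rightarrow> bool"
  where "simply_connected_space T \<longleftrightarrow>
    path_connected_space T \<and>
    (\<forall>q. pathin T q \<and> q 0 = q 1 \<longrightarrow>
      (\<exists>a\<in>topspace T.
        homotopic_with (\<lambda>h. h 0 = h 1) (top_of_set {0..1::real}) T q (\<lambda>_. a)))"

definition covering_map :: "'a topology \<Rightarrow> 'b topology \<Rightarrow> ('a \<Rightarrow> 'b) \<Rightarrow> bool"
  where "covering_map X Y p \<longleftrightarrow>
    continuous_map X Y p \<and> p ` topspace X = topspace Y \<and>
    (\<forall>y\<in>topspace Y. \<exists>V. openin Y V \<and> y \<in> V \<and>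
      (\<exists>\<W>. \<Union>\<W> = {x \<in> topspace X. p x \<in> V} \<and> (\<forall>W\<in>\<W>. openin X W) \<and>
        pairwise disjnt \<W> \<and>
        (\<forall>W\<in>\<W>. homeomorphic_map (subtopology X W) (subtopology Y V) p)))"

definition universal_covering_of_Aut ::
    "'a::complex_normed_vector set \<Rightarrow> 'g monoid \<Rightarrow> 'g topology \<Rightarrow> ('g \<Rightarrow> 'a \<Rightarrow> 'a) \<Rightarrow> bool"
  where "universal_covering_of_Aut D G T p \<longleftrightarrow>
    topological_group G T \<and> simply_connected_space T \<and>
    p \<in> hom G (BijGroup D \<lparr>carrier := Aut_hol_0 D\<rparr>) \<and>
    covering_map T (subtopology (Aut_hol_topology D) (Aut_hol_0 D)) p"


section \<open>The Siegel domain\<close>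

type_synonym ('n, 'r) point = "(complex^'n^'n) \<times> (complex^'r^'n)"

abbreviation cmat :: "real^'c^'b \<Rightarrow> complex^'c^'b"
  where "cmat \<equiv> map_matrix complex_of_real"

definition adjoint_matrix :: "complex^'c^'b \<Rightarrow> complex^'b^'c"
  where "adjoint_matrix A = transpose (map_matrix cnj A)"

definition pos_def_matrices :: "(real^'n^'n) set"
  where "pos_def_matrices = {Y. transpose Y = Y \<and> (\<forall>x. x \<noteq> 0 \<longrightarrow> x \<bullet> (Y *v x) > 0)}"

definition Q :: "complex^'r^'n \<Rightarrow> complex^'r^'n \<Rightarrow> complex^'n^'n"
  where "Q U V = (1/4) *\<^sub>C (U ** adjoint_matrix V + map_matrix cnj V ** transpose U)"

definition siegel_domain :: "('n::finite, 'r::finite) point set"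
  where "siegel_domain =
    {(Z, V). transpose Z = Z \<and> cmat (map_matrix Im Z) - Q V V \<in> cmat ` pos_def_matrices}"


section \<open>The Lie algebra\<close>

text \<open>The index type is the disjoint union of four blocks of sizes \<open>r\<close>, \<open>\<nu>\<close>, \<open>r\<close>, \<open>\<nu>\<close>.\<close>

type_synonym ('n, 'r) lie_matrix =
  "real^(('r + 'n) + ('r + 'n))^(('r + 'n) + ('r + 'n))"

definition iota :: "real^'n^'n \<Rightarrow> complex^'r^'r \<Rightarrow> complex^'r^'n \<Rightarrow> real^'n^'n
    \<Rightarrow> ('n::finite, 'r::finite) lie_matrix"
  where "iota T K V U = (\<chi> a b. case a of
      Inl (Inl i) \<Rightarrow> (case b of
          Inl (Inl j) \<Rightarrow> Re (K $ i $ j)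
        | Inl (Inr j) \<Rightarrow> 0
        | Inr (Inl j) \<Rightarrow> - Im (K $ i $ j)
        | Inr (Inr j) \<Rightarrow> Re (V $ j $ i))
    | Inl (Inr i) \<Rightarrow> (case b of
          Inl (Inl j) \<Rightarrow> Im (V $ i $ j)
        | Inl (Inr j) \<Rightarrow> T $ i $ j
        | Inr (Inl j) \<Rightarrow> Re (V $ i $ j)
        | Inr (Inr j) \<Rightarrow> U $ i $ j)
    | Inr (Inl i) \<Rightarrow> (case b of
          Inl (Inl j) \<Rightarrow> Im (K $ i $ j)
        | Inl (Inr j) \<Rightarrow> 0
        | Inr (Inl j) \<Rightarrow> Re (K $ i $ j)
        | Inr (Inr j) \<Rightarrow> - Im (V $ j $ i))
    | Inr (Inr i) \<Rightarrow> (case b of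
          Inl (Inl j) \<Rightarrow> 0
        | Inl (Inr j) \<Rightarrow> 0
        | Inr (Inl j) \<Rightarrow> 0
        | Inr (Inr j) \<Rightarrow> - (T $ j $ i)))"

definition skew_hermitian :: "(complex^'r^'r) set"
  where "skew_hermitian = {K. adjoint_matrix K = - K}"

definition sym_real :: "(real^'n^'n) set"
  where "sym_real = {U. transpose U = U}"

definition gtilde :: "('n::finite, 'r::finite) lie_matrix set"
  where "gtilde = {iota T K V U |T K V U. K \<in> skew_hermitian \<and> U \<in> sym_real}"

definition lie_subalgebra :: "('n::finite, 'r::finite) lie_matrix set \<Rightarrow> bool"
  where "lie_subalgebra \<h> \<longleftrightarrow> subspace \<h> \<and> \<h> \<subseteq> gtilde \<and>
    (\<forall>X\<in>\<h>. \<forall>Y\<in>\<h>. X ** Y - Y ** X \<in> \<h>)"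

definition z1 :: "('n::finite, 'r::finite) lie_matrix set"
  where "z1 = {iota (mat a) 0 0 0 |a. True}"

definition z2 :: "('n::finite, 'r::finite) lie_matrix set"
  where "z2 = {iota 0 (mat (\<i> * complex_of_real a)) 0 0 |a. True}"

text \<open>The space of complex-valued real-linear forms on a real subspace; being extensional, two forms
  are equal as HOL functions iff they agree on the subspace.\<close>

definition complex_dual :: "'a::real_vector set \<Rightarrow> ('a \<Rightarrow> complex) set"
  where "complex_dual S = {c \<in> extensional S.
    (\<forall>x\<in>S. \<forall>y\<in>S. c (x + y) = c x + c y) \<and> (\<forall>x\<in>S. \<forall>a. c (a *\<^sub>R x) = a *\<^sub>R c x)}"


section \<open>Exponential map, adjoint action and triangular subgroups\<close>

text \<open>The real-linear identification of the Lie algebra with complete holomorphic vector fields on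
  the domain, \<open>X \<mapsto> d/dt exp (t X) z\<close> at \<open>t = 0\<close>. It is determined by the automorphisms
  \<open>exp (t X)\<close> for the four kinds of generators, which are respectively
  \<open>(Z, V) \<mapsto> (e\<^sup>t\<^sup>T Z (e\<^sup>t\<^sup>T)\<^sup>t, e\<^sup>t\<^sup>T V)\<close>, \<open>(Z, V) \<mapsto> (Z, V e\<^sup>-\<^sup>t\<^sup>K)\<close>,
  \<open>(Z, V) \<mapsto> (Z + 2 i t Q(V, V0) + i t\<^sup>2 Q(V0, V0), V + t V0)\<close> and \<open>(Z, V) \<mapsto> (Z + t U, V)\<close>.\<close>

definition lie_vector_field :: "real^'n^'n \<Rightarrow> complex^'r^'r \<Rightarrow> complex^'r^'n \<Rightarrow> real^'n^'n
    \<Rightarrow> ('n::finite, 'r::finite) point \<Rightarrow> ('n, 'r) point"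
  where "lie_vector_field T K V0 U = (\<lambda>(Z, V).
    (cmat T ** Z + Z ** transpose (cmat T) + (2 * \<i>) *\<^sub>C Q V V0 + cmat U,
     cmat T ** V - V ** K + V0))"

text \<open>\<open>\<gamma>\<close> is the one-parameter subgroup of \<open>G\<close> with initial velocity \<open>X\<close>: its image under \<open>p\<close> is the
  flow of the vector field belonging to \<open>X\<close>.\<close>

definition one_parameter_subgroup ::
    "'g monoid \<Rightarrow> 'g topology \<Rightarrow> ('g \<Rightarrow> ('n::finite, 'r::finite) point \<Rightarrow> ('n, 'r) point)
      \<Rightarrow> ('n, 'r) lie_matrix \<Rightarrow> (real \<Rightarrow> 'g) \<Rightarrow> bool"
  where "one_parameter_subgroup G T p X \<gamma> \<longleftrightarrow>
    continuous_map euclideanreal T \<gamma> \<and> (\<forall>s t. \<gamma> (s + t) = \<gamma> s \<otimes>\<^bsub>G\<^esub> \<gamma> t) \<and>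
    (\<exists>S K V U. X = iota S K V U \<and> K \<in> skew_hermitian \<and> U \<in> sym_real \<and>
      (\<forall>z\<in>siegel_domain. \<forall>t.
        ((\<lambda>s. p (\<gamma> s) z) has_vector_derivative lie_vector_field S K V U (p (\<gamma> t) z)) (at t)))"

definition lie_exp ::
    "'g monoid \<Rightarrow> 'g topology \<Rightarrow> ('g \<Rightarrow> ('n::finite, 'r::finite) point \<Rightarrow> ('n, 'r) point)
      \<Rightarrow> ('n, 'r) lie_matrix \<Rightarrow> 'g"
  where "lie_exp G T p X = (THE \<gamma>. one_parameter_subgroup G T p X \<gamma>) 1"

definition Ad ::
    "'g monoid \<Rightarrow> 'g topology \<Rightarrow> ('g \<Rightarrow> ('n::finite, 'r::finite) point \<Rightarrow> ('n, 'r) point)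
      \<Rightarrow> 'g \<Rightarrow> ('n, 'r) lie_matrix \<Rightarrow> ('n, 'r) lie_matrix"
  where "Ad G T p g X = (THE Y. Y \<in> gtilde \<and>
    (\<forall>t. g \<otimes>\<^bsub>G\<^esub> lie_exp G T p (t *\<^sub>R X) \<otimes>\<^bsub>G\<^esub> inv\<^bsub>G\<^esub> g = lie_exp G T p (t *\<^sub>R Y)))"

text \<open>Connected (not necessarily closed) Lie subgroups correspond to subalgebras of the Lie algebra.\<close>

definition connected_lie_subgroup ::
    "'g monoid \<Rightarrow> 'g topology \<Rightarrow> ('g \<Rightarrow> ('n::finite, 'r::finite) point \<Rightarrow> ('n, 'r) point)
      \<Rightarrow> 'g set \<Rightarrow> bool"
  where "connected_lie_subgroup G T p B \<longleftrightarrow>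
    (\<exists>\<h>. lie_subalgebra \<h> \<and> B = generate G (lie_exp G T p ` \<h>))"

definition triangular_subgroup ::
    "'g monoid \<Rightarrow> 'g topology \<Rightarrow> ('g \<Rightarrow> ('n::finite, 'r::finite) point \<Rightarrow> ('n, 'r) point)
      \<Rightarrow> 'g set \<Rightarrow> bool"
  where "triangular_subgroup G T p B \<longleftrightarrow>
    connected_lie_subgroup G T p B \<and>
    (\<exists>bs. distinct bs \<and> independent (set bs) \<and> span (set bs) = gtilde \<and>
      (\<forall>b\<in>B. \<forall>j<length bs. Ad G T p b (bs ! j) \<in> span (set (take (Suc j) bs))))"

definition maximal_triangular_subgroup ::
    "'g monoid \<Rightarrow> 'g topology \<Rightarrow> ('g \<Rightarrow> ('n::finite, 'r::finite) point \<Rightarrow> ('n, 'r) point)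
      \<Rightarrow> 'g set \<Rightarrow> bool"
  where "maximal_triangular_subgroup G T p B \<longleftrightarrow>
    triangular_subgroup G T p B \<and>
    (\<forall>B'. triangular_subgroup G T p B' \<and> B \<subseteq> B' \<longrightarrow> B' = B)"


section \<open>Projections, characters and representations of the special unitary group\<close>

definition SU :: "(complex^'r^'r) monoid"
  where "SU = \<lparr>carrier = {A. adjoint_matrix A ** A = mat 1 \<and> det A = 1},
    mult = (**), one = mat 1\<rparr>"

text \<open>A homomorphism \<open>\<phi>\<close> of \<open>G\<close> into itself has differential \<open>L\<close> iff \<open>\<phi> \<circ> exp = exp \<circ> L\<close>; for the
  matrix-valued projection the differential is the derivative along one-parameter subgroups.\<close>

definition is_p11 ::
    "'g monoid \<Rightarrow> 'g topology \<Rightarrow> ('g \<Rightarrow> ('n::finite, 'r::finite) point \<Rightarrow> ('n, 'r) point)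
      \<Rightarrow> ('g \<Rightarrow> 'g) \<Rightarrow> bool"
  where "is_p11 G T p \<phi> \<longleftrightarrow>
    \<phi> \<in> hom G (G \<lparr>carrier := lie_exp G T p ` z1\<rparr>) \<and> continuous_map T T \<phi> \<and>
    (\<forall>S K V U. K \<in> skew_hermitian \<and> U \<in> sym_real \<longrightarrow>
      \<phi> (lie_exp G T p (iota S K V U)) =
        lie_exp G T p (iota (mat (trace S / real CARD('n))) 0 0 0))"

definition is_p21 ::
    "'g monoid \<Rightarrow> 'g topology \<Rightarrow> ('g \<Rightarrow> ('n::finite, 'r::finite) point \<Rightarrow> ('n, 'r) point)
      \<Rightarrow> ('g \<Rightarrow> 'g) \<Rightarrow> bool"
  where "is_p21 G T p \<phi> \<longleftrightarrow>
    \<phi> \<in> hom G (G \<lparr>carrier := lie_exp G T p ` z2\<rparr>) \<and> continuous_map T T \<phi> \<and>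
    (\<forall>S K V U. K \<in> skew_hermitian \<and> U \<in> sym_real \<longrightarrow>
      \<phi> (lie_exp G T p (iota S K V U)) =
        lie_exp G T p (iota 0 (mat (trace K / of_nat CARD('r))) 0 0))"

definition is_p2 ::
    "'g monoid \<Rightarrow> 'g topology \<Rightarrow> ('g \<Rightarrow> ('n::finite, 'r::finite) point \<Rightarrow> ('n, 'r) point)
      \<Rightarrow> ('g \<Rightarrow> complex^'r^'r) \<Rightarrow> bool"
  where "is_p2 G T p \<phi> \<longleftrightarrow>
    \<phi> \<in> hom G SU \<and> continuous_map T euclidean \<phi> \<and>
    (\<forall>S K V U. K \<in> skew_hermitian \<and> U \<in> sym_real \<longrightarrow>
      ((\<lambda>t. \<phi> (lie_exp G T p (t *\<^sub>R iota S K V U))) has_vector_derivative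
        K - mat (trace K / of_nat CARD('r))) (at 0))"

text \<open>\<open>y\<^sup>c = e\<^bsup>c(x)\<^esup>\<close> for \<open>y = exp x\<close> with \<open>x \<in> \<z>\<close>, where \<open>\<z>\<close> is \<open>z1\<close> or \<open>z2\<close> (on both of these
  the exponential map of the simply connected group is injective).\<close>

definition cpower ::
    "'g monoid \<Rightarrow> 'g topology \<Rightarrow> ('g \<Rightarrow> ('n::finite, 'r::finite) point \<Rightarrow> ('n, 'r) point)
      \<Rightarrow> ('n, 'r) lie_matrix set \<Rightarrow> 'g \<Rightarrow> (('n, 'r) lie_matrix \<Rightarrow> complex) \<Rightarrow> complex"
  where "cpower G T p \<z> y c = exp (c (inv_into \<z> (lie_exp G T p) y))"

text \<open>Irreducible unitary representations of a compact group are finite-dimensional; the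
  representation space is taken to be \<open>\<complex>\<^sup>d\<close> with the standard Hermitian inner product.\<close>

definition unitary_matrix :: "complex^'d^'d \<Rightarrow> bool"
  where "unitary_matrix A \<longleftrightarrow> adjoint_matrix A ** A = mat 1"

definition irreducible_unitary_rep :: "(complex^'r^'r \<Rightarrow> complex^'d^'d) \<Rightarrow> bool"
  where "irreducible_unitary_rep \<Theta> \<longleftrightarrow>
    (\<forall>A\<in>carrier SU. unitary_matrix (\<Theta> A)) \<and>
    (\<forall>A\<in>carrier SU. \<forall>B\<in>carrier SU. \<Theta> (A ** B) = \<Theta> A ** \<Theta> B) \<and>
    continuous_on (carrier SU) \<Theta> \<and>
    (\<forall>W. 0 \<in> W \<and> (\<forall>x\<in>W. \<forall>y\<in>W. x + y \<in> W) \<and> (\<forall>c. \<forall>x\<in>W. c *\<^sub>C x \<in> W) \<and>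
      (\<forall>A\<in>carrier SU. \<forall>x\<in>W. \<Theta> A *v x \<in> W) \<longrightarrow> W = {0} \<or> W = UNIV)"

definition SU_rep_equiv ::
    "(complex^'r^'r \<Rightarrow> complex^'d^'d) \<Rightarrow> (complex^'r^'r \<Rightarrow> complex^'e^'e) \<Rightarrow> bool"
  where "SU_rep_equiv \<Theta> \<Theta>' \<longleftrightarrow>
    (\<exists>L :: complex^'d^'e. adjoint_matrix L ** L = mat 1 \<and> L ** adjoint_matrix L = mat 1 \<and>
      (\<forall>A\<in>carrier SU. L ** \<Theta> A = \<Theta>' A ** L))"


section \<open>Representations on holomorphic functions and their unitarizations\<close>

definition pi_rep ::
    "'g monoid \<Rightarrow> 'g topology \<Rightarrow> ('g \<Rightarrow> ('n::finite, 'r::finite) point \<Rightarrow> ('n, 'r) point)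
      \<Rightarrow> ('g \<Rightarrow> 'g) \<Rightarrow> ('g \<Rightarrow> 'g) \<Rightarrow> ('g \<Rightarrow> complex^'r^'r)
      \<Rightarrow> (('n, 'r) lie_matrix \<Rightarrow> complex) \<Rightarrow> (('n, 'r) lie_matrix \<Rightarrow> complex)
      \<Rightarrow> (complex^'r^'r \<Rightarrow> complex^'d^'d)
      \<Rightarrow> 'g \<Rightarrow> (('n, 'r) point \<Rightarrow> complex^'d) \<Rightarrow> ('n, 'r) point \<Rightarrow> complex^'d"
  where "pi_rep G T p p11 p21 p2 c1 c2 \<Theta> g f = (\<lambda>z. if z \<in> siegel_domain
    then (cpower G T p z1 (p11 g) c1 * cpower G T p z2 (p21 g) c2)
           *\<^sub>C (\<Theta> (p2 g) *v f (p (inv\<^bsub>G\<^esub> g) z))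
    else 0)"

definition tau_rep ::
    "'g monoid \<Rightarrow> 'g topology \<Rightarrow> ('g \<Rightarrow> ('n::finite, 'r::finite) point \<Rightarrow> ('n, 'r) point)
      \<Rightarrow> ('g \<Rightarrow> 'g) \<Rightarrow> (('n, 'r) lie_matrix \<Rightarrow> complex)
      \<Rightarrow> 'g \<Rightarrow> (('n, 'r) point \<Rightarrow> complex) \<Rightarrow> ('n, 'r) point \<Rightarrow> complex"
  where "tau_rep G T p p11 c g f = (\<lambda>z. if z \<in> siegel_domain
    then cpower G T p z1 (p11 g) c * f (p (inv\<^bsub>G\<^esub> g) z)
    else 0)"

record ('a, 'w) function_space =
  vecs :: "('a \<Rightarrow> 'w) set"
  ip :: "('a \<Rightarrow> 'w) \<Rightarrow> ('a \<Rightarrow> 'w) \<Rightarrow> complex"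

definition ip_norm :: "('a, 'w) function_space \<Rightarrow> ('a \<Rightarrow> 'w) \<Rightarrow> real"
  where "ip_norm H f = sqrt (Re (ip H f f))"

definition hilbert_function_space ::
    "('a, 'w::complex_normed_vector) function_space \<Rightarrow> bool"
  where "hilbert_function_space H \<longleftrightarrow>
    (\<lambda>_. 0) \<in> vecs H \<and>
    (\<forall>f\<in>vecs H. \<forall>h\<in>vecs H. (\<lambda>z. f z + h z) \<in> vecs H) \<and>
    (\<forall>c. \<forall>f\<in>vecs H. (\<lambda>z. c *\<^sub>C f z) \<in> vecs H) \<and>
    (\<forall>f\<in>vecs H. \<forall>h\<in>vecs H. \<forall>k\<in>vecs H. ip H (\<lambda>z. f z + h z) k = ip H f k + ip H h k) \<and>
    (\<forall>c. \<forall>f\<in>vecs H. \<forall>h\<in>vecs H. ip H (\<lambda>z. c *\<^sub>C f z) h = c * ip H f h) \<and>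
    (\<forall>f\<in>vecs H. \<forall>h\<in>vecs H. ip H h f = cnj (ip H f h)) \<and>
    (\<forall>f\<in>vecs H. f \<noteq> (\<lambda>_. 0) \<longrightarrow> Re (ip H f f) > 0) \<and>
    (\<forall>F :: nat \<Rightarrow> 'a \<Rightarrow> 'w. (\<forall>n. F n \<in> vecs H) \<and>
        (\<forall>e>0. \<exists>N. \<forall>m\<ge>N. \<forall>n\<ge>N. ip_norm H (\<lambda>z. F m z - F n z) < e) \<longrightarrow>
      (\<exists>f\<in>vecs H. (\<lambda>n. ip_norm H (\<lambda>z. F n z - f z)) \<longlonglongrightarrow> 0))"

definition continuously_embedded ::
    "'a::topological_space set \<Rightarrow> ('a, 'w::complex_normed_vector) function_space \<Rightarrow> bool"
  where "continuously_embedded D H \<longleftrightarrow>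
    (\<forall>(F :: nat \<Rightarrow> 'a \<Rightarrow> 'w) f. (\<forall>n. F n \<in> vecs H) \<and> f \<in> vecs H \<and>
        (\<lambda>n. ip_norm H (\<lambda>z. F n z - f z)) \<longlonglongrightarrow> 0 \<longrightarrow>
      (\<forall>K. compact K \<and> K \<subseteq> D \<longrightarrow> uniform_limit K F f sequentially))"

definition is_unitarization ::
    "'a::complex_normed_vector set \<Rightarrow> 'g monoid
      \<Rightarrow> ('g \<Rightarrow> ('a \<Rightarrow> 'w::complex_normed_vector) \<Rightarrow> 'a \<Rightarrow> 'w)
      \<Rightarrow> ('a, 'w) function_space \<Rightarrow> bool"
  where "is_unitarization D G \<rho> H \<longleftrightarrow>
    hilbert_function_space H \<and> vecs H \<noteq> {\<lambda>_. 0} \<and>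
    vecs H \<subseteq> holomorphic_functions D \<and> continuously_embedded D H \<and>
    (\<forall>g\<in>carrier G. \<forall>f\<in>vecs H. \<rho> g f \<in> vecs H) \<and>
    (\<forall>g\<in>carrier G. \<forall>f\<in>vecs H. \<forall>h\<in>vecs H. ip H (\<rho> g f) (\<rho> g h) = ip H f h)"

definition unitarizable ::
    "'a::complex_normed_vector set \<Rightarrow> 'g monoid
      \<Rightarrow> ('g \<Rightarrow> ('a \<Rightarrow> 'w::complex_normed_vector) \<Rightarrow> 'a \<Rightarrow> 'w) \<Rightarrow> bool"
  where "unitarizable D G \<rho> \<longleftrightarrow> (\<exists>H. is_unitarization D G \<rho> H)"

text \<open>The Hilbert space of the unitarization, which is unique up to unitary equivalence.\<close>

definition unitarization ::
    "'a::complex_normed_vector set \<Rightarrow> 'g monoid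
      \<Rightarrow> ('g \<Rightarrow> ('a \<Rightarrow> 'w::complex_normed_vector) \<Rightarrow> 'a \<Rightarrow> 'w)
      \<Rightarrow> ('a, 'w) function_space"
  where "unitarization D G \<rho> = (SOME H. is_unitarization D G \<rho> H)"

definition unitarily_equivalent ::
    "'g set \<Rightarrow> ('g \<Rightarrow> ('a \<Rightarrow> 'w::complex_normed_vector) \<Rightarrow> 'a \<Rightarrow> 'w)
      \<Rightarrow> ('a, 'w) function_space
      \<Rightarrow> ('g \<Rightarrow> ('a \<Rightarrow> 'v::complex_normed_vector) \<Rightarrow> 'a \<Rightarrow> 'v)
      \<Rightarrow> ('a, 'v) function_space \<Rightarrow> bool"
  where "unitarily_equivalent S \<rho> H \<rho>' H' \<longleftrightarrow>
    (\<exists>A. bij_betw A (vecs H) (vecs H') \<and>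
      (\<forall>f\<in>vecs H. \<forall>h\<in>vecs H. A (\<lambda>z. f z + h z) = (\<lambda>z. A f z + A h z)) \<and>
      (\<forall>c. \<forall>f\<in>vecs H. A (\<lambda>z. c *\<^sub>C f z) = (\<lambda>z. c *\<^sub>C A f z)) \<and>
      (\<forall>f\<in>vecs H. \<forall>h\<in>vecs H. ip H' (A f) (A h) = ip H f h) \<and>
      (\<forall>g\<in>S. \<forall>f\<in>vecs H. A (\<rho> g f) = \<rho>' g (A f)))"

text \<open>Equivalence, over the subgroup \<open>S\<close>, of the unitarizations of two representations of \<open>G\<close>.\<close>

definition unitarizations_equivalent_on ::
    "'g set \<Rightarrow> 'a::complex_normed_vector set \<Rightarrow> 'g monoid
      \<Rightarrow> ('g \<Rightarrow> ('a \<Rightarrow> 'w::complex_normed_vector) \<Rightarrow> 'a \<Rightarrow> 'w)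
      \<Rightarrow> ('g \<Rightarrow> ('a \<Rightarrow> 'v::complex_normed_vector) \<Rightarrow> 'a \<Rightarrow> 'v) \<Rightarrow> bool"
  where "unitarizations_equivalent_on S D G \<rho> \<rho>' \<longleftrightarrow>
    unitarily_equivalent S \<rho> (unitarization D G \<rho>) \<rho>' (unitarization D G \<rho>')"

end

theory Submission
 imports Defs "HOL-Complex_Analysis.Conformal_Mappings"
begin

text \<open>The reproducing kernel of a unitarization is covariant. The subgroup \<open>B\<close> acts transitively on the
 domain, so a covariant kernel is determined by its value at a base point. There it commutes with the
 isotropy group \<open>U(r)\<close>, so it is a scalar by Schur's lemma, and the unitarization of \<open>\<pi>\<close> is that of \<open>\<tau>\<close>
 tensored with the space of \<open>\<Theta>\<^sub>2\<close>. The value at the base point of the kernel of an intertwiner of two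
 \<open>\<pi>\<close> intertwines the characters and the representations of \<open>U(r)\<close>. Conversely an intertwiner of two \<open>\<tau>\<close>
 over \<open>B\<close> is one over \<open>G\<close>, since kernels are determined on the diagonal by polarization.\<close>

section \<open>Operator exponentials\<close>

text \<open>The group \<open>G\<close> is given only as a simply connected topological group that
  covers the automorphisms, so its Lie theory has to be rebuilt. The infinitesimal automorphisms are
  affine vector fields; one extra real coordinate makes them linear operators, their flows are
  operator exponentials, and a local section of \<open>p\<close> lifts the flows to one-parameter
  subgroups of \<open>G\<close>. Likewise \<open>B\<close> is known only through maximality. A
  triangularizable subalgebra is shown to have no unitary part and simultaneously triangular parts
  \<open>T\<close>, which places it inside an explicit algebra \<open>borel\<close> for some ordered
  basis. The obstacle in passing from \<open>B\<close> back to \<open>G\<close> is that elements are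
  compared through their action on points: an element of \<open>G\<close> and one of
  \<open>B\<close> with the same effect on a point might differ in the character that
  \<open>tau\<close> carries. Finally, the unitarizations are arbitrary choices, unique only up to a
  positive factor of the inner product, so factors \<open>\<kappa>\<close> accompany all comparisons
  of Hilbert spaces and are absorbed by square roots in the operators.\<close>

text \<open>The function \<open>exp\<close> requires a multiplication, which bounded linear functions do not have.\<close>

typedef (overloaded) 'a endo = "UNIV :: ('a::real_normed_vector \<Rightarrow>\<^sub>L 'a) set"
 morphisms blinfun_of_endo endo_of_blinfun ..

setup_lifting type_definition_endo

instantiation endo :: (real_normed_vector) real_normed_vector
begin
lift_definition zero_endo :: "'a endo" is 0 .
lift_definition plus_endo :: "'a endo => 'a endo => 'a endo" is "(+)" .
lift_definition minus_endo :: "'a endo => 'a endo => 'a endo" is "(-)" .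
lift_definition uminus_endo :: "'a endo => 'a endo" is uminus .
lift_definition scaleR_endo :: "real => 'a endo => 'a endo" is scaleR .
lift_definition norm_endo :: "'a endo => real" is norm .
lift_definition dist_endo :: "'a endo => 'a endo => real" is dist .
definition sgn_endo :: "'a endo => 'a endo" where "sgn_endo x = scaleR (inverse (norm x)) x"
definition uniformity_endo :: "('a endo \<times> 'a endo) filter"
 where "uniformity_endo = (INF e\<in>{0<..}. principal {(x, y). dist x y < e})"
definition open_endo :: "'a endo set => bool"
 where "open_endo U \<longleftrightarrow> (\<forall>x\<in>U. eventually (\<lambda>(x', y). x' = x \<longrightarrow> y \<in> U) uniformity)"
instance by standard (unfold sgn_endo_def uniformity_endo_def open_endo_def,
   (transfer; simp add: algebra_simps dist_norm norm_triangle_ineq)+)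
end

text \<open>The sort \<open>perfect_space\<close> excludes the zero space, on which the identity
  would have norm 0 instead of 1.\<close>

instantiation endo :: ("{real_normed_vector, perfect_space}") real_normed_algebra_1
begin
lift_definition one_endo :: "'a endo" is id_blinfun .
lift_definition times_endo :: "'a endo => 'a endo => 'a endo" is blinfun_compose .
instance
proof
 fix a b c :: "'a endo" and r :: real
 show "(a * b) * c = a * (b * c)" by transfer (auto intro: blinfun_eqI)
 show "(a + b) * c = a * c + b * c" by transfer (auto intro!: blinfun_eqI simp: blinfun.add_left)
 show "a * (b + c) = a * b + a * c"
  by transfer (auto intro!: blinfun_eqI simp: blinfun.add_left blinfun.add_right)
 show "1 * a = a" by transfer (auto intro: blinfun_eqI)
 show "a * 1 = a" by transfer (auto intro: blinfun_eqI)
 show "r *\<^sub>R a * b = r *\<^sub>R (a * b)" by transfer (auto intro!: blinfun_eqI simp: blinfun.scaleR_left)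
 show "a * r *\<^sub>R b = r *\<^sub>R (a * b)"
  by transfer (auto intro!: blinfun_eqI simp: blinfun.scaleR_left blinfun.scaleR_right)
 show "norm (1::'a endo) = 1" by transfer simp
 thus "(0::'a endo) \<noteq> 1" by (metis norm_zero zero_neq_one)
 show "norm (a * b) \<le> norm a * norm b" by transfer (rule norm_blinfun_compose)
qed
end

instance endo :: (banach) banach
proof
 fix X :: "nat => 'a endo"
 assume "Cauchy X"
 hence "Cauchy (\<lambda>n. blinfun_of_endo (X n))" by (simp add: Cauchy_def dist_endo.rep_eq)
 then obtain L where "(\<lambda>n. blinfun_of_endo (X n)) \<longlonglongrightarrow> L" using Cauchy_convergent convergent_def by blast
 hence "X \<longlonglongrightarrow> endo_of_blinfun L" by (simp add: tendsto_iff dist_endo.rep_eq endo_of_blinfun_inverse)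
 thus "convergent X" by (auto simp: convergent_def)
qed

lift_definition app :: "'a::real_normed_vector endo => 'a => 'a" is blinfun_apply .

lemma bounded_bilinear_app: "bounded_bilinear app"
proof -
 have "bounded_linear (blinfun_of_endo :: 'a endo => _)" by (rule bounded_linear_intro[where K = 1])
   (simp_all add: plus_endo.rep_eq scaleR_endo.rep_eq norm_endo.rep_eq)
 from bounded_bilinear.comp1[OF bounded_bilinear_blinfun_apply this]
 show ?thesis by (simp add: app.rep_eq[abs_def])
qed

interpretation app: bounded_bilinear app by (rule bounded_bilinear_app)

lemma endo_eqI: "(\<And>x. app A x = app B x) ==> A = B" by transfer (rule blinfun_eqI)

lemma app_mult [simp]: "app (A * B) x = app A (app B x)" by transfer simp

lemma app_one [simp]: "app 1 x = x" by transfer simp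

text \<open>Unspecified unless \<open>f\<close> is bounded and linear; it is used only through
  \<open>app_endo\<close>.\<close>

definition endo :: "('a => 'a) => 'a::real_normed_vector endo" where "endo f = endo_of_blinfun (Blinfun f)"

lemma app_endo: "bounded_linear f ==> app (endo f) x = f x"
 by (simp add: endo_def app.rep_eq endo_of_blinfun_inverse bounded_linear_Blinfun_apply)

lemma exp_scaleR_add: "exp ((s + t) *\<^sub>R A) = exp (s *\<^sub>R A) * exp (t *\<^sub>R (A::'a::{real_normed_algebra_1,banach}))"
 by (simp add: scaleR_left_distrib exp_add_commuting)

lemma exp_minus_scaleR_cancel [simp]:
 "exp (- (t *\<^sub>R A)) * exp (t *\<^sub>R (A::'a::{real_normed_algebra_1,banach})) = 1"
 "exp (t *\<^sub>R A) * exp (- (t *\<^sub>R A)) = 1"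
 using exp_minus_inverse[of "t *\<^sub>R A"] exp_minus_inverse[of "- (t *\<^sub>R A)"] by auto

lemma exp_app_derivative:
 fixes A :: "'a::{banach,perfect_space} endo"
 shows "((\<lambda>t. app (exp (t *\<^sub>R A)) x) has_vector_derivative app A (app (exp (t *\<^sub>R A)) x)) (at t)"
 using bounded_linear.has_vector_derivative[OF app.bounded_linear_left
   exp_scaleR_has_vector_derivative_left[of A t], of x] by simp

text \<open>Applying \<open>exp (- t A)\<close> to a solution gives a path with derivative 0, hence
  a constant. All later identifications of flows rest on this uniqueness.\<close>

lemma linear_ode_unique:
 fixes A :: "'a::{banach,perfect_space} endo"
 assumes z: "\<And>t. (z has_vector_derivative app A (z t)) (at t)"
 shows "z t = app (exp (t *\<^sub>R A)) (z 0)"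
proof -
 have deriv: "((\<lambda>t. app (exp (t *\<^sub>R (- A))) (z t)) has_vector_derivative 0) (at s within UNIV)" for s
 proof -
  have "((\<lambda>t. app (exp (t *\<^sub>R (- A))) (z t)) has_vector_derivative
    app (exp (s *\<^sub>R (- A))) (app A (z s)) + app (exp (s *\<^sub>R (- A)) * (- A)) (z s)) (at s)"
   by (rule app.has_vector_derivative[OF exp_scaleR_has_vector_derivative_right z])
  thus ?thesis by (simp add: app.minus_left app.minus_right)
 qed
 obtain c where c: "\<And>s. s \<in> UNIV ==> app (exp (s *\<^sub>R (- A))) (z s) = c"
  using has_vector_derivative_zero_constant[OF convex_UNIV deriv] by metis
 have "app (exp (t *\<^sub>R (- A))) (z t) = z 0" using c[of t] c[of 0] by simp
 hence "app (exp (t *\<^sub>R A)) (app (exp (t *\<^sub>R (- A))) (z t)) = app (exp (t *\<^sub>R A)) (z 0)" by (rule arg_cong)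
 thus ?thesis by (simp only: app_mult[symmetric] scaleR_minus_right exp_minus_scaleR_cancel app_one)
qed

text \<open>The Cauchy product of the series of \<open>exp A * w\<close> and \<open>exp (- A)\<close> has the terms \<open>(ad A)\<^sup>n w / n!\<close>.\<close>

section \<open>Several complex variables on the Siegel domain\<close>

lemma bounded_bilinear_scaleC: "bounded_bilinear (scaleC :: complex => 'a::complex_normed_vector => 'a)"
proof
 fix a b :: complex and x y :: 'a and r :: real
 show "(a + b) *\<^sub>C x = a *\<^sub>C x + b *\<^sub>C x" by (rule scaleC_add_left)
 show "a *\<^sub>C (x + y) = a *\<^sub>C x + a *\<^sub>C y" by (rule scaleC_add_right)
 show "(r *\<^sub>R a) *\<^sub>C x = r *\<^sub>R a *\<^sub>C x" by (simp add: scaleR_conv_of_real scaleC_scaleC flip: scaleC_of_real)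
 show "a *\<^sub>C r *\<^sub>R x = r *\<^sub>R a *\<^sub>C x" by (simp add: scaleC_scaleC mult.commute flip: scaleC_of_real)
 show "\<exists>K. \<forall>a (b::'a). norm (a *\<^sub>C b) \<le> norm a * norm b * K" by (rule exI[of _ 1]) (simp add: norm_scaleC)
qed

abbreviation \<D> :: "('n::finite, 'r::finite) point set" where "\<D> \<equiv> siegel_domain"
abbreviation "adj \<equiv> adjoint_matrix"

interpretation scaleC: bounded_bilinear "scaleC :: complex => 'a::complex_normed_vector => 'a"
 by (rule bounded_bilinear_scaleC)

lemma scaleC_one [simp]: "1 *\<^sub>C x = (x::'a::complex_normed_vector)" using scaleC_of_real[of 1 x] by simp

lemma scaleC_complex_eq [simp]: "c *\<^sub>C (z::complex) = c * z" by (simp add: scaleC_complex_def)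

lemma scaleC_vec_nth [simp]: "(c *\<^sub>C x) $ i = c *\<^sub>C (x $ i)" by (simp add: scaleC_vec_def)

lemma fst_scaleC [simp]: "fst (c *\<^sub>C x) = c *\<^sub>C fst x" and snd_scaleC [simp]: "snd (c *\<^sub>C x) = c *\<^sub>C snd x"
 by (simp_all add: scaleC_prod_def)

lemma map_matrix_nth [simp]: "map_matrix f A $ i $ j = f (A $ i $ j)" by (simp add: map_matrix_def)

text \<open>The value at \<open>x\<close> of the quadratic form of \<open>Im Z - Q V V\<close>,
  expanded so that continuity, concavity in \<open>z\<close> and derivatives along flows can be read
  off. The factor 1/2 arises because \<open>Q V V\<close> is half the real part of \<open>V\<close>
  times its adjoint.\<close>

definition siegel_form :: "real^'n => ('n::finite, 'r::finite) point => real" where "siegel_form x z =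
  Im (\<Sum>i\<in>UNIV. \<Sum>j\<in>UNIV. complex_of_real (x $ i * x $ j) * fst z $ i $ j)
  - (\<Sum>k\<in>UNIV. (cmod (\<Sum>i\<in>UNIV. complex_of_real (x $ i) * snd z $ i $ k))\<^sup>2) / 2"

text \<open>The complex subspace in which the domain is relatively open; slices and polarization
  have to stay inside it.\<close>

definition sym_points :: "('n::finite, 'r::finite) point set"
 where "sym_points = {z. transpose (fst z) = fst z}"

lemma Q_self_nth: "Q V V $ i $ j = complex_of_real (Re (\<Sum>k\<in>UNIV. V $ i $ k * cnj (V $ j $ k)) / 2)"
proof -
 let ?S = "\<Sum>k\<in>UNIV. V $ i $ k * cnj (V $ j $ k)"
 have "Q V V $ i $ j = (1/4) * (?S + cnj ?S)"
  by (simp add: Q_def matrix_matrix_mult_def adjoint_matrix_def transpose_def)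
 thus ?thesis by (simp add: complex_add_cnj del: cnj_sum Re_sum)
qed

lemma siegel_form_eq:
 fixes Z :: "complex^'n^'n" and V :: "complex^'r^'n"
 defines "Y \<equiv> \<chi> i j. Im (Z $ i $ j) - Re (\<Sum>k\<in>UNIV. V $ i $ k * cnj (V $ j $ k)) / 2"
 shows "x \<bullet> (Y *v x) = siegel_form x (Z, V)"
proof -
 have 1: "(cmod (\<Sum>i\<in>UNIV. complex_of_real (x $ i) * V $ i $ k))\<^sup>2 =
   (\<Sum>i\<in>UNIV. \<Sum>j\<in>UNIV. x $ i * (x $ j * Re (V $ i $ k * cnj (V $ j $ k))))" for k
 proof -
  have "(cmod (\<Sum>i\<in>UNIV. complex_of_real (x $ i) * V $ i $ k))\<^sup>2
    = Re ((\<Sum>i\<in>UNIV. complex_of_real (x $ i) * V $ i $ k)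
      * cnj (\<Sum>i\<in>UNIV. complex_of_real (x $ i) * V $ i $ k))" by (metis Re_complex_of_real complex_norm_square)
  also have "\<dots> = (\<Sum>i\<in>UNIV. \<Sum>j\<in>UNIV. Re ((complex_of_real (x $ i) * V $ i $ k)
    * (complex_of_real (x $ j) * cnj (V $ j $ k))))"
   by (simp only: cnj_sum complex_cnj_mult complex_cnj_complex_of_real sum_product Re_sum)
  also have "\<dots> = (\<Sum>i\<in>UNIV. \<Sum>j\<in>UNIV. x $ i * (x $ j * Re (V $ i $ k * cnj (V $ j $ k))))"
   by (intro sum.cong refl) (simp add: algebra_simps)
  finally show ?thesis .
 qed
 have "(\<Sum>k\<in>UNIV. (cmod (\<Sum>i\<in>UNIV. complex_of_real (x $ i) * V $ i $ k))\<^sup>2) =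
   (\<Sum>i\<in>UNIV. \<Sum>j\<in>UNIV. \<Sum>k\<in>UNIV. x $ i * (x $ j * Re (V $ i $ k * cnj (V $ j $ k))))"
  unfolding 1 by (subst sum.swap, rule sum.cong[OF refl], rule sum.swap)
 thus ?thesis by (simp add: siegel_form_def Y_def inner_vec_def matrix_vector_mult_def sum_distrib_left
    right_diff_distrib left_diff_distrib sum_subtractf sum_divide_distrib mult.assoc mult.left_commute mult.commute)
qed

lemma siegel_domain_iff: "z \<in> \<D> \<longleftrightarrow> z \<in> sym_points \<and> (\<forall>x. x \<noteq> 0 \<longrightarrow> siegel_form x z > 0)"
proof -
 obtain Z V where z: "z = (Z, V)" by (cases z)
 define Y where "Y = (\<chi> i j. Im (Z $ i $ j) - Re (\<Sum>k\<in>UNIV. V $ i $ k * cnj (V $ j $ k)) / 2)"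
 have eq: "cmat (map_matrix Im Z) - Q V V = cmat Y" by (simp add: vec_eq_iff Q_self_nth Y_def)
 have inj: "cmat A = cmat B \<longleftrightarrow> A = B" for A B :: "real^'n^'n" by (simp add: vec_eq_iff)
 have "transpose Y = Y" if "transpose Z = Z"
 proof -
  have "Z $ i $ j = Z $ j $ i" for i j using that by (metis transpose_def vec_lambda_beta)
  moreover have "Re (V $ i $ k * cnj (V $ j $ k)) = Re (V $ j $ k * cnj (V $ i $ k))" for i j k by simp
  ultimately show ?thesis by (simp add: vec_eq_iff Y_def transpose_def mult.commute)
 qed
 thus ?thesis using siegel_form_eq[of _ Z V, folded Y_def]
  by (auto simp: z siegel_domain_def eq image_iff inj pos_def_matrices_def sym_points_def)
qed

lemma siegel_form_scale: "siegel_form (c *\<^sub>R x) z = c\<^sup>2 * siegel_form x z"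
proof -
 have "(\<Sum>i\<in>UNIV. \<Sum>j\<in>UNIV. complex_of_real ((c *\<^sub>R x) $ i * (c *\<^sub>R x) $ j) * fst z $ i $ j)
   = complex_of_real (c\<^sup>2) * (\<Sum>i\<in>UNIV. \<Sum>j\<in>UNIV. complex_of_real (x $ i * x $ j) * fst z $ i $ j)"
  by (simp add: sum_distrib_left power2_eq_square mult.assoc mult.left_commute)
 moreover have "(\<Sum>i\<in>UNIV. complex_of_real ((c *\<^sub>R x) $ i) * snd z $ i $ k)
   = complex_of_real c * (\<Sum>i\<in>UNIV. complex_of_real (x $ i) * snd z $ i $ k)" for k
  by (simp add: sum_distrib_left mult.assoc)
 ultimately show ?thesis unfolding siegel_form_def
  by (simp only: norm_mult norm_of_real power_mult_distrib power2_abs Im_complex_of_real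
    times_complex.simps Re_complex_of_real sum_distrib_left[symmetric]) (simp add: right_diff_distrib)
qed

lemma continuous_on_siegel_form:
 "continuous_on UNIV (\<lambda>p. siegel_form (snd p) (fst p :: ('n::finite, 'r::finite) point))"
 unfolding siegel_form_def by (auto intro!: continuous_intros)

text \<open>By homogeneity it is enough to test the form on the unit sphere. The sphere is compact,
  so the tube lemma makes positivity on it an open condition on \<open>z\<close>.\<close>

lemma siegel_domain_rel_open: "\<exists>W. open W \<and> \<D> = W \<inter> (sym_points :: ('n::finite, 'r::finite) point set)"
proof (intro exI conjI)
 let ?W = "{z. \<forall>x\<in>sphere 0 1. siegel_form x (z :: ('n, 'r) point) > 0}"
 let ?O = "{p. siegel_form (snd p) (fst p :: ('n, 'r) point) > 0}"
 have "open ?O" by (intro open_Collect_less continuous_on_siegel_form continuous_on_const)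
 show "open ?W"
 proof (subst open_subopen, intro ballI)
  fix z assume "z \<in> ?W"
  hence sub: "{z} \<times> sphere 0 1 \<subseteq> ?O" by auto
  have "openin (prod_topology euclidean euclidean) ?O"
   using \<open>open ?O\<close> by (simp add: euclidean_product_topology)
  from tube_lemma_right[OF this _ _ sub] obtain X where "z \<in> X" "open X" "X \<times> sphere 0 1 \<subseteq> ?O"
   by (fastforce simp: compactin_euclidean_iff)
  thus "\<exists>X. open X \<and> z \<in> X \<and> X \<subseteq> ?W" by fastforce
 qed
 have "siegel_form x z > 0" if z: "z \<in> ?W" and "x \<noteq> 0" for x z
 proof -
  have "siegel_form (x /\<^sub>R norm x) z > 0" using that by simp
  thus ?thesis using \<open>x \<noteq> 0\<close> by (simp add: siegel_form_scale zero_less_mult_iff)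
 qed
 thus "\<D> = ?W \<inter> sym_points" by (auto simp: siegel_domain_iff) (metis norm_zero zero_neq_one)
qed

text \<open>The first term of the form is linear in \<open>z\<close>, and the subtracted term is a
  sum of squared moduli of linear functions, hence convex.\<close>

lemma siegel_form_concave:
 fixes a b :: "('n::finite, 'r::finite) point"
 assumes "0 \<le> t" "t \<le> 1"
 shows "(1 - t) * siegel_form x a + t * siegel_form x b \<le> siegel_form x ((1 - t) *\<^sub>R a + t *\<^sub>R b)"
proof -
 define L where "L z = (\<Sum>i\<in>UNIV. \<Sum>j\<in>UNIV. complex_of_real (x $ i * x $ j) * fst z $ i $ j)"
  for z :: "('n, 'r) point"
 define M where "M z k = (\<Sum>i\<in>UNIV. complex_of_real (x $ i) * snd z $ i $ k)" for z :: "('n, 'r) point" and k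
 have L: "L (s *\<^sub>R a + t *\<^sub>R b) = s *\<^sub>R L a + t *\<^sub>R L b" for s t
  by (simp add: L_def distrib_left sum.distrib scaleR_right.sum)
 have M: "M (s *\<^sub>R a + t *\<^sub>R b) k = s *\<^sub>R M a k + t *\<^sub>R M b k" for s t k
  by (simp add: M_def distrib_left sum.distrib scaleR_right.sum)
 have sq: "(cmod ((1 - t) *\<^sub>R p + t *\<^sub>R q))\<^sup>2 \<le> (1 - t) * (cmod p)\<^sup>2 + t * (cmod q)\<^sup>2" for p q
 proof -
  have "(1 - t) * (cmod p)\<^sup>2 + t * (cmod q)\<^sup>2 - (cmod ((1 - t) *\<^sub>R p + t *\<^sub>R q))\<^sup>2
    = t * (1 - t) * (cmod (p - q))\<^sup>2" unfolding cmod_power2 by (simp add: power2_eq_square algebra_simps)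
  also have "\<dots> \<ge> 0" using assms by simp
  finally show ?thesis by simp
 qed
 have "(\<Sum>k\<in>UNIV. (cmod (M ((1 - t) *\<^sub>R a + t *\<^sub>R b) k))\<^sup>2)
   \<le> (\<Sum>k\<in>UNIV. (1 - t) * (cmod (M a k))\<^sup>2 + t * (cmod (M b k))\<^sup>2)" unfolding M by (intro sum_mono sq)
 also have "\<dots> = (1 - t) * (\<Sum>k\<in>UNIV. (cmod (M a k))\<^sup>2) + t * (\<Sum>k\<in>UNIV. (cmod (M b k))\<^sup>2)"
  by (simp only: sum.distrib sum_distrib_left)
 finally show ?thesis unfolding siegel_form_def L_def[symmetric] M_def[symmetric] L by (simp add: field_simps)
qed

lemma sym_points_subspace: "subspace sym_points"
 by (auto simp: subspace_def sym_points_def vec_eq_iff transpose_def)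

lemma sym_points_add: "a \<in> sym_points ==> b \<in> sym_points ==> a + b \<in> sym_points"
 using sym_points_subspace by (rule subspace_add)

lemma sym_points_scaleC: "a \<in> sym_points ==> c *\<^sub>C a \<in> sym_points"
 by (auto simp: sym_points_def vec_eq_iff transpose_def)

lemma siegel_domain_sym: "z \<in> \<D> ==> z \<in> sym_points" by (simp add: siegel_domain_iff)

text \<open>Follows from concavity of the form. Convexity makes the slices of the domain by complex
  lines connected, as analytic continuation in \<open>polarization\<close> requires.\<close>

lemma convex_siegel_domain: "convex (\<D> :: ('n::finite, 'r::finite) point set)"
proof (rule convexI)
 fix a b :: "('n, 'r) point" and u v :: real
 assume ab: "a \<in> \<D>" "b \<in> \<D>" and uv: "0 \<le> u" "0 \<le> v" "u + v = 1"
 hence u: "u = 1 - v" by simp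
 have "siegel_form x (u *\<^sub>R a + v *\<^sub>R b) > 0" if "x \<noteq> 0" for x
 proof -
  have p: "siegel_form x a > 0" "siegel_form x b > 0" using ab that by (auto simp: siegel_domain_iff)
  have "u * siegel_form x a + v * siegel_form x b > 0"
  proof (cases "v = 0")
   case False
   thus ?thesis using p uv by (intro add_nonneg_pos) auto
  qed (use p u in simp)
  also have "\<dots> \<le> siegel_form x (u *\<^sub>R a + v *\<^sub>R b)" unfolding u using uv by (intro siegel_form_concave) auto
  finally show ?thesis .
 qed
 moreover have "u *\<^sub>R a + v *\<^sub>R b \<in> sym_points"
  using ab by (intro subspace_add subspace_scale sym_points_subspace siegel_domain_sym)
 ultimately show "u *\<^sub>R a + v *\<^sub>R b \<in> \<D>" by (simp add: siegel_domain_iff)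
qed

section \<open>Holomorphic functions along complex lines\<close>

lemma open_slice:
 fixes u v :: "('n::finite, 'r::finite) point"
 assumes "u \<in> sym_points" "v \<in> sym_points"
 shows "open {\<alpha>. u + \<alpha> *\<^sub>C v \<in> \<D>}"
proof -
 obtain W where W: "open W" "\<D> = W \<inter> (sym_points :: ('n, 'r) point set)" using siegel_domain_rel_open by blast
 have "{\<alpha>. u + \<alpha> *\<^sub>C v \<in> \<D>} = (\<lambda>\<alpha>. u + \<alpha> *\<^sub>C v) -` W"
  using assms by (auto simp: W(2) sym_points_add sym_points_scaleC)
 moreover have "open \<dots>" by (intro open_vimage W continuous_intros scaleC.continuous_on)
 ultimately show ?thesis by simp
qed

lemma convex_slice: "convex {\<alpha>. u + \<alpha> *\<^sub>C v \<in> \<D>}"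
proof (rule convexI)
 fix a b :: complex and s t :: real
 assume ab: "a \<in> {\<alpha>. u + \<alpha> *\<^sub>C v \<in> \<D>}" "b \<in> {\<alpha>. u + \<alpha> *\<^sub>C v \<in> \<D>}" and st: "0 \<le> s" "0 \<le> t" "s + t = 1"
 have "s *\<^sub>R (u + a *\<^sub>C v) + t *\<^sub>R (u + b *\<^sub>C v) = (s + t) *\<^sub>R u + (s *\<^sub>R a + t *\<^sub>R b) *\<^sub>C v"
  by (simp add: algebra_simps scaleC.add_left scaleC.scaleR_left)
 thus "s *\<^sub>R a + t *\<^sub>R b \<in> {\<alpha>. u + \<alpha> *\<^sub>C v \<in> \<D>}"
  using convexD[OF convex_siegel_domain, of "u + a *\<^sub>C v" "u + b *\<^sub>C v" s t] ab st by simp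
qed

text \<open>By the chain rule the derivative along the line is
  \<open>\<beta> \<mapsto> F (\<beta> v)\<close>, which complex linearity of \<open>F\<close> turns
  into multiplication by the number \<open>F v\<close>. This reduces several variables to
  one.\<close>

lemma holomorphic_slice:
 fixes f :: "'a::complex_normed_vector => complex"
 assumes f: "holomorphic_map_on f D"
 shows "(\<lambda>\<alpha>. f (u + \<alpha> *\<^sub>C v)) holomorphic_on {\<alpha>. u + \<alpha> *\<^sub>C v \<in> D}" (is "_ holomorphic_on ?E")
 unfolding holomorphic_on_def
proof
 fix \<alpha> assume \<alpha>: "\<alpha> \<in> ?E"
 then obtain F where F: "(f has_derivative F) (at (u + \<alpha> *\<^sub>C v) within D)"
  and lin: "\<And>c x. F (c *\<^sub>C x) = c *\<^sub>C F x" using f by (force simp: holomorphic_map_on_def)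
 have "((\<lambda>\<alpha>. u + \<alpha> *\<^sub>C v) has_derivative (\<lambda>\<beta>. \<beta> *\<^sub>C v)) (at \<alpha> within ?E)"
  by (auto intro!: derivative_eq_intros scaleC.bounded_linear_left[THEN bounded_linear_imp_has_derivative])
 hence "((\<lambda>\<alpha>. f (u + \<alpha> *\<^sub>C v)) has_derivative (\<lambda>\<beta>. F (\<beta> *\<^sub>C v))) (at \<alpha> within ?E)"
  by (rule has_derivative_in_compose) (rule has_derivative_subset[OF F], auto)
 hence "((\<lambda>\<alpha>. f (u + \<alpha> *\<^sub>C v)) has_field_derivative (F v)) (at \<alpha> within ?E)"
  by (simp add: has_field_derivative_def lin mult_commute_abs)
 thus "(\<lambda>\<alpha>. f (u + \<alpha> *\<^sub>C v)) field_differentiable at \<alpha> within ?E" by (auto simp: field_differentiable_def)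
qed

text \<open>Discs of radius \<open>R / 3\<close> about points of the half disc stay inside the given
  disc because 1/2 + 1/3 < 1. So Cauchy's inequality bounds the derivatives uniformly on the half
  disc, and Taylor's formula gives the remainders; 18 is 2 times the square of 3.\<close>

lemma holomorphic_quadratic_estimate:
 assumes f: "f holomorphic_on ball c R" and R: "R > 0"
  and M: "\<And>z. z \<in> ball c R ==> cmod (f z) \<le> M" and s: "cmod s < R / 2"
 shows "cmod (f (c + s) - f c - s * deriv f c) \<le> 18 * M / R\<^sup>2 * (cmod s)\<^sup>2"
  and "cmod (f (c + s) - f c) \<le> 6 * M / R * cmod s" and "cmod (deriv f c) \<le> 3 * M / R"
proof -
 have D: "cmod ((deriv ^^ n) f x) \<le> fact n * M / (R / 3) ^ n" if "x \<in> ball c (R / 2)" for n x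
 proof (rule Cauchy_inequality)
  have sub: "cball x (R / 3) \<subseteq> ball c R"
  proof
   fix y assume "y \<in> cball x (R / 3)"
   hence "dist x y \<le> R / 3" "dist c x < R / 2" using that by auto
   hence "dist c y < R" using dist_triangle[of c y x] R by linarith
   thus "y \<in> ball c R" by simp
  qed
  show "f holomorphic_on ball x (R / 3)" using f sub ball_subset_cball by (blast intro: holomorphic_on_subset)
  show "continuous_on (cball x (R / 3)) f"
   using f sub by (blast intro: holomorphic_on_imp_continuous_on continuous_on_subset)
  show "cmod (f y) \<le> M" if "cmod (x - y) = R / 3" for y using M[of y] sub that R by (auto simp: dist_norm)
 qed (use R in auto)
 have sub2: "ball c (R / 2) \<subseteq> ball c R" using R by (intro subset_ball) auto
 have c: "c \<in> ball c (R / 2)" "c + s \<in> ball c (R / 2)" using R s by (auto simp: dist_norm)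
 have der: "((deriv ^^ i) f has_field_derivative (deriv ^^ Suc i) f x) (at x within ball c (R / 2))"
  if "x \<in> ball c (R / 2)" for i x
 proof -
  have "(deriv ^^ i) f holomorphic_on ball c R" using f by (rule holomorphic_higher_deriv) auto
  hence "((deriv ^^ i) f has_field_derivative deriv ((deriv ^^ i) f) x) (at x)"
   by (rule holomorphic_derivI[where S = "ball c R"]) (use that sub2 in auto)
  thus ?thesis by (auto intro: has_field_derivative_at_within)
 qed
 have "cmod ((deriv ^^ 0) f (c + s) - (\<Sum>i\<le>1. (deriv ^^ i) f c * (c + s - c) ^ i / fact i))
   \<le> (fact 2 * M / (R / 3) ^ 2) * cmod (c + s - c) ^ Suc 1 / fact 1"
  by (rule field_Taylor[where S = "ball c (R / 2)" and f = "\<lambda>i. (deriv ^^ i) f"])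
   (use der D[of _ 2] c in \<open>simp_all add: numeral_2_eq_2 del: funpow.simps\<close>)
 thus "cmod (f (c + s) - f c - s * deriv f c) \<le> 18 * M / R\<^sup>2 * (cmod s)\<^sup>2"
  by (simp add: power_divide field_simps power2_eq_square)
 have "cmod ((deriv ^^ 0) f (c + s) - (\<Sum>i\<le>0. (deriv ^^ i) f c * (c + s - c) ^ i / fact i))
   \<le> (fact 1 * M / (R / 3) ^ 1) * cmod (c + s - c) ^ Suc 0 / fact 0"
 proof (rule field_Taylor[where S = "ball c (R / 2)" and f = "\<lambda>i. (deriv ^^ i) f"])
  show "cmod ((deriv ^^ Suc 0) f x) \<le> fact 1 * M / (R / 3) ^ 1" if "x \<in> ball c (R / 2)" for x
   using D[OF that, of 1] by simp
 qed (use der c in blast)+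
 hence "cmod (f (c + s) - f c) \<le> 3 * M / R * cmod s" by (simp add: field_simps)
 also have "0 \<le> M" using M[of c] R by (meson centre_in_ball norm_ge_zero order_trans)
 hence "3 * M / R * cmod s \<le> 6 * M / R * cmod s" using R by (intro mult_right_mono divide_right_mono) auto
 finally show "cmod (f (c + s) - f c) \<le> 6 * M / R * cmod s" .
 show "cmod (deriv f c) \<le> 3 * M / R" using D[OF c(1), of 1] by (simp add: field_simps)
qed

lemma has_field_derivative_quadratic:
 fixes f :: "complex => complex"
 assumes "\<delta> > 0" and "\<And>s. cmod s < \<delta> ==> cmod (f (x + s) - f x - s * L) \<le> K * (cmod s)\<^sup>2"
 shows "(f has_field_derivative L) (at x)"
proof -
 have "((\<lambda>s. (f (x + s) - f x) / s - L) \<longlongrightarrow> 0) (at 0)"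
 proof (rule Lim_null_comparison)
  show "\<forall>\<^sub>F s in at 0. cmod ((f (x + s) - f x) / s - L) \<le> K * cmod s" unfolding eventually_at
  proof (intro exI[of _ \<delta>] conjI ballI impI assms)
   fix s :: complex assume s: "s \<noteq> 0 \<and> dist s 0 < \<delta>"
   have "cmod ((f (x + s) - f x) / s - L) = cmod (f (x + s) - f x - s * L) / cmod s"
    using s by (simp add: field_simps flip: norm_divide)
   also have "\<dots> \<le> K * (cmod s)\<^sup>2 / cmod s" using s assms(2)[of s] by (intro divide_right_mono) auto
   finally show "cmod ((f (x + s) - f x) / s - L) \<le> K * cmod s" using s by (simp add: power2_eq_square)
  qed
  show "((\<lambda>s. K * cmod s) \<longlongrightarrow> 0) (at 0)" by (auto intro!: tendsto_eq_intros)
 qed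
 thus ?thesis by (simp add: DERIV_def LIM_zero_iff)
qed

text \<open>A weak form of Hartogs's theorem, in the spirit of Osgood: local boundedness replaces
  joint continuity. The increment along the diagonal splits into a step in the first variable, a
  step in the second, and the variation of the first partial derivative \<open>D1\<close> with the
  second variable; each has an error of second order.\<close>

lemma separately_holomorphic_diagonal:
 fixes \<Phi> :: "complex => complex => complex"
 assumes A: "open A" and B: "open B" and hol1: "\<And>\<beta>. \<beta> \<in> B ==> (\<lambda>\<alpha>. \<Phi> \<alpha> \<beta>) holomorphic_on A"
  and hol2: "\<And>\<alpha>. \<alpha> \<in> A ==> (\<lambda>\<beta>. \<Phi> \<alpha> \<beta>) holomorphic_on B"
  and bdd: "\<And>K L. compact K ==> K \<subseteq> A ==> compact L ==> L \<subseteq> B ==> \<exists>M. \<forall>\<alpha>\<in>K. \<forall>\<beta>\<in>L. cmod (\<Phi> \<alpha> \<beta>) \<le> M"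
 shows "(\<lambda>\<zeta>. \<Phi> (a * \<zeta>) (b * \<zeta>)) holomorphic_on {\<zeta>. a * \<zeta> \<in> A \<and> b * \<zeta> \<in> B}"
proof -
 have "\<exists>L. ((\<lambda>\<zeta>. \<Phi> (a * \<zeta>) (b * \<zeta>)) has_field_derivative L) (at \<zeta>)" if \<zeta>: "a * \<zeta> \<in> A" "b * \<zeta> \<in> B" for \<zeta>
 proof -
  obtain R1 R2 where "R1 > 0" "R2 > 0" "cball (a * \<zeta>) R1 \<subseteq> A" "cball (b * \<zeta>) R2 \<subseteq> B"
   using \<zeta> A B by (meson open_contains_cball)
  then obtain R where R: "R > 0" "cball (a * \<zeta>) R \<subseteq> A" "cball (b * \<zeta>) R \<subseteq> B"
   by (intro that[of "min R1 R2"]) (auto simp: cball_min_Int)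
  obtain M where "\<And>\<alpha> \<beta>. \<alpha> \<in> cball (a * \<zeta>) R ==> \<beta> \<in> cball (b * \<zeta>) R ==> cmod (\<Phi> \<alpha> \<beta>) \<le> M"
   using bdd[OF compact_cball R(2) compact_cball R(3)] by blast
  hence M: "cmod (\<Phi> \<alpha> \<beta>) \<le> M" if "\<alpha> \<in> ball (a * \<zeta>) R" "\<beta> \<in> ball (b * \<zeta>) R" for \<alpha> \<beta> using that by auto
  define \<alpha> \<beta> where "\<alpha> = a * \<zeta>" and "\<beta> = b * \<zeta>"
  define D1 where "D1 t = deriv (\<lambda>x. \<Phi> x t) \<alpha>" for t
  define D2 where "D2 = deriv (\<lambda>y. \<Phi> \<alpha> y) \<beta>"
  have sub: "ball \<alpha> R \<subseteq> A" "ball \<beta> R \<subseteq> B" using R ball_subset_cball by (fastforce simp: \<alpha>_def \<beta>_def)+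
  have h1: "(\<lambda>x. \<Phi> x t) holomorphic_on ball \<alpha> R" if "t \<in> ball \<beta> R" for t
   by (rule holomorphic_on_subset[OF hol1 sub(1)]) (use sub(2) that in blast)
  have h2: "(\<lambda>y. \<Phi> x y) holomorphic_on ball \<beta> R" if "x \<in> ball \<alpha> R" for x
   by (rule holomorphic_on_subset[OF hol2 sub(2)]) (use sub(1) that in blast)
  have M': "cmod (\<Phi> x y) \<le> M" if "x \<in> ball \<alpha> R" "y \<in> ball \<beta> R" for x y
   using M that by (auto simp: \<alpha>_def \<beta>_def)
  have cen: "\<alpha> \<in> ball \<alpha> R" "\<beta> \<in> ball \<beta> R" using R by auto
  have inb: "\<beta> + t \<in> ball \<beta> R" if "cmod t < R / 2" for t using that R by (simp add: dist_norm)
  \<comment> \<open>\<open>D1 (\<beta> + t) - D1 \<beta>\<close> is the derivative of a difference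
    of functions that is of order \<open>t\<close> uniformly on the disc, and Cauchy's inequality
    passes this order on to the derivative.\<close>
  have D1: "cmod (D1 (\<beta> + t) - D1 \<beta>) \<le> 3 * (6 * M / R * cmod t) / R" if t: "cmod t < R / 2" for t
  proof -
   have "deriv (\<lambda>x. \<Phi> x (\<beta> + t) - \<Phi> x \<beta>) \<alpha> = D1 (\<beta> + t) - D1 \<beta>" unfolding D1_def
    by (intro deriv_diff holomorphic_on_imp_differentiable_at[where s = "ball \<alpha> R"] h1 inb t cen) auto
   moreover have "cmod (deriv (\<lambda>x. \<Phi> x (\<beta> + t) - \<Phi> x \<beta>) \<alpha>) \<le> 3 * (6 * M / R * cmod t) / R"
   proof (rule holomorphic_quadratic_estimate(3)[where s = 0])
    show "(\<lambda>x. \<Phi> x (\<beta> + t) - \<Phi> x \<beta>) holomorphic_on ball \<alpha> R" by (intro holomorphic_on_diff h1 inb t cen)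
    show "cmod (\<Phi> x (\<beta> + t) - \<Phi> x \<beta>) \<le> 6 * M / R * cmod t" if "x \<in> ball \<alpha> R" for x
     by (rule holomorphic_quadratic_estimate(2)) (use that h2 M' t R in auto)
   qed (use R in auto)
   ultimately show ?thesis by simp
  qed
  \<comment> \<open>The summand 1 keeps \<open>N\<close> positive when \<open>a\<close> and
    \<open>b\<close> both vanish.\<close>
  define N where "N = 1 + cmod a + cmod b"
  define C where "C = 18 * M / R\<^sup>2"
  have N: "cmod a \<le> N" "cmod b \<le> N" "N > 0" by (auto simp: N_def add_pos_nonneg)
  have "0 \<le> M" using M'[OF cen] by (meson norm_ge_zero order_trans)
  hence C: "C \<ge> 0" using R by (simp add: C_def)
  have "((\<lambda>\<zeta>. \<Phi> (a * \<zeta>) (b * \<zeta>)) has_field_derivative (a * D1 \<beta> + b * D2)) (at \<zeta>)"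
  proof (rule has_field_derivative_quadratic[where \<delta> = "R / (2 * N)" and K = "3 * (C * N\<^sup>2)"])
   show "R / (2 * N) > 0" using R N by simp
   fix s assume s: "cmod s < R / (2 * N)"
   hence sN: "N * cmod s < R / 2" using N by (simp add: field_simps)
   have as: "cmod (a * s) \<le> N * cmod s" and bs: "cmod (b * s) \<le> N * cmod s"
    using N by (auto simp: norm_mult intro: mult_right_mono)
   hence as': "cmod (a * s) < R / 2" and bs': "cmod (b * s) < R / 2" using sN by auto
   have as2: "(cmod (a * s))\<^sup>2 \<le> N\<^sup>2 * (cmod s)\<^sup>2" and bs2: "(cmod (b * s))\<^sup>2 \<le> N\<^sup>2 * (cmod s)\<^sup>2"
    using power_mono[OF as, of 2] power_mono[OF bs, of 2] by (simp_all add: power_mult_distrib)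
   have 1: "cmod (\<Phi> (\<alpha> + a * s) (\<beta> + b * s) - \<Phi> \<alpha> (\<beta> + b * s) - a * s * D1 (\<beta> + b * s))
     \<le> C * (cmod (a * s))\<^sup>2" unfolding D1_def C_def
    by (rule holomorphic_quadratic_estimate(1)) (use h1 inb bs' as' M' R in auto)
   have 2: "cmod (\<Phi> \<alpha> (\<beta> + b * s) - \<Phi> \<alpha> \<beta> - b * s * D2) \<le> C * (cmod (b * s))\<^sup>2" unfolding D2_def C_def
    by (rule holomorphic_quadratic_estimate(1)) (use h2 bs' M' R in auto)
   have "cmod (a * s * (D1 (\<beta> + b * s) - D1 \<beta>)) \<le> cmod (a * s) * (3 * (6 * M / R * cmod (b * s)) / R)"
    unfolding norm_mult[of "a * s"] by (intro mult_left_mono D1 bs') auto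
   also have "\<dots> = C * (cmod (a * s) * cmod (b * s))" by (simp add: C_def power2_eq_square)
   also have "\<dots> \<le> C * ((N * cmod s) * (N * cmod s))" using C as bs N by (intro mult_left_mono mult_mono) auto
   finally have 3: "cmod (a * s * (D1 (\<beta> + b * s) - D1 \<beta>)) \<le> C * (N\<^sup>2 * (cmod s)\<^sup>2)"
    by (simp add: power2_eq_square mult_ac)
   have "\<Phi> (a * (\<zeta> + s)) (b * (\<zeta> + s)) - \<Phi> (a * \<zeta>) (b * \<zeta>) - s * (a * D1 \<beta> + b * D2)
     = (\<Phi> (\<alpha> + a * s) (\<beta> + b * s) - \<Phi> \<alpha> (\<beta> + b * s) - a * s * D1 (\<beta> + b * s))
      + (\<Phi> \<alpha> (\<beta> + b * s) - \<Phi> \<alpha> \<beta> - b * s * D2) + a * s * (D1 (\<beta> + b * s) - D1 \<beta>)"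
    by (simp add: \<alpha>_def \<beta>_def algebra_simps)
   also have "cmod \<dots> \<le> C * (cmod (a * s))\<^sup>2 + C * (cmod (b * s))\<^sup>2 + C * (N\<^sup>2 * (cmod s)\<^sup>2)"
    by (intro norm_triangle_le add_mono 1 2 3)
   also have "\<dots> \<le> 3 * (C * N\<^sup>2) * (cmod s)\<^sup>2" using mult_left_mono[OF as2 C] mult_left_mono[OF bs2 C] by simp
   finally show "cmod (\<Phi> (a * (\<zeta> + s)) (b * (\<zeta> + s)) - \<Phi> (a * \<zeta>) (b * \<zeta>) - s * (a * D1 \<beta> + b * D2))
     \<le> 3 * (C * N\<^sup>2) * (cmod s)\<^sup>2" .
  qed
  thus ?thesis by blast
 qed
 thus ?thesis unfolding holomorphic_on_def field_differentiable_def
  by (blast intro: has_field_derivative_at_within)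
qed

text \<open>The points \<open>u + i \<zeta> v\<close> and \<open>u + i (cnj \<zeta>) v\<close> coincide for real \<open>\<zeta>\<close> and are the two given
 points for \<open>\<zeta> = - i\<close>, where \<open>u\<close> is their midpoint.\<close>

lemma polarization:
 fixes F :: "('n::finite, 'r::finite) point => ('n, 'r) point => complex"
 assumes hol1: "\<And>w. w \<in> \<D> ==> holomorphic_map_on (\<lambda>z. F z w) \<D>"
  and hol2: "\<And>z. z \<in> \<D> ==> holomorphic_map_on (\<lambda>w. cnj (F z w)) \<D>"
  and bdd: "\<And>K. compact K ==> K \<subseteq> \<D> ==> \<exists>M. \<forall>z\<in>K. \<forall>w\<in>K. cmod (F z w) \<le> M" and diag: "\<And>z. z \<in> \<D> ==> F z z = 0"
  and z: "z \<in> \<D>" and w: "w \<in> \<D>"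
 shows "F z w = 0"
proof -
 define u v where "u = (1/2) *\<^sub>R (z + w)" and "v = (1/2) *\<^sub>R (z - w)"
 have sym: "u \<in> sym_points" "v \<in> sym_points"
  unfolding u_def v_def using siegel_domain_sym[OF z] siegel_domain_sym[OF w]
  by (auto intro!: subspace_scale subspace_add subspace_diff sym_points_subspace)
 have uv: "u + v = z" "u - v = w" by (simp_all add: u_def v_def algebra_simps flip: scaleR_left_distrib)
 define E where "E = {\<alpha>. u + \<alpha> *\<^sub>C v \<in> \<D>}"
 have E: "open E" "convex E" unfolding E_def by (rule open_slice[OF sym], rule convex_slice)
 have E1: "1 \<in> E" "- 1 \<in> E" using z w uv by (auto simp: E_def scaleC.minus_left)
 have "(1/2) *\<^sub>R 1 + (1/2) *\<^sub>R (- 1) \<in> E" by (rule convexD[OF E(2) E1]) auto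
 hence E0: "0 \<in> E" by simp
 define E' where "E' = cnj -` E"
 have cnjE: "cnj ` E' = E" unfolding E'_def by (rule surj_image_vimage_eq) (metis complex_cnj_cnj surjI)
 have E': "open E'" "convex E'" unfolding E'_def by (intro open_vimage E continuous_intros,
    intro convex_linear_vimage E bounded_linear.linear bounded_linear_cnj)
 \<comment> \<open>\<open>F\<close> is antiholomorphic in its second argument, so conjugating
   \<open>\<beta>\<close> makes \<open>\<Phi>\<close> holomorphic in both variables; accordingly
   \<open>\<beta>\<close> ranges over the mirror image \<open>E'\<close> of
   \<open>E\<close>.\<close>
 define \<Phi> where "\<Phi> \<alpha> \<beta> = F (u + \<alpha> *\<^sub>C v) (u + cnj \<beta> *\<^sub>C v)" for \<alpha> \<beta>
 define \<Omega> where "\<Omega> = {\<zeta>. \<i> * \<zeta> \<in> E \<and> (- \<i>) * \<zeta> \<in> E'}"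
 have hol: "(\<lambda>\<zeta>. \<Phi> (\<i> * \<zeta>) ((- \<i>) * \<zeta>)) holomorphic_on \<Omega>" unfolding \<Omega>_def
 proof (rule separately_holomorphic_diagonal[OF E(1) E'(1)])
  show "(\<lambda>\<alpha>. \<Phi> \<alpha> \<beta>) holomorphic_on E" if "\<beta> \<in> E'" for \<beta>
   unfolding \<Phi>_def E_def by (rule holomorphic_slice, rule hol1) (use that in \<open>auto simp: E'_def E_def\<close>)
  show "(\<lambda>\<beta>. \<Phi> \<alpha> \<beta>) holomorphic_on E'" if "\<alpha> \<in> E" for \<alpha>
  proof -
   have "(\<lambda>\<beta>. cnj (F (u + \<alpha> *\<^sub>C v) (u + \<beta> *\<^sub>C v))) holomorphic_on cnj ` E'"
    unfolding cnjE E_def by (rule holomorphic_slice, rule hol2) (use that in \<open>auto simp: E_def\<close>)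
   from holomorphic_on_compose_cnj_cnj[OF this E'(1)] show ?thesis by (simp add: o_def \<Phi>_def)
  qed
  show "\<exists>M. \<forall>\<alpha>\<in>K. \<forall>\<beta>\<in>L. cmod (\<Phi> \<alpha> \<beta>) \<le> M" if K: "compact K" "K \<subseteq> E" and L: "compact L" "L \<subseteq> E'" for K L
  proof -
   let ?s = "\<lambda>\<alpha>. u + \<alpha> *\<^sub>C v"
   have "compact (?s ` (K \<union> cnj ` L))"
    using K L by (intro compact_continuous_image compact_Un continuous_intros scaleC.continuous_on) auto
   moreover have "?s ` (K \<union> cnj ` L) \<subseteq> \<D>" using K L cnjE by (auto simp: E_def E'_def)
   ultimately obtain M where "\<forall>z\<in>?s ` (K \<union> cnj ` L). \<forall>w\<in>?s ` (K \<union> cnj ` L). cmod (F z w) \<le> M"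
    using bdd by blast
   thus ?thesis by (intro exI[of _ M]) (auto simp: \<Phi>_def)
  qed
 qed
 have \<Omega>_eq: "\<Omega> = ((*) \<i>) -` E \<inter> ((*) (- \<i>)) -` E'" by (auto simp: \<Omega>_def)
 have "open \<Omega>" unfolding \<Omega>_eq by (intro open_Int open_vimage E E' continuous_intros)
 have "convex \<Omega>" unfolding \<Omega>_eq
  by (intro convex_Int convex_linear_vimage E E' bounded_linear.linear bounded_linear_mult_right)
 hence "connected \<Omega>" by (rule convex_connected)
 have 0: "0 \<in> \<Omega>" using E0 by (simp add: \<Omega>_def E'_def)
 \<comment> \<open>The identity theorem needs zeros that accumulate inside \<open>\<Omega>\<close>:
   the real points do, since \<open>\<Omega>\<close> is an open set around 0.\<close>
 have "0 islimpt (\<Omega> \<inter> \<real>)" unfolding islimpt_approachable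
 proof (intro allI impI)
  fix e :: real assume "e > 0"
  obtain d where d: "d > 0" "ball 0 d \<subseteq> \<Omega>" using \<open>open \<Omega>\<close> 0 open_contains_ball by blast
  let ?x = "complex_of_real (min d e / 2)"
  have "?x \<in> ball 0 d" using d \<open>e > 0\<close> by simp
  thus "\<exists>x'\<in>\<Omega> \<inter> \<real>. x' \<noteq> 0 \<and> dist x' 0 < e" using d \<open>e > 0\<close> by (intro bexI[of _ ?x]) auto
 qed
 moreover have "\<Phi> (\<i> * \<zeta>) ((- \<i>) * \<zeta>) = 0" if "\<zeta> \<in> \<Omega> \<inter> \<real>" for \<zeta>
  using that diag by (auto simp: \<Phi>_def \<Omega>_def E_def Reals_cnj_iff)
 moreover have "- \<i> \<in> \<Omega>" using E1 by (simp add: \<Omega>_def E'_def)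
 ultimately have "\<Phi> (\<i> * (- \<i>)) ((- \<i>) * (- \<i>)) = 0"
  using analytic_continuation[OF hol \<open>open \<Omega>\<close> \<open>connected \<Omega>\<close> _ 0, of "\<Omega> \<inter> \<real>"] by blast
 thus ?thesis using uv by (simp add: \<Phi>_def scaleC.minus_left)
qed

definition base_point :: "('n::finite, 'r::finite) point" where "base_point = (mat \<i>, 0)"

section \<open>Hilbert spaces of functions\<close>

lemma scaleC_two: "2 *\<^sub>C x = x + (x::'a::complex_normed_vector)" using scaleC_add_left[of 1 1 x] by simp

locale hilbert_functions =
 fixes H :: "('a, 'w::complex_normed_vector) function_space"
 assumes hilbert: "hilbert_function_space H"
begin

abbreviation nrm where "nrm \<equiv> ip_norm H"

lemmas hilbert_conj = hilbert[unfolded hilbert_function_space_def, THEN conjunct1]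
 hilbert[unfolded hilbert_function_space_def, THEN conjunct2, THEN conjunct1]
 hilbert[unfolded hilbert_function_space_def, THEN conjunct2, THEN conjunct2, THEN conjunct1]
 hilbert[unfolded hilbert_function_space_def, THEN conjunct2, THEN conjunct2, THEN conjunct2, THEN conjunct1]
 hilbert[unfolded hilbert_function_space_def, THEN conjunct2, THEN conjunct2, THEN conjunct2, THEN conjunct2, THEN conjunct1]
 hilbert[unfolded hilbert_function_space_def, THEN conjunct2, THEN conjunct2, THEN conjunct2, THEN conjunct2, THEN conjunct2, THEN conjunct1]
 hilbert[unfolded hilbert_function_space_def, THEN conjunct2, THEN conjunct2, THEN conjunct2, THEN conjunct2, THEN conjunct2, THEN conjunct2, THEN conjunct1]
 hilbert[unfolded hilbert_function_space_def, THEN conjunct2, THEN conjunct2, THEN conjunct2, THEN conjunct2, THEN conjunct2, THEN conjunct2, THEN conjunct2]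

lemma zero_mem: "(\<lambda>_. 0) \<in> vecs H" using hilbert_conj(1) by blast

lemma add_mem: "f \<in> vecs H ==> h \<in> vecs H ==> (\<lambda>z. f z + h z) \<in> vecs H" using hilbert_conj(2) by blast

lemma scale_mem: "f \<in> vecs H ==> (\<lambda>z. c *\<^sub>C f z) \<in> vecs H" using hilbert_conj(3) by blast

lemma ip_add_left: "f \<in> vecs H ==> h \<in> vecs H ==> k \<in> vecs H ==> ip H (\<lambda>z. f z + h z) k = ip H f k + ip H h k"
 using hilbert_conj(4) by blast

lemma ip_scale_left: "f \<in> vecs H ==> h \<in> vecs H ==> ip H (\<lambda>z. c *\<^sub>C f z) h = c * ip H f h"
 using hilbert_conj(5) by blast

lemma ip_commute: "f \<in> vecs H ==> h \<in> vecs H ==> ip H h f = cnj (ip H f h)" using hilbert_conj(6) by blast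

lemma ip_pos: "f \<in> vecs H ==> f \<noteq> (\<lambda>_. 0) ==> Re (ip H f f) > 0" using hilbert_conj(7) by blast
lemma complete:
 assumes "\<And>n. F n \<in> vecs H" and "\<And>e. e > 0 ==> \<exists>N. \<forall>m\<ge>N. \<forall>n\<ge>N. nrm (\<lambda>z. F m z - F n z) < e"
 shows "\<exists>f\<in>vecs H. (\<lambda>n. nrm (\<lambda>z. F n z - f z)) \<longlonglongrightarrow> 0" using hilbert_conj(8) assms by blast

lemma uminus_mem: "f \<in> vecs H ==> (\<lambda>z. - f z) \<in> vecs H"
 using scale_mem[of f "- 1"] by (simp add: scaleC.minus_left)

lemma diff_mem: "f \<in> vecs H ==> h \<in> vecs H ==> (\<lambda>z. f z - h z) \<in> vecs H"
 using add_mem[OF _ uminus_mem] by simp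

lemma sum_mem: "(\<And>i. i \<in> I ==> f i \<in> vecs H) ==> (\<lambda>z. \<Sum>i\<in>I. f i z) \<in> vecs H"
 by (induction I rule: infinite_finite_induct) (auto simp: zero_mem intro: add_mem)

lemma ip_add_right:
 "f \<in> vecs H ==> h \<in> vecs H ==> k \<in> vecs H ==> ip H k (\<lambda>z. f z + h z) = ip H k f + ip H k h"
 by (simp add: ip_commute[of _ k] add_mem ip_add_left)

lemma ip_scale_right: "f \<in> vecs H ==> h \<in> vecs H ==> ip H h (\<lambda>z. c *\<^sub>C f z) = cnj c * ip H h f"
 by (simp add: ip_commute[of _ h] scale_mem ip_scale_left)

lemma ip_minus_left: "f \<in> vecs H ==> k \<in> vecs H ==> ip H (\<lambda>z. - f z) k = - ip H f k"
 using ip_scale_left[of f k "- 1"] by (simp add: scaleC.minus_left)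

lemma ip_minus_right: "f \<in> vecs H ==> k \<in> vecs H ==> ip H k (\<lambda>z. - f z) = - ip H k f"
 using ip_scale_right[of f k "- 1"] by (simp add: scaleC.minus_left)

lemma ip_diff_left:
 "f \<in> vecs H ==> h \<in> vecs H ==> k \<in> vecs H ==> ip H (\<lambda>z. f z - h z) k = ip H f k - ip H h k"
 using ip_add_left[OF _ uminus_mem] by (simp add: ip_minus_left)

lemma ip_diff_right:
 "f \<in> vecs H ==> h \<in> vecs H ==> k \<in> vecs H ==> ip H k (\<lambda>z. f z - h z) = ip H k f - ip H k h"
 using ip_add_right[OF _ uminus_mem] by (simp add: ip_minus_right)

lemma ip_zero_left: "k \<in> vecs H ==> ip H (\<lambda>_. 0) k = 0"
 using ip_scale_left[OF zero_mem, of k 0] by (simp add: scaleC.zero_right)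

lemma ip_zero_right: "k \<in> vecs H ==> ip H k (\<lambda>_. 0) = 0"
 using ip_scale_right[OF zero_mem, of k 0] by (simp add: scaleC.zero_right)

lemma ip_sum_left:
 assumes "\<And>i. i \<in> I ==> f i \<in> vecs H" "k \<in> vecs H"
 shows "ip H (\<lambda>z. \<Sum>i\<in>I. f i z) k = (\<Sum>i\<in>I. ip H (f i) k)"
 using assms by (induction I rule: infinite_finite_induct) (auto simp: ip_zero_left ip_add_left sum_mem)

lemma ip_sum_right:
 assumes "\<And>i. i \<in> I ==> f i \<in> vecs H" "k \<in> vecs H"
 shows "ip H k (\<lambda>z. \<Sum>i\<in>I. f i z) = (\<Sum>i\<in>I. ip H k (f i))"
 using assms by (induction I rule: infinite_finite_induct) (auto simp: ip_zero_right ip_add_right sum_mem)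

lemma ip_nonneg: "f \<in> vecs H ==> Re (ip H f f) \<ge> 0"
 using ip_pos[of f] ip_zero_left[OF zero_mem] by (cases "f = (\<lambda>_. 0)") auto

lemma ip_self_real: "f \<in> vecs H ==> Im (ip H f f) = 0" using ip_commute[of f f] by (simp add: complex_eq_iff)

lemma nrm_nonneg [simp]: "f \<in> vecs H ==> nrm f \<ge> 0" by (simp add: ip_norm_def ip_nonneg)

lemma nrm_sq: "f \<in> vecs H ==> (nrm f)\<^sup>2 = Re (ip H f f)" by (simp add: ip_norm_def ip_nonneg)

lemma ip_self: "f \<in> vecs H ==> ip H f f = complex_of_real ((nrm f)\<^sup>2)"
 by (simp add: nrm_sq complex_eq_iff ip_self_real)

lemma nrm_eq_0: "f \<in> vecs H ==> nrm f = 0 \<longleftrightarrow> f = (\<lambda>_. 0)"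
 using ip_pos[of f] ip_zero_left[OF zero_mem] by (cases "f = (\<lambda>_. 0)") (auto simp: ip_norm_def)

lemma ip_self_eq_0: "f \<in> vecs H ==> ip H f f = 0 \<longleftrightarrow> f = (\<lambda>_. 0)" by (simp add: ip_self nrm_eq_0)

lemma nrm_scale: "f \<in> vecs H ==> nrm (\<lambda>z. c *\<^sub>C f z) = cmod c * nrm f"
proof -
 assume f: "f \<in> vecs H"
 have "(nrm (\<lambda>z. c *\<^sub>C f z))\<^sup>2 = Re (c * cnj c * ip H f f)"
  using f by (simp add: nrm_sq scale_mem ip_scale_left ip_scale_right mult.assoc)
 also have "\<dots> = (cmod c * nrm f)\<^sup>2"
  using f by (simp add: complex_norm_square[symmetric] nrm_sq power_mult_distrib del: of_real_power)
 finally show ?thesis using f by (simp add: scale_mem)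
qed

lemma nrm_minus_commute: "f \<in> vecs H ==> h \<in> vecs H ==> nrm (\<lambda>z. f z - h z) = nrm (\<lambda>z. h z - f z)"
 using nrm_scale[OF diff_mem, of h f "- 1"] by (simp add: scaleC.minus_left)

lemma nrm_sq_add:
 assumes "f \<in> vecs H" "h \<in> vecs H"
 shows "(nrm (\<lambda>z. f z + h z))\<^sup>2 = (nrm f)\<^sup>2 + 2 * Re (ip H f h) + (nrm h)\<^sup>2" using assms ip_commute[OF assms]
 by (simp add: nrm_sq add_mem ip_add_left ip_add_right)

lemma nrm_sq_diff:
 assumes "f \<in> vecs H" "h \<in> vecs H"
 shows "(nrm (\<lambda>z. f z - h z))\<^sup>2 = (nrm f)\<^sup>2 - 2 * Re (ip H f h) + (nrm h)\<^sup>2" using assms ip_commute[OF assms]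
 by (simp add: nrm_sq diff_mem ip_diff_left ip_diff_right)

lemma Cauchy_Schwarz:
 assumes f: "f \<in> vecs H" and h: "h \<in> vecs H"
 shows "cmod (ip H f h) \<le> nrm f * nrm h"
proof (cases "h = (\<lambda>_. 0)")
 case True
 thus ?thesis using f h by (simp add: ip_zero_right)
next
 case False
 define N where "N = (nrm h)\<^sup>2"
 have N: "N > 0" using False h nrm_eq_0[of h] by (simp add: N_def)
 define c where "c = ip H f h / N"
 have "0 \<le> (nrm (\<lambda>z. f z - c *\<^sub>C h z))\<^sup>2" by simp
 also have "\<dots> = (nrm f)\<^sup>2 - 2 * Re (cnj c * ip H f h) + (cmod c * nrm h)\<^sup>2"
  using f h by (simp add: nrm_sq_diff scale_mem ip_scale_right nrm_scale)
 also have "cnj c * ip H f h = complex_of_real ((cmod (ip H f h))\<^sup>2 / N)"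
  by (simp only: c_def of_real_divide complex_norm_square complex_cnj_divide complex_cnj_complex_of_real)
   (simp add: mult.commute)
 also have "(cmod c * nrm h)\<^sup>2 = (cmod (ip H f h))\<^sup>2 / N"
  using N by (simp add: c_def power_mult_distrib N_def[symmetric] norm_divide power_divide)
   (simp add: power2_eq_square)
 finally have "(cmod (ip H f h))\<^sup>2 / N \<le> (nrm f)\<^sup>2" by simp
 hence "(cmod (ip H f h))\<^sup>2 \<le> (nrm f * nrm h)\<^sup>2" using N by (simp add: field_simps N_def power_mult_distrib)
 thus ?thesis by (rule power2_le_imp_le) (use f h in simp)
qed

lemma tendsto_ip:
 assumes F: "\<And>n. F n \<in> vecs H" and f: "f \<in> vecs H" and lim: "(\<lambda>n. nrm (\<lambda>z. F n z - f z)) \<longlonglongrightarrow> 0"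
  and h: "h \<in> vecs H"
 shows "(\<lambda>n. ip H (F n) h) \<longlonglongrightarrow> ip H f h"
proof -
 have "cmod (ip H (F n) h - ip H f h) \<le> nrm (\<lambda>z. F n z - f z) * nrm h" for n
  using Cauchy_Schwarz[OF diff_mem[OF F f] h] by (simp add: ip_diff_left[OF F f h])
 thus ?thesis
  by (intro LIM_zero_cancel[OF Lim_null_comparison[OF _ tendsto_mult_left_zero[OF lim]]] always_eventually allI)
qed

lemma nrm_triangle:
 assumes f: "f \<in> vecs H" and h: "h \<in> vecs H"
 shows "nrm (\<lambda>z. f z + h z) \<le> nrm f + nrm h"
proof (rule power2_le_imp_le)
 have "Re (ip H f h) \<le> nrm f * nrm h" using Cauchy_Schwarz[OF f h] complex_Re_le_cmod order_trans by blast
 thus "(nrm (\<lambda>z. f z + h z))\<^sup>2 \<le> (nrm f + nrm h)\<^sup>2" by (simp add: nrm_sq_add[OF f h] power2_sum)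
qed (use f h in simp)

lemma nrm_triangle_diff:
 assumes f: "f \<in> vecs H" and h: "h \<in> vecs H" and k: "k \<in> vecs H"
 shows "nrm (\<lambda>z. f z - k z) \<le> nrm (\<lambda>z. f z - h z) + nrm (\<lambda>z. h z - k z)"
 using nrm_triangle[OF diff_mem[OF f h] diff_mem[OF h k]] by simp

definition closed_subspace :: "('a => 'w) set => bool" where "closed_subspace S \<longleftrightarrow> S \<subseteq> vecs H \<and> (\<lambda>_. 0) \<in> S \<and>
  (\<forall>f\<in>S. \<forall>h\<in>S. (\<lambda>z. f z + h z) \<in> S) \<and> (\<forall>c. \<forall>f\<in>S. (\<lambda>z. c *\<^sub>C f z) \<in> S) \<and>
  (\<forall>F f. (\<forall>n. F n \<in> S) \<and> f \<in> vecs H \<and> (\<lambda>n. nrm (\<lambda>z. F n z - f z)) \<longlonglongrightarrow> 0 \<longrightarrow> f \<in> S)"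

text \<open>By the parallelogram law a sequence in \<open>S\<close> minimizing the distance to \<open>f\<close> is a Cauchy sequence.\<close>

lemma projection:
 assumes S: "closed_subspace S" and f: "f \<in> vecs H"
 shows "\<exists>h\<in>S. \<forall>k\<in>S. ip H (\<lambda>z. f z - h z) k = 0"
proof -
 have SH: "h \<in> S ==> h \<in> vecs H" for h using S by (auto simp: closed_subspace_def)
 have Sadd: "h \<in> S ==> k \<in> S ==> (\<lambda>z. h z + k z) \<in> S" for h k using S by (auto simp: closed_subspace_def)
 have Sscale: "h \<in> S ==> (\<lambda>z. c *\<^sub>C h z) \<in> S" for h c using S by (auto simp: closed_subspace_def)
 define \<delta> where "\<delta> h = (nrm (\<lambda>z. f z - h z))\<^sup>2" for h
 define d where "d = Inf (\<delta> ` S)"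
 have bdd: "bdd_below (\<delta> ` S)" by (rule bdd_belowI[of _ 0]) (auto simp: \<delta>_def)
 have ne: "\<delta> ` S \<noteq> {}" using S by (auto simp: closed_subspace_def)
 have d_le: "d \<le> \<delta> h" if "h \<in> S" for h unfolding d_def using that bdd by (auto intro: cInf_lower)
 have "\<exists>h\<in>S. \<delta> h < d + inverse (real (Suc n))" for n
 proof -
  have "d < d + inverse (real (Suc n))" by simp
  thus ?thesis unfolding d_def by (subst (asm) cInf_less_iff[OF ne bdd]) auto
 qed
 then obtain h where h: "\<And>n. h n \<in> S" "\<And>n. \<delta> (h n) < d + inverse (real (Suc n))" by metis
 note hH = SH[OF h(1)]
 have par: "(nrm (\<lambda>z. h m z - h n z))\<^sup>2 \<le> 2 * inverse (real (Suc m)) + 2 * inverse (real (Suc n))" for m n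
 proof -
  let ?a = "\<lambda>z. f z - h n z" and ?b = "\<lambda>z. f z - h m z"
  have ab: "?a \<in> vecs H" "?b \<in> vecs H" using f hH by (auto intro: diff_mem)
  have mid: "(\<lambda>z. (1/2) *\<^sub>C (h n z + h m z)) \<in> S" using Sscale[OF Sadd[OF h(1) h(1)]] .
  have 1: "(nrm (\<lambda>z. ?a z + ?b z))\<^sup>2 = 4 * \<delta> (\<lambda>z. (1/2) *\<^sub>C (h n z + h m z))"
  proof -
   have "(\<lambda>z. ?a z + ?b z) = (\<lambda>z. 2 *\<^sub>C (f z - (1/2) *\<^sub>C (h n z + h m z)))"
    by (simp add: scaleC.diff_right scaleC_scaleC scaleC_two algebra_simps)
   thus ?thesis using nrm_scale[OF diff_mem[OF f SH[OF mid]], of 2] by (simp add: \<delta>_def power_mult_distrib)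
  qed
  have 2: "(nrm (\<lambda>z. ?a z - ?b z))\<^sup>2 = (nrm (\<lambda>z. h m z - h n z))\<^sup>2" by simp
  have "(nrm (\<lambda>z. ?a z + ?b z))\<^sup>2 + (nrm (\<lambda>z. ?a z - ?b z))\<^sup>2 = 2 * \<delta> (h n) + 2 * \<delta> (h m)"
   using nrm_sq_add[OF ab] nrm_sq_diff[OF ab] by (simp add: \<delta>_def)
  hence "(nrm (\<lambda>z. h m z - h n z))\<^sup>2 = 2 * \<delta> (h n) + 2 * \<delta> (h m) - 4 * \<delta> (\<lambda>z. (1/2) *\<^sub>C (h n z + h m z))"
   unfolding 1 2 by simp
  also have "\<dots> \<le> 2 * inverse (real (Suc m)) + 2 * inverse (real (Suc n))"
   using h(2)[of n] h(2)[of m] d_le[OF mid] by linarith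
  finally show ?thesis .
 qed
 have "\<exists>g\<in>vecs H. (\<lambda>n. nrm (\<lambda>z. h n z - g z)) \<longlonglongrightarrow> 0"
 proof (rule complete[OF hH])
  fix e :: real assume e: "e > 0"
  obtain N where N: "inverse (real (Suc N)) < e\<^sup>2 / 4" using reals_Archimedean[of "e\<^sup>2 / 4"] e by auto
  have "nrm (\<lambda>z. h m z - h n z) < e" if "m \<ge> N" "n \<ge> N" for m n
  proof (rule power2_less_imp_less)
   have "inverse (real (Suc m)) \<le> inverse (real (Suc N))" "inverse (real (Suc n)) \<le> inverse (real (Suc N))"
    using that by (auto intro: le_imp_inverse_le)
   thus "(nrm (\<lambda>z. h m z - h n z))\<^sup>2 < e\<^sup>2" using par[of m n] N by linarith
  qed (use e in simp)
  thus "\<exists>N. \<forall>m\<ge>N. \<forall>n\<ge>N. nrm (\<lambda>z. h m z - h n z) < e" by blast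
 qed
 then obtain g where g: "g \<in> vecs H" "(\<lambda>n. nrm (\<lambda>z. h n z - g z)) \<longlonglongrightarrow> 0" by blast
 have gS: "g \<in> S" using S g h(1) unfolding closed_subspace_def by blast
 let ?u = "\<lambda>z. f z - g z"
 have uH: "?u \<in> vecs H" using f g by (intro diff_mem)
 have "nrm ?u \<le> sqrt d"
 proof (rule LIMSEQ_le)
  show "(\<lambda>n. sqrt (d + inverse (real (Suc n))) + nrm (\<lambda>z. h n z - g z)) \<longlonglongrightarrow> sqrt d"
   by (rule tendsto_eq_intros tendsto_real_sqrt LIMSEQ_inverse_real_of_nat g refl | simp)+
  show "(\<lambda>n. nrm ?u) \<longlonglongrightarrow> nrm ?u" by simp
  have "nrm ?u \<le> sqrt (d + inverse (real (Suc n))) + nrm (\<lambda>z. h n z - g z)" for n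
  proof -
   have "nrm (\<lambda>z. f z - h n z) \<le> sqrt (d + inverse (real (Suc n)))"
    using h(2)[of n] by (intro real_le_rsqrt) (simp add: \<delta>_def)
   thus ?thesis using nrm_triangle_diff[OF f hH g(1), of n] by simp
  qed
  thus "\<exists>N. \<forall>n\<ge>N. nrm ?u \<le> sqrt (d + inverse (real (Suc n))) + nrm (\<lambda>z. h n z - g z)" by blast
 qed
 moreover have "d \<ge> 0" unfolding d_def using ne by (intro cInf_greatest) (auto simp: \<delta>_def)
 ultimately have u_d: "(nrm ?u)\<^sup>2 \<le> d" using uH by (metis nrm_nonneg power_mono real_sqrt_pow2)
 have "ip H ?u k = 0" if k: "k \<in> S" for k
 proof -
  define a where "a = ip H ?u k"
  \<comment> \<open>With this step length the quadratic term of the variation is at most half of the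
    linear one. The 1 in the denominator covers the case \<open>k = 0\<close>.\<close>
  define t where "t = 1 / ((nrm k)\<^sup>2 + 1)"
  have t: "t > 0" "t * (nrm k)\<^sup>2 \<le> 1" by (auto simp: t_def add_nonneg_pos)
  define c where "c = t * a"
  have gk: "(\<lambda>z. g z + c *\<^sub>C k z) \<in> S" using Sadd[OF gS Sscale[OF k]] .
  have "(nrm ?u)\<^sup>2 \<le> \<delta> (\<lambda>z. g z + c *\<^sub>C k z)" using u_d d_le[OF gk] by simp
  also have "\<dots> = (nrm (\<lambda>z. ?u z - c *\<^sub>C k z))\<^sup>2" by (simp add: \<delta>_def diff_diff_eq)
  also have "\<dots> = (nrm ?u)\<^sup>2 - 2 * Re (cnj c * a) + (cmod c * nrm k)\<^sup>2"
   using uH SH[OF k] by (simp add: nrm_sq_diff scale_mem ip_scale_right nrm_scale a_def)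
  also have "cnj c * a = complex_of_real (t * (cmod a)\<^sup>2)"
   by (simp only: c_def complex_cnj_mult complex_cnj_complex_of_real of_real_mult complex_norm_square)
    (simp add: mult_ac)
  also have "(cmod c * nrm k)\<^sup>2 = t * (cmod a)\<^sup>2 * (t * (nrm k)\<^sup>2)"
   by (simp add: c_def norm_mult power_mult_distrib power2_eq_square)
  finally have "2 * (t * (cmod a)\<^sup>2) \<le> t * (cmod a)\<^sup>2 * (t * (nrm k)\<^sup>2)" by simp
  also have "\<dots> \<le> t * (cmod a)\<^sup>2 * 1" using t by (intro mult_left_mono) auto
  finally have "t * (cmod a)\<^sup>2 \<le> 0" by simp
  thus ?thesis using t by (simp add: a_def mult_le_0_iff)
 qed
 thus ?thesis using gS by blast
qed

text \<open>If \<open>\<phi>\<close> does not vanish identically, the component \<open>g\<close> of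
  some \<open>f0\<close> orthogonal to the kernel of \<open>\<phi>\<close> represents
  \<open>\<phi>\<close> up to a scalar. The scalar is conjugated because the inner product is
  conjugate linear on the right.\<close>

lemma Riesz:
 assumes add: "\<And>f h. f \<in> vecs H ==> h \<in> vecs H ==> \<phi> (\<lambda>z. f z + h z) = \<phi> f + \<phi> h"
  and scale: "\<And>c f. f \<in> vecs H ==> \<phi> (\<lambda>z. c *\<^sub>C f z) = c * \<phi> f"
  and cont: "\<And>F f. (\<And>n. F n \<in> vecs H) ==> f \<in> vecs H ==>
   (\<lambda>n. nrm (\<lambda>z. F n z - f z)) \<longlonglongrightarrow> 0 ==> (\<lambda>n. \<phi> (F n)) \<longlonglongrightarrow> \<phi> f"
 shows "\<exists>k\<in>vecs H. \<forall>f\<in>vecs H. ip H f k = \<phi> f"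
proof (cases "\<forall>f\<in>vecs H. \<phi> f = 0")
 case True
 thus ?thesis using zero_mem ip_zero_right by force
next
 case False
 then obtain f0 where f0: "f0 \<in> vecs H" "\<phi> f0 \<noteq> 0" by blast
 define S where "S = {f \<in> vecs H. \<phi> f = 0}"
 have \<phi>0: "\<phi> (\<lambda>_. 0) = 0" using scale[OF zero_mem, of 0] by (simp add: scaleC.zero_right)
 have "closed_subspace S" unfolding closed_subspace_def
 proof (intro conjI allI impI ballI)
  fix F f assume F: "(\<forall>n. F n \<in> S) \<and> f \<in> vecs H \<and> (\<lambda>n. nrm (\<lambda>z. F n z - f z)) \<longlonglongrightarrow> 0"
  hence "(\<lambda>n. \<phi> (F n)) \<longlonglongrightarrow> \<phi> f" by (intro cont) (auto simp: S_def)
  moreover have "\<phi> (F n) = 0" for n using F by (auto simp: S_def)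
  ultimately have "\<phi> f = 0" by (simp add: LIMSEQ_const_iff)
  thus "f \<in> S" using F by (simp add: S_def)
 qed (auto simp: S_def \<phi>0 zero_mem add_mem scale_mem add scale)
 from projection[OF this f0(1)] obtain h where h: "h \<in> S"
  and orth: "\<And>k. k \<in> S ==> ip H (\<lambda>z. f0 z - h z) k = 0" by blast
 define g where "g = (\<lambda>z. f0 z - h z)"
 have hH: "h \<in> vecs H" "\<phi> h = 0" using h by (auto simp: S_def)
 have gH: "g \<in> vecs H" unfolding g_def using f0 hH by (intro diff_mem)
 have "\<phi> (\<lambda>z. g z + h z) = \<phi> g + \<phi> h" using gH hH by (intro add)
 hence \<phi>g: "\<phi> g \<noteq> 0" using f0 hH by (simp add: g_def)
 hence gg: "ip H g g \<noteq> 0" using gH \<phi>0 by (auto simp: ip_self_eq_0)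
 show ?thesis
 proof (intro bexI ballI)
  let ?k = "\<lambda>z. cnj (\<phi> g / ip H g g) *\<^sub>C g z"
  show "?k \<in> vecs H" using gH by (rule scale_mem)
  fix f assume f: "f \<in> vecs H"
  \<comment> \<open>Subtracting this multiple of \<open>g\<close> moves \<open>f\<close> into the
    kernel of \<open>\<phi>\<close>, to which \<open>g\<close> is orthogonal.\<close>
  let ?s = "\<lambda>z. f z + (- (\<phi> f / \<phi> g)) *\<^sub>C g z"
  have "?s \<in> S" using f gH \<phi>g add[OF f scale_mem[OF gH]] by (auto simp: S_def scale intro!: add_mem scale_mem)
  hence "ip H g ?s = 0" using orth by (simp add: g_def)
  moreover have "?s \<in> vecs H" using \<open>?s \<in> S\<close> by (simp add: S_def)
  ultimately have "ip H ?s g = 0" using ip_commute[of g ?s] gH by simp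
  hence "ip H f g = \<phi> f / \<phi> g * ip H g g" using f gH by (simp add: ip_add_left scale_mem ip_scale_left)
  thus "ip H f ?k = \<phi> f" using f gH \<phi>g gg by (simp add: ip_scale_right field_simps)
 qed
qed

end

section \<open>Reproducing kernels\<close>

text \<open>The linear functionals \<open>co i\<close> are the coordinates of the finite-dimensional value space.\<close>

locale reproducing_kernel_space = hilbert_functions H
 for H :: "('a::complex_normed_vector, 'w::complex_normed_vector) function_space" +
 fixes D :: "'a set" and co :: "'i::finite => 'w => complex"
 assumes embedded: "continuously_embedded D H" and vecs_holomorphic: "vecs H \<subseteq> holomorphic_functions D"
  and co_bounded: "bounded_linear (co i)" and co_scale: "co i (c *\<^sub>C x) = c * co i x"
  and co_inject: "(\<And>i. co i x = co i y) ==> x = y"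
begin

lemma co_add: "co i (x + y) = co i x + co i y"
 using co_bounded by (simp add: bounded_linear.linear linear_add)

lemma co_zero: "co i 0 = 0" using co_bounded by (simp add: bounded_linear.linear linear_0)

lemma vecs_outside: "f \<in> vecs H ==> z \<notin> D ==> f z = 0"
 using vecs_holomorphic by (auto simp: holomorphic_functions_def)

lemma vecs_eqI:
 assumes "f \<in> vecs H" "h \<in> vecs H" "\<And>z i. z \<in> D ==> co i (f z) = co i (h z)"
 shows "f = h"
proof
 fix z show "f z = h z" using assms(3) vecs_outside[OF assms(1)] vecs_outside[OF assms(2)]
  by (cases "z \<in> D") (auto intro: co_inject)
qed

text \<open>A one-point set is compact, so uniform convergence on compact sets contains pointwise
  convergence.\<close>

lemma limit_pointwise:
 assumes "\<And>n. F n \<in> vecs H" "f \<in> vecs H" "(\<lambda>n. nrm (\<lambda>z. F n z - f z)) \<longlonglongrightarrow> 0" "w \<in> D"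
 shows "(\<lambda>n. F n w) \<longlonglongrightarrow> f w"
proof -
 have "\<forall>K. compact K \<and> K \<subseteq> D \<longrightarrow> uniform_limit K F f sequentially"
  using embedded[unfolded continuously_embedded_def, THEN spec, THEN spec, THEN mp, of F f] assms by simp
 from spec[OF this, of "{w}"] have "uniform_limit {w} F f sequentially" using assms by simp
 thus ?thesis by (rule tendsto_uniform_limitI) simp
qed

lemma kernel_exists: "w \<in> D ==> \<exists>k\<in>vecs H. \<forall>f\<in>vecs H. ip H f k = co i (f w)"
proof (rule Riesz)
 fix F f assume "w \<in> D" "\<And>n. F n \<in> vecs H" "f \<in> vecs H" "(\<lambda>n. nrm (\<lambda>z. F n z - f z)) \<longlonglongrightarrow> 0"
 thus "(\<lambda>n. co i (F n w)) \<longlonglongrightarrow> co i (f w)" by (intro bounded_linear.tendsto[OF co_bounded] limit_pointwise)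
qed (auto simp: co_add co_scale)

text \<open>Column \<open>i\<close> of the reproducing kernel at \<open>w\<close>, as a function of
  the other variable.\<close>

definition kr :: "'a => 'i => 'a => 'w"
 where "kr w i = (SOME k. k \<in> vecs H \<and> (\<forall>f\<in>vecs H. ip H f k = co i (f w)))"

lemma kr: "w \<in> D ==> kr w i \<in> vecs H \<and> (\<forall>f\<in>vecs H. ip H f (kr w i) = co i (f w))"
 unfolding kr_def using someI_ex[OF kernel_exists[unfolded Bex_def]] .

lemma kr_mem: "w \<in> D ==> kr w i \<in> vecs H" using kr by blast

lemma kr_reproducing: "w \<in> D ==> f \<in> vecs H ==> ip H f (kr w i) = co i (f w)" using kr by blast

lemma kr_reproducing': "w \<in> D ==> f \<in> vecs H ==> ip H (kr w i) f = cnj (co i (f w))"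
 using kr_reproducing ip_commute kr_mem by metis

lemma kr_unique:
 assumes "w \<in> D" "k \<in> vecs H" "\<And>f. f \<in> vecs H ==> ip H f k = co i (f w)"
 shows "k = kr w i"
proof -
 have "ip H f (\<lambda>z. k z - kr w i z) = 0" if "f \<in> vecs H" for f
  using assms kr_mem kr_reproducing that by (simp add: ip_diff_right)
 hence "(\<lambda>z. k z - kr w i z) = (\<lambda>_. 0)" using assms kr_mem diff_mem ip_self_eq_0 by metis
 thus ?thesis by (metis eq_iff_diff_eq_0 ext)
qed

lemma kr_swap: "w \<in> D ==> z \<in> D ==> co i (kr w j z) = cnj (co j (kr z i w))"
 using kr_reproducing[of z "kr w j" i] kr_reproducing'[of w "kr z i" j] kr_mem by simp

lemma kr_diagonal: "w \<in> D ==> co i (kr w i w) = complex_of_real ((nrm (kr w i))\<^sup>2)"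
 using kr_reproducing[of w "kr w i" i] kr_mem ip_self by simp

lemma kr_nonzero: "vecs H \<noteq> {\<lambda>_. 0} ==> \<exists>w\<in>D. \<exists>i. kr w i \<noteq> (\<lambda>_. 0)"
proof (rule ccontr)
 assume ne: "vecs H \<noteq> {\<lambda>_. 0}" and "\<not> (\<exists>w\<in>D. \<exists>i. kr w i \<noteq> (\<lambda>_. 0))"
 hence 0: "kr w i = (\<lambda>_. 0)" if "w \<in> D" for w i using that by blast
 have "f = (\<lambda>_. 0)" if f: "f \<in> vecs H" for f
 proof (rule vecs_eqI[OF f zero_mem])
  fix z i assume "z \<in> D"
  thus "co i (f z) = co i 0" using kr_reproducing[OF _ f, of z i] 0 f by (simp add: ip_zero_right co_zero)
 qed
 thus False using ne zero_mem by blast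
qed

text \<open>If the norms \<open>N n\<close> were unbounded along points \<open>z n\<close> of
  \<open>K\<close>, the kernel functions divided by the square of \<open>N n\<close> would tend to 0
  in norm, hence uniformly on \<open>K\<close>; but their coordinate at \<open>z n\<close> is 1.
  This bound provides the local boundedness that polarization asks of a kernel.\<close>

lemma kr_locally_bounded:
 assumes K: "compact K" "K \<subseteq> D"
 shows "\<exists>C. \<forall>z\<in>K. \<forall>i. nrm (kr z i) \<le> C"
proof (rule ccontr)
 assume "\<not> (\<exists>C. \<forall>z\<in>K. \<forall>i. nrm (kr z i) \<le> C)"
 hence "\<exists>z i. z \<in> K \<and> nrm (kr z i) > real (Suc n)" for n by (metis linorder_not_le)
 then obtain z i where zi: "\<And>n. z n \<in> K" "\<And>n. nrm (kr (z n) (i n)) > real (Suc n)" by metis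
 define N where "N n = nrm (kr (z n) (i n))" for n
 have N: "N n > real (Suc n)" for n using zi by (simp add: N_def)
 hence N0: "N n > 0" for n by (meson of_nat_0_less_iff order_less_trans zero_less_Suc)
 have zD: "z n \<in> D" for n using zi K by blast
 note krH = kr_mem[OF zD]
 define F where "F n = (\<lambda>x. complex_of_real (inverse ((N n)\<^sup>2)) *\<^sub>C kr (z n) (i n) x)" for n
 have FH: "F n \<in> vecs H" for n unfolding F_def using krH by (rule scale_mem)
 have nF: "nrm (\<lambda>x. F n x - 0) = inverse (N n)" for n
  using N0[of n] nrm_scale[OF krH, of "complex_of_real (inverse ((N n)\<^sup>2))" n "i n"]
  by (simp add: F_def norm_mult norm_inverse N_def[symmetric] power2_eq_square)
 have "(\<lambda>n. inverse (N n)) \<longlonglongrightarrow> 0"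
 proof (rule tendsto_sandwich[OF _ _ tendsto_const LIMSEQ_inverse_real_of_nat])
  show "\<forall>\<^sub>F n in sequentially. 0 \<le> inverse (N n)" using N0 by (auto intro!: always_eventually less_imp_le)
  show "\<forall>\<^sub>F n in sequentially. inverse (N n) \<le> inverse (real (Suc n))"
   by (intro always_eventually allI le_imp_inverse_le less_imp_le N) simp
 qed
 hence "uniform_limit K F (\<lambda>_. 0) sequentially"
  using embedded[unfolded continuously_embedded_def, THEN spec, THEN spec, THEN mp, of F "\<lambda>_. 0"]
   K FH zero_mem nF by simp
 moreover obtain B where B: "B > 0" "\<And>i x. cmod (co i x) \<le> B * norm x"
 proof -
  have "\<forall>i. \<exists>B>0. \<forall>x. cmod (co i x) \<le> norm x * B" using co_bounded bounded_linear.pos_bounded by blast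
  then obtain b where b: "\<And>i. b i > 0" "\<And>i x. cmod (co i x) \<le> norm x * b i" by metis
  show ?thesis
  proof (rule that[of "\<Sum>i\<in>UNIV. b i"])
   show "(\<Sum>i\<in>UNIV. b i) > 0" using b by (intro sum_pos) auto
   fix i and x :: 'w
   have "b i \<le> (\<Sum>i\<in>UNIV. b i)" using b by (intro member_le_sum) (auto intro: less_imp_le)
   hence "norm x * b i \<le> norm x * (\<Sum>i\<in>UNIV. b i)" by (intro mult_left_mono) auto
   thus "cmod (co i x) \<le> (\<Sum>i\<in>UNIV. b i) * norm x" using b(2)[of i x] by (simp add: mult.commute)
  qed
 qed
 ultimately have "\<forall>\<^sub>F n in sequentially. \<forall>x\<in>K. dist (F n x) 0 < 1 / B"
  unfolding uniform_limit_iff by (meson zero_less_divide_1_iff)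
 then obtain n where n: "\<And>x. x \<in> K ==> norm (F n x) < 1 / B" by (auto simp: eventually_sequentially)
 have "co (i n) (F n (z n)) = 1"
  using kr_diagonal[OF zD[of n], of "i n"] N0[of n] by (simp add: F_def co_scale N_def[symmetric])
 hence "1 \<le> B * norm (F n (z n))" using B(2)[of "i n" "F n (z n)"] by simp
 thus False using n[OF zi(1), of n] B(1) by (simp add: field_simps)
qed

lemma holomorphic_co:
 assumes "f \<in> vecs H"
 shows "holomorphic_map_on (\<lambda>z. co i (f z)) D"
proof -
 have "f \<in> holomorphic_functions D" using assms vecs_holomorphic by (rule rev_subsetD)
 hence hol: "holomorphic_map_on f D" by (simp add: holomorphic_functions_def)
 have "\<exists>F. ((\<lambda>z. co i (f z)) has_derivative F) (at z within D) \<and> (\<forall>c x. F (c *\<^sub>C x) = c *\<^sub>C F x)"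
  if zD: "z \<in> D" for z
 proof -
  obtain F where F: "(f has_derivative F) (at z within D)" "\<forall>c x. F (c *\<^sub>C x) = c *\<^sub>C F x"
   using bspec[OF hol[unfolded holomorphic_map_on_def] zD] by (elim exE conjE)
  have "((\<lambda>z. co i (f z)) has_derivative (\<lambda>x. co i (F x))) (at z within D)"
   by (rule bounded_linear.has_derivative[OF co_bounded F(1)])
  moreover have "\<forall>c x. co i (F (c *\<^sub>C x)) = c *\<^sub>C co i (F x)" using F(2) by (simp add: co_scale)
  ultimately show ?thesis by (intro exI[of _ "\<lambda>x. co i (F x)"] conjI)
 qed
 thus ?thesis unfolding holomorphic_map_on_def by (intro ballI)
qed

end

text \<open>The functions of \<open>H1\<close> that lie in \<open>H2\<close> with proportional inner
  products form a closed subspace. It contains all kernel functions, and a function orthogonal to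
  these vanishes. A kernel multiplied by \<open>\<kappa>\<close> belongs to the inner product
  divided by \<open>\<kappa>\<close>.\<close>

lemma kernel_determines_space:
 fixes H1 H2 :: "('a::complex_normed_vector, 'w::complex_normed_vector) function_space"
 assumes 1: "reproducing_kernel_space H1 D co" and 2: "reproducing_kernel_space H2 D co" and \<kappa>: "\<kappa> > 0"
  and kr_eq: "\<And>w i. w \<in> D ==> reproducing_kernel_space.kr H1 co w i
   = (\<lambda>z. complex_of_real \<kappa> *\<^sub>C reproducing_kernel_space.kr H2 co w i z)"
 shows "vecs H1 \<subseteq> vecs H2" "f \<in> vecs H1 ==> h \<in> vecs H1 ==> ip H2 f h = \<kappa> * ip H1 f h"
proof -
 interpret r1: reproducing_kernel_space H1 D co by fact
 interpret r2: reproducing_kernel_space H2 D co by fact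
 define S where "S = {f. f \<in> vecs H1 \<and> f \<in> vecs H2 \<and>
  (\<forall>h. h \<in> vecs H1 \<longrightarrow> h \<in> vecs H2 \<longrightarrow> ip H2 f h = \<kappa> * ip H1 f h)}"
 have SD: "f \<in> vecs H1" "f \<in> vecs H2" "\<And>h. h \<in> vecs H1 ==> h \<in> vecs H2 ==> ip H2 f h = \<kappa> * ip H1 f h"
  if "f \<in> S" for f using that by (auto simp: S_def)
 have kS: "r1.kr w i \<in> S" if w: "w \<in> D" for w i
 proof -
  have eq: "r1.kr w i = (\<lambda>z. complex_of_real \<kappa> *\<^sub>C r2.kr w i z)" by (rule kr_eq[OF w])
  have "r1.kr w i \<in> vecs H2" unfolding eq by (rule r2.scale_mem[OF r2.kr_mem[OF w]])
  moreover have "ip H2 (r1.kr w i) h = \<kappa> * ip H1 (r1.kr w i) h" if "h \<in> vecs H1" "h \<in> vecs H2" for h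
   unfolding r1.kr_reproducing'[OF w that(1)] unfolding eq
   by (simp add: r2.ip_scale_left[OF r2.kr_mem[OF w] that(2)] r2.kr_reproducing'[OF w that(2)])
  ultimately show ?thesis using r1.kr_mem[OF w] by (simp add: S_def)
 qed
 have "r1.closed_subspace S" unfolding r1.closed_subspace_def
 proof (intro conjI ballI allI impI)
  fix F f assume "(\<forall>n. F n \<in> S) \<and> f \<in> vecs H1 \<and> (\<lambda>n. ip_norm H1 (\<lambda>z. F n z - f z)) \<longlonglongrightarrow> 0"
  hence FS: "\<And>n. F n \<in> S" and f: "f \<in> vecs H1" and lim: "(\<lambda>n. ip_norm H1 (\<lambda>z. F n z - f z)) \<longlonglongrightarrow> 0" by blast+
  note F1 = SD(1)[OF FS] and F2 = SD(2)[OF FS]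
  \<comment> \<open>The norms are proportional on \<open>S\<close>, so the sequence is Cauchy for
    both of them; the two limits agree because both spaces are continuously embedded in the same
    functions.\<close>
  have "\<exists>g\<in>vecs H2. (\<lambda>n. ip_norm H2 (\<lambda>z. F n z - g z)) \<longlonglongrightarrow> 0"
  proof (rule r2.complete[OF F2])
   fix e :: real assume "e > 0"
   hence "e / (2 * sqrt \<kappa>) > 0" using \<kappa> by simp
   from order_tendstoD(2)[OF lim this] obtain N
    where N: "\<And>n. n \<ge> N ==> ip_norm H1 (\<lambda>z. F n z - f z) < e / (2 * sqrt \<kappa>)"
    by (auto simp: eventually_sequentially)
   have "ip_norm H2 (\<lambda>z. F m z - F n z) < e" if "m \<ge> N" "n \<ge> N" for m n
   proof -
    have "ip_norm H1 (\<lambda>z. F m z - F n z) < e / (2 * sqrt \<kappa>) + e / (2 * sqrt \<kappa>)"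
     using r1.nrm_triangle_diff[OF F1[of m] f F1[of n]] N[OF that(1)] N[OF that(2)]
      r1.nrm_minus_commute[OF f F1[of n]] by linarith
    hence "sqrt \<kappa> * ip_norm H1 (\<lambda>z. F m z - F n z) < e" using \<kappa> by (simp add: field_simps)
    moreover have "ip H2 (\<lambda>z. F m z - F n z) (\<lambda>z. F m z - F n z) = \<kappa> * ip H1 (\<lambda>z. F m z - F n z) (\<lambda>z. F m z - F n z)"
     by (simp add: r1.ip_diff_left r2.ip_diff_left r1.diff_mem r2.diff_mem F1 F2 SD(3)[OF FS] right_diff_distrib)
    ultimately show ?thesis using \<kappa> by (simp add: ip_norm_def real_sqrt_mult)
   qed
   thus "\<exists>N. \<forall>m\<ge>N. \<forall>n\<ge>N. ip_norm H2 (\<lambda>z. F m z - F n z) < e" by blast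
  qed
  then obtain g where g: "g \<in> vecs H2" "(\<lambda>n. ip_norm H2 (\<lambda>z. F n z - g z)) \<longlonglongrightarrow> 0" by blast
  have fg: "f = g"
  proof
   fix z show "f z = g z"
   proof (cases "z \<in> D")
    case True
    show ?thesis
     using r1.limit_pointwise[OF F1 f lim True] r2.limit_pointwise[OF F2 g True] by (rule LIMSEQ_unique)
   qed (use r1.vecs_outside[OF f] r2.vecs_outside[OF g(1)] in auto)
  qed
  have "ip H2 f h = \<kappa> * ip H1 f h" if h: "h \<in> vecs H1" "h \<in> vecs H2" for h
  proof (rule LIMSEQ_unique)
   show "(\<lambda>n. ip H2 (F n) h) \<longlonglongrightarrow> ip H2 f h" unfolding fg by (rule r2.tendsto_ip[OF F2 g h(2)])
   show "(\<lambda>n. ip H2 (F n) h) \<longlonglongrightarrow> \<kappa> * ip H1 f h"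
    unfolding SD(3)[OF FS h] by (intro tendsto_mult_left r1.tendsto_ip F1 f lim h)
  qed
  thus "f \<in> S" using f g(1) by (simp add: S_def fg)
 qed (auto simp: S_def r1.zero_mem r2.zero_mem r1.ip_zero_left r2.ip_zero_left r1.add_mem r2.add_mem r1.ip_add_left
   r2.ip_add_left r1.scale_mem r2.scale_mem r1.ip_scale_left r2.ip_scale_left distrib_left)
 note proj = r1.projection[OF this]
 have all: "f \<in> S" if f: "f \<in> vecs H1" for f
 proof -
  obtain h where h: "h \<in> S" "\<And>k. k \<in> S ==> ip H1 (\<lambda>z. f z - h z) k = 0" using proj[OF f] by blast
  have "(\<lambda>z. f z - h z) = (\<lambda>_. 0)" using h(2)[OF kS] r1.kr_reproducing[OF _ r1.diff_mem[OF f SD(1)[OF h(1)]]]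
   by (intro r1.vecs_eqI r1.diff_mem f SD(1) h r1.zero_mem) (simp add: r1.co_zero)
  from fun_cong[OF this] have "f = h" by (intro ext) simp
  thus ?thesis using h(1) by simp
 qed
 show "vecs H1 \<subseteq> vecs H2" using all SD(2) by blast
 show "ip H2 f h = \<kappa> * ip H1 f h" if "f \<in> vecs H1" "h \<in> vecs H1"
  by (rule SD(3)[OF all[OF that(1)] that(2) SD(2)[OF all[OF that(2)]]])
qed

section \<open>The vector fields of the Lie algebra and their flows\<close>

text \<open>The sort of the entries covers real and complex matrices at once.\<close>

interpretation mm: bounded_bilinear
 "(**) :: 'k::{euclidean_space,real_algebra_1}^'b::finite^'a::finite => 'k^'c::finite^'b => 'k^'c^'a"
 unfolding bilinear_conv_bounded_bilinear[symmetric] bilinear_def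
 by (auto intro!: linearI simp: matrix_matrix_mult_def vec_eq_iff algebra_simps sum.distrib scaleR_right.sum)

interpretation mv: bounded_bilinear
 "(*v) :: 'k::{euclidean_space,real_algebra_1}^'b::finite^'a::finite => 'k^'b => 'k^'a"
 unfolding bilinear_conv_bounded_bilinear[symmetric] bilinear_def
 by (auto intro!: linearI simp: matrix_vector_mult_def vec_eq_iff algebra_simps sum.distrib scaleR_right.sum)

lemma bounded_linear_transpose:
 "bounded_linear (transpose :: 'k::euclidean_space^'b::finite^'a::finite => 'k^'a^'b)"
 unfolding linear_conv_bounded_linear[symmetric] by (auto intro!: linearI simp: transpose_def vec_eq_iff)

lemma bounded_linear_cmat: "bounded_linear (cmat :: real^'b::finite^'a::finite => complex^'b^'a)"
 unfolding linear_conv_bounded_linear[symmetric] by (auto intro!: linearI simp: vec_eq_iff complex_eq_iff)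

lemma bounded_linear_map_cnj:
 "bounded_linear (map_matrix cnj :: complex^'b::finite^'a::finite => complex^'b^'a)"
 unfolding linear_conv_bounded_linear[symmetric] by (auto intro!: linearI simp: vec_eq_iff)

lemmas tr_add = linear_add[OF bounded_linear.linear[OF bounded_linear_transpose]]
lemmas tr_scaleR = linear_scale[OF bounded_linear.linear[OF bounded_linear_transpose]]
lemmas tr_diff = linear_diff[OF bounded_linear.linear[OF bounded_linear_transpose]]
lemmas tr_neg = linear_neg[OF bounded_linear.linear[OF bounded_linear_transpose]]
lemmas tr_zero = linear_0[OF bounded_linear.linear[OF bounded_linear_transpose]]
lemmas cm_add = linear_add[OF bounded_linear.linear[OF bounded_linear_cmat]]
lemmas cm_scaleR = linear_scale[OF bounded_linear.linear[OF bounded_linear_cmat]]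
lemmas cm_diff = linear_diff[OF bounded_linear.linear[OF bounded_linear_cmat]]
lemmas cm_neg = linear_neg[OF bounded_linear.linear[OF bounded_linear_cmat]]
lemmas cm_zero = linear_0[OF bounded_linear.linear[OF bounded_linear_cmat]]
lemmas cnjm_add = linear_add[OF bounded_linear.linear[OF bounded_linear_map_cnj]]
lemmas cnjm_scaleR = linear_scale[OF bounded_linear.linear[OF bounded_linear_map_cnj]]
lemmas cnjm_diff = linear_diff[OF bounded_linear.linear[OF bounded_linear_map_cnj]]
lemmas cnjm_zero = linear_0[OF bounded_linear.linear[OF bounded_linear_map_cnj]]

lemma mm_scaleC_left: "(c *\<^sub>C A) ** B = c *\<^sub>C (A ** (B :: complex^'c::finite^'b::finite))"
 and mm_scaleC_right: "A ** (c *\<^sub>C B) = c *\<^sub>C (A ** B)"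
 by (simp_all add: matrix_matrix_mult_def vec_eq_iff sum_distrib_left algebra_simps)

lemma transpose_scaleC: "transpose (c *\<^sub>C A) = c *\<^sub>C transpose (A :: complex^'b::finite^'a::finite)"
 by (simp add: transpose_def vec_eq_iff)

lemma cmat_mult: "cmat (A ** B) = cmat A ** cmat (B :: real^'c::finite^'b::finite)"
 by (simp add: matrix_matrix_mult_def vec_eq_iff)

lemma cmat_transpose: "cmat (transpose A) = transpose (cmat A)" by (simp add: transpose_def vec_eq_iff)

lemma map_cnj_mult: "map_matrix cnj (A ** B) = map_matrix cnj A ** map_matrix cnj (B :: complex^'c::finite^'b::finite)"
 by (simp add: matrix_matrix_mult_def vec_eq_iff)

lemma map_cnj_transpose: "map_matrix cnj (transpose A) = transpose (map_matrix cnj A)"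
 by (simp add: transpose_def vec_eq_iff)

lemma map_cnj_cmat [simp]: "map_matrix cnj (cmat A) = cmat A" by (simp add: vec_eq_iff)

lemma map_cnj_cnj [simp]: "map_matrix cnj (map_matrix cnj A) = A" by (simp add: vec_eq_iff)

lemma map_cnj_scaleC: "map_matrix cnj (c *\<^sub>C A) = cnj c *\<^sub>C map_matrix cnj A" by (simp add: vec_eq_iff)

interpretation Q: bounded_bilinear "Q :: complex^'r::finite^'n::finite => complex^'r^'n => complex^'n^'n"
 unfolding bilinear_conv_bounded_bilinear[symmetric] bilinear_def
 by (auto intro!: linearI simp: Q_def adjoint_matrix_def mm.add_left mm.add_right mm.scaleR_left
   mm.scaleR_right tr_add tr_scaleR cnjm_add cnjm_scaleR scaleC_add_right scaleC.scaleR_right algebra_simps)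

lemma Q_scaleC_left: "Q (c *\<^sub>C U) V = c *\<^sub>C Q U V"
 by (simp add: Q_def mm_scaleC_left mm_scaleC_right transpose_scaleC scaleC_add_right scaleC_scaleC mult.commute)

lemma transpose_Q: "transpose (Q U V) = Q U V"
 by (simp add: Q_def transpose_scaleC tr_add matrix_transpose_mul adjoint_matrix_def add.commute)

lemma map_cnj_Q: "map_matrix cnj (Q U V) = Q V U"
 by (simp add: Q_def map_cnj_scaleC cnjm_add map_cnj_mult adjoint_matrix_def map_cnj_transpose add.commute)

text \<open>The infinitesimal form of the equivariance \<open>Q (A U) (A V) = A Q(U, V) A^t\<close>
  for real \<open>A\<close>; it holds because a real matrix commutes with conjugation.\<close>

lemma Q_real_mult: "cmat T ** Q U V + Q U V ** transpose (cmat T) = Q (cmat T ** U) V + Q U (cmat T ** V)"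
 by (simp add: Q_def mm_scaleC_left mm_scaleC_right mm.add_left mm.add_right adjoint_matrix_def
   matrix_transpose_mul map_cnj_mult map_cnj_transpose matrix_mul_assoc algebra_simps flip: scaleC_add_right)

text \<open>The infinitesimal form of the invariance of \<open>Q\<close> under the unitary group
  acting on the right.\<close>

lemma Q_skew:
 assumes "K \<in> skew_hermitian"
 shows "Q (U ** K) V = - Q U (V ** K)"
proof -
 have K: "transpose (map_matrix cnj K) = - K" using assms by (simp add: skew_hermitian_def adjoint_matrix_def)
 hence K': "map_matrix cnj K = - transpose K" by (metis tr_neg transpose_transpose)
 show ?thesis
  by (simp add: Q_def adjoint_matrix_def matrix_transpose_mul map_cnj_mult matrix_mul_assoc[symmetric] K
    mm.minus_left mm.minus_right K' tr_neg matrix_transpose_mul add.commute scaleC.minus_right[symmetric])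
qed

text \<open>The affine field made linear: the extra coordinate \<open>s\<close> multiplies the
  constant terms and does not move itself. The original field is found on the slice
  \<open>s = 1\<close>.\<close>

definition affine_field :: "real^'n^'n => complex^'r^'r => complex^'r^'n => real^'n^'n
   => ('n::finite, 'r::finite) point \<times> real => ('n, 'r) point \<times> real"
 where "affine_field T K V0 U = (\<lambda>((Z, V), s).
  ((cmat T ** Z + Z ** transpose (cmat T) + (2 * \<i>) *\<^sub>C Q V V0 + s *\<^sub>R cmat U,
   cmat T ** V - V ** K + s *\<^sub>R V0), 0))"

lemma linear_affine_field: "linear (affine_field T K V0 U)"
 by (rule linearI) (auto simp: affine_field_def mm.add_left mm.add_right mm.scaleR_left
   mm.scaleR_right Q.add_left Q.scaleR_left scaleC_add_right scaleC.scaleR_right algebra_simps)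

lemma affine_field_add:
 "affine_field (T + T') (K + K') (V + V') (U + U') e = affine_field T K V U e + affine_field T' K' V' U' e"
 by (cases e; cases "fst e") (auto simp: affine_field_def mm.add_left mm.add_right tr_add cm_add Q.add_right
   scaleC_add_right algebra_simps)

lemma affine_field_scaleR:
 "affine_field (c *\<^sub>R T) (c *\<^sub>R K) (c *\<^sub>R V) (c *\<^sub>R U) e = c *\<^sub>R affine_field T K V U e"
 by (cases e; cases "fst e") (auto simp: affine_field_def mm.scaleR_left mm.scaleR_right tr_scaleR cm_scaleR
   Q.scaleR_right scaleC.scaleR_right algebra_simps)

text \<open>The terms with \<open>T\<close> and \<open>K\<close> are settled by the infinitesimal
  symmetries of \<open>Q\<close>. The motions by \<open>V\<close> and \<open>V'\<close> commute only
  up to the translation of \<open>Z\<close> by \<open>4 Im Q(V, V')\<close>, as in a Heisenberg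
  algebra; the factor comes from \<open>2 i\<close> times a difference of conjugates.\<close>

lemma affine_field_bracket:
 fixes V V' :: "complex^'r::finite^'n::finite"
 assumes K: "K \<in> skew_hermitian" and K': "K' \<in> skew_hermitian"
 shows "affine_field T K V U (affine_field T' K' V' U' e) - affine_field T' K' V' U' (affine_field T K V U e)
  = affine_field (T ** T' - T' ** T) (K ** K' - K' ** K) (cmat T ** V' - V' ** K - (cmat T' ** V - V ** K'))
    (T ** U' + U' ** transpose T - (T' ** U + U ** transpose T') + 4 *\<^sub>R map_matrix Im (Q V V')) e"
proof -
 obtain Z W s where e: "e = ((Z, W), s)" by (metis surj_pair)
 have im: "(2 * \<i>) *\<^sub>C (Q V' V - Q V V') = cmat (4 *\<^sub>R map_matrix Im (Q V V'))"
 proof -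
  have "Q V' V = map_matrix cnj (Q V V')" by (simp add: map_cnj_Q)
  thus ?thesis by (simp add: vec_eq_iff complex_eq_iff)
 qed
 have T: "cmat T ** Q W V' + Q W V' ** transpose (cmat T) - Q (cmat T ** W) V' = Q W (cmat T ** V')" for T W V'
  using Q_real_mult[of T W V'] by (simp add: algebra_simps)
 have 1: "cmat T ** ((2 * \<i>) *\<^sub>C Q W V') + (2 * \<i>) *\<^sub>C Q W V' ** transpose (cmat T)
   - (2 * \<i>) *\<^sub>C Q (cmat T ** W) V' = (2 * \<i>) *\<^sub>C Q W (cmat T ** V')" for T W V'
  by (simp only: mm_scaleC_left mm_scaleC_right scaleC.diff_right[symmetric] scaleC_add_right[symmetric] T)
 have im2: "s *\<^sub>R cmat (4 *\<^sub>R map_matrix Im (Q V V')) = s *\<^sub>R (2 * \<i>) *\<^sub>C Q V' V - s *\<^sub>R (2 * \<i>) *\<^sub>C Q V V'"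
  by (simp add: im[symmetric] scaleC.diff_right scaleR_diff_right)
 show ?thesis using 1[of T W V'] 1[of T' W V] im2 unfolding e affine_field_def
  by (simp add: mm.add_left mm.add_right mm.diff_left mm.diff_right mm.scaleR_left mm.scaleR_right
    Q.add_left Q.diff_left Q.add_right Q.diff_right Q.scaleR_left scaleC_add_right scaleC.diff_right
    scaleC.scaleR_right tr_add tr_diff cm_add cm_diff cmat_mult cmat_transpose matrix_transpose_mul
    matrix_mul_assoc Q_skew[OF K] Q_skew[OF K'] scaleC.minus_right scaleR_diff_right scaleR_add_right
    algebra_simps)
qed

section \<open>Coordinates and bracket on the Lie algebra\<close>

definition iotaT :: "('n::finite, 'r::finite) lie_matrix => real^'n^'n"
 where "iotaT X = (\<chi> i j. X $ Inl (Inr i) $ Inl (Inr j))"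
definition iotaK :: "('n::finite, 'r::finite) lie_matrix => complex^'r^'r"
 where "iotaK X = (\<chi> i j. Complex (X $ Inl (Inl i) $ Inl (Inl j)) (X $ Inr (Inl i) $ Inl (Inl j)))"
definition iotaV :: "('n::finite, 'r::finite) lie_matrix => complex^'r^'n"
 where "iotaV X = (\<chi> i j. Complex (X $ Inl (Inr i) $ Inr (Inl j)) (X $ Inl (Inr i) $ Inl (Inl j)))"
definition iotaU :: "('n::finite, 'r::finite) lie_matrix => real^'n^'n"
 where "iotaU X = (\<chi> i j. X $ Inl (Inr i) $ Inr (Inr j))"

lemma iota_components [simp]: "iotaT (iota T K V U) = T" "iotaK (iota T K V U) = K"
 "iotaV (iota T K V U) = V" "iotaU (iota T K V U) = U"
 by (simp_all add: iotaT_def iotaK_def iotaV_def iotaU_def iota_def vec_eq_iff)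

lemma iota_inject: "iota T K V U = iota T' K' V' U' \<longleftrightarrow> T = T' \<and> K = K' \<and> V = V' \<and> U = U'"
 by (metis iota_components)

text \<open>The block extractions are total functions, so linearity holds on all matrices and not
  only on \<open>gtilde\<close>.\<close>

lemma components_linear: "iotaT (X + Y) = iotaT X + iotaT Y" "iotaT (c *\<^sub>R X) = c *\<^sub>R iotaT X"
 "iotaK (X + Y) = iotaK X + iotaK Y" "iotaK (c *\<^sub>R X) = c *\<^sub>R iotaK X"
 "iotaV (X + Y) = iotaV X + iotaV Y" "iotaV (c *\<^sub>R X) = c *\<^sub>R iotaV X"
 "iotaU (X + Y) = iotaU X + iotaU Y" "iotaU (c *\<^sub>R X) = c *\<^sub>R iotaU X"
 by (simp_all add: iotaT_def iotaK_def iotaV_def iotaU_def vec_eq_iff complex_eq_iff)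

lemma iota_add: "iota T K V U + iota T' K' V' U' = iota (T + T') (K + K') (V + V') (U + U')"
 by (auto simp: iota_def vec_eq_iff split: sum.split)

lemma iota_scaleR: "c *\<^sub>R iota T K V U = iota (c *\<^sub>R T) (c *\<^sub>R K) (c *\<^sub>R V) (c *\<^sub>R U)"
 by (auto simp: iota_def vec_eq_iff split: sum.split)

lemma subspace_skew_hermitian: "subspace skew_hermitian"
 by (auto simp: subspace_def skew_hermitian_def adjoint_matrix_def cnjm_add cnjm_scaleR cnjm_zero
   tr_zero tr_add tr_scaleR)

lemma subspace_sym_real: "subspace sym_real"
 by (auto simp: subspace_def sym_real_def tr_add tr_scaleR tr_zero)

lemma gtilde_iff: "X \<in> gtilde \<longleftrightarrow> X = iota (iotaT X) (iotaK X) (iotaV X) (iotaU X)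
  \<and> iotaK X \<in> skew_hermitian \<and> iotaU X \<in> sym_real" unfolding gtilde_def by (auto simp: iota_inject)

lemma iota_gtilde: "K \<in> skew_hermitian ==> U \<in> sym_real ==> iota T K V U \<in> gtilde" by (auto simp: gtilde_def)

lemma subspace_gtilde: "subspace (gtilde :: ('n::finite, 'r::finite) lie_matrix set)"
proof (rule subspaceI)
 show "0 \<in> (gtilde :: ('n, 'r) lie_matrix set)"
 proof -
  have "iota 0 0 0 0 = (0 :: ('n, 'r) lie_matrix)" by (auto simp: iota_def vec_eq_iff split: sum.split)
  thus ?thesis by (metis iota_gtilde subspace_0 subspace_skew_hermitian subspace_sym_real)
 qed
 fix X Y :: "('n, 'r) lie_matrix" and c :: real
 assume X: "X \<in> gtilde"
 show "c *\<^sub>R X \<in> gtilde"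
  using X subspace_scale[OF subspace_skew_hermitian] subspace_scale[OF subspace_sym_real]
  by (auto simp: gtilde_def iota_scaleR) blast
 assume Y: "Y \<in> gtilde"
 show "X + Y \<in> gtilde" using X Y subspace_add[OF subspace_skew_hermitian] subspace_add[OF subspace_sym_real]
  unfolding gtilde_def by (auto simp: iota_add) blast
qed

definition lop :: "('n::finite, 'r::finite) lie_matrix => (('n, 'r) point \<times> real) endo"
 where "lop X = endo (affine_field (iotaT X) (iotaK X) (iotaV X) (iotaU X))"

lemma app_lop: "app (lop X) e = affine_field (iotaT X) (iotaK X) (iotaV X) (iotaU X) e"
 unfolding lop_def by (rule app_endo) (rule linear_affine_field[unfolded linear_conv_bounded_linear])

lemma linear_lop: "linear lop" by (rule linearI; rule endo_eqI)
  (simp_all add: app_lop app.add_left app.scaleR_left components_linear affine_field_add affine_field_scaleR)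

text \<open>The bracket of the vector fields, taken over from \<open>affine_field_bracket\<close>
  because it is the flows that have to be conjugated. It is compared with the matrix commutator, in
  which \<open>lie_subalgebra\<close> is phrased, in \<open>iota_commutator\<close>.\<close>

definition lie_bracket :: "('n::finite, 'r::finite) lie_matrix => ('n, 'r) lie_matrix => ('n, 'r) lie_matrix"
 where "lie_bracket X Y = iota (iotaT X ** iotaT Y - iotaT Y ** iotaT X)
  (iotaK X ** iotaK Y - iotaK Y ** iotaK X)
  (cmat (iotaT X) ** iotaV Y - iotaV Y ** iotaK X - (cmat (iotaT Y) ** iotaV X - iotaV X ** iotaK Y))
  (iotaT X ** iotaU Y + iotaU Y ** transpose (iotaT X) - (iotaT Y ** iotaU X + iotaU X ** transpose (iotaT Y))
   + 4 *\<^sub>R map_matrix Im (Q (iotaV X) (iotaV Y)))"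

lemma lop_bracket:
 fixes X Y :: "('n::finite, 'r::finite) lie_matrix"
 assumes "X \<in> gtilde" "Y \<in> gtilde"
 shows "lop X * lop Y - lop Y * lop X = lop (lie_bracket X Y)"
proof (rule endo_eqI)
 fix e :: "('n, 'r) point \<times> real"
 have "iotaK X \<in> skew_hermitian" "iotaK Y \<in> skew_hermitian" using assms by (auto simp: gtilde_iff)
 from affine_field_bracket[OF this] show "app (lop X * lop Y - lop Y * lop X) e = app (lop (lie_bracket X Y)) e"
  by (simp add: app.diff_left app_lop lie_bracket_def)
qed

lemma lie_bracket_gtilde:
 fixes X Y :: "('n::finite, 'r::finite) lie_matrix"
 assumes "X \<in> gtilde" "Y \<in> gtilde"
 shows "lie_bracket X Y \<in> gtilde" unfolding lie_bracket_def
proof (rule iota_gtilde)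
 have K: "adj (iotaK X) = - iotaK X" "adj (iotaK Y) = - iotaK Y"
  and U: "transpose (iotaU X) = iotaU X" "transpose (iotaU Y) = iotaU Y"
  using assms by (auto simp: gtilde_iff skew_hermitian_def sym_real_def)
 show "iotaK X ** iotaK Y - iotaK Y ** iotaK X \<in> skew_hermitian"
  using K by (simp add: skew_hermitian_def adjoint_matrix_def cnjm_diff tr_diff map_cnj_mult
    matrix_transpose_mul mm.minus_left mm.minus_right)
 have "transpose (map_matrix Im (Q A B)) = map_matrix Im (Q A B)" for A B :: "complex^'r^'n"
  using transpose_Q[of A B] by (simp add: vec_eq_iff transpose_def)
 thus "iotaT X ** iotaU Y + iotaU Y ** transpose (iotaT X)
   - (iotaT Y ** iotaU X + iotaU X ** transpose (iotaT Y))
   + 4 *\<^sub>R map_matrix Im (Q (iotaV X) (iotaV Y)) \<in> sym_real"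
  using U by (simp add: sym_real_def tr_add tr_diff tr_scaleR matrix_transpose_mul)
qed

section \<open>Flows of the vector fields\<close>

definition flow :: "('n::finite, 'r::finite) lie_matrix => real => ('n, 'r) point => ('n, 'r) point"
 where "flow X t z = fst (app (exp (t *\<^sub>R lop X)) (z, 1))"

lemma bounded_linear_has_vector_derivative:
 "bounded_linear f ==> (g has_vector_derivative g') F ==> ((\<lambda>t. f (g t)) has_vector_derivative f g') F"
 by (rule bounded_linear.has_vector_derivative)

lemma constant_of_zero_derivative:
 fixes f :: "real => 'a::real_normed_vector"
 assumes "\<And>s. (f has_vector_derivative 0) (at s)"
 shows "f t = f 0"
proof -
 obtain c where "\<And>s. s \<in> UNIV ==> f s = c"
  by (rule has_vector_derivative_zero_constant[OF convex_UNIV, of f]) (use assms in auto)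
 thus ?thesis by simp
qed

text \<open>The extra coordinate has velocity 0. So the exponentials preserve the slice where it is
  1, on which they are the flow, and the slice where it is 0, on which they are its linear
  part.\<close>

lemma snd_exp_lop: "snd (app (exp (t *\<^sub>R lop X)) e) = snd e"
proof -
 have "((\<lambda>t. snd (app (exp (t *\<^sub>R lop X)) e)) has_vector_derivative 0) (at s)" for s
 proof -
  have "((\<lambda>t. snd (app (exp (t *\<^sub>R lop X)) e)) has_vector_derivative
    snd (app (lop X) (app (exp (s *\<^sub>R lop X)) e))) (at s)"
   by (rule bounded_linear_has_vector_derivative[OF bounded_linear_snd exp_app_derivative])
  thus ?thesis by (simp add: app_lop affine_field_def split_beta)
 qed
 thus ?thesis using constant_of_zero_derivative[of "\<lambda>t. snd (app (exp (t *\<^sub>R lop X)) e)" t] by simp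
qed

lemma exp_lop_flow: "app (exp (t *\<^sub>R lop X)) (z, 1) = (flow X t z, 1)"
 using snd_exp_lop[of t X "(z, 1)"] by (simp add: flow_def prod_eq_iff)

abbreviation field :: "('n::finite, 'r::finite) lie_matrix => ('n, 'r) point => ('n, 'r) point"
 where "field X \<equiv> lie_vector_field (iotaT X) (iotaK X) (iotaV X) (iotaU X)"

lemma app_lop_field: "app (lop X) (z, 1) = (field X z, 0)"
 by (simp add: app_lop affine_field_def lie_vector_field_def split_beta)

lemma flow_derivative: "((\<lambda>t. flow X t z) has_vector_derivative field X (flow X t z)) (at t)"
proof -
 have "((\<lambda>t. fst (app (exp (t *\<^sub>R lop X)) (z, 1))) has_vector_derivative
   fst (app (lop X) (app (exp (t *\<^sub>R lop X)) (z, 1)))) (at t)"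
  by (rule bounded_linear_has_vector_derivative[OF bounded_linear_fst exp_app_derivative])
 thus ?thesis by (simp add: exp_lop_flow app_lop_field)
qed

text \<open>An explicit formula for a flow is thus verified by differentiating it, and a symmetry of
  the field becomes one of the flow.\<close>

lemma flow_unique:
 assumes "\<And>t. (\<zeta> has_vector_derivative field X (\<zeta> t)) (at t)"
 shows "\<zeta> t = flow X t (\<zeta> 0)"
proof -
 have "((\<lambda>t. (\<zeta> t, 1::real)) has_vector_derivative app (lop X) (\<zeta> t, 1)) (at t)" for t
  using has_vector_derivative_Pair[OF assms[of t] has_vector_derivative_const[of 1]] by (simp add: app_lop_field)
 from arg_cong[OF linear_ode_unique[of "\<lambda>t. (\<zeta> t, 1)", OF this, of t], of fst] show ?thesis
  by (simp add: flow_def)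
qed

lemma flow_0 [simp]: "flow X 0 z = z" by (simp add: flow_def)

lemma flow_add: "flow X (s + t) z = flow X s (flow X t z)"
 unfolding flow_def[of X "s + t"] by (simp add: exp_scaleR_add exp_lop_flow)

lemma flow_scaleR: "flow (c *\<^sub>R X) t z = flow X (c * t) z"
 by (simp add: flow_def linear_scale[OF linear_lop] mult.commute)

lemma continuous_on_flow: "continuous_on UNIV (\<lambda>p. flow X (fst p) (snd p))"
proof -
 have "continuous_on UNIV (\<lambda>t. exp (t *\<^sub>R lop X))" by (rule continuous_at_imp_continuous_on)
   (rule ballI has_vector_derivative_continuous[OF exp_scaleR_has_vector_derivative_left])+
 from continuous_on_compose2[OF this continuous_on_fst[OF continuous_on_id]] show ?thesis
  unfolding flow_def by (intro continuous_intros app.continuous_on) auto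
qed

definition flow_lin :: "('n::finite, 'r::finite) lie_matrix => real => ('n, 'r) point => ('n, 'r) point"
 where "flow_lin X t h = fst (app (exp (t *\<^sub>R lop X)) (h, 0))"

lemma exp_lop_lin: "app (exp (t *\<^sub>R lop X)) (h, 0) = (flow_lin X t h, 0)"
 using snd_exp_lop[of t X "(h, 0)"] by (simp add: flow_lin_def prod_eq_iff)

lemma flow_affine: "flow X t (z + h) = flow X t z + flow_lin X t h"
proof -
 have "app (exp (t *\<^sub>R lop X)) (z + h, 1) = app (exp (t *\<^sub>R lop X)) (z, 1) + app (exp (t *\<^sub>R lop X)) (h, 0)"
  by (simp flip: app.add_right)
 thus ?thesis by (simp add: flow_def flow_lin_def)
qed

lemma bounded_linear_flow_lin: "bounded_linear (flow_lin X t)"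
proof -
 have "bounded_linear (\<lambda>h. (h, 0 :: real))"
  by (intro bounded_linear_Pair bounded_linear_ident bounded_linear_zero)
 hence "bounded_linear (\<lambda>h. fst (app (exp (t *\<^sub>R lop X)) (h, 0)))"
  by (intro bounded_linear_compose[OF bounded_linear_fst] bounded_linear_compose[OF app.bounded_linear_right])
 thus ?thesis by (simp add: flow_lin_def[abs_def])
qed

text \<open>The moving variable enters \<open>Q\<close> only in the first, complex-linear argument,
  so the linear part of the field is complex linear. Both sides then solve the same linear
  equation.\<close>

lemma flow_lin_scaleC: "flow_lin X t (c *\<^sub>C h) = c *\<^sub>C flow_lin X t h"
proof -
 let ?e = "\<lambda>t. (c *\<^sub>C flow_lin X t h, 0 :: real)"
 have "(?e has_vector_derivative app (lop X) (?e t)) (at t)" for t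
 proof -
  have "((\<lambda>t. flow_lin X t h) has_vector_derivative fst (app (lop X) (flow_lin X t h, 0))) (at t)"
   using bounded_linear_has_vector_derivative[OF bounded_linear_fst exp_app_derivative[of "lop X" "(h, 0)" t]]
   by (simp add: exp_lop_lin)
  hence "((\<lambda>t. c *\<^sub>C flow_lin X t h) has_vector_derivative c *\<^sub>C fst (app (lop X) (flow_lin X t h, 0))) (at t)"
   by (rule bounded_linear_has_vector_derivative[OF scaleC.bounded_linear_right])
  from has_vector_derivative_Pair[OF this has_vector_derivative_const[of 0]]
  show ?thesis by (simp add: app_lop affine_field_def split_beta prod_eq_iff scaleC_prod_def mm_scaleC_left
     mm_scaleC_right Q_scaleC_left scaleC_add_right scaleC.diff_right scaleC_scaleC mult.commute)
 qed
 from arg_cong[OF linear_ode_unique[of ?e, OF this, of t], of fst] show ?thesis by (simp add: flow_lin_def)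
qed

lemma flow_holomorphic: "holomorphic_map_on (flow X t) D" unfolding holomorphic_map_on_def
proof (intro ballI exI conjI allI)
 fix z
 have "((\<lambda>w. flow X t 0 + flow_lin X t w) has_derivative (\<lambda>w. 0 + flow_lin X t w)) (at z within D)"
  by (rule has_derivative_add[OF has_derivative_const
    bounded_linear_imp_has_derivative[OF bounded_linear_flow_lin]])
 moreover have "flow X t 0 + flow_lin X t w = flow X t w" for w
  using flow_affine[of X t 0 w] by (simp only: add_0_left)
 ultimately show "(flow X t has_derivative flow_lin X t) (at z within D)" by simp
qed (rule flow_lin_scaleC)

section \<open>Invariance of the domain under the flows\<close>

declare transpose_matrix_vector [simp del]

text \<open>The bilinear and not the Hermitian product: \<open>Z\<close> enters the form bilinearly
  and \<open>V\<close> sesquilinearly, so conjugations are written out where they occur.\<close>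

definition cdot :: "complex^'n::finite => complex^'n => complex" where "cdot x y = (\<Sum>i\<in>UNIV. x $ i * y $ i)"

interpretation cdot: bounded_bilinear cdot unfolding bilinear_conv_bounded_bilinear[symmetric] bilinear_def
 by (auto intro!: linearI simp: cdot_def algebra_simps sum.distrib scaleR_right.sum)

lemma cdot_commute: "cdot x y = cdot y x" by (simp add: cdot_def mult.commute)

lemma cdot_transpose: "cdot (transpose A *v x) y = cdot x (A *v y)"
proof -
 have "cdot (transpose A *v x) y = (\<Sum>i\<in>UNIV. \<Sum>j\<in>UNIV. A $ j $ i * x $ j * y $ i)"
  by (simp add: cdot_def matrix_vector_mult_def transpose_def sum_distrib_right)
 also have "\<dots> = (\<Sum>j\<in>UNIV. \<Sum>i\<in>UNIV. A $ j $ i * x $ j * y $ i)" by (rule sum.swap)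
 also have "\<dots> = cdot x (A *v y)" by (simp add: cdot_def matrix_vector_mult_def sum_distrib_left mult_ac)
 finally show ?thesis .
qed

abbreviation cvec :: "real^'n => complex^'n" where "cvec x \<equiv> (\<chi> i. complex_of_real (x $ i))"
abbreviation cnjv :: "complex^'n => complex^'n" where "cnjv x \<equiv> (\<chi> i. cnj (x $ i))"

lemma siegel_form_cdot: "siegel_form x z = Im (cdot (cvec x) (fst z *v cvec x))
  - Re (cdot (transpose (snd z) *v cvec x) (cnjv (transpose (snd z) *v cvec x))) / 2"
proof -
 have 1: "cdot (cvec x) (fst z *v cvec x)
   = (\<Sum>i\<in>UNIV. \<Sum>j\<in>UNIV. complex_of_real (x $ i * x $ j) * fst z $ i $ j)"
  by (simp add: cdot_def matrix_vector_mult_def sum_distrib_left mult_ac)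
 have 2: "cdot b (cnjv b) = complex_of_real (\<Sum>k\<in>UNIV. (cmod (b $ k))\<^sup>2)" for b :: "complex^'b"
  by (simp add: cdot_def complex_norm_square del: of_real_power)
 have 3: "(transpose (snd z) *v cvec x) $ k = (\<Sum>i\<in>UNIV. complex_of_real (x $ i) * snd z $ i $ k)" for k
  by (simp add: matrix_vector_mult_def transpose_def mult.commute)
 show ?thesis unfolding siegel_form_def 1 2 unfolding 3 by simp
qed

lemma cnjv_mult: "map_matrix cnj A *v cnjv x = cnjv (A *v x)" by (simp add: matrix_vector_mult_def vec_eq_iff)

lemma cnjv_cvec [simp]: "cnjv (cvec x) = cvec x" by (simp add: vec_eq_iff)

lemma cvec_mult: "cvec (A *v x) = cmat A *v cvec x" by (simp add: matrix_vector_mult_def vec_eq_iff)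

lemma mv_scaleC_left: "(c *\<^sub>C A) *v y = c *\<^sub>C (A *v (y :: complex^'a::finite))"
 by (simp add: matrix_vector_mult_def vec_eq_iff sum_distrib_left mult_ac)

lemma cdot_scaleC_right: "cdot y (c *\<^sub>C z) = c * cdot y z" by (simp add: cdot_def sum_distrib_left mult_ac)

text \<open>The two summands of \<open>Q\<close> contribute equally to the quadratic form, which
  turns the factor 1/4 into 1/2.\<close>

lemma cdot_Q: "cdot (cvec x) (Q V V0 *v cvec x)
  = cdot (transpose V *v cvec x) (cnjv (transpose V0 *v cvec x)) / 2"
proof -
 have a: "adj V0 *v cvec x = cnjv (transpose V0 *v cvec x)"
  using cnjv_mult[of "transpose V0" "cvec x"] by (simp add: adjoint_matrix_def map_cnj_transpose)
 have "cdot (cvec x) (Q V V0 *v cvec x) = (1/4) *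
   (cdot (cvec x) ((V ** adj V0) *v cvec x) + cdot (cvec x) ((map_matrix cnj V0 ** transpose V) *v cvec x))"
  by (simp add: Q_def mv_scaleC_left cdot_scaleC_right mv.add_left cdot.add_right)
 also have "cdot (cvec x) ((V ** adj V0) *v cvec x)
   = cdot (transpose V *v cvec x) (cnjv (transpose V0 *v cvec x))"
  by (simp add: matrix_vector_mul_assoc[symmetric] a cdot_transpose[symmetric])
 also have "cdot (cvec x) ((map_matrix cnj V0 ** transpose V) *v cvec x)
   = cdot (transpose V *v cvec x) (cnjv (transpose V0 *v cvec x))"
 proof -
  have "cdot (cvec x) ((map_matrix cnj V0 ** transpose V) *v cvec x)
    = cdot (transpose (map_matrix cnj V0) *v cvec x) (transpose V *v cvec x)"
   by (simp add: matrix_vector_mul_assoc[symmetric] cdot_transpose)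
  also have "transpose (map_matrix cnj V0) *v cvec x = cnjv (transpose V0 *v cvec x)"
   using a by (simp add: adjoint_matrix_def)
  finally show ?thesis by (simp add: cdot_commute)
 qed
 finally show ?thesis by simp
qed

text \<open>When the test vector moves contragrediently to \<open>T\<close>, all contributions
  cancel: those of \<open>T\<close> by this choice, that of \<open>K\<close> because it is skew,
  that of \<open>U\<close> because it is real, and those of \<open>V0\<close> because the change of
  \<open>Im Z\<close> compensates the change of the square of \<open>V\<close>.\<close>

lemma siegel_form_flow_derivative:
 fixes X :: "('n::finite, 'r::finite) lie_matrix"
 assumes X: "X \<in> gtilde" and \<xi>: "\<And>t. (\<xi> has_vector_derivative - (transpose (iotaT X) *v \<xi> t)) (at t)"
 shows "((\<lambda>t. siegel_form (\<xi> t) (flow X t z)) has_vector_derivative 0) (at t)"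
proof -
 let ?T = "cmat (iotaT X)" and ?K = "iotaK X" and ?V0 = "iotaV X" and ?U = "iotaU X"
 define Z V where "Z = fst (flow X t z)" and "V = snd (flow X t z)"
 define x where "x = cvec (\<xi> t)"
 have K: "adj ?K = - ?K" using X by (simp add: gtilde_iff skew_hermitian_def)
 have dx: "((\<lambda>t. cvec (\<xi> t)) has_vector_derivative - (transpose ?T *v x)) (at t)"
 proof -
  have "bounded_linear (cvec :: real^'n => _)" unfolding linear_conv_bounded_linear[symmetric]
   by (auto intro!: linearI simp: vec_eq_iff complex_eq_iff)
  from bounded_linear_has_vector_derivative[OF this \<xi>[of t]]
  have "((\<lambda>t. cvec (\<xi> t)) has_vector_derivative cvec (- (transpose (iotaT X) *v \<xi> t))) (at t)" .
  moreover have "cvec (- (transpose (iotaT X) *v \<xi> t)) = - (transpose ?T *v x)"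
   using cvec_mult[of "transpose (iotaT X)" "\<xi> t"] by (simp add: x_def cmat_transpose vec_eq_iff)
  ultimately show ?thesis by simp
 qed
 let ?Z' = "?T ** Z + Z ** transpose ?T + (2 * \<i>) *\<^sub>C Q V ?V0 + cmat ?U"
 let ?V' = "?T ** V - V ** ?K + ?V0"
 have fl: "field X (flow X t z) = (?Z', ?V')" by (simp add: lie_vector_field_def Z_def V_def split_beta)
 have dZ: "((\<lambda>t. fst (flow X t z)) has_vector_derivative ?Z') (at t)"
  using bounded_linear_has_vector_derivative[OF bounded_linear_fst flow_derivative[of X z t]] by (simp add: fl)
 have dV: "((\<lambda>t. transpose (snd (flow X t z))) has_vector_derivative transpose ?V') (at t)"
  using bounded_linear_has_vector_derivative[OF bounded_linear_transpose
    bounded_linear_has_vector_derivative[OF bounded_linear_snd flow_derivative[of X z t]]] by (simp add: fl)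
 define b where "b = transpose V *v x"
 define \<beta> where "\<beta> = transpose ?V0 *v x"
 have "((\<lambda>t. transpose (snd (flow X t z)) *v cvec (\<xi> t)) has_vector_derivative
   transpose V *v (- (transpose ?T *v x)) + transpose ?V' *v x) (at t)"
  using mv.has_vector_derivative[OF dV dx] by (simp add: V_def x_def)
 also have "transpose V *v (- (transpose ?T *v x)) + transpose ?V' *v x = - (transpose ?K *v b) + \<beta>"
  by (simp add: b_def \<beta>_def tr_add tr_diff matrix_transpose_mul mv.add_left mv.diff_left mv.minus_right
    matrix_vector_mul_assoc)
 finally have db: "((\<lambda>t. transpose (snd (flow X t z)) *v cvec (\<xi> t)) has_vector_derivative
   - (transpose ?K *v b) + \<beta>) (at t)" .
 have "((\<lambda>t. cdot (cvec (\<xi> t)) (fst (flow X t z) *v cvec (\<xi> t))) has_vector_derivative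
   cdot x (Z *v (- (transpose ?T *v x)) + ?Z' *v x) + cdot (- (transpose ?T *v x)) (Z *v x)) (at t)"
  using cdot.has_vector_derivative[OF dx mv.has_vector_derivative[OF dZ dx]] by (simp add: Z_def x_def)
 also have "cdot x (Z *v (- (transpose ?T *v x)) + ?Z' *v x) + cdot (- (transpose ?T *v x)) (Z *v x)
   = \<i> * cdot b (cnjv \<beta>) + cdot x (cmat ?U *v x)"
 proof -
  show ?thesis using cdot_Q[of "\<xi> t" V ?V0]
   by (simp add: mv_scaleC_left cdot_scaleC_right mv.add_left mv.minus_right cdot.add_right cdot.minus_right cdot.minus_left
     cdot_transpose matrix_vector_mul_assoc b_def \<beta>_def x_def mult.commute[of 2])
 qed
 finally have da: "((\<lambda>t. cdot (cvec (\<xi> t)) (fst (flow X t z) *v cvec (\<xi> t))) has_vector_derivative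
   \<i> * cdot b (cnjv \<beta>) + cdot x (cmat ?U *v x)) (at t)" .
 have bl: "bounded_linear (cnjv :: complex^'r => _)" unfolding linear_conv_bounded_linear[symmetric]
  by (auto intro!: linearI simp: vec_eq_iff)
 have dq: "((\<lambda>t. cdot (transpose (snd (flow X t z)) *v cvec (\<xi> t)) (cnjv (transpose (snd (flow X t z)) *v cvec (\<xi> t))))
   has_vector_derivative cdot b (cnjv (- (transpose ?K *v b) + \<beta>)) + cdot (- (transpose ?K *v b) + \<beta>) (cnjv b)) (at t)"
  using cdot.has_vector_derivative[OF db bounded_linear_has_vector_derivative[OF bl db]]
  by (simp add: b_def V_def x_def)
 have re: "Re (cdot u (cnjv v)) = Re (cdot v (cnjv u))" for u v :: "complex^'r"
  by (simp add: cdot_def algebra_simps)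
 have skew: "Re (cdot b (cnjv (transpose ?K *v b))) = 0"
 proof -
  have c: "cnjv (transpose ?K *v b) = - (?K *v cnjv b)"
  proof -
   have "cnjv (transpose ?K *v b) = map_matrix cnj (transpose ?K) *v cnjv b" by (rule cnjv_mult[symmetric])
   also have "map_matrix cnj (transpose ?K) = - ?K"
    using K by (simp add: adjoint_matrix_def map_cnj_transpose)
   finally show ?thesis by (simp add: mv.minus_left)
  qed
  have "cdot b (?K *v cnjv b) = cdot (transpose ?K *v b) (cnjv b)" by (simp add: cdot_transpose)
  hence "Re (cdot b (cnjv (transpose ?K *v b))) = - Re (cdot (transpose ?K *v b) (cnjv b))"
   by (simp add: c cdot.minus_right)
  also have "\<dots> = - Re (cdot b (cnjv (transpose ?K *v b)))" by (simp only: re)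
  finally show ?thesis by simp
 qed
 have Re_dq: "Re (cdot b (cnjv (- (transpose ?K *v b) + \<beta>)) + cdot (- (transpose ?K *v b) + \<beta>) (cnjv b))
   = 2 * Re (cdot b (cnjv \<beta>))"
 proof -
  have "Re (cdot b (cnjv (- (transpose ?K *v b) + \<beta>))) = Re (cdot b (cnjv \<beta>))"
  proof -
   have "cnjv (- (transpose ?K *v b) + \<beta>) = - cnjv (transpose ?K *v b) + cnjv \<beta>" by (simp add: vec_eq_iff)
   thus ?thesis by (simp only: cdot.add_right cdot.minus_right plus_complex.simps uminus_complex.simps skew)
  qed
  thus ?thesis using re[of "- (transpose ?K *v b) + \<beta>" b] by simp
 qed
 have Im_U: "Im (cdot x (cmat ?U *v x)) = 0"
 proof -
  have "cdot x (cmat ?U *v x) = complex_of_real (\<Sum>i\<in>UNIV. \<xi> t $ i * (?U *v \<xi> t) $ i)"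
   using cvec_mult[of ?U "\<xi> t"] by (simp add: cdot_def x_def flip: cvec_mult)
  thus ?thesis by simp
 qed
 have "((\<lambda>t. Im (cdot (cvec (\<xi> t)) (fst (flow X t z) *v cvec (\<xi> t)))
   - Re (cdot (transpose (snd (flow X t z)) *v cvec (\<xi> t)) (cnjv (transpose (snd (flow X t z)) *v cvec (\<xi> t)))) / 2)
   has_vector_derivative Im (\<i> * cdot b (cnjv \<beta>) + cdot x (cmat ?U *v x))
    - Re (cdot b (cnjv (- (transpose ?K *v b) + \<beta>)) + cdot (- (transpose ?K *v b) + \<beta>) (cnjv b)) / 2) (at t)"
  by (intro has_vector_derivative_diff bounded_linear_has_vector_derivative[OF bounded_linear_Im da]
    bounded_linear_has_vector_derivative[OF bounded_linear_divide
     bounded_linear_has_vector_derivative[OF bounded_linear_Re dq]])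
 thus ?thesis unfolding siegel_form_cdot Re_dq using Im_U by simp
qed

text \<open>Transposing \<open>Z\<close> carries flow lines to flow lines, because \<open>U\<close>
  and the values of \<open>Q\<close> are symmetric; by uniqueness a flow line that starts symmetric
  stays symmetric.\<close>

lemma flow_sym_points:
 fixes z :: "('n::finite, 'r::finite) point"
 assumes X: "X \<in> gtilde" and z: "z \<in> sym_points"
 shows "flow X t z \<in> sym_points"
proof -
 let ?s = "\<lambda>z :: ('n, 'r) point. (transpose (fst z), snd z)"
 have U: "transpose (iotaU X) = iotaU X" using X by (simp add: gtilde_iff sym_real_def)
 have bl: "bounded_linear ?s"
  by (intro bounded_linear_Pair bounded_linear_snd bounded_linear_compose[OF bounded_linear_transpose bounded_linear_fst])
 have s: "?s (field X w) = field X (?s w)" for w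
  by (simp add: lie_vector_field_def split_beta tr_add matrix_transpose_mul transpose_scaleC transpose_Q U
    add.commute flip: cmat_transpose)
 have "((\<lambda>t. ?s (flow X t z)) has_vector_derivative field X (?s (flow X t z))) (at t)" for t
  using bounded_linear_has_vector_derivative[OF bl flow_derivative[of X z t]] by (simp only: s)
 from flow_unique[of "\<lambda>t. ?s (flow X t z)" X, OF this, of t]
 have "?s (flow X t z) = flow X t z" using z by (simp add: sym_points_def)
 thus ?thesis by (simp add: sym_points_def prod_eq_iff)
qed

lemma flow_siegel_domain:
 assumes X: "X \<in> gtilde" and z: "z \<in> \<D>"
 shows "flow X t z \<in> \<D>"
proof -
 have "siegel_form x (flow X t z) > 0" if x: "x \<noteq> 0" for x
 proof -
  define A where "A = endo (\<lambda>y. - (transpose (iotaT X) *v y))"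
  have app_A: "app A y = - (transpose (iotaT X) *v y)" for y
   unfolding A_def by (rule app_endo) (intro bounded_linear_minus mv.bounded_linear_right)
  \<comment> \<open>The test vector is traced back from time \<open>t\<close> to time 0, where
    positivity of the form is known.\<close>
  define x0 where "x0 = app (exp (- (t *\<^sub>R A))) x"
  define \<xi> where "\<xi> = (\<lambda>s. app (exp (s *\<^sub>R A)) x0)"
  have \<xi>t: "\<xi> t = x" by (simp add: \<xi>_def x0_def flip: app_mult)
  have \<xi>0: "\<xi> 0 = x0" by (simp add: \<xi>_def)
  have "x0 \<noteq> 0" using \<xi>t x by (auto simp: \<xi>_def app.zero_right)
  have "(\<xi> has_vector_derivative - (transpose (iotaT X) *v \<xi> s)) (at s)" for s
   using exp_app_derivative[of A x0 s] by (simp add: \<xi>_def app_A)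
  from siegel_form_flow_derivative[OF X this]
  have d: "((\<lambda>s. siegel_form (\<xi> s) (flow X s z)) has_vector_derivative 0) (at s)" for s by simp
  have "siegel_form x (flow X t z) = siegel_form x0 z"
   using constant_of_zero_derivative[of "\<lambda>s. siegel_form (\<xi> s) (flow X s z)" t] d by (simp add: \<xi>t \<xi>0)
  thus ?thesis using z \<open>x0 \<noteq> 0\<close> by (simp add: siegel_domain_iff)
 qed
 thus ?thesis using flow_sym_points[OF X siegel_domain_sym[OF z]] by (simp add: siegel_domain_iff)
qed

section \<open>Lifting one-parameter groups to the universal covering group\<close>

text \<open>The base is a space with a binary operation that \<open>p\<close> respects. In this way
  continuity of composition of automorphisms does not have to be established for the compact-open
  topology.\<close>

locale covered_group = group G for G :: "'g monoid" (structure) +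
 fixes T :: "'g topology" and S :: "'b topology" and p :: "'g => 'b" and mult' :: "'b => 'b => 'b"
 assumes top: "topological_group G T" and cov: "covering_map T S p"
  and p_mult: "g \<in> carrier G ==> h \<in> carrier G ==> p (g \<otimes> h) = mult' (p g) (p h)"
begin

lemma topspace_T: "topspace T = carrier G"
 and continuous_mult: "continuous_map (prod_topology T T) T (\<lambda>(g, h). g \<otimes> h)"
 and continuous_inv: "continuous_map T T (\<lambda>g. inv g)" using top by (auto simp: topological_group_def)

lemma continuous_map_mult:
 assumes "continuous_map X T f" "continuous_map X T g"
 shows "continuous_map X T (\<lambda>x. f x \<otimes> g x)"
 using continuous_map_compose[OF continuous_map_pairedI[OF assms] continuous_mult] by (simp add: o_def)

lemma continuous_map_inv: "continuous_map X T f ==> continuous_map X T (\<lambda>x. inv (f x))"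
 using continuous_map_compose[OF _ continuous_inv, of X f] by (simp add: o_def)

lemma local_section:
 obtains W V s where "openin T W" "\<one> \<in> W" "inj_on p W" "openin S V" "p \<one> \<in> V" "p ` W = V"
  "continuous_map (subtopology S V) T s" "\<And>y. y \<in> V ==> s y \<in> W \<and> p (s y) = y"
proof -
 have "p \<one> \<in> topspace S" using cov topspace_T by (auto simp: covering_map_def)
 from cov[unfolded covering_map_def, THEN conjunct2, THEN conjunct2, THEN bspec, OF this] obtain V \<W> where V: "openin S V" "p \<one> \<in> V" and W: "\<Union>\<W> = {x \<in> topspace T. p x \<in> V}"
  "\<forall>W\<in>\<W>. openin T W" "\<forall>W\<in>\<W>. homeomorphic_map (subtopology T W) (subtopology S V) p" by (elim exE conjE)
 have "\<one> \<in> \<Union>\<W>" using V W(1) topspace_T by auto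
 then obtain W where W': "W \<in> \<W>" "\<one> \<in> W" by blast
 hence hm: "homeomorphic_map (subtopology T W) (subtopology S V) p" and oW: "openin T W" using W by auto
 obtain s where s: "homeomorphic_maps (subtopology T W) (subtopology S V) p s"
  using hm by (auto simp: homeomorphic_map_maps)
 have tW: "topspace (subtopology T W) = W" using oW openin_subset by (auto simp: topspace_subtopology)
 have tV: "topspace (subtopology S V) = V" using V openin_subset by (auto simp: topspace_subtopology)
 show ?thesis
 proof (rule that[OF oW W'(2) _ V])
  show "inj_on p W" using homeomorphic_imp_injective_map[OF hm] unfolding tW .
  show "p ` W = V" using homeomorphic_imp_surjective_map[OF hm] unfolding tW tV .
  show "continuous_map (subtopology S V) T s"
   using s by (auto simp: homeomorphic_maps_def continuous_map_in_subtopology)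
  show "s y \<in> W \<and> p (s y) = y" if "y \<in> V" for y
   using s that unfolding homeomorphic_maps_def continuous_map_def tV tW by auto
 qed
qed

lemma pow_eqI:
 assumes \<gamma>: "\<And>s t. \<gamma> (s + t) = \<gamma> s \<otimes> \<gamma> t" "\<And>t. \<gamma> t \<in> carrier G"
 shows "\<gamma> (real n * t) = \<gamma> t [^] n"
proof (induction n)
 case 0
 have "\<gamma> 0 \<otimes> \<gamma> 0 = \<gamma> 0" using \<gamma>(1)[of 0 0] by simp
 thus ?case using \<gamma>(2) l_cancel_one by simp
next
 case (Suc n)
 thus ?case by (simp add: \<gamma>(1)[symmetric] algebra_simps flip: Suc.IH)
qed

text \<open>For small parameters the quotient of the two subgroups lies in a sheet on which
  \<open>p\<close> is injective, and it has the same image as \<open>\<one>\<close>. An arbitrary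
  parameter is a multiple of a small one.\<close>

lemma one_parameter_unique:
 fixes \<gamma> \<gamma>' :: "real => 'g"
 assumes \<gamma>: "continuous_map euclideanreal T \<gamma>" "\<And>s t. \<gamma> (s + t) = \<gamma> s \<otimes> \<gamma> t"
  and \<gamma>': "continuous_map euclideanreal T \<gamma>'" "\<And>s t. \<gamma>' (s + t) = \<gamma>' s \<otimes> \<gamma>' t"
  and eq: "\<And>t. p (\<gamma> t) = p (\<gamma>' t)"
 shows "\<gamma> = \<gamma>'"
proof
 fix t
 obtain W where W: "openin T W" "\<one> \<in> W" "inj_on p W" using local_section by metis
 have mem: "\<gamma> s \<in> carrier G" "\<gamma>' s \<in> carrier G" for s
  using \<gamma>(1) \<gamma>'(1) by (auto simp: continuous_map_def topspace_T)
 define \<delta> where "\<delta> s = inv (\<gamma> s) \<otimes> \<gamma>' s" for s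
 have c\<delta>: "continuous_map euclideanreal T \<delta>"
  unfolding \<delta>_def by (intro continuous_map_mult continuous_map_inv \<gamma> \<gamma>')
 have op: "open {s. \<delta> s \<in> W}" using openin_continuous_map_preimage[OF c\<delta> W(1)] by simp
 have z: "\<gamma> 0 = \<one>" "\<gamma>' 0 = \<one>"
  using pow_eqI[OF \<gamma>(2) mem(1), of 0 0] pow_eqI[OF \<gamma>'(2) mem(2), of 0 0] by simp_all
 hence "0 \<in> {s. \<delta> s \<in> W}" using W by (simp add: \<delta>_def)
 then obtain e where e: "e > 0" "ball 0 e \<subseteq> {s. \<delta> s \<in> W}" using op open_contains_ball by blast
 have small: "\<gamma> s = \<gamma>' s" if "\<bar>s\<bar> < e" for s
 proof -
  have "s \<in> ball 0 e" using that by simp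
  hence "\<delta> s \<in> W" using e(2) by blast
  moreover have "p (\<delta> s) = p \<one>"
   using p_mult[of "inv (\<gamma> s)" "\<gamma>' s"] p_mult[of "inv (\<gamma> s)" "\<gamma> s"] mem eq by (simp add: \<delta>_def)
  ultimately have "\<delta> s = \<one>" using W by (meson inj_onD)
  thus ?thesis using mem by (simp add: \<delta>_def) (metis inv_closed inv_equality inv_inv)
 qed
 obtain n :: nat where n: "\<bar>t\<bar> / e < real n" using reals_Archimedean2 by blast
 hence "n > 0" using e by (cases n) (auto simp: field_simps)
 hence "\<bar>t / real n\<bar> < e" using n e by (simp add: field_simps)
 hence "\<gamma> (real n * (t / real n)) = \<gamma>' (real n * (t / real n))"
  by (simp only: pow_eqI[OF \<gamma>(2) mem(1)] pow_eqI[OF \<gamma>'(2) mem(2)] small)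
 thus "\<gamma> t = \<gamma>' t" using \<open>n > 0\<close> by simp
qed

text \<open>The local section turns \<open>\<phi>\<close> into a local homomorphism
  \<open>\<gamma>0\<close> near 0. It is extended to the line by taking the power \<open>m\<close>
  of \<open>\<gamma>0 (t / m)\<close> for large \<open>m\<close>, which does not depend on
  \<open>m\<close>.\<close>

lemma one_parameter_lift:
 fixes \<phi> :: "real => 'b"
 assumes c\<phi>: "continuous_map euclideanreal S \<phi>" and h\<phi>: "\<And>s t. \<phi> (s + t) = mult' (\<phi> s) (\<phi> t)"
  and z\<phi>: "\<phi> 0 = p \<one>"
 obtains \<gamma> where "continuous_map euclideanreal T \<gamma>" "\<And>s t. \<gamma> (s + t) = \<gamma> s \<otimes> \<gamma> t" "\<And>t. p (\<gamma> t) = \<phi> t"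
proof -
 obtain W V s where W: "openin T W" "\<one> \<in> W" "inj_on p W" and V: "openin S V" "p \<one> \<in> V" "p ` W = V"
  and s: "continuous_map (subtopology S V) T s" "\<And>y. y \<in> V ==> s y \<in> W \<and> p (s y) = y"
  by (rule local_section, rule that; assumption)
 have WG: "W \<subseteq> carrier G" using W(1) openin_subset topspace_T by blast
 define \<gamma>0 where "\<gamma>0 t = s (\<phi> t)" for t
 have "open {t. \<phi> t \<in> V}" using openin_continuous_map_preimage[OF c\<phi> V(1)] by simp
 moreover have "0 \<in> {t. \<phi> t \<in> V}" using V z\<phi> by simp
 ultimately obtain d where d: "d > 0" "ball 0 d \<subseteq> {t. \<phi> t \<in> V}" using open_contains_ball by blast
 define I where "I = {-d<..<d}"
 have \<phi>V: "\<phi> t \<in> V" if "t \<in> I" for t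
 proof -
  have "t \<in> ball 0 d" using that by (auto simp: I_def)
  thus ?thesis using d(2) by blast
 qed
 have \<gamma>0W: "\<gamma>0 t \<in> W" "p (\<gamma>0 t) = \<phi> t" if "t \<in> I" for t using s(2)[OF \<phi>V[OF that]] by (auto simp: \<gamma>0_def)
 have "continuous_map (top_of_set I) (subtopology S V) \<phi>"
  using c\<phi> \<phi>V by (auto simp: continuous_map_in_subtopology continuous_map_from_subtopology)
 from continuous_map_compose[OF this s(1)] have c0: "continuous_map (top_of_set I) T \<gamma>0"
  by (simp add: o_def \<gamma>0_def[abs_def])
 have pre: "open {t \<in> I. \<gamma>0 t \<in> A}" if "openin T A" for A
 proof -
  have "openin (top_of_set I) {t \<in> I. \<gamma>0 t \<in> A}" using openin_continuous_map_preimage[OF c0 that] by simp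
  thus ?thesis by (simp add: openin_open_eq I_def)
 qed
 have I0: "0 \<in> I" using d by (simp add: I_def)
 have \<gamma>00: "\<gamma>0 0 = \<one>" using W(3) \<gamma>0W[OF I0] W(2) z\<phi> by (metis inj_onD)
 \<comment> \<open>Products of elements close to \<open>\<one>\<close> stay in the sheet
   \<open>W\<close>, where an equality can be checked after applying \<open>p\<close>.\<close>
 have "openin (prod_topology T T) {x \<in> topspace (prod_topology T T). (case x of (g, h) => g \<otimes> h) \<in> W}"
  by (rule openin_continuous_map_preimage[OF continuous_mult W(1)])
 moreover have "(\<one>, \<one>) \<in> {x \<in> topspace (prod_topology T T). (case x of (g, h) => g \<otimes> h) \<in> W}"
  using W by (simp add: topspace_T)
 ultimately obtain A1 A2 where A: "openin T A1" "openin T A2" "\<one> \<in> A1" "\<one> \<in> A2"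
  "A1 \<times> A2 \<subseteq> {x \<in> topspace (prod_topology T T). (case x of (g, h) => g \<otimes> h) \<in> W}"
  unfolding openin_prod_topology_alt by meson
 have "open ({t \<in> I. \<gamma>0 t \<in> A1} \<inter> {t \<in> I. \<gamma>0 t \<in> A2})" by (intro open_Int pre A)
 moreover have "0 \<in> {t \<in> I. \<gamma>0 t \<in> A1} \<inter> {t \<in> I. \<gamma>0 t \<in> A2}" using A I0 \<gamma>00 by simp
 ultimately obtain e' where e': "e' > 0" "ball 0 e' \<subseteq> {t \<in> I. \<gamma>0 t \<in> A1} \<inter> {t \<in> I. \<gamma>0 t \<in> A2}"
  using open_contains_ball by blast
 \<comment> \<open>Half of \<open>d\<close> keeps the sum of two small parameters inside
   \<open>I\<close>.\<close>
 define e where "e = min e' (d / 2)"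
 have e: "e > 0" using e' d by (simp add: e_def)
 have eI: "t \<in> I" if "\<bar>t\<bar> < e" for t using that d by (auto simp: e_def I_def)
 have loc: "\<gamma>0 (a + b) = \<gamma>0 a \<otimes> \<gamma>0 b" if ab: "\<bar>a\<bar> < e" "\<bar>b\<bar> < e" for a b
 proof -
  have "a \<in> ball 0 e'" "b \<in> ball 0 e'" using ab by (auto simp: e_def)
  hence "(\<gamma>0 a, \<gamma>0 b) \<in> A1 \<times> A2" using e'(2) by blast
  hence "\<gamma>0 a \<otimes> \<gamma>0 b \<in> W" using A(5) by auto
  moreover have abI: "a + b \<in> I" using ab by (auto simp: e_def I_def)
  moreover have "p (\<gamma>0 a \<otimes> \<gamma>0 b) = p (\<gamma>0 (a + b))"
   using \<gamma>0W[OF eI[OF ab(1)]] \<gamma>0W[OF eI[OF ab(2)]] \<gamma>0W[OF abI] WG p_mult h\<phi> by (metis subsetD)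
  ultimately show ?thesis using \<gamma>0W(1)[OF abI] W(3) by (metis inj_onD)
 qed
 have g0G: "\<gamma>0 t \<in> carrier G" if "\<bar>t\<bar> < e" for t using \<gamma>0W(1)[OF eI[OF that]] WG by blast
 have pow: "\<gamma>0 (t / real m) [^] k = \<gamma>0 (real k * t / real m)" if t: "\<bar>t\<bar> < e" and k: "k \<le> m" and m: "m > 0" for t k m
  using k
 proof (induction k)
  case (Suc k)
  have lt: "\<bar>real j * t / real m\<bar> < e" if "j \<le> m" for j
  proof -
   have "real j * \<bar>t\<bar> / real m \<le> real m * \<bar>t\<bar> / real m"
    using that by (intro divide_right_mono mult_right_mono) auto
   thus ?thesis using t m by (simp add: abs_mult)
  qed
  have "\<gamma>0 (real k * t / real m + t / real m) = \<gamma>0 (real k * t / real m) \<otimes> \<gamma>0 (t / real m)"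
   using lt[of k] lt[of 1] Suc.prems by (intro loc) auto
  thus ?case using Suc by (simp add: algebra_simps add_divide_distrib)
 qed (simp add: \<gamma>00)
 \<comment> \<open>The summand 1 makes \<open>N t\<close> positive and the quotient strictly smaller
   than \<open>e\<close>.\<close>
 define N where "N t = nat \<lceil>\<bar>t\<bar> / e\<rceil> + 1" for t
 have N: "N t > 0" "\<bar>t / real (N t)\<bar> < e" for t
 proof -
  show "N t > 0" by (simp add: N_def)
  have "\<bar>t\<bar> / e < real (N t)" unfolding N_def by linarith
  thus "\<bar>t / real (N t)\<bar> < e" using e \<open>N t > 0\<close> by (simp add: field_simps)
 qed
 define \<gamma> where "\<gamma> t = \<gamma>0 (t / real (N t)) [^] N t" for t
 \<comment> \<open>Two admissible exponents are compared with their product, a common refinement of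
   both subdivisions.\<close>
 have \<gamma>_eq: "\<gamma> t = \<gamma>0 (t / real m) [^] m" if m: "m > 0" "\<bar>t / real m\<bar> < e" for t m
 proof -
  have 1: "\<gamma>0 (t / real a) [^] a = \<gamma>0 (t / real (a * b)) [^] (a * b)"
   if "a > 0" "b > 0" "\<bar>t / real a\<bar> < e" for a b :: nat
  proof -
   have "\<bar>x / real b\<bar> \<le> \<bar>x\<bar>" for x :: real
    using that(2) mult_left_mono[of 1 "real b" "\<bar>x\<bar>"] by (simp add: abs_divide divide_le_eq)
   from this[of "t / real a"] have "\<bar>t / real a / real b\<bar> \<le> \<bar>t / real a\<bar>" .
   hence "\<bar>t / real a / real b\<bar> < e" using that by linarith
   hence "\<gamma>0 (t / real a / real b) \<in> carrier G" by (rule g0G)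
   moreover have "\<gamma>0 (t / real a) = \<gamma>0 (t / real a / real b) [^] b"
    using pow[OF that(3) order_refl that(2)] that(2) by simp
   ultimately show ?thesis by (simp add: nat_pow_pow mult.commute)
  qed
  show ?thesis
   unfolding \<gamma>_def using 1[OF N(1) m(1) N(2)] 1[OF m(1) N(1) m(2), of t] by (simp add: mult.commute)
 qed
 have \<gamma>G: "\<gamma> t \<in> carrier G" for t unfolding \<gamma>_def by (intro nat_pow_closed g0G N)
 have \<gamma>_small: "\<gamma> t = \<gamma>0 t" if "\<bar>t\<bar> < e" for t using \<gamma>_eq[of 1 t] that g0G[OF that] by simp
 have hom: "\<gamma> (a + b) = \<gamma> a \<otimes> \<gamma> b" for a b
 proof -
  obtain m :: nat where m: "(\<bar>a\<bar> + \<bar>b\<bar>) / e < real m" using reals_Archimedean2 by blast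
  hence m0: "m > 0" using e by (cases m) (auto simp: field_simps)
  have "\<bar>a\<bar> + \<bar>b\<bar> < e * real m" using m e by (simp add: field_simps)
  hence lt: "\<bar>a / real m\<bar> < e" "\<bar>b / real m\<bar> < e" "\<bar>(a + b) / real m\<bar> < e"
   using m0 by (auto simp: pos_divide_less_eq)
  have "\<gamma> (a + b) = (\<gamma>0 (a / real m) \<otimes> \<gamma>0 (b / real m)) [^] m"
   using \<gamma>_eq[OF m0 lt(3)] loc[OF lt(1,2)] by (simp add: add_divide_distrib)
  \<comment> \<open>The power of the product splits because the factors commute: \<open>loc\<close>
    applies to both orders of the sum.\<close>
  also have "\<dots> = \<gamma>0 (a / real m) [^] m \<otimes> \<gamma>0 (b / real m) [^] m"
   using loc[OF lt(1,2)] loc[OF lt(2,1)] lt by (intro pow_mult_distrib g0G) (auto simp: add.commute)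
  finally show ?thesis using \<gamma>_eq[OF m0] lt by simp
 qed
 have p\<gamma>: "p (\<gamma> t) = \<phi> t" for t
 proof -
  let ?u = "t / real (N t)"
  have "p (\<gamma>0 ?u [^] k) = \<phi> (real k * ?u)" for k :: nat
  proof (induction k)
   case (Suc k)
   have "p (\<gamma>0 ?u [^] Suc k) = mult' (\<phi> (real k * ?u)) (\<phi> ?u)"
    using Suc g0G[OF N(2)] \<gamma>0W(2)[OF eI[OF N(2)]] by (simp add: p_mult)
   thus ?case by (simp add: h\<phi>[symmetric] algebra_simps add_divide_distrib)
  qed (simp add: z\<phi>)
  from this[of "N t"] show ?thesis using N(1)[of t] by (simp add: \<gamma>_def)
 qed
 \<comment> \<open>Continuity at \<open>t0\<close> is carried over from 0, where
   \<open>\<gamma>\<close> agrees with \<open>\<gamma>0\<close>, by left translation.\<close>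
 have "continuous_map euclideanreal T \<gamma>" unfolding continuous_map_def
 proof (intro conjI allI impI)
  show "\<gamma> \<in> topspace euclideanreal \<rightarrow> topspace T" using \<gamma>G by (auto simp: topspace_T)
  fix U assume U: "openin T U"
  have "\<exists>R. open R \<and> t0 \<in> R \<and> R \<subseteq> {t. \<gamma> t \<in> U}" if t0: "\<gamma> t0 \<in> U" for t0
  proof -
   have "continuous_map T T (\<lambda>g. \<gamma> t0 \<otimes> g)" using \<gamma>G by (intro continuous_map_mult) (auto simp: topspace_T)
   from openin_continuous_map_preimage[OF this U]
   have U': "openin T {g \<in> carrier G. \<gamma> t0 \<otimes> g \<in> U}" by (simp add: topspace_T)
   have "open ({t \<in> I. \<gamma>0 t \<in> {g \<in> carrier G. \<gamma> t0 \<otimes> g \<in> U}} \<inter> ball 0 e)" by (intro open_Int pre U') simp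
   hence op: "open ((\<lambda>t. t - t0) -` ({t \<in> I. \<gamma>0 t \<in> {g \<in> carrier G. \<gamma> t0 \<otimes> g \<in> U}} \<inter> ball 0 e))"
    by (intro open_vimage continuous_intros)
   have "\<gamma> t \<in> U" if "t - t0 \<in> {t \<in> I. \<gamma>0 t \<in> {g \<in> carrier G. \<gamma> t0 \<otimes> g \<in> U}} \<inter> ball 0 e" for t
    using that hom[of t0 "t - t0"] \<gamma>_small[of "t - t0"] by simp
   moreover have "0 \<in> {t \<in> I. \<gamma>0 t \<in> {g \<in> carrier G. \<gamma> t0 \<otimes> g \<in> U}} \<inter> ball 0 e" using t0 I0 e \<gamma>00 \<gamma>G by simp
   ultimately show ?thesis
    using op by (intro exI[of _ "(\<lambda>t. t - t0) -` ({t \<in> I. \<gamma>0 t \<in> {g \<in> carrier G. \<gamma> t0 \<otimes> g \<in> U}} \<inter> ball 0 e)"]) auto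
  qed
  thus "openin euclideanreal {x \<in> topspace euclideanreal. \<gamma> x \<in> U}"
   by (subst open_openin[symmetric], subst open_subopen) auto
 qed
 thus ?thesis using that hom p\<gamma> by blast
qed

end

text \<open>Restricted to the domain because the members of \<open>Bij\<close> are
  extensional.\<close>

definition flow_map :: "('n::finite, 'r::finite) lie_matrix => real => ('n, 'r) point => ('n, 'r) point"
 where "flow_map X t = (\<lambda>z\<in>\<D>. flow X t z)"

lemma flow_minus [simp]: "flow X (- t) (flow X t z) = z" "flow X t (flow X (- t) z) = z"
 by (simp_all flip: flow_add)

lemma holomorphic_map_on_cong:
 assumes "\<And>z. z \<in> D ==> f z = g z" "holomorphic_map_on f D"
 shows "holomorphic_map_on g D"
proof -
 have "(g has_derivative F) (at z within D)" if "z \<in> D" "(f has_derivative F) (at z within D)" for z F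
  using has_derivative_transform[OF that(1) _ that(2), of g] assms(1) by auto
 thus ?thesis using assms(2) unfolding holomorphic_map_on_def by (intro ballI) metis
qed

lemma flow_map_Aut:
 assumes X: "X \<in> gtilde"
 shows "flow_map X t \<in> Aut_hol \<D>"
proof -
 have bij: "bij_betw (flow_map X t) \<D> \<D>" by (rule bij_betw_byWitness[where f' = "flow_map X (- t)"])
   (auto simp: flow_map_def flow_siegel_domain[OF X])
 have inv: "inv_into \<D> (flow_map X t) z = flow X (- t) z" if z: "z \<in> \<D>" for z
 proof (rule inv_into_f_eq)
  show "inj_on (flow_map X t) \<D>" using bij by (rule bij_betw_imp_inj_on)
 qed (use z flow_siegel_domain[OF X z] in \<open>auto simp: flow_map_def\<close>)
 have "holomorphic_map_on (flow_map X t) \<D>"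
  by (rule holomorphic_map_on_cong[OF _ flow_holomorphic]) (auto simp: flow_map_def)
 moreover have "holomorphic_map_on (inv_into \<D> (flow_map X t)) \<D>"
  by (rule holomorphic_map_on_cong[OF _ flow_holomorphic]) (simp add: inv)
 ultimately show ?thesis using bij by (simp add: Aut_hol_def Bij_def) (simp add: flow_map_def)
qed

lemma topspace_Aut_hol: "topspace (Aut_hol_topology D) = Aut_hol D"
 unfolding Aut_hol_topology_def topology_generated_by_topspace by (auto intro!: exI[of _ "{}"])

lemma Aut_hol_0_subset: "Aut_hol_0 D \<subseteq> Aut_hol D"
 unfolding Aut_hol_0_def using connected_component_of_subset_topspace[of "Aut_hol_topology D"] topspace_Aut_hol by metis

text \<open>A subbasic open set asks that a compact set be mapped into an open one; joint continuity
  of the flow and the tube lemma make this an open condition on \<open>t\<close>.\<close>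

lemma continuous_flow_map:
 fixes X :: "('n::finite, 'r::finite) lie_matrix"
 assumes X: "X \<in> gtilde"
 shows "continuous_map euclideanreal (Aut_hol_topology \<D>) (flow_map X)" unfolding Aut_hol_topology_def
proof (rule continuous_on_generated_topo)
 fix A :: "(('n, 'r) point => ('n, 'r) point) set"
 assume "A \<in> {{f \<in> Aut_hol \<D>. f ` K \<subseteq> U} |K U. compact K \<and> K \<subseteq> \<D> \<and> open U}"
 then obtain K U where A: "A = {f \<in> Aut_hol \<D>. f ` K \<subseteq> U}" and KU: "compact K" "K \<subseteq> \<D>" "open U" by blast
 have eq: "flow_map X -` A \<inter> topspace euclideanreal = {t. \<forall>z\<in>K. flow X t z \<in> U}"
  using KU(2) flow_map_Aut[OF X] by (auto simp: A flow_map_def image_subset_iff)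
 have op: "open {q. flow X (fst q) (snd q) \<in> U}"
  using open_vimage[OF KU(3) continuous_on_flow[of X]] by (simp add: vimage_def)
 have "\<exists>W. open W \<and> t \<in> W \<and> W \<subseteq> {t. \<forall>z\<in>K. flow X t z \<in> U}" if t: "\<forall>z\<in>K. flow X t z \<in> U" for t
 proof -
  have op': "openin (prod_topology euclidean euclidean) {q. flow X (fst q) (snd q) \<in> U}"
   using op by (simp add: euclidean_product_topology)
  have K: "compactin euclidean K" using KU(1) by (simp add: compactin_euclidean_iff)
  have sub: "{t} \<times> K \<subseteq> {q. flow X (fst q) (snd q) \<in> U}" using t by auto
  from tube_lemma_right[OF op' K _ sub] obtain W W' where W: "openin euclidean W" "t \<in> W" "K \<subseteq> W'"
   "W \<times> W' \<subseteq> {q. flow X (fst q) (snd q) \<in> U}" by auto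
  have "W \<subseteq> {t. \<forall>z\<in>K. flow X t z \<in> U}" using W(3,4) by fastforce
  thus ?thesis using W(1,2) by (intro exI[of _ W]) simp
 qed
 hence "open {t. \<forall>z\<in>K. flow X t z \<in> U}" by (subst open_subopen) blast
 thus "openin euclideanreal (flow_map X -` A \<inter> topspace euclideanreal)" unfolding eq by simp
next
 show "flow_map X ` topspace euclideanreal \<subseteq> \<Union>{{f \<in> Aut_hol \<D>. f ` K \<subseteq> U} |K U. compact K \<and> K \<subseteq> \<D> \<and> open U}"
  unfolding topspace_Aut_hol[unfolded Aut_hol_topology_def topology_generated_by_topspace]
  using flow_map_Aut[OF X] by (intro image_subsetI)
qed

lemma flow_map_Aut_0:
 assumes X: "X \<in> gtilde"
 shows "flow_map X t \<in> Aut_hol_0 \<D>"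
proof -
 have "flow_map X 0 = (\<lambda>z\<in>\<D>. z)" by (auto simp: flow_map_def)
 moreover have "connectedin (Aut_hol_topology \<D>) (range (flow_map X))"
  using connectedin_continuous_map_image[OF continuous_flow_map[OF X], of UNIV] by simp
 ultimately show ?thesis unfolding Aut_hol_0_def connected_component_of_def
  by (auto intro!: exI[of _ "range (flow_map X)"]) (metis rangeI)
qed

text \<open>The quadratic form contributed by \<open>W\<close> is bounded on the unit sphere, so a
  large multiple of the identity outweighs it. Every matrix \<open>W\<close> thus occurs as second
  coordinate of a point of the domain, which allows fields to be tested on arbitrary
  \<open>W\<close>.\<close>

lemma sym_points_scaled_base: "\<exists>c>0. (mat (\<i> * complex_of_real c), W) \<in> (\<D> :: ('n::finite, 'r::finite) point set)"
proof -
 define q where "q x = (\<Sum>k\<in>UNIV. (cmod (\<Sum>i\<in>UNIV. complex_of_real (x $ i) * W $ i $ k))\<^sup>2) / 2" for x :: "real^'n"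
 have form: "siegel_form x (mat (\<i> * complex_of_real c), W) = c * (norm x)\<^sup>2 - q x" for x :: "real^'n" and c
 proof -
  have "(\<Sum>j\<in>UNIV. complex_of_real (x $ i * x $ j) * mat (\<i> * complex_of_real c) $ i $ j)
    = complex_of_real (x $ i * x $ i) * (\<i> * complex_of_real c)" for i
   by (subst sum.mono_neutral_right[of UNIV "{i}"]) (auto simp: mat_def)
  thus ?thesis
   by (simp add: siegel_form_def q_def power2_norm_eq_inner inner_vec_def sum_distrib_left mult_ac)
 qed
 have "continuous_on (sphere 0 1) q" unfolding q_def by (auto intro!: continuous_intros)
 hence "bdd_above (q ` sphere 0 1)"
  by (intro bounded_imp_bdd_above compact_imp_bounded compact_continuous_image compact_sphere)
 then obtain M where M: "\<And>x. x \<in> sphere 0 1 ==> q x \<le> M" unfolding bdd_above_def by blast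
 let ?c = "\<bar>M\<bar> + 1"
 have pos: "siegel_form x (mat (\<i> * complex_of_real ?c), W) > 0" if x: "x \<noteq> 0" for x :: "real^'n"
 proof -
  let ?y = "x /\<^sub>R norm x"
  have y: "norm ?y = 1" "x = norm x *\<^sub>R ?y" using x by auto
  have "siegel_form ?y (mat (\<i> * complex_of_real ?c), W) > 0" using M[of ?y] y(1) unfolding form by simp
  thus ?thesis using x by (subst y(2), subst siegel_form_scale) simp
 qed
 have "(mat (\<i> * complex_of_real ?c), W) \<in> (\<D> :: ('n, 'r) point set)"
  unfolding siegel_domain_iff using pos by (auto simp: sym_points_def)
 thus ?thesis by (intro exI[of _ ?c]) auto
qed

text \<open>The points \<open>(Z, 0)\<close> determine \<open>V\<close>, the points \<open>(Z, V)\<close> determine \<open>(T, K)\<close> up to a common scalar,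
 which is both real and imaginary.\<close>

lemma field_inject:
 fixes X Y :: "('n::finite, 'r::finite) lie_matrix"
 assumes X: "X \<in> gtilde" and Y: "Y \<in> gtilde" and eq: "\<And>z. z \<in> \<D> ==> field X z = field Y z"
 shows "X = Y"
proof -
 define X0 where "X0 = X - Y"
 have X0: "X0 \<in> gtilde" unfolding X0_def by (rule subspace_diff[OF subspace_gtilde X Y])
 have zero: "field X0 z = 0" if z: "z \<in> \<D>" for z
 proof -
  have "app (lop X0) (z, 1) = app (lop X) (z, 1) - app (lop Y) (z, 1)"
   by (simp add: X0_def linear_diff[OF linear_lop] app.diff_left)
  thus ?thesis using eq[OF z] by (simp add: app_lop_field zero_prod_def)
 qed
 have W: "cmat (iotaT X0) ** W - W ** iotaK X0 + iotaV X0 = 0" for W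
 proof -
  obtain c where "(mat (\<i> * complex_of_real c), W) \<in> (\<D> :: ('n, 'r) point set)"
   using sym_points_scaled_base by blast
  from zero[OF this] show ?thesis by (simp add: lie_vector_field_def prod_eq_iff)
 qed
 have V: "iotaV X0 = 0" using W[of 0] by (simp add: mm.zero_left mm.zero_right)
 have K: "adj (iotaK X0) = - iotaK X0" using X0 by (simp add: gtilde_iff skew_hermitian_def)
 \<comment> \<open>The relation \<open>T W = W K\<close> is tested on matrix units \<open>W\<close>;
   it leaves only diagonal entries, all with one common value.\<close>
 have ent: "(if l = b then complex_of_real (iotaT X0 $ a $ i) else 0) = (if a = i then iotaK X0 $ l $ b else 0)"
  for a i :: 'n and l b :: 'r
 proof -
  let ?W = "(\<chi> m n. if m = i \<and> n = l then 1 else 0) :: complex^'r^'n"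
  have 1: "(cmat (iotaT X0) ** ?W) $ a $ b = (if l = b then complex_of_real (iotaT X0 $ a $ i) else 0)"
   unfolding matrix_matrix_mult_def by (simp, subst sum.mono_neutral_right[of UNIV "{i}"]) auto
  have 2: "(?W ** iotaK X0) $ a $ b = (if a = i then iotaK X0 $ l $ b else 0)"
   unfolding matrix_matrix_mult_def by (simp, subst sum.mono_neutral_right[of UNIV "{l}"]) auto
  have "cmat (iotaT X0) ** ?W = ?W ** iotaK X0" using W[of ?W] V by simp
  hence "(cmat (iotaT X0) ** ?W) $ a $ b = (?W ** iotaK X0) $ a $ b" by simp
  thus ?thesis unfolding 1 2 .
 qed
 have diag: "iotaT X0 $ i $ i = 0 \<and> iotaK X0 $ l $ l = 0" for i :: 'n and l :: 'r
 proof -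
  have e: "complex_of_real (iotaT X0 $ i $ i) = iotaK X0 $ l $ l" using ent[of l l i i] by simp
  have "cnj (iotaK X0 $ l $ l) = - iotaK X0 $ l $ l"
   using arg_cong[OF K, of "\<lambda>M. M $ l $ l"] by (simp add: adjoint_matrix_def transpose_def)
  hence "Re (iotaK X0 $ l $ l) = 0" by (simp add: complex_eq_iff)
  hence "iotaT X0 $ i $ i = 0" using e by (metis Re_complex_of_real)
  thus ?thesis using e by simp
 qed
 have T: "iotaT X0 = 0"
 proof -
  have "iotaT X0 $ a $ i = 0" for a i using ent[of undefined undefined a i] diag by (cases "a = i") auto
  thus ?thesis by (simp add: vec_eq_iff)
 qed
 have K0: "iotaK X0 = 0"
 proof -
  have "iotaK X0 $ l $ b = 0" for l b using ent[of l b undefined undefined] diag by (cases "l = b") auto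
  thus ?thesis by (simp add: vec_eq_iff)
 qed
 have U: "iotaU X0 = 0"
 proof -
  obtain c where "(mat (\<i> * complex_of_real c), 0) \<in> (\<D> :: ('n, 'r) point set)"
   using sym_points_scaled_base by blast
  from zero[OF this] show ?thesis
   by (simp add: lie_vector_field_def prod_eq_iff T V Q.zero_left cm_zero mm.zero_left mm.zero_right tr_zero)
    (simp add: vec_eq_iff)
 qed
 have "X0 = iota 0 0 0 0" using X0 T K0 V U by (simp add: gtilde_iff)
 also have "\<dots> = 0 *\<^sub>R iota 0 0 0 0" by (simp add: iota_scaleR)
 finally show ?thesis by (simp add: X0_def)
qed

section \<open>Exponential map and adjoint action\<close>

lemma exp_app_mem:
 fixes A :: "'a::{banach,perfect_space} endo"
 assumes W: "subspace W" "closed W" and inv: "\<And>w. w \<in> W ==> app A w \<in> W" and w: "w \<in> W"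
 shows "app (exp A) w \<in> W"
proof -
 have pow: "app (A ^ n) w \<in> W" for n by (induction n) (auto simp: w inv)
 have "(\<lambda>n. \<Sum>i<n. A ^ i /\<^sub>R fact i) \<longlonglongrightarrow> exp A" using exp_converges[of A] by (simp add: sums_def)
 from bounded_linear.tendsto[OF app.bounded_linear_left this]
 have "(\<lambda>n. app (\<Sum>i<n. A ^ i /\<^sub>R fact i) w) \<longlonglongrightarrow> app (exp A) w" .
 thus ?thesis
 proof (rule closed_sequentially[OF W(2), rotated])
  show "app (\<Sum>i<n. A ^ i /\<^sub>R fact i) w \<in> W" for n
  unfolding app.sum_left by (intro subspace_sum W subspace_scale) (auto simp: app.scaleR_left intro!: subspace_scale W pow)
 qed
qed

lemma map_Im_add: "map_matrix Im (A + B) = map_matrix Im A + map_matrix Im B"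
 and map_Im_scaleR: "map_matrix Im (c *\<^sub>R A) = c *\<^sub>R map_matrix Im A" by (simp_all add: vec_eq_iff)

lemma linear_lie_bracket: "linear (lie_bracket X)"
 by (rule linearI) (simp_all add: lie_bracket_def components_linear iota_add iota_scaleR mm.add_left
   mm.add_right mm.scaleR_left mm.scaleR_right tr_add tr_scaleR cm_add cm_scaleR Q.add_right Q.scaleR_right
   iota_inject map_Im_add map_Im_scaleR algebra_simps)

definition ad :: "('n::finite, 'r::finite) lie_matrix => ('n, 'r) lie_matrix endo"
 where "ad X = endo (lie_bracket X)"

lemma app_ad: "app (ad X) Y = lie_bracket X Y"
 unfolding ad_def by (rule app_endo) (rule linear_lie_bracket[unfolded linear_conv_bounded_linear])

lemma ad_scaleR: "ad (c *\<^sub>R X) = c *\<^sub>R ad X"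
 by (rule endo_eqI) (simp add: app_ad app.scaleR_left lie_bracket_def components_linear iota_scaleR
   iota_inject mm.scaleR_left mm.scaleR_right tr_scaleR cm_scaleR Q.scaleR_left map_Im_scaleR algebra_simps)

lemma exp_ad_gtilde:
 assumes "X \<in> gtilde" "Y \<in> gtilde"
 shows "app (exp (ad X)) Y \<in> gtilde"
 by (rule exp_app_mem) (use assms in \<open>auto simp: subspace_gtilde app_ad lie_bracket_gtilde intro: closed_subspace\<close>)

text \<open>The identity Ad(exp X) = exp(ad X) in the operator algebra: the path \<open>w t\<close>
  solves \<open>w' = L w - w L\<close>, so conjugating it back by the exponential of
  \<open>t L\<close> gives derivative 0.\<close>

lemma lop_exp_ad:
 fixes X Y :: "('n::finite, 'r::finite) lie_matrix"
 assumes X: "X \<in> gtilde" and Y: "Y \<in> gtilde"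
 shows "lop (app (exp (ad X)) Y) = exp (lop X) * lop Y * exp (- lop X)"
proof -
 let ?L = "lop X"
 have bl: "bounded_linear (lop :: ('n, 'r) lie_matrix => _)"
  using linear_lop linear_conv_bounded_linear by blast
 define w where "w t = lop (app (exp (t *\<^sub>R ad X)) Y)" for t
 have mem: "app (exp (t *\<^sub>R ad X)) Y \<in> gtilde" for t
  using exp_ad_gtilde[OF subspace_scale[OF subspace_gtilde X] Y, of t] by (simp add: ad_scaleR)
 have dw: "(w has_vector_derivative (?L * w t - w t * ?L)) (at t)" for t
  using bounded_linear_has_vector_derivative[OF bl exp_app_derivative[of "ad X" Y t]]
  by (simp add: w_def[abs_def] app_ad lop_bracket[OF X mem])
 have "((\<lambda>t. exp (t *\<^sub>R (- ?L)) * w t * exp (t *\<^sub>R ?L)) has_vector_derivative 0) (at t)" for t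
 proof -
  have "((\<lambda>t. (exp (t *\<^sub>R (- ?L)) * w t) * exp (t *\<^sub>R ?L)) has_vector_derivative
    (exp (t *\<^sub>R (- ?L)) * w t) * (?L * exp (t *\<^sub>R ?L))
    + (exp (t *\<^sub>R (- ?L)) * (?L * w t - w t * ?L) + exp (t *\<^sub>R (- ?L)) * (- ?L) * w t) * exp (t *\<^sub>R ?L)) (at t)"
   by (intro has_vector_derivative_mult exp_scaleR_has_vector_derivative_left
     exp_scaleR_has_vector_derivative_right dw)
  thus ?thesis by (simp add: algebra_simps)
 qed
 from constant_of_zero_derivative[of "\<lambda>t. exp (t *\<^sub>R (- ?L)) * w t * exp (t *\<^sub>R ?L)" 1, OF this]
 have "exp (- ?L) * w 1 * exp ?L = w 0" by simp
 hence "exp ?L * (exp (- ?L) * w 1 * exp ?L) * exp (- ?L) = exp ?L * w 0 * exp (- ?L)" by simp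
 moreover have "exp ?L * (exp (- ?L) * w 1 * exp ?L) * exp (- ?L)
   = (exp ?L * exp (- ?L)) * w 1 * (exp ?L * exp (- ?L))" by (simp only: mult.assoc)
 moreover have "exp ?L * exp (- ?L) = 1" using exp_minus_scaleR_cancel(2)[of 1 ?L] by simp
 ultimately show ?thesis by (simp add: w_def)
qed

text \<open>By \<open>lop_exp_ad\<close> the conjugated flow solves the differential equation of the
  field that belongs to \<open>exp (ad X) Y\<close>.\<close>

lemma flow_conjugate:
 assumes X: "X \<in> gtilde" and Y: "Y \<in> gtilde"
 shows "flow X 1 (flow Y t (flow X (- 1) z)) = flow (app (exp (ad X)) Y) t z"
proof (rule flow_unique[of "\<lambda>t. flow X 1 (flow Y t (flow X (- 1) z))", simplified])
 fix t
 let ?e = "\<lambda>t. app (exp (lop X)) (app (exp (t *\<^sub>R lop Y)) (app (exp (- lop X)) (z, 1)))"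
 have e: "?e t = (flow X 1 (flow Y t (flow X (- 1) z)), 1)" for t
  using exp_lop_flow[of 1 X] exp_lop_flow[of "- 1" X] by (simp add: exp_lop_flow)
 have cancel: "exp (- lop X) * exp (lop X) = 1" using exp_minus_scaleR_cancel(1)[of 1 "lop X"] by simp
 hence cancel': "exp (- lop X) * (exp (lop X) * u) = u" for u by (simp flip: mult.assoc)
 have "(?e has_vector_derivative app (exp (lop X)) (app (lop Y) (app (exp (t *\<^sub>R lop Y)) (app (exp (- lop X)) (z, 1))))) (at t)"
  by (rule bounded_linear_has_vector_derivative[OF app.bounded_linear_right exp_app_derivative])
 also have "app (exp (lop X)) (app (lop Y) (app (exp (t *\<^sub>R lop Y)) (app (exp (- lop X)) (z, 1))))
   = app (lop (app (exp (ad X)) Y)) (?e t)"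
  unfolding lop_exp_ad[OF X Y] by (simp add: app_mult[symmetric] mult.assoc cancel' del: app_mult)
 finally have "((\<lambda>t. (flow X 1 (flow Y t (flow X (- 1) z)), 1 :: real)) has_vector_derivative
   app (lop (app (exp (ad X)) Y)) (flow X 1 (flow Y t (flow X (- 1) z)), 1)) (at t)" unfolding e .
 from bounded_linear_has_vector_derivative[OF bounded_linear_fst this]
 show "((\<lambda>t. flow X 1 (flow Y t (flow X (- 1) z))) has_vector_derivative
   field (app (exp (ad X)) Y) (flow X 1 (flow Y t (flow X (- 1) z)))) (at t)" by (simp add: app_lop_field)
qed

section \<open>The exponential map of the covering group\<close>

locale siegel_cover =
 fixes G :: "'g monoid" (structure) and T :: "'g topology"
  and p :: "'g => ('n::finite, 'r::finite) point => ('n, 'r) point"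
 assumes universal: "universal_covering_of_Aut \<D> G T p"
begin

abbreviation Exp where "Exp \<equiv> lie_exp G T p"

lemma p_hom: "p \<in> hom G (BijGroup \<D> \<lparr>carrier := Aut_hol_0 \<D>\<rparr>)"
 using universal by (simp add: universal_covering_of_Aut_def)

lemma simply_connected: "simply_connected_space T"
 using universal by (simp add: universal_covering_of_Aut_def)

lemma p_Aut: "g \<in> carrier G ==> p g \<in> Aut_hol_0 \<D>" using p_hom by (auto simp: hom_def)

lemma p_Bij: "g \<in> carrier G ==> p g \<in> Bij \<D>" using p_Aut Aut_hol_0_subset by (fastforce simp: Aut_hol_def)

sublocale covered_group G T "subtopology (Aut_hol_topology \<D>) (Aut_hol_0 \<D>)" p "compose \<D>"
proof -
 have tg: "topological_group G T" and cov: "covering_map T (subtopology (Aut_hol_topology \<D>) (Aut_hol_0 \<D>)) p"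
  using universal by (simp_all add: universal_covering_of_Aut_def)
 then interpret group G by (simp add: topological_group_def)
 show "covered_group G T (subtopology (Aut_hol_topology \<D>) (Aut_hol_0 \<D>)) p (compose \<D>)"
 proof
  show "p (g \<otimes> h) = compose \<D> (p g) (p h)" if "g \<in> carrier G" "h \<in> carrier G" for g h
   using that p_hom p_Bij by (simp add: hom_def BijGroup_def)
 qed (fact tg cov)+
qed

lemma p_mem: "g \<in> carrier G ==> z \<in> \<D> ==> p g z \<in> \<D>" using p_Bij Bij_imp_funcset by blast

lemma p_mult_apply: "g \<in> carrier G ==> h \<in> carrier G ==> z \<in> \<D> ==> p (g \<otimes> h) z = p g (p h z)"
 by (simp add: p_mult compose_eq)

text \<open>\<open>p \<one>\<close> is an idempotent and injective map of the domain, hence the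
  identity on it.\<close>

lemma p_one: "p \<one> = (\<lambda>z\<in>\<D>. z)"
proof (rule extensionalityI[where A = \<D>])
 show "p \<one> \<in> extensional \<D>" using p_Bij by (simp add: Bij_def)
 fix z :: "('n, 'r) point" assume z: "z \<in> \<D>"
 have "p \<one> (p \<one> z) = p \<one> z" using p_mult_apply[of \<one> \<one> z] z by simp
 moreover have "inj_on (p \<one>) \<D>" using p_Bij[of \<one>] by (simp add: Bij_def bij_betw_def)
 ultimately show "p \<one> z = (\<lambda>z\<in>\<D>. z) z" using z p_mem by (simp add: inj_onD)
qed simp

lemma p_one_apply [simp]: "z \<in> \<D> ==> p \<one> z = z" by (simp add: p_one)

lemma p_inv_apply [simp]: "g \<in> carrier G ==> z \<in> \<D> ==> p (inv g) (p g z) = z"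
 "g \<in> carrier G ==> z \<in> \<D> ==> p g (p (inv g) z) = z" by (simp_all flip: p_mult_apply)

lemma p_extensional_eqI:
 assumes "g \<in> carrier G" "\<And>z. z \<in> \<D> ==> p g z = f z"
 shows "p g = (\<lambda>z\<in>\<D>. f z)"
 using p_Bij[OF assms(1)] assms(2) by (intro extensionalityI[where A = \<D>]) (auto simp: Bij_def)

lemma continuous_p_apply:
 assumes z: "z \<in> \<D>"
 shows "continuous_map T euclidean (\<lambda>g. p g z)"
proof -
 have cp: "continuous_map T (Aut_hol_topology \<D>) p"
  using cov by (auto simp: covering_map_def continuous_map_in_subtopology)
 show ?thesis unfolding continuous_map_def
 proof (intro conjI allI impI)
  fix U :: "('n, 'r) point set" assume "openin euclidean U"
  hence U: "open U" by simp
  have "openin (Aut_hol_topology \<D>) {f \<in> Aut_hol \<D>. f ` {z} \<subseteq> U}" unfolding Aut_hol_topology_def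
   by (rule topology_generated_by_Basis) (use z U in \<open>blast intro: compact_sing\<close>)
  from openin_continuous_map_preimage[OF cp this]
  have "openin T {g \<in> topspace T. p g \<in> Aut_hol \<D> \<and> p g z \<in> U}" by simp
  moreover have "{g \<in> topspace T. p g \<in> Aut_hol \<D> \<and> p g z \<in> U} = {g \<in> topspace T. p g z \<in> U}"
   using p_Aut Aut_hol_0_subset by (auto simp: topspace_T)
  ultimately show "openin T {g \<in> topspace T. p g z \<in> U}" by simp
 qed auto
qed

definition one_param :: "('n, 'r) lie_matrix => real => 'g"
 where "one_param X = (THE \<gamma>. one_parameter_subgroup G T p X \<gamma>)"

lemma one_parameter_subgroup_flow:
 assumes X: "X \<in> gtilde" and \<gamma>: "one_parameter_subgroup G T p X \<gamma>" and z: "z \<in> \<D>"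
 shows "p (\<gamma> t) z = flow X t z"
proof -
 from \<gamma> have c: "continuous_map euclideanreal T \<gamma>" and h: "\<And>s t. \<gamma> (s + t) = \<gamma> s \<otimes> \<gamma> t"
  and d: "\<And>t. ((\<lambda>s. p (\<gamma> s) z) has_vector_derivative field X (p (\<gamma> t) z)) (at t)"
  using z by (auto simp: one_parameter_subgroup_def)
 have mem: "\<gamma> s \<in> carrier G" for s using c by (auto simp: continuous_map_def topspace_T)
 have "\<gamma> 0 = \<one>" using pow_eqI[OF h mem, of 0 0] by simp
 thus ?thesis using flow_unique[of "\<lambda>s. p (\<gamma> s) z" X, OF d, of t] z by simp
qed

text \<open>Replaces the differential equation and the existential quantifiers of the definition by
  the explicit flow.\<close>

lemma one_parameter_subgroup_iff:
 assumes X: "X \<in> gtilde"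
 shows "one_parameter_subgroup G T p X \<gamma> \<longleftrightarrow> continuous_map euclideanreal T \<gamma> \<and>
  (\<forall>s t. \<gamma> (s + t) = \<gamma> s \<otimes> \<gamma> t) \<and> (\<forall>t. \<forall>z\<in>\<D>. p (\<gamma> t) z = flow X t z)" (is "_ \<longleftrightarrow> ?R")
proof
 assume \<gamma>: "one_parameter_subgroup G T p X \<gamma>"
 thus ?R using one_parameter_subgroup_flow[OF X \<gamma>] by (auto simp: one_parameter_subgroup_def)
next
 assume R: ?R
 have Xi: "X = iota (iotaT X) (iotaK X) (iotaV X) (iotaU X)" "iotaK X \<in> skew_hermitian" "iotaU X \<in> sym_real"
  using X by (auto simp: gtilde_iff)
 have "((\<lambda>s. p (\<gamma> s) z) has_vector_derivative field X (p (\<gamma> t) z)) (at t)" if z: "z \<in> \<D>" for z t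
 proof -
  have "(\<lambda>s. p (\<gamma> s) z) = (\<lambda>s. flow X s z)" using R z by auto
  thus ?thesis using flow_derivative[of X z t] by metis
 qed
 thus "one_parameter_subgroup G T p X \<gamma>" unfolding one_parameter_subgroup_def using R Xi
  by (intro conjI exI[of _ "iotaT X"] exI[of _ "iotaK X"] exI[of _ "iotaV X"] exI[of _ "iotaU X"]) auto
qed

text \<open>Gives a meaning to the definite description in \<open>lie_exp\<close>: the curve
  \<open>flow_map X\<close> is lifted through the covering, and the lift is unique.\<close>

lemma one_parameter_subgroup_ex1:
 assumes X: "X \<in> gtilde"
 shows "\<exists>!\<gamma>. one_parameter_subgroup G T p X \<gamma>"
proof -
 have c: "continuous_map euclideanreal (subtopology (Aut_hol_topology \<D>) (Aut_hol_0 \<D>)) (flow_map X)"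
  using continuous_flow_map[OF X] flow_map_Aut_0[OF X] by (auto simp: continuous_map_in_subtopology)
 have h: "flow_map X (s + t) = compose \<D> (flow_map X s) (flow_map X t)" for s t
  by (auto simp: flow_map_def compose_def flow_add flow_siegel_domain[OF X])
 have z: "flow_map X 0 = p \<one>" by (auto simp: flow_map_def p_one)
 obtain \<gamma> where \<gamma>: "continuous_map euclideanreal T \<gamma>" "\<And>s t. \<gamma> (s + t) = \<gamma> s \<otimes> \<gamma> t"
  "\<And>t. p (\<gamma> t) = flow_map X t" by (rule one_parameter_lift[OF c h z], rule that; assumption)
 have "one_parameter_subgroup G T p X \<gamma>"
  unfolding one_parameter_subgroup_iff[OF X] using \<gamma> by (simp add: flow_map_def)
 moreover have "\<gamma>' = \<gamma>" if \<gamma>': "one_parameter_subgroup G T p X \<gamma>'" for \<gamma>'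
 proof (rule one_parameter_unique)
  note \<gamma>'' = \<gamma>'[unfolded one_parameter_subgroup_iff[OF X]]
  show "continuous_map euclideanreal T \<gamma>'" "\<gamma>' (s + t) = \<gamma>' s \<otimes> \<gamma>' t" for s t using \<gamma>'' by auto
  have "\<gamma>' t \<in> carrier G" for t using \<gamma>'' by (auto simp: continuous_map_def topspace_T)
  thus "p (\<gamma>' t) = p (\<gamma> t)" for t unfolding \<gamma>(3) flow_map_def using \<gamma>'' by (intro p_extensional_eqI) auto
 qed (fact \<gamma>)+
 ultimately show ?thesis by blast
qed

lemma one_param: "X \<in> gtilde ==> one_parameter_subgroup G T p X (one_param X)"
 unfolding one_param_def by (rule theI'[OF one_parameter_subgroup_ex1])

lemma one_param_eqI: "X \<in> gtilde ==> one_parameter_subgroup G T p X \<gamma> ==> one_param X = \<gamma>"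
 using one_parameter_subgroup_ex1 one_param by blast

lemma one_param_props:
 assumes X: "X \<in> gtilde"
 shows "continuous_map euclideanreal T (one_param X)"
  and "one_param X (s + t) = one_param X s \<otimes> one_param X t" and "z \<in> \<D> ==> p (one_param X t) z = flow X t z"
  and "one_param X t \<in> carrier G" and "one_param X 0 = \<one>"
proof -
 note h = one_param[OF X, unfolded one_parameter_subgroup_iff[OF X]]
 show "continuous_map euclideanreal T (one_param X)"
  and add: "one_param X (s + t) = one_param X s \<otimes> one_param X t"
  and "z \<in> \<D> ==> p (one_param X t) z = flow X t z" for s t using h by auto
 show mem: "one_param X t \<in> carrier G" for t using h by (auto simp: continuous_map_def topspace_T)
 show "one_param X 0 = \<one>" using pow_eqI[of "one_param X" 0 0] add mem by simp
qed

lemma lie_exp_scaleR: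
 assumes X: "X \<in> gtilde"
 shows "Exp (t *\<^sub>R X) = one_param X t"
proof -
 have tX: "t *\<^sub>R X \<in> gtilde" by (rule subspace_scale[OF subspace_gtilde X])
 have "one_param (t *\<^sub>R X) = (\<lambda>s. one_param X (s * t))"
 proof (rule one_param_eqI[OF tX], unfold one_parameter_subgroup_iff[OF tX], intro conjI allI ballI)
  have "continuous_map euclideanreal euclideanreal (\<lambda>s. s * t)"
   by (simp add: continuous_map_iff_continuous2 continuous_intros)
  from continuous_map_compose[OF this one_param_props(1)[OF X]]
  show "continuous_map euclideanreal T (\<lambda>s. one_param X (s * t))" by (simp add: o_def)
 qed (simp_all add: one_param_props(2,3)[OF X] distrib_right flow_scaleR mult.commute[of t])
 thus ?thesis by (simp add: lie_exp_def flip: one_param_def)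
qed

lemma lie_exp_one_param: "X \<in> gtilde ==> Exp X = one_param X 1" using lie_exp_scaleR[of X 1] by simp

lemma lie_exp_mem: "X \<in> gtilde ==> Exp X \<in> carrier G" by (simp add: lie_exp_one_param one_param_props)

lemma p_lie_exp: "X \<in> gtilde ==> z \<in> \<D> ==> p (Exp X) z = flow X 1 z"
 by (simp add: lie_exp_one_param one_param_props)

lemma lie_exp_add: "X \<in> gtilde ==> Exp ((s + t) *\<^sub>R X) = Exp (s *\<^sub>R X) \<otimes> Exp (t *\<^sub>R X)"
 by (simp add: lie_exp_scaleR one_param_props)

lemma lie_exp_zero: "Exp 0 = \<one>"
 using lie_exp_scaleR[OF subspace_0[OF subspace_gtilde], of 0] one_param_props(5)[OF subspace_0[OF subspace_gtilde]]
 by simp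

lemma lie_exp_minus: "X \<in> gtilde ==> Exp (- X) = inv (Exp X)"
proof -
 assume X: "X \<in> gtilde"
 have "Exp (- X) \<otimes> Exp X = \<one>" using lie_exp_add[OF X, of "- 1" 1] by (simp add: lie_exp_zero)
 thus ?thesis
  using lie_exp_mem[OF X] lie_exp_mem[OF subspace_neg[OF subspace_gtilde X]] by (simp add: inv_equality)
qed

text \<open>The one-parameter subgroup determines the flow, its velocity at time 0 is the field, and
  the field determines the matrix. This is the uniqueness in the definition of
  \<open>Ad\<close>.\<close>

lemma one_param_inject:
 assumes X: "X \<in> gtilde" and Y: "Y \<in> gtilde" and eq: "\<And>t. Exp (t *\<^sub>R X) = Exp (t *\<^sub>R Y)"
 shows "X = Y"
proof (rule field_inject[OF X Y])
 fix z :: "('n, 'r) point" assume z: "z \<in> \<D>"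
 have "(\<lambda>t. flow X t z) = (\<lambda>t. flow Y t z)"
  using eq one_param_props(3)[OF X z] one_param_props(3)[OF Y z] by (auto simp: lie_exp_scaleR X Y)
 thus "field X z = field Y z"
  using flow_derivative[of X z 0] flow_derivative[of Y z 0] vector_derivative_unique_at by (metis flow_0)
qed

text \<open>The adjoint action as a relation, which can be composed without knowing beforehand that
  the definite description in \<open>Ad\<close> denotes.\<close>

definition conj_rel :: "'g => ('n, 'r) lie_matrix => ('n, 'r) lie_matrix => bool"
 where "conj_rel g X Y \<longleftrightarrow> X \<in> gtilde \<and> Y \<in> gtilde \<and> (\<forall>t. g \<otimes> Exp (t *\<^sub>R X) \<otimes> inv g = Exp (t *\<^sub>R Y))"

lemma Ad_eqI:
 assumes "conj_rel g X Y"
 shows "Ad G T p g X = Y" unfolding Ad_def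
proof (rule the_equality)
 fix Y' assume Y': "Y' \<in> gtilde \<and> (\<forall>t. g \<otimes> Exp (t *\<^sub>R X) \<otimes> inv g = Exp (t *\<^sub>R Y'))"
 thus "Y' = Y" using assms by (intro one_param_inject) (auto simp: conj_rel_def)
qed (use assms in \<open>auto simp: conj_rel_def\<close>)

lemma conj_rel_one: "X \<in> gtilde ==> conj_rel \<one> X X"
 by (simp add: conj_rel_def lie_exp_mem subspace_scale[OF subspace_gtilde])

lemma conj_rel_mult:
 assumes "g \<in> carrier G" "h \<in> carrier G" "conj_rel h X Y" "conj_rel g Y Z"
 shows "conj_rel (g \<otimes> h) X Z"
proof -
 have "g \<otimes> h \<otimes> Exp (t *\<^sub>R X) \<otimes> inv (g \<otimes> h) = Exp (t *\<^sub>R Z)" for t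
 proof -
  have m: "Exp (t *\<^sub>R X) \<in> carrier G"
   using assms(3) by (intro lie_exp_mem subspace_scale[OF subspace_gtilde]) (simp add: conj_rel_def)
  have "g \<otimes> h \<otimes> Exp (t *\<^sub>R X) \<otimes> inv (g \<otimes> h) = g \<otimes> (h \<otimes> Exp (t *\<^sub>R X) \<otimes> inv h) \<otimes> inv g"
   using assms(1,2) m by (simp add: inv_mult_group m_assoc)
  thus ?thesis using assms(3,4) by (simp add: conj_rel_def)
 qed
 thus ?thesis using assms(3,4) by (simp add: conj_rel_def)
qed

text \<open>The conjugate of a one-parameter subgroup is again one, and
  \<open>flow_conjugate\<close> identifies the element it belongs to.\<close>

lemma conj_rel_lie_exp:
 assumes X: "X \<in> gtilde" and Y: "Y \<in> gtilde"
 shows "conj_rel (Exp X) Y (app (exp (ad X)) Y)"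
proof -
 let ?g = "Exp X" and ?Z = "app (exp (ad X)) Y"
 have Z: "?Z \<in> gtilde" by (rule exp_ad_gtilde[OF X Y])
 have g: "?g \<in> carrier G" by (rule lie_exp_mem[OF X])
 let ?\<delta> = "\<lambda>t. ?g \<otimes> one_param Y t \<otimes> inv ?g"
 note mem = one_param_props(4)[OF Y]
 have pinv: "p (inv ?g) z = flow X (- 1) z" if z: "z \<in> \<D>" for z
  using p_lie_exp[OF subspace_neg[OF subspace_gtilde X] z] flow_scaleR[of "- 1" X 1 z]
  by (simp add: lie_exp_minus[OF X])
 have "one_param ?Z = ?\<delta>"
 proof (rule one_param_eqI[OF Z], unfold one_parameter_subgroup_iff[OF Z], intro conjI allI ballI)
  show "continuous_map euclideanreal T ?\<delta>"
   using g by (intro continuous_map_mult one_param_props(1)[OF Y]) (auto simp: topspace_T)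
  show "?\<delta> (s + t) = ?\<delta> s \<otimes> ?\<delta> t" for s t
  proof -
   have "inv ?g \<otimes> (?g \<otimes> x) = x" if "x \<in> carrier G" for x using g that by (simp add: m_assoc[symmetric])
   thus ?thesis using g mem by (simp add: one_param_props(2)[OF Y] m_assoc)
  qed
  fix t and z :: "('n, 'r) point" assume z: "z \<in> \<D>"
  have "p (?\<delta> t) z = p ?g (p (one_param Y t) (p (inv ?g) z))" using g mem z by (simp add: p_mult_apply p_mem)
  also have "\<dots> = flow X 1 (flow Y t (flow X (- 1) z))"
   using z g mem by (simp add: pinv p_lie_exp[OF X] one_param_props(3)[OF Y] flow_siegel_domain X Y)
  also have "\<dots> = flow ?Z t z" by (rule flow_conjugate[OF X Y])
  finally show "p (?\<delta> t) z = flow ?Z t z" .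
 qed
 thus ?thesis unfolding conj_rel_def using Y Z by (simp add: lie_exp_scaleR)
qed

lemma Ad_lie_exp: "X \<in> gtilde ==> Y \<in> gtilde ==> Ad G T p (Exp X) Y = app (exp (ad X)) Y"
 by (rule Ad_eqI[OF conj_rel_lie_exp])

lemma generate_lie_exp_mem:
 assumes "\<h> \<subseteq> gtilde" "b \<in> generate G (Exp ` \<h>)"
 shows "b \<in> carrier G" using generate_in_carrier[OF _ assms(2)] assms(1) lie_exp_mem by blast

end

section \<open>Triangularizable operators\<close>

text \<open>A maximum point on the unit sphere of the absolute value of \<open>x . f x\<close> is an
  eigenvector. The absolute value secures a nonzero eigenvalue: if the maximum were 0, the symmetric
  form would vanish identically and \<open>f\<close> with it.\<close>

lemma self_adjoint_eigenvector:
 fixes f :: "'a::euclidean_space => 'a"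
 assumes lin: "linear f" and sym: "\<And>x y. f x \<bullet> y = x \<bullet> f y" and ne: "f \<noteq> (\<lambda>_. 0)"
 shows "\<exists>c v. c \<noteq> 0 \<and> v \<noteq> 0 \<and> f v = c *\<^sub>R v"
proof -
 have sphere: "(sphere 0 1 :: 'a set) \<noteq> {}" by simp
 have cont: "continuous_on (sphere 0 1) (\<lambda>x. \<bar>x \<bullet> f x\<bar>)"
  by (intro continuous_intros linear_continuous_on lin[unfolded linear_conv_bounded_linear])
 obtain v where v: "norm v = 1" and max: "\<And>x. norm x = 1 ==> \<bar>x \<bullet> f x\<bar> \<le> \<bar>v \<bullet> f v\<bar>"
  using continuous_attains_sup[OF compact_sphere sphere cont] by auto
 define c where "c = v \<bullet> f v"
 have bound: "\<bar>x \<bullet> f x\<bar> \<le> \<bar>c\<bar> * (x \<bullet> x)" for x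
 proof (cases "x = 0")
  case False
  define y where "y = x /\<^sub>R norm x"
  have y: "norm y = 1" "x = norm x *\<^sub>R y" using False by (auto simp: y_def)
  have "x \<bullet> f x = (norm x)\<^sup>2 * (y \<bullet> f y)"
   by (subst (1 2) y(2)) (simp add: linear_scale[OF lin] power2_eq_square)
  moreover have "x \<bullet> x = (norm x)\<^sup>2" by (simp add: power2_norm_eq_inner)
  ultimately show ?thesis
   using mult_left_mono[OF max[OF y(1)], of "(norm x)\<^sup>2"] by (simp add: abs_mult c_def mult.commute)
 qed (simp add: linear_0[OF lin])
 have c0: "c \<noteq> 0"
 proof
  assume "c = 0"
  hence z: "x \<bullet> f x = 0" for x using bound[of x] by simp
  have "f y \<bullet> x = 0" for x y
   using z[of "x + y"] z[of x] z[of y] sym[of y x] by (simp add: linear_add[OF lin] inner_add inner_commute)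
  thus False using ne by (metis inner_eq_zero_iff)
 qed
 \<comment> \<open>With this sign the form \<open>|c| (x . x) - s (x . f x)\<close> is nonnegative
   and vanishes at \<open>v\<close>, so its first-order term at \<open>v\<close> is zero in every
   direction \<open>y\<close>.\<close>
 define s where "s = sgn c"
 have s: "\<bar>c\<bar> = s * c" "s * s = 1" using c0 by (auto simp: s_def sgn_if)
 have pos: "0 \<le> \<bar>c\<bar> * (x \<bullet> x) - s * (x \<bullet> f x)" for x using bound[of x] by (auto simp: s_def sgn_if)
 have "(\<bar>c\<bar> *\<^sub>R v - s *\<^sub>R f v) \<bullet> y = 0" for y
 proof -
  define A where "A = (\<bar>c\<bar> *\<^sub>R v - s *\<^sub>R f v) \<bullet> y"
  define B where "B = \<bar>c\<bar> * (y \<bullet> y) - s * (y \<bullet> f y)"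
  have vv: "v \<bullet> v = 1" using v by (simp add: power2_norm_eq_inner[symmetric])
  have "0 \<le> 2 * t * A + t\<^sup>2 * B" for t
  proof -
   have fy: "y \<bullet> f v = v \<bullet> f y" using sym[of v y] by (simp add: inner_commute)
   have "\<bar>c\<bar> * ((v + t *\<^sub>R y) \<bullet> (v + t *\<^sub>R y)) - s * ((v + t *\<^sub>R y) \<bullet> f (v + t *\<^sub>R y))
     = (\<bar>c\<bar> * (v \<bullet> v) - s * (v \<bullet> f v)) + 2 * t * A + t\<^sup>2 * B"
    by (simp add: A_def B_def linear_add[OF lin] linear_scale[OF lin] inner_add_left inner_add_right
      inner_diff_left sym fy inner_commute[of y v] algebra_simps power2_eq_square)
   also have "\<bar>c\<bar> * (v \<bullet> v) - s * (v \<bullet> f v) = 0" using s vv by (simp add: c_def)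
   finally show ?thesis using pos[of "v + t *\<^sub>R y"] by simp
  qed
  note q = this
  have B: "B \<ge> 0" unfolding B_def by (rule pos)
  \<comment> \<open>A test value for the quadratic inequality: at \<open>t = - u\<close> the
    right-hand side is \<open>- u^2 (B + 2)\<close>. The added 1 avoids division by zero.\<close>
  define u where "u = A / (B + 1)"
  have A: "A = u * (B + 1)" using B by (simp add: u_def)
  have "0 \<le> 2 * (- u) * A + (- u)\<^sup>2 * B" by (rule q)
  also have "\<dots> = - (u\<^sup>2 * (B + 2))" by (simp add: A algebra_simps power2_eq_square)
  finally have "u\<^sup>2 * (B + 2) \<le> 0" by simp
  hence "u = 0" using B by (auto simp: mult_le_0_iff)
  hence "A = 0" by (simp add: A)
  thus ?thesis by (simp add: A_def)
 qed
 hence "\<bar>c\<bar> *\<^sub>R v = s *\<^sub>R f v" by (metis inner_eq_zero_iff right_minus_eq)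
 hence "(s * s) *\<^sub>R f v = (s * s * c) *\<^sub>R v" using s(1) by (metis scaleR_scaleR mult.assoc)
 hence "f v = c *\<^sub>R v" by (simp add: s)
 thus ?thesis using c0 v by (intro exI[of _ c] exI[of _ v]) auto
qed

lemma inner_hermitian:
 fixes A :: "complex^'a::finite^'a"
 assumes A: "adj A = A"
 shows "(A *v x) \<bullet> y = x \<bullet> (A *v y)"
proof -
 have re: "u \<bullet> v = Re (cdot u (cnjv v))" for u v :: "complex^'a"
  by (simp add: inner_vec_def cdot_def inner_complex_def)
 have "A = transpose (transpose A)" by simp
 hence "cdot (A *v x) (cnjv y) = cdot x (transpose A *v cnjv y)"
  using cdot_transpose[of "transpose A" x "cnjv y"] by simp
 also have "transpose A = map_matrix cnj A"
  using A by (metis adjoint_matrix_def map_cnj_transpose map_cnj_cnj)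
 finally show ?thesis by (simp add: re cnjv_mult)
qed

lemma hermitian_eigenvector:
 fixes A :: "complex^'a::finite^'a"
 assumes A: "adj A = A" and ne: "A \<noteq> 0"
 shows "\<exists>c v. c \<noteq> 0 \<and> v \<noteq> 0 \<and> A *v v = complex_of_real c *\<^sub>C v"
proof -
 have "linear ((*v) A)" using mv.bounded_linear_right[of A] by (rule bounded_linear.linear)
 moreover have "(*v) A \<noteq> (\<lambda>_. 0)" using ne by (metis matrix_eq matrix_vector_mult_0)
 ultimately show ?thesis
  using self_adjoint_eigenvector[of "(*v) A"] inner_hermitian[OF A] by (simp add: scaleC_of_real)
qed

text \<open>Says that \<open>S\<close> has codimension at most one in \<open>S'\<close>, as linear
  dependence modulo \<open>S\<close> of any two elements. In this form it passes to projections and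
  preimages without counting dimensions.\<close>

definition flag_step :: "'a::real_vector set => 'a set => bool" where "flag_step S S' \<longleftrightarrow> S \<subseteq> S' \<and>
  (\<forall>x\<in>S'. \<forall>y\<in>S'. \<exists>a b. (a, b) \<noteq> (0, 0) \<and> a *\<^sub>R x + b *\<^sub>R y \<in> S)"

text \<open>In the first member of the flag that meets \<open>P\<close> nontrivially, any two
  vectors of \<open>P\<close> are linearly dependent, since a suitable combination falls into the
  preceding member. This applies to \<open>v\<close> and \<open>R v\<close>, and the eigenvalue is
  real.\<close>

lemma triangular_eigenvector:
 fixes S :: "nat => 'a::real_vector set"
 assumes S: "S 0 = {0}" "\<And>j. j < N ==> flag_step (S j) (S (Suc j))"
  and R: "\<And>j x. j \<le> N ==> x \<in> S j ==> R x \<in> S j"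
  and P: "subspace P" "\<And>x. x \<in> P ==> R x \<in> P" and x: "x \<in> P" "x \<in> S N" "x \<noteq> 0"
 shows "\<exists>v\<in>P. v \<noteq> 0 \<and> (\<exists>\<mu>. R v = \<mu> *\<^sub>R v)"
proof -
 define j where "j = (LEAST j. \<exists>v\<in>P. v \<in> S j \<and> v \<noteq> 0)"
 have ex: "\<exists>v\<in>P. v \<in> S j \<and> v \<noteq> 0" unfolding j_def by (rule LeastI[of _ N]) (use x in blast)
 have least: "k < j ==> v \<in> P ==> v \<in> S k ==> v = 0" for k v unfolding j_def using not_less_Least by blast
 have jN: "j \<le> N" unfolding j_def by (rule Least_le) (use x in blast)
 obtain v where v: "v \<in> P" "v \<in> S j" "v \<noteq> 0" using ex by blast
 have "j \<noteq> 0" using v S(1) by (cases j) auto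
 then obtain i where i: "j = Suc i" by (cases j) auto
 have "R v \<in> S j" using R[OF jN v(2)] .
 then obtain a b where ab: "(a, b) \<noteq> (0, 0)" "a *\<^sub>R R v + b *\<^sub>R v \<in> S i"
  using S(2)[of i] jN v(2) unfolding i flag_step_def by (metis Suc_le_lessD)
 have "a *\<^sub>R R v + b *\<^sub>R v \<in> P" using P v by (intro subspace_add subspace_scale) auto
 hence 0: "a *\<^sub>R R v + b *\<^sub>R v = 0" using least[of i] ab(2) i by simp
 hence "a \<noteq> 0" using ab(1) v(3) by auto
 have "a *\<^sub>R R v = (- b) *\<^sub>R v" using 0 by (simp add: add_eq_0_iff)
 hence "R v = (- b / a) *\<^sub>R v" using \<open>a \<noteq> 0\<close> by (metis divide_inverse_commute scaleR_scaleR scaleR_one left_inverse)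
 thus ?thesis using v by blast
qed

lemma triangular_basis_of_list:
 fixes xs :: "'a::real_vector list"
 assumes "\<forall>A\<in>Ops. \<forall>j<length xs. A (xs ! j) \<in> span (set (take (Suc j) xs))"
 shows "\<exists>bs. distinct bs \<and> independent (set bs) \<and> span (set bs) = span (set xs) \<and>
  (\<forall>A\<in>Ops. \<forall>j<length bs. A (bs ! j) \<in> span (set (take (Suc j) bs)))" using assms
proof (induction xs rule: rev_induct)
 case Nil
 thus ?case by (intro exI[of _ "[]"]) (simp add: independent_empty)
next
 case (snoc x xs)
 have "\<forall>A\<in>Ops. \<forall>j<length xs. A (xs ! j) \<in> span (set (take (Suc j) xs))"
 proof (intro ballI allI impI)
  fix A j assume "A \<in> Ops" "j < length xs"
  thus "A (xs ! j) \<in> span (set (take (Suc j) xs))"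
   using snoc.prems[rule_format, of A j] by (simp add: nth_append)
 qed
 from snoc.IH[OF this] obtain bs where bs: "distinct bs" "independent (set bs)" "span (set bs) = span (set xs)"
  "\<And>A j. A \<in> Ops ==> j < length bs ==> A (bs ! j) \<in> span (set (take (Suc j) bs))" by blast
 have Ax: "A x \<in> span (insert x (set xs))" if "A \<in> Ops" for A
  using snoc.prems[rule_format, OF that, of "length xs"] by simp
 have ins: "span (insert x (set bs)) = span (insert x (set xs))" using bs(3) by (simp add: span_insert)
 show ?case
 proof (cases "x \<in> span (set bs)")
  case True
  hence "span (insert x (set xs)) = span (set bs)" using ins span_redundant by metis
  thus ?thesis using bs by (intro exI[of _ bs]) auto
 next
  case False
  hence x: "x \<notin> set bs" using span_base by blast
  have "A ((bs @ [x]) ! j) \<in> span (set (take (Suc j) (bs @ [x])))"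
   if "A \<in> Ops" "j < length (bs @ [x])" for A j
  proof (cases "j < length bs")
   case True
   thus ?thesis using bs(4)[OF that(1) True] by (simp add: nth_append)
  next
   case False
   hence "j = length bs" using that by simp
   thus ?thesis using Ax[OF that(1)] ins by simp
  qed
  moreover have "independent (set (bs @ [x]))" using bs(2) False x by (simp add: independent_insert)
  ultimately show ?thesis using bs(1) x ins by (intro exI[of _ "bs @ [x]"]) auto
 qed
qed

text \<open>Sorting by rank places everything of smaller rank before \<open>x\<close>. Elements of
  equal rank may come in any order, because the image of \<open>x\<close> involves only
  \<open>x\<close> itself among them.\<close>

lemma triangular_basis_of_ranked:
 fixes P :: "(nat \<times> 'a::real_vector) set"
 assumes fin: "finite P"
  and A: "\<And>A r x. A \<in> Ops ==> (r, x) \<in> P ==> A x \<in> span (insert x {y. \<exists>r'<r. (r', y) \<in> P})"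
 shows "\<exists>bs. distinct bs \<and> independent (set bs) \<and> span (set bs) = span (snd ` P) \<and>
  (\<forall>A\<in>Ops. \<forall>j<length bs. A (bs ! j) \<in> span (set (take (Suc j) bs)))"
proof -
 obtain ps0 where "set ps0 = P" using finite_list[OF fin] by blast
 then obtain ps where ps: "set ps = P" "sorted (map fst ps)" by (metis set_sort sorted_sort_key)
 have "A (map snd ps ! j) \<in> span (set (take (Suc j) (map snd ps)))" if AO: "A \<in> Ops" and j: "j < length ps" for A j
 proof -
  obtain r x where rx: "ps ! j = (r, x)" by (cases "ps ! j")
  have "(r, x) \<in> P" using ps(1) j rx nth_mem by fastforce
  have "y \<in> set (take (Suc j) (map snd ps))" if lt: "r' < r" and mem: "(r', y) \<in> P" for r' y
  proof -
   obtain k where k: "k < length ps" "ps ! k = (r', y)" using mem ps(1) by (metis in_set_conv_nth)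
   have "k < j"
   proof (rule ccontr)
    assume "\<not> k < j"
    hence "map fst ps ! j \<le> map fst ps ! k" using ps(2) k j by (intro sorted_nth_mono) auto
    thus False using rx k j lt by simp
   qed
   hence "take (Suc j) (map snd ps) ! k = y" "k < length (take (Suc j) (map snd ps))" using k j by auto
   thus ?thesis by (metis nth_mem)
  qed
  moreover have "x \<in> set (take (Suc j) (map snd ps))" using rx j by (auto simp: take_Suc_conv_app_nth)
  ultimately have "insert x {y. \<exists>r'<r. (r', y) \<in> P} \<subseteq> set (take (Suc j) (map snd ps))" by auto
  from subsetD[OF span_mono[OF this] A[OF AO \<open>(r, x) \<in> P\<close>]] show ?thesis using rx j by simp
 qed
 hence "\<forall>A\<in>Ops. \<forall>j<length (map snd ps). A (map snd ps ! j) \<in> span (set (take (Suc j) (map snd ps)))" by simp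
 from triangular_basis_of_list[OF this] show ?thesis using ps(1) by auto
qed

lemma flag_step_span: "flag_step (span S) (span (insert b S))" unfolding flag_step_def
proof (intro conjI ballI)
 show "span S \<subseteq> span (insert b S)" by (rule span_mono) auto
 fix x y assume "x \<in> span (insert b S)" "y \<in> span (insert b S)"
 then obtain k l where kl: "x - k *\<^sub>R b \<in> span S" "y - l *\<^sub>R b \<in> span S" by (auto simp: span_breakdown_eq)
 show "\<exists>\<alpha> \<beta>. (\<alpha>, \<beta>) \<noteq> (0, 0) \<and> \<alpha> *\<^sub>R x + \<beta> *\<^sub>R y \<in> span S"
 proof (cases "k = 0")
  case True
  thus ?thesis using kl by (intro exI[of _ 1] exI[of _ 0]) auto
 next
  case False
  have "(- l) *\<^sub>R (x - k *\<^sub>R b) + k *\<^sub>R (y - l *\<^sub>R b) \<in> span S" using kl by (intro span_add span_scale)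
  also have "(- l) *\<^sub>R (x - k *\<^sub>R b) + k *\<^sub>R (y - l *\<^sub>R b) = (- l) *\<^sub>R x + k *\<^sub>R y"
   by (simp add: algebra_simps)
  finally show ?thesis using False by (intro exI[of _ "- l"] exI[of _ k]) auto
 qed
qed

text \<open>Serves to cut flags out of the Lie algebra: the coordinate \<open>v\<close> is kept and
  the coordinate \<open>u\<close> is projected away.\<close>

lemma flag_step_preimage:
 assumes "flag_step S S'"
  and e: "\<And>a b v u v' u'. e (a *\<^sub>R v + b *\<^sub>R v') (a *\<^sub>R u + b *\<^sub>R u') = a *\<^sub>R e v u + b *\<^sub>R e v' u'"
 shows "flag_step {v. \<exists>u. e v u \<in> S} {v. \<exists>u. e v u \<in> S'}" unfolding flag_step_def
proof (intro conjI ballI)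
 show "{v. \<exists>u. e v u \<in> S} \<subseteq> {v. \<exists>u. e v u \<in> S'}" using assms(1) by (auto simp: flag_step_def)
 fix v v' assume "v \<in> {v. \<exists>u. e v u \<in> S'}" "v' \<in> {v. \<exists>u. e v u \<in> S'}"
 then obtain u u' where u: "e v u \<in> S'" "e v' u' \<in> S'" by blast
 then obtain a b where ab: "(a, b) \<noteq> (0, 0)" "a *\<^sub>R e v u + b *\<^sub>R e v' u' \<in> S"
  using assms(1) unfolding flag_step_def by meson
 have "e (a *\<^sub>R v + b *\<^sub>R v') (a *\<^sub>R u + b *\<^sub>R u') \<in> S" using ab(2) by (simp only: e)
 thus "\<exists>a b. (a, b) \<noteq> (0, 0) \<and> a *\<^sub>R v + b *\<^sub>R v' \<in> {v. \<exists>u. e v u \<in> S}" using ab(1) by blast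
qed

lemma derivative_mem_subspace:
 fixes f :: "real => 'a::euclidean_space"
 assumes W: "subspace W" and f: "\<And>t. f t \<in> W" and d: "(f has_vector_derivative D) (at t)"
 shows "D \<in> W"
proof -
 have sp: "span W = W" using W by (simp add: span_eq_iff)
 obtain y z where yz: "y \<in> span W" "\<And>w. w \<in> span W ==> orthogonal z w" "D = y + z"
  using orthogonal_subspace_decomp_exists[of W D] by metis
 have "((\<lambda>t. z \<bullet> f t) has_vector_derivative z \<bullet> D) (at t)"
  by (rule bounded_linear_has_vector_derivative[OF bounded_linear_inner_right d])
 moreover have "(\<lambda>t. z \<bullet> f t) = (\<lambda>_. 0)" using yz(2) f sp by (auto simp: orthogonal_def)
 ultimately have "((\<lambda>_::real. 0::real) has_vector_derivative z \<bullet> D) (at t)" by simp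
 hence "z \<bullet> D = 0" using vector_derivative_unique_at[OF _ has_vector_derivative_const] by blast
 hence "z \<bullet> z = 0" using yz(2)[OF yz(1)] by (simp add: yz(3) inner_add_right orthogonal_def)
 thus ?thesis using yz sp by simp
qed

text \<open>Each member of the flag is spanned by its predecessor and one vector \<open>y\<close>,
  which is 0 where the flag repeats itself. The list of these vectors is triangular for all matrices
  at once, and its redundant members are dropped.\<close>

lemma flag_basis:
 fixes F :: "nat => (real^'n::finite) set"
 assumes F: "F 0 = {0}" "F N = UNIV" "\<And>j. j < N ==> flag_step (F j) (F (Suc j))" "\<And>j. subspace (F j)"
  and T: "\<And>M j x. M \<in> \<T> ==> j \<le> N ==> x \<in> F j ==> M *v x \<in> F j"
 shows "\<exists>bs. length bs = CARD('n) \<and> distinct bs \<and> independent (set bs) \<and> span (set bs) = UNIV \<and>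
  (\<forall>M\<in>\<T>. \<forall>j<length bs. M *v (bs ! j) \<in> span (set (take (Suc j) bs)))"
proof -
 have "\<exists>y\<in>F (Suc j). F (Suc j) \<subseteq> span (insert y (F j))" if j: "j < N" for j
 proof (cases "F (Suc j) \<subseteq> F j")
  case True
  thus ?thesis using subspace_0[OF F(4)] span_superset by (intro bexI[of _ 0]) auto
 next
  case False
  then obtain y where y: "y \<in> F (Suc j)" "y \<notin> F j" by blast
  have "x \<in> span (insert y (F j))" if x: "x \<in> F (Suc j)" for x
  proof -
   obtain a b where ab: "(a, b) \<noteq> (0, 0)" "a *\<^sub>R x + b *\<^sub>R y \<in> F j"
    using F(3)[OF j] x y(1) unfolding flag_step_def by meson
   have "a \<noteq> 0"
   proof
    assume "a = 0"
    hence "b \<noteq> 0" "b *\<^sub>R y \<in> F j" using ab by auto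
    hence "inverse b *\<^sub>R b *\<^sub>R y \<in> F j" using subspace_scale[OF F(4)] by blast
    thus False using y(2) \<open>b \<noteq> 0\<close> by simp
   qed
   have "inverse a *\<^sub>R ((a *\<^sub>R x + b *\<^sub>R y) - b *\<^sub>R y) \<in> span (insert y (F j))"
    using ab(2) by (intro span_scale span_diff span_base) (auto intro: span_base)
   thus ?thesis using \<open>a \<noteq> 0\<close> by simp
  qed
  thus ?thesis using y by blast
 qed
 then obtain y where y: "\<And>j. j < N ==> y j \<in> F (Suc j)" "\<And>j. j < N ==> F (Suc j) \<subseteq> span (insert (y j) (F j))"
  by metis
 define xs where "xs = map y [0..<N]"
 have len: "length xs = N" by (simp add: xs_def)
 have sp: "span (set (take j xs)) = F j" if "j \<le> N" for j using that
 proof (induction j)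
  case 0
  thus ?case using F(1) by simp
 next
  case (Suc j)
  have IH: "span (set (take j xs)) = F j" using Suc by simp
  have t: "set (take (Suc j) xs) = insert (y j) (set (take j xs))"
   using Suc.prems by (simp add: take_Suc_conv_app_nth len) (simp add: xs_def)
  have "insert (y j) (F j) \<subseteq> span (insert (y j) (set (take j xs)))"
   using IH span_mono[of "set (take j xs)" "insert (y j) (set (take j xs))"] by (auto intro: span_base)
  hence "span (insert (y j) (F j)) \<subseteq> span (insert (y j) (set (take j xs)))" by (simp add: span_minimal)
  hence "F (Suc j) \<subseteq> span (set (take (Suc j) xs))" using y(2)[of j] Suc.prems t by auto
  moreover have "F j \<subseteq> F (Suc j)" using F(3)[of j] Suc.prems by (simp add: flag_step_def)
  hence "set (take (Suc j) xs) \<subseteq> F (Suc j)"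
   using y(1)[of j] Suc.prems IH t span_superset[of "set (take j xs)"] by auto
  hence "span (set (take (Suc j) xs)) \<subseteq> F (Suc j)" by (intro span_minimal F(4))
  ultimately show ?case by blast
 qed
 have "\<forall>A\<in>(*v) ` \<T>. \<forall>j<length xs. A (xs ! j) \<in> span (set (take (Suc j) xs))"
 proof (intro ballI allI impI)
  fix A j assume A: "A \<in> (*v) ` \<T>" and j: "j < length xs"
  hence jN: "Suc j \<le> N" by (simp add: len)
  have "xs ! j \<in> F (Suc j)" using y(1)[of j] j by (simp add: xs_def)
  thus "A (xs ! j) \<in> span (set (take (Suc j) xs))" using A T[OF _ jN] sp[OF jN] by auto
 qed
 from triangular_basis_of_list[OF this] obtain bs where bs: "distinct bs" "independent (set bs)"
  "span (set bs) = span (set xs)" "\<forall>A\<in>(*v) ` \<T>. \<forall>j<length bs. A (bs ! j) \<in> span (set (take (Suc j) bs))"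
  by (elim exE conjE)
 have "span (set bs) = UNIV" using bs(3) sp[of N] F(2) len by simp
 moreover from this have "card (set bs) = CARD('n)" using dim_eq_card[of "set bs" UNIV] bs(2) by simp
 ultimately show ?thesis using bs by (intro exI[of _ bs]) (auto simp: distinct_card)
qed

text \<open>Upper triangular for the order that \<open>rk\<close> puts on the index type, which need
  not carry one of its own.\<close>

definition upper :: "('n => nat) => real^'n^'n => bool"
 where "upper rk M \<longleftrightarrow> (\<forall>i j. rk j < rk i \<longrightarrow> M $ i $ j = 0)"

text \<open>The columns of \<open>C\<close> are the basis vectors, arranged along \<open>rk\<close>;
  \<open>Ci\<close> expresses vectors in this basis, and members of the flag have vanishing
  coordinates of higher rank.\<close>

lemma flag_basis_matrix:
 assumes len: "length bs = CARD('n::finite)" and d: "distinct bs"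
  and ind: "independent (set bs)" and sp: "span (set bs) = (UNIV :: (real^'n) set)"
  and T: "\<forall>M\<in>\<T>. \<forall>j<length bs. M *v (bs ! j) \<in> span (set (take (Suc j) bs))"
 shows "\<exists>(rk :: 'n => nat) C Ci. inj rk \<and> C ** Ci = mat 1 \<and> Ci ** C = mat 1 \<and> (\<forall>M\<in>\<T>. upper rk (Ci ** M ** C))"
proof -
 obtain rk :: "'n => nat" where rk: "bij_betw rk UNIV {0..<CARD('n)}"
  using ex_bij_betw_finite_nat[of "UNIV :: 'n set"] by auto
 have inj: "inj rk" and rk_lt: "rk i < CARD('n)" for i using rk by (auto simp: bij_betw_def)
 define C :: "real^'n^'n" where "C = (\<chi> i j. (bs ! rk j) $ i)"
 have col: "column j C = bs ! rk j" for j by (simp add: column_def C_def vec_eq_iff)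
 have "columns C = set bs"
 proof -
  have "columns C = (\<lambda>k. bs ! k) ` (rk ` UNIV)" by (auto simp: columns_def col)
  also have "\<dots> = set bs" using rk len by (auto simp: bij_betw_def set_conv_nth)
  finally show ?thesis .
 qed
 then obtain Ci where Ci: "C ** Ci = mat 1" using matrix_right_invertible_span_columns[of C] sp
  by (auto simp: span_vec_eq)
 hence Ci': "Ci ** C = mat 1" by (simp add: matrix_left_right_inverse)
 have vanish: "(Ci *v v) $ i = 0" if v: "v \<in> span (set (take (Suc m) bs))" and i: "m < rk i" for v m i using v
 proof (induction rule: span_induct)
  show "subspace {v. (Ci *v v) $ i = 0}"
   by (auto simp: subspace_def matrix_vector_right_distrib matrix_vector_mult_scaleR)
  fix x assume "x \<in> set (take (Suc m) bs)"
  then obtain k where k: "k < length bs" "k < Suc m" "x = bs ! k" by (auto simp: in_set_conv_nth)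
  then obtain j where j: "rk j = k" using rk len by (metis bij_betw_imp_surj_on imageE atLeastLessThan_iff zero_le)
  have "x = C *v axis j 1" using k(3) j col[of j] by (simp add: matrix_vector_mul_component matrix_vector_mult_basis)
  hence "Ci *v x = axis j 1" by (simp add: matrix_vector_mul_assoc Ci')
  moreover have "i \<noteq> j" using j k(2) i by auto
  ultimately show "(Ci *v x) $ i = 0" by (simp add: axis_def)
 qed
 have "upper rk (Ci ** M ** C)" if M: "M \<in> \<T>" for M unfolding upper_def
 proof (intro allI impI)
  fix i j assume ij: "rk j < rk i"
  have "(Ci ** M ** C) $ i $ j = ((Ci ** M ** C) *v axis j 1) $ i"
   by (simp add: matrix_vector_mult_basis column_def)
  also have "(Ci ** M ** C) *v axis j 1 = Ci *v (M *v (C *v axis j 1))"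
   by (simp only: matrix_vector_mul_assoc matrix_mul_assoc)
  also have "C *v axis j 1 = bs ! rk j" by (simp add: matrix_vector_mult_basis col)
  also have "(Ci *v (M *v (bs ! rk j))) $ i = 0" by (rule vanish[OF _ ij]) (use T M rk_lt[of j] len in auto)
  finally show "(Ci ** M ** C) $ i $ j = 0" .
 qed
 thus ?thesis using inj Ci Ci' by blast
qed

text \<open>The candidate for the Lie algebra of \<open>B\<close>, up to the choice of a basis: all
  of the part of \<open>V\<close> and \<open>U\<close>, and those \<open>T\<close> that are
  triangular in the basis formed by the columns of \<open>C\<close>.\<close>

definition borel :: "('n => nat) => real^'n^'n => real^'n^'n => ('n::finite, 'r::finite) lie_matrix set"
 where "borel rk C Ci = {iota T 0 V U |T V U. U \<in> sym_real \<and> upper rk (Ci ** T ** C)}"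

lemma lie_bracket_iota:
 "lie_bracket (iota T K V U) (iota T' K' V' U') = iota (T ** T' - T' ** T) (K ** K' - K' ** K)
  (cmat T ** V' - V' ** K - (cmat T' ** V - V ** K'))
  (T ** U' + U' ** transpose T - (T' ** U + U ** transpose T') + 4 *\<^sub>R map_matrix Im (Q V V'))"
 by (simp add: lie_bracket_def)

text \<open>If \<open>V = v w\<^sup>t\<close> is an eigenvector of \<open>V \<mapsto> T V - V K\<close> to a real eigenvalue \<open>\<mu>\<close>, where \<open>w\<close> is
 an eigenvector of \<open>K\<^sup>t\<close> to \<open>i \<kappa>\<close>, then \<open>cnj v w\<^sup>t\<close> is one to \<open>\<mu> - 2 i \<kappa>\<close>, and so \<open>\<kappa> = 0\<close>.\<close>

lemma triangular_skew_zero: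
 fixes S :: "nat => (complex^'r::finite^'n::finite) set"
 assumes K: "K \<in> skew_hermitian" and S: "S 0 = {0}" "S N = UNIV" "\<And>j. j < N ==> flag_step (S j) (S (Suc j))"
  and R: "\<And>j V. j \<le> N ==> V \<in> S j ==> cmat T ** V - V ** K \<in> S j"
 shows "K = 0"
proof (rule ccontr)
 assume "K \<noteq> 0"
 \<comment> \<open>Multiplication by the imaginary unit makes the skew-Hermitian matrix Hermitian,
   which provides a nonzero real eigenvalue \<open>c\<close>.\<close>
 define A where "A = \<i> *\<^sub>C transpose K"
 have Kh: "transpose (map_matrix cnj K) = - K" using K by (simp add: skew_hermitian_def adjoint_matrix_def)
 hence "map_matrix cnj K = - transpose K" by (metis tr_neg transpose_transpose)
 hence "adj A = A"
  by (simp add: A_def adjoint_matrix_def map_cnj_scaleC map_cnj_transpose transpose_scaleC scaleC.minus_left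
    scaleC.minus_right tr_neg)
 moreover have "A \<noteq> 0"
 proof
  assume "A = 0"
  hence "(- \<i>) *\<^sub>C A = 0" by (simp add: scaleC.zero_right)
  hence "transpose K = 0" by (simp add: A_def scaleC_scaleC)
  thus False using \<open>K \<noteq> 0\<close> by (metis tr_zero transpose_transpose)
 qed
 ultimately obtain c w where c: "c \<noteq> 0" and w: "w \<noteq> 0" "A *v w = complex_of_real c *\<^sub>C w"
  using hermitian_eigenvector by blast
 define \<kappa> where "\<kappa> = - c"
 have Kw: "transpose K *v w = (\<i> * complex_of_real \<kappa>) *\<^sub>C w"
 proof -
  have "(- \<i>) *\<^sub>C (A *v w) = transpose K *v w" by (simp add: A_def scaleC_scaleC flip: mv_scaleC_left)
  thus ?thesis using w(2) by (simp add: scaleC_scaleC \<kappa>_def)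
 qed
 \<comment> \<open>The matrices \<open>v w^t\<close> form an invariant subspace, on which the
   operator becomes the map \<open>L\<close> on vectors.\<close>
 define ot where "ot v = (\<chi> i k. v $ i * w $ k)" for v :: "complex^'n"
 have ot_lin: "ot (x + y) = ot x + ot y" "ot (c *\<^sub>C x) = c *\<^sub>C ot x" "ot (r *\<^sub>R x) = r *\<^sub>R ot x" for x y c r
  by (simp_all add: ot_def vec_eq_iff algebra_simps)
 obtain k where k: "w $ k \<noteq> 0" using w(1) by (auto simp: vec_eq_iff)
 have ot_inj: "x = y" if "ot x = ot y" for x y
 proof -
  have "x $ i = y $ i" for i using arg_cong[OF that, of "\<lambda>M. M $ i $ k"] k by (simp add: ot_def)
  thus ?thesis by (simp add: vec_eq_iff)
 qed
 define L where "L v = cmat T *v v - (\<i> * complex_of_real \<kappa>) *\<^sub>C v" for v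
 have Rot: "cmat T ** ot v - ot v ** K = ot (L v)" for v
 proof -
  have 1: "(cmat T ** ot v) $ i $ l = (cmat T *v v) $ i * w $ l" for i l
   by (simp add: ot_def matrix_matrix_mult_def matrix_vector_mult_def sum_distrib_left mult_ac)
  have 2: "(ot v ** K) $ i $ l = v $ i * (transpose K *v w) $ l" for i l
   by (simp add: ot_def matrix_matrix_mult_def matrix_vector_mult_def transpose_def sum_distrib_left mult_ac)
  show ?thesis by (simp add: vec_eq_iff 1 2 Kw) (simp add: ot_def L_def algebra_simps)
 qed
 have L_lin: "L (r *\<^sub>R x) = r *\<^sub>R L x" "L (z *\<^sub>C x) = z *\<^sub>C L x" for r x z
  by (simp_all add: L_def mv.scaleR_right scaleC.scaleR_right scaleR_diff_right scaleC.diff_right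
    scaleC_scaleC mult.commute) (simp add: matrix_vector_mult_def vec_eq_iff sum_distrib_left mult_ac)
 have sub1: "subspace (range ot)"
  using ot_lin by (auto simp: subspace_def image_iff) (metis scaleR_zero_left, metis, metis)
 have ne: "ot (axis i 1) \<noteq> 0" for i
 proof
  assume "ot (axis i 1) = 0"
  hence "ot (axis i 1) = ot 0" using ot_lin(3)[of 0 0] by simp
  thus False using ot_inj by fastforce
 qed
 have "\<exists>V\<in>range ot. V \<noteq> 0 \<and> (\<exists>\<mu>. cmat T ** V - V ** K = \<mu> *\<^sub>R V)"
 proof (rule triangular_eigenvector[where S = S and N = N and x = "ot (axis undefined 1)"])
  show "cmat T ** V - V ** K \<in> range ot" if "V \<in> range ot" for V using that Rot by auto
 qed (use S R sub1 ne in auto)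
 then obtain V \<mu> where V: "V \<in> range ot" "V \<noteq> 0" "cmat T ** V - V ** K = \<mu> *\<^sub>R V" by blast
 from V(1) obtain v where v: "V = ot v" by blast
 have v0: "v \<noteq> 0" using V(2) v ot_lin(3)[of 0 0] by auto
 have Lv: "L v = \<mu> *\<^sub>R v" using V(3) unfolding v Rot by (intro ot_inj) (simp add: ot_lin)
 define v' where "v' = cnjv v"
 have v'0: "v' \<noteq> 0" using v0 by (auto simp: v'_def vec_eq_iff)
 have Tv: "cmat T *v v = (complex_of_real \<mu> + \<i> * complex_of_real \<kappa>) *\<^sub>C v"
  using Lv by (simp add: L_def scaleC_add_left scaleC_of_real algebra_simps)
 have "cmat T *v v' = cnjv (cmat T *v v)" using cnjv_mult[of "cmat T" v] by (simp add: v'_def)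
 also have "\<dots> = (complex_of_real \<mu> - \<i> * complex_of_real \<kappa>) *\<^sub>C v'" by (simp add: Tv v'_def vec_eq_iff)
 finally have Lv': "L v' = (complex_of_real \<mu> - 2 * \<i> * complex_of_real \<kappa>) *\<^sub>C v'"
  by (simp add: L_def scaleC.diff_left[symmetric] mult.assoc)
 \<comment> \<open>On this complex line the operator is multiplication by the number
   \<open>\<mu> - 2 i \<kappa>\<close>. Triangularity supplies a real eigenvalue here as well, so
   that number is real.\<close>
 let ?P = "range (\<lambda>z. ot (z *\<^sub>C v'))"
 have sub2: "subspace ?P"
 proof (rule subspaceI)
  show "0 \<in> ?P" using ot_lin(3)[of 0 0] by (intro image_eqI[of _ _ 0]) (simp_all add: scaleC.zero_left)
  fix x y assume x: "x \<in> ?P"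
  then obtain a where a: "x = ot (a *\<^sub>C v')" by blast
  show "r *\<^sub>R x \<in> ?P" for r
   by (intro image_eqI[of _ _ "of_real r * a"]) (simp_all add: a ot_lin flip: scaleC_scaleC scaleC_of_real)
  assume "y \<in> ?P"
  then obtain b where b: "y = ot (b *\<^sub>C v')" by blast
  show "x + y \<in> ?P" by (intro image_eqI[of _ _ "a + b"]) (simp_all add: a b scaleC_add_left ot_lin(1))
 qed
 have Rz: "cmat T ** ot (z *\<^sub>C v') - ot (z *\<^sub>C v') ** K = ot (((complex_of_real \<mu> - 2 * \<i> * complex_of_real \<kappa>) * z) *\<^sub>C v')" for z
  by (simp add: Rot L_lin Lv' scaleC_scaleC mult.commute)
 have P2: "cmat T ** x - x ** K \<in> ?P" if x: "x \<in> ?P" for x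
 proof -
  from x obtain z where "x = ot (z *\<^sub>C v')" by blast
  thus ?thesis by (simp add: Rz)
 qed
 have "ot (1 *\<^sub>C v') \<noteq> 0" using v'0 ot_inj[of v' 0] ot_lin(3)[of 0 0] by auto
 hence "\<exists>V\<in>?P. V \<noteq> 0 \<and> (\<exists>\<mu>. cmat T ** V - V ** K = \<mu> *\<^sub>R V)"
  by (intro triangular_eigenvector[where S = S and N = N and x = "ot (1 *\<^sub>C v')"] P2)
   (use S R sub2 in \<open>auto simp del: scaleC_one\<close>)
 then obtain V' \<mu>' where V': "V' \<in> ?P" "V' \<noteq> 0" "cmat T ** V' - V' ** K = \<mu>' *\<^sub>R V'" by blast
 from V'(1) obtain z where z: "V' = ot (z *\<^sub>C v')" by blast
 have z0: "z \<noteq> 0" using V'(2) z ot_lin(3)[of 0 0] by (auto simp: scaleC.zero_left)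
 have "ot (((complex_of_real \<mu> - 2 * \<i> * complex_of_real \<kappa>) * z) *\<^sub>C v') = ot ((complex_of_real \<mu>' * z) *\<^sub>C v')"
  using V'(3) unfolding z Rz by (simp add: ot_lin flip: scaleC_of_real scaleC_scaleC)
 hence "((complex_of_real \<mu> - 2 * \<i> * complex_of_real \<kappa>) * z) *\<^sub>C v' = (complex_of_real \<mu>' * z) *\<^sub>C v'"
  by (rule ot_inj)
 moreover obtain i where "v' $ i \<noteq> 0" using v'0 by (auto simp: vec_eq_iff)
 ultimately have "(complex_of_real \<mu> - 2 * \<i> * complex_of_real \<kappa>) * z = complex_of_real \<mu>' * z"
  by (auto simp: vec_eq_iff)
 hence "complex_of_real \<mu> - 2 * \<i> * complex_of_real \<kappa> = complex_of_real \<mu>'" using z0 by simp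
 hence "\<kappa> = 0" by (simp add: complex_eq_iff)
 thus False using c by (simp add: \<kappa>_def)
qed

context siegel_cover
begin

text \<open>Differentiating the adjoint action along one-parameter subgroups shows that the brackets
  with \<open>\<h>\<close> preserve a full flag of \<open>gtilde\<close>. The flag induced on the
  matrices \<open>V\<close> forces \<open>K = 0\<close> and then restricts to a flag of the real
  vectors that is preserved by all the parts \<open>T\<close>.\<close>

lemma triangular_subset_borel:
 assumes "triangular_subgroup G T p B"
 shows "\<exists>\<h> rk C Ci. lie_subalgebra \<h> \<and> B = generate G (Exp ` \<h>) \<and> inj rk \<and>
  C ** Ci = mat 1 \<and> Ci ** C = mat 1 \<and> \<h> \<subseteq> borel rk C Ci"
proof -
 obtain \<h> bs where h: "lie_subalgebra \<h>" "B = generate G (Exp ` \<h>)"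
  and bs: "span (set bs) = (gtilde :: ('n, 'r) lie_matrix set)"
   "\<And>b j. b \<in> B ==> j < length bs ==> Ad G T p b (bs ! j) \<in> span (set (take (Suc j) bs))"
  using assms unfolding triangular_subgroup_def connected_lie_subgroup_def by metis
 have hg: "X \<in> gtilde" if "X \<in> \<h>" for X using h(1) that by (auto simp: lie_subalgebra_def)
 have bsg: "bs ! j \<in> gtilde" if "j < length bs" for j using bs(1) that by (metis nth_mem span_base)
 have br: "lie_bracket X (bs ! j) \<in> span (set (take (Suc j) bs))" if X: "X \<in> \<h>" and j: "j < length bs" for X j
 proof -
  have "app (exp (t *\<^sub>R ad X)) (bs ! j) \<in> span (set (take (Suc j) bs))" for t
  proof -
   have tX: "t *\<^sub>R X \<in> \<h>" using h(1) X by (auto simp: lie_subalgebra_def subspace_scale)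
   hence "Exp (t *\<^sub>R X) \<in> B" unfolding h(2) by (intro generate.incl) auto
   from bs(2)[OF this j] show ?thesis by (simp add: Ad_lie_exp[OF hg[OF tX] bsg[OF j]] ad_scaleR)
  qed
  from derivative_mem_subspace[OF subspace_span this exp_app_derivative[of "ad X" _ 0]]
  show ?thesis by (simp add: app_ad)
 qed
 define W where "W j = span (set (take j bs))" for j
 define N where "N = length bs"
 have W0: "W 0 = {0}" by (simp add: W_def)
 have WN: "W N = gtilde" by (simp add: W_def N_def bs(1))
 have Wstep: "flag_step (W j) (W (Suc j))" if "j < N" for j
  using that by (simp add: W_def N_def take_Suc_conv_app_nth flag_step_span)
 have Wbr: "lie_bracket X Y \<in> W j" if X: "X \<in> \<h>" and j: "j \<le> N" and Y: "Y \<in> W j" for X Y j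
  using Y unfolding W_def
 proof (induction rule: span_induct)
  show "subspace {Y. lie_bracket X Y \<in> span (set (take j bs))}"
   by (auto simp: subspace_def linear_0[OF linear_lie_bracket] linear_add[OF linear_lie_bracket]
     linear_scale[OF linear_lie_bracket] span_0 span_add span_scale)
  fix Y assume "Y \<in> set (take j bs)"
  then obtain i where i: "i < j" "i < length bs" "Y = bs ! i" by (auto simp: in_set_conv_nth)
  have "set (take (Suc i) bs) \<subseteq> set (take j bs)" using i(1) by (intro set_take_subset_set_take) auto
  thus "lie_bracket X Y \<in> span (set (take j bs))" using br[OF X i(2)] i(3) span_mono by blast
 qed
 \<comment> \<open>The elements with \<open>T = 0\<close> and \<open>K = 0\<close> are taken modulo
   \<open>U\<close>; on the remaining \<open>V\<close> an element of \<open>\<h>\<close> acts by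
   \<open>V \<mapsto> T V - V K\<close>.\<close>
 define S :: "nat => (complex^'r^'n) set" where "S j = {V. \<exists>U. iota 0 0 V U \<in> W j}" for j
 have i0: "iota 0 0 0 0 = (0 :: ('n, 'r) lie_matrix)" by (auto simp: iota_def vec_eq_iff split: sum.split)
 have S0: "S 0 = {0}" unfolding S_def W0 using i0 by (auto simp: iota_inject simp flip: i0)
 have SN: "S N = UNIV" unfolding S_def WN
  using subspace_0[OF subspace_skew_hermitian] subspace_0[OF subspace_sym_real] iota_gtilde by fast
 have Sstep: "flag_step (S j) (S (Suc j))" if "j < N" for j
  unfolding S_def by (rule flag_step_preimage[OF Wstep[OF that]]) (simp add: iota_add iota_scaleR)
 have Ssub: "subspace (S j)" for j
 proof (rule subspaceI)
  have sW: "subspace (W j)" by (simp add: W_def)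
  show "0 \<in> S j" using subspace_0[OF sW] i0 by (auto simp: S_def intro!: exI[of _ 0])
  fix V V' r assume "V \<in> S j"
  then obtain U where U: "iota 0 0 V U \<in> W j" by (auto simp: S_def)
  show "r *\<^sub>R V \<in> S j" using subspace_scale[OF sW U, of r] by (auto simp: S_def iota_scaleR)
  assume "V' \<in> S j"
  then obtain U' where U': "iota 0 0 V' U' \<in> W j" by (auto simp: S_def)
  show "V + V' \<in> S j" using subspace_add[OF sW U U'] by (auto simp: S_def iota_add)
 qed
 have SR: "cmat (iotaT X) ** V - V ** iotaK X \<in> S j" if X: "X \<in> \<h>" and j: "j \<le> N" and V: "V \<in> S j" for X V j
 proof -
  obtain U where U: "iota 0 0 V U \<in> W j" using V by (auto simp: S_def)
  have X': "X = iota (iotaT X) (iotaK X) (iotaV X) (iotaU X)" using hg[OF X] by (simp add: gtilde_iff)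
  have "lie_bracket X (iota 0 0 V U) \<in> W j" by (rule Wbr[OF X j U])
  thus ?thesis by (subst (asm) X') (auto simp: lie_bracket_iota S_def mm.zero_left mm.zero_right cm_zero)
 qed
 have K0: "iotaK X = 0" if X: "X \<in> \<h>" for X
  by (rule triangular_skew_zero[where S = S and N = N and T = "iotaT X"])
   (use hg[OF X] S0 SN Sstep SR[OF X] in \<open>auto simp: gtilde_iff\<close>)
 \<comment> \<open>A copy of the real vectors in a single column, the one with index
   \<open>undefined\<close>. Since \<open>K = 0\<close>, left multiplication by \<open>T\<close>
   preserves it.\<close>
 define cV :: "real^'n => complex^'r^'n" where "cV x = (\<chi> i k. if k = undefined then complex_of_real (x $ i) else 0)" for x
 have cV_lin: "cV (x + y) = cV x + cV y" "cV (r *\<^sub>R x) = r *\<^sub>R cV x" for x y r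
  by (auto simp: cV_def vec_eq_iff complex_eq_iff)
 have cV_mult: "cmat M ** cV x = cV (M *v x)" for M x
  by (auto simp: cV_def vec_eq_iff matrix_matrix_mult_def matrix_vector_mult_def)
 define F where "F j = {x. cV x \<in> S j}" for j
 have "\<exists>bs. length bs = CARD('n) \<and> distinct bs \<and> independent (set bs) \<and> span (set bs) = (UNIV :: (real^'n) set) \<and>
   (\<forall>M\<in>iotaT ` \<h>. \<forall>j<length bs. M *v (bs ! j) \<in> span (set (take (Suc j) bs)))"
 proof (rule flag_basis[where F = F and N = N])
  have "x = 0" if "cV x = 0" for x
  proof -
   have "x $ i = 0" for i using arg_cong[OF that, of "\<lambda>M. M $ i $ undefined"] by (simp add: cV_def)
   thus ?thesis by (simp add: vec_eq_iff)
  qed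
  moreover have "cV 0 = 0" using cV_lin(2)[of 0 0] by simp
  ultimately show "F 0 = {0}" by (auto simp: F_def S0)
  show "F N = UNIV" by (simp add: F_def SN)
  show "flag_step (F j) (F (Suc j))" if "j < N" for j
   unfolding F_def using flag_step_preimage[OF Sstep[OF that], of "\<lambda>x (_::real). cV x"] by (simp add: cV_lin)
  show "subspace (F j)" for j using Ssub[of j] \<open>cV 0 = 0\<close> by (auto simp: F_def subspace_def cV_lin)
  fix M j x assume "M \<in> iotaT ` \<h>" "j \<le> N" "x \<in> F j"
  thus "M *v x \<in> F j" using SR[of _ j "cV x"] K0 by (auto simp: F_def cV_mult mm.zero_right)
 qed
 then obtain bs' where bs': "length bs' = CARD('n)" "distinct bs'" "independent (set bs')" "span (set bs') = (UNIV :: (real^'n) set)"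
   "\<forall>M\<in>iotaT ` \<h>. \<forall>j<length bs'. M *v (bs' ! j) \<in> span (set (take (Suc j) bs'))" by (elim exE conjE)
 obtain rk :: "'n => nat" and C Ci where rk: "inj rk" "C ** Ci = mat 1" "Ci ** C = mat 1"
  "\<And>M. M \<in> iotaT ` \<h> ==> upper rk (Ci ** M ** C)" using flag_basis_matrix[OF bs'] by blast
 have "\<h> \<subseteq> borel rk C Ci"
 proof
  fix X assume X: "X \<in> \<h>"
  have "X = iota (iotaT X) 0 (iotaV X) (iotaU X)" "iotaU X \<in> sym_real"
   using hg[OF X] K0[OF X] by (auto simp: gtilde_iff)
  thus "X \<in> borel rk C Ci" using rk(4) X unfolding borel_def by blast
 qed
 thus ?thesis using h rk by blast
qed

end

section \<open>Maximal triangular subgroups\<close>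

lemma sum_UNIV_sum: "(\<Sum>x\<in>(UNIV :: ('a::finite + 'b::finite) set). f x) = (\<Sum>a\<in>UNIV. f (Inl a)) + (\<Sum>b\<in>UNIV. f (Inr b))"
 using sum.Plus[of "UNIV :: 'a set" "UNIV :: 'b set" f] by (simp add: o_def)

text \<open>Links the matrix commutator of \<open>lie_subalgebra\<close> with the bracket of the
  fields, for the elements without \<open>K\<close> that make up \<open>borel\<close>.\<close>

lemma iota_commutator:
 assumes "U \<in> sym_real" "U' \<in> sym_real"
 shows "iota T 0 V U ** iota T' 0 V' U' - iota T' 0 V' U' ** iota T 0 V U
  = lie_bracket (iota T 0 V U) (iota T' 0 V' U')"
proof -
 have U: "U $ i $ j = U $ j $ i" "U' $ i $ j = U' $ j $ i" for i j
  using assms by (auto simp: sym_real_def transpose_def vec_eq_iff)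
 have imQ: "4 * Im (Q V V' $ i $ j) = (\<Sum>k\<in>UNIV. Im (V $ i $ k) * Re (V' $ j $ k) - Re (V $ i $ k) * Im (V' $ j $ k)
   - Im (V' $ i $ k) * Re (V $ j $ k) + Re (V' $ i $ k) * Im (V $ j $ k))" for i j
  by (simp add: Q_def matrix_matrix_mult_def adjoint_matrix_def transpose_def sum.distrib[symmetric]
    algebra_simps)
 show ?thesis unfolding lie_bracket_iota
  by (auto simp: vec_eq_iff iota_def matrix_matrix_mult_def transpose_def sum_UNIV_sum imQ
    sum_subtractf sum.distrib U sum_negf mult.commute split: sum.split)
qed

section \<open>Generators of the Lie algebra adapted to an ordered basis\<close>

locale ordered_basis =
 fixes rk :: "'n::finite => nat" and C Ci :: "real^'n^'n"
 assumes rk: "inj rk" and C: "C ** Ci = mat 1" and Ci: "Ci ** C = mat 1"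
begin

lemma upper_mult: "upper rk M ==> upper rk N ==> upper rk (M ** N)" unfolding upper_def matrix_matrix_mult_def
proof (intro allI impI)
 fix i j assume M: "\<forall>i j. rk j < rk i \<longrightarrow> M $ i $ j = 0" and N: "\<forall>i j. rk j < rk i \<longrightarrow> N $ i $ j = 0"
  and ij: "rk j < rk i"
 have "M $ i $ k * N $ k $ j = 0" for k using M N ij by (cases "rk k < rk i") auto
 hence "(\<Sum>k\<in>UNIV. M $ i $ k * N $ k $ j) = 0" by (intro sum.neutral) blast
 thus "(\<chi> i j. \<Sum>k\<in>UNIV. M $ i $ k * N $ k $ j) $ i $ j = 0" by simp
qed

lemma upper_diff: "upper rk M ==> upper rk N ==> upper rk (M - N)" by (simp add: upper_def)

lemma Ci_C_cancel [simp]: "Ci ** (C ** A) = A" "C ** (Ci ** A) = A" by (simp_all add: matrix_mul_assoc C Ci)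

lemma upper_commutator:
 assumes "upper rk (Ci ** T ** C)" "upper rk (Ci ** T' ** C)"
 shows "upper rk (Ci ** (T ** T' - T' ** T) ** C)"
proof -
 have "Ci ** (T ** T' - T' ** T) ** C = (Ci ** T ** C) ** (Ci ** T' ** C) - (Ci ** T' ** C) ** (Ci ** T ** C)"
  by (simp add: mm.diff_left mm.diff_right matrix_mul_assoc[symmetric])
 thus ?thesis using assms by (simp add: upper_diff upper_mult)
qed

lemma borel_gtilde: "X \<in> borel rk C Ci ==> X \<in> gtilde"
 using subspace_0[OF subspace_skew_hermitian] by (auto simp: borel_def intro: iota_gtilde)

lemma lie_subalgebra_borel: "lie_subalgebra (borel rk C Ci :: ('n, 'r::finite) lie_matrix set)"
 unfolding lie_subalgebra_def
proof (intro conjI ballI subsetI)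
 show "subspace (borel rk C Ci :: ('n, 'r) lie_matrix set)"
 proof (rule subspaceI)
  have "iota 0 0 0 0 = (0 :: ('n, 'r) lie_matrix)" by (auto simp: iota_def vec_eq_iff split: sum.split)
  moreover have "iota 0 0 0 0 \<in> (borel rk C Ci :: ('n, 'r) lie_matrix set)"
   using subspace_0[OF subspace_sym_real] by (auto simp: borel_def iota_inject upper_def mm.zero_left mm.zero_right)
  ultimately show "(0 :: ('n, 'r) lie_matrix) \<in> borel rk C Ci" by simp
 qed (auto simp: borel_def iota_add iota_scaleR iota_inject upper_def mm.add_left mm.add_right
   mm.scaleR_left mm.scaleR_right intro: subspace_add[OF subspace_sym_real] subspace_scale[OF subspace_sym_real])
 show "X \<in> gtilde" if "X \<in> borel rk C Ci" for X :: "('n, 'r) lie_matrix" using borel_gtilde[OF that] .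
 fix X Y :: "('n, 'r) lie_matrix" assume XY: "X \<in> borel rk C Ci" "Y \<in> borel rk C Ci"
 then obtain T V U T' V' U' where X: "X = iota T 0 V U" "U \<in> sym_real" "upper rk (Ci ** T ** C)"
  and Y: "Y = iota T' 0 V' U'" "U' \<in> sym_real" "upper rk (Ci ** T' ** C)" by (auto simp: borel_def)
 have "lie_bracket X Y \<in> gtilde" using XY by (intro lie_bracket_gtilde borel_gtilde)
 hence "iotaU (lie_bracket X Y) \<in> sym_real" by (simp add: gtilde_iff)
 hence "lie_bracket X Y \<in> borel rk C Ci"
  using upper_commutator[OF X(3) Y(3)] unfolding borel_def X(1) Y(1) lie_bracket_iota
  by (auto simp: iota_inject mm.zero_left)
 thus "X ** Y - Y ** X \<in> borel rk C Ci" by (simp only: X(1) Y(1) iota_commutator[OF X(2) Y(2)])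
qed

definition unit_mat :: "'n => 'n => real^'n^'n" where "unit_mat i j = (\<chi> a b. if a = i \<and> b = j then 1 else 0)"

lemma unit_mat_sum: "M = (\<Sum>i\<in>UNIV. \<Sum>j\<in>UNIV. M $ i $ j *\<^sub>R unit_mat i j)"
proof -
 have "(\<Sum>i\<in>UNIV. \<Sum>j\<in>UNIV. M $ i $ j *\<^sub>R unit_mat i j) $ a $ b = M $ a $ b" for a b
 proof -
  have "(\<Sum>j\<in>UNIV. (M $ i $ j *\<^sub>R unit_mat i j) $ a $ b) = (if i = a then M $ a $ b else 0)" for i
   by (subst sum.mono_neutral_right[of UNIV "{b}"]) (auto simp: unit_mat_def)
  thus ?thesis by simp
 qed
 thus ?thesis by (simp add: vec_eq_iff)
qed

lemma mult_unit_mat: "M ** unit_mat i j = (\<Sum>k\<in>UNIV. M $ k $ i *\<^sub>R unit_mat k j)"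
proof -
 have "(M ** unit_mat i j) $ a $ b = (if b = j then M $ a $ i else 0)" for a b
  unfolding matrix_matrix_mult_def
  by (simp, subst sum.mono_neutral_right[of UNIV "{i}"]) (auto simp: unit_mat_def)
 moreover have "(\<Sum>k\<in>UNIV. M $ k $ i *\<^sub>R unit_mat k j) $ a $ b = (if b = j then M $ a $ i else 0)" for a b
  by (simp, subst sum.mono_neutral_right[of UNIV "{a}"]) (auto simp: unit_mat_def)
 ultimately show ?thesis by (simp add: vec_eq_iff)
qed

lemma unit_mat_mult: "unit_mat i j ** M = (\<Sum>k\<in>UNIV. M $ j $ k *\<^sub>R unit_mat i k)"
proof -
 have "(unit_mat i j ** M) $ a $ b = (if a = i then M $ j $ b else 0)" for a b
  unfolding matrix_matrix_mult_def
  by (simp, subst sum.mono_neutral_right[of UNIV "{j}"]) (auto simp: unit_mat_def)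
 moreover have "(\<Sum>k\<in>UNIV. M $ j $ k *\<^sub>R unit_mat i k) $ a $ b = (if a = i then M $ j $ b else 0)" for a b
  by (simp, subst sum.mono_neutral_right[of UNIV "{b}"]) (auto simp: unit_mat_def)
 ultimately show ?thesis by (simp add: vec_eq_iff)
qed

lemma transpose_unit_mat: "transpose (unit_mat i j) = unit_mat j i"
 by (auto simp: unit_mat_def transpose_def vec_eq_iff)

text \<open>The parts transform differently under the change of basis: \<open>U\<close> by
  congruence, \<open>V\<close> by multiplication from the left, \<open>T\<close> by conjugation.
  Hence the three different uses of \<open>C\<close>.\<close>

definition gU :: "'n => 'n => ('n, 'r::finite) lie_matrix"
 where "gU i j = iota 0 0 0 (C ** (unit_mat i j + unit_mat j i) ** transpose C)"
definition gV :: "'n => complex^'r => ('n, 'r::finite) lie_matrix"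
 where "gV i w = iota 0 0 (\<chi> a k. complex_of_real (C $ a $ i) * w $ k) 0"
definition gT :: "'n => 'n => ('n, 'r::finite) lie_matrix"
 where "gT i j = iota (C ** unit_mat i j ** Ci) 0 0 0"

lemma linear_iotas: "linear (\<lambda>U. iota 0 0 0 U :: ('n, 'r::finite) lie_matrix)"
 "linear (\<lambda>V. iota 0 0 V 0 :: ('n, 'r) lie_matrix)" "linear (\<lambda>T. iota T 0 0 0 :: ('n, 'r) lie_matrix)"
 "linear (\<lambda>K. iota 0 K 0 0 :: ('n, 'r) lie_matrix)" by (auto intro!: linearI simp: iota_add iota_scaleR)

lemma linear_conj: "linear (\<lambda>M :: real^'n^'n. C ** M ** A)"
 by (rule linearI) (simp_all add: mm.add_left mm.add_right mm.scaleR_left mm.scaleR_right)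

lemma iota_U_sum:
 assumes "U \<in> sym_real"
 shows "(iota 0 0 0 U :: ('n, 'r::finite) lie_matrix)
  = (\<Sum>i\<in>UNIV. \<Sum>j\<in>UNIV. ((Ci ** U ** transpose Ci) $ i $ j / 2) *\<^sub>R gU i j)"
proof -
 define S where "S = Ci ** U ** transpose Ci"
 have tS: "transpose S = S" using assms by (simp add: S_def matrix_transpose_mul sym_real_def matrix_mul_assoc)
 hence sym: "S $ i $ j = S $ j $ i" for i j by (metis transpose_def vec_lambda_beta)
 have "transpose Ci ** transpose C = mat 1" by (simp add: C flip: matrix_transpose_mul)
 hence U: "U = C ** S ** transpose C" by (simp add: S_def matrix_mul_assoc[symmetric])
 have "S = (\<Sum>i\<in>UNIV. \<Sum>j\<in>UNIV. (S $ i $ j / 2) *\<^sub>R (unit_mat i j + unit_mat j i))"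
 proof -
  have "(\<Sum>i\<in>UNIV. \<Sum>j\<in>UNIV. (S $ i $ j / 2) *\<^sub>R unit_mat j i) = (\<Sum>j\<in>UNIV. \<Sum>i\<in>UNIV. (S $ j $ i / 2) *\<^sub>R unit_mat j i)"
   by (subst sum.swap) (simp add: sym)
  hence "(\<Sum>i\<in>UNIV. \<Sum>j\<in>UNIV. (S $ i $ j / 2) *\<^sub>R (unit_mat i j + unit_mat j i))
    = (\<Sum>i\<in>UNIV. \<Sum>j\<in>UNIV. (S $ i $ j / 2) *\<^sub>R unit_mat i j) + (\<Sum>i\<in>UNIV. \<Sum>j\<in>UNIV. (S $ i $ j / 2) *\<^sub>R unit_mat i j)"
   by (simp add: scaleR_add_right sum.distrib)
  also have "\<dots> = (\<Sum>i\<in>UNIV. \<Sum>j\<in>UNIV. S $ i $ j *\<^sub>R unit_mat i j)"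
   by (simp add: sum.distrib[symmetric] flip: scaleR_left_distrib)
  finally show ?thesis using unit_mat_sum[of S] by simp
 qed
 from arg_cong[OF this, of "\<lambda>M. C ** M ** transpose C"]
 have "U = (\<Sum>i\<in>UNIV. \<Sum>j\<in>UNIV. (S $ i $ j / 2) *\<^sub>R (C ** (unit_mat i j + unit_mat j i) ** transpose C))"
  by (simp only: U[symmetric] linear_sum[OF linear_conj] linear_scale[OF linear_conj])
 from arg_cong[OF this, of "\<lambda>U. iota 0 0 0 U :: ('n, 'r) lie_matrix"]
 show ?thesis unfolding S_def[symmetric]
  by (simp only: gU_def linear_sum[OF linear_iotas(1)] linear_scale[OF linear_iotas(1)])
qed

lemma iota_V_sum:
 fixes V :: "complex^'r::finite^'n"
 shows "(iota 0 0 V 0 :: ('n, 'r) lie_matrix) = (\<Sum>i\<in>UNIV. gV i ((cmat Ci ** V) $ i))"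
proof -
 have "V = cmat C ** (cmat Ci ** V)" by (simp add: matrix_mul_assoc C cmat_mult[symmetric])
   (simp add: matrix_matrix_mult_def mat_def vec_eq_iff if_distrib if_distribR cong: if_cong)
 hence "V = (\<Sum>i\<in>UNIV. (\<chi> a k. complex_of_real (C $ a $ i) * (cmat Ci ** V) $ i $ k))"
  by (subst (asm) matrix_matrix_mult_def) (simp add: vec_eq_iff)
 from arg_cong[OF this, of "\<lambda>V. iota 0 0 V 0 :: ('n, 'r) lie_matrix"] show ?thesis
  by (simp only: gV_def linear_sum[OF linear_iotas(2)])
qed

lemma iota_T_sum:
 "(iota T 0 0 0 :: ('n, 'r::finite) lie_matrix) = (\<Sum>i\<in>UNIV. \<Sum>j\<in>UNIV. (Ci ** T ** C) $ i $ j *\<^sub>R gT i j)"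
proof -
 have "T = C ** (Ci ** T ** C) ** Ci" by (simp add: matrix_mul_assoc C) (simp add: matrix_mul_assoc[symmetric] C)
 also have "\<dots> = (\<Sum>i\<in>UNIV. \<Sum>j\<in>UNIV. (Ci ** T ** C) $ i $ j *\<^sub>R (C ** unit_mat i j ** Ci))"
  using arg_cong[OF unit_mat_sum[of "Ci ** T ** C"], of "\<lambda>M. C ** M ** Ci"]
  by (simp only: linear_sum[OF linear_conj] linear_scale[OF linear_conj])
 finally have "T = (\<Sum>i\<in>UNIV. \<Sum>j\<in>UNIV. (Ci ** T ** C) $ i $ j *\<^sub>R (C ** unit_mat i j ** Ci))" .
 from arg_cong[OF this, of "\<lambda>T. iota T 0 0 0 :: ('n, 'r) lie_matrix"] show ?thesis
  by (simp only: gT_def linear_sum[OF linear_iotas(3)] linear_scale[OF linear_iotas(3)])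
qed

end

lemma Im_matrix_zero: "map_matrix Im 0 = 0" by (simp add: vec_eq_iff)

context ordered_basis
begin

definition rk_bound :: nat where "rk_bound = Suc (Max (range rk))"

lemma rk_less: "rk i < rk_bound" by (simp add: rk_bound_def le_imp_less_Suc)

definition skew_basis :: "(complex^'r::finite^'r) set"
 where "skew_basis = (SOME B. B \<subseteq> skew_hermitian \<and> independent B \<and> skew_hermitian \<subseteq> span B)"

lemma skew_basis: "skew_basis \<subseteq> (skew_hermitian :: (complex^'r::finite^'r) set)"
 "independent (skew_basis :: (complex^'r^'r) set)" "skew_hermitian \<subseteq> span (skew_basis :: (complex^'r^'r) set)"
proof -
 obtain B where "B \<subseteq> skew_hermitian" "independent B" "skew_hermitian \<subseteq> span (B :: (complex^'r^'r) set)"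
  using maximal_independent_subset[of "skew_hermitian :: (complex^'r^'r) set"] by metis
 hence "\<exists>B. B \<subseteq> skew_hermitian \<and> independent B \<and> skew_hermitian \<subseteq> span (B :: (complex^'r^'r) set)"
  by (intro exI[of _ B] conjI)
 hence "(skew_basis :: (complex^'r^'r) set) \<subseteq> skew_hermitian \<and> independent (skew_basis :: (complex^'r^'r) set)
   \<and> skew_hermitian \<subseteq> span (skew_basis :: (complex^'r^'r) set)" unfolding skew_basis_def by (rule someI_ex)
 thus "skew_basis \<subseteq> (skew_hermitian :: (complex^'r^'r) set)"
  "independent (skew_basis :: (complex^'r^'r) set)" "skew_hermitian \<subseteq> span (skew_basis :: (complex^'r^'r) set)"
  by simp_all
qed

text \<open>The ranks are chosen such that the bracket with an element of the Borel subalgebra maps a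
 generator to a multiple of itself up to generators of smaller rank.\<close>

definition gens :: "(nat \<times> ('n, 'r::finite) lie_matrix) set"
 where "gens = (\<lambda>(i, j). (rk i + rk j, gU i j)) ` UNIV
  \<union> (\<lambda>(i, w). (2 * rk_bound + rk i, gV i w)) ` (UNIV \<times> (range (\<lambda>k. axis k 1) \<union> range (\<lambda>k. axis k \<i>)))
  \<union> (\<lambda>(i, j). (3 * rk_bound + rk i + (rk_bound - rk j), gT i j)) ` UNIV
  \<union> (\<lambda>K. (5 * rk_bound, iota 0 K 0 0)) ` skew_basis"

definition below :: "nat => ('n, 'r::finite) lie_matrix set" where "below r = {y. \<exists>r'<r. (r', y) \<in> gens}"

lemma finite_gens: "finite gens" by (simp add: gens_def independent_imp_finite[OF skew_basis(2)])

lemma gens_mem: "(rk i + rk j, gU i j) \<in> gens"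
 "(2 * rk_bound + rk i, gV i (axis k 1)) \<in> gens" "(2 * rk_bound + rk i, gV i (axis k \<i>)) \<in> gens"
 "(3 * rk_bound + rk i + (rk_bound - rk j), gT i j) \<in> gens"
 "K \<in> skew_basis ==> (5 * rk_bound, iota 0 K 0 0) \<in> gens"
proof -
 show "(rk i + rk j, gU i j) \<in> gens" unfolding gens_def by (intro UnI1 image_eqI[where x = "(i, j)"]) auto
 show "(2 * rk_bound + rk i, gV i (axis k 1)) \<in> gens"
  unfolding gens_def by (rule UnI1, rule UnI1, rule UnI2, rule image_eqI[where x = "(i, axis k 1)"]) auto
 show "(2 * rk_bound + rk i, gV i (axis k \<i>)) \<in> gens"
  unfolding gens_def by (rule UnI1, rule UnI1, rule UnI2, rule image_eqI[where x = "(i, axis k \<i>)"]) auto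
 show "(3 * rk_bound + rk i + (rk_bound - rk j), gT i j) \<in> gens"
  unfolding gens_def by (rule UnI1, rule UnI2, rule image_eqI[where x = "(i, j)"]) auto
 show "(5 * rk_bound, iota 0 K 0 0) \<in> gens" if "K \<in> skew_basis"
  unfolding gens_def using that by (intro UnI2 image_eqI[where x = K]) auto
qed

lemma below_mem: "rk i + rk j < r ==> gU i j \<in> below r"
 "2 * rk_bound + rk i < r ==> gV i (axis k 1) \<in> below r"
 "2 * rk_bound + rk i < r ==> gV i (axis k \<i>) \<in> below r"
 "3 * rk_bound + rk i + (rk_bound - rk j) < r ==> gT i j \<in> below r"
 unfolding below_def using gens_mem by blast+

text \<open>The ranks are layered: the generators of type \<open>U\<close> lie below
  \<open>2 * rk_bound\<close>, those of type \<open>V\<close> below \<open>3 * rk_bound\<close>,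
  those of type \<open>T\<close> below \<open>5 * rk_bound\<close>, and those of type
  \<open>K\<close> at \<open>5 * rk_bound\<close>. A term of a bracket that leaves its layer falls
  into a lower one and needs no closer inspection.\<close>

lemma gU_below: "2 * rk_bound \<le> r ==> U \<in> sym_real ==> iota 0 0 0 U \<in> span (below r)"
proof -
 assume r: "2 * rk_bound \<le> r" and U: "U \<in> sym_real"
 have "rk i + rk j < r" for i j using rk_less[of i] rk_less[of j] r by simp
 thus ?thesis unfolding iota_U_sum[OF U] by (intro span_sum span_scale span_base below_mem)
qed

lemma linear_gV: "linear (gV i :: _ => ('n, 'r::finite) lie_matrix)"
proof (rule linearI)
 fix x y :: "complex^'r" and c :: real
 have "(\<chi> a k. complex_of_real (C $ a $ i) * (x + y) $ k) =
   (\<chi> a k. complex_of_real (C $ a $ i) * x $ k) + (\<chi> a k. complex_of_real (C $ a $ i) * y $ k)"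
  by (simp add: vec_eq_iff algebra_simps)
 thus "gV i (x + y) = (gV i x + gV i y :: ('n, 'r) lie_matrix)" by (simp add: gV_def iota_add)
 have "(\<chi> a k. complex_of_real (C $ a $ i) * (c *\<^sub>R x) $ k) = c *\<^sub>R (\<chi> a k. complex_of_real (C $ a $ i) * x $ k)"
  by (simp add: vec_eq_iff)
 thus "gV i (c *\<^sub>R x) = (c *\<^sub>R gV i x :: ('n, 'r) lie_matrix)" by (simp add: gV_def iota_scaleR)
qed

lemma gV_below:
 assumes "3 * rk_bound \<le> r"
 shows "(iota 0 0 V 0 :: ('n, 'r::finite) lie_matrix) \<in> span (below r)"
proof -
 have w: "w = (\<Sum>k\<in>UNIV. Re (w $ k) *\<^sub>R axis k 1 + Im (w $ k) *\<^sub>R axis k \<i>)" for w :: "complex^'r"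
 proof -
  have "(\<Sum>k\<in>UNIV. Re (w $ k) *\<^sub>R axis k 1 + Im (w $ k) *\<^sub>R axis k \<i>) $ l = w $ l" for l
  proof -
   have "(\<Sum>k\<in>UNIV. (Re (w $ k) *\<^sub>R axis k 1 + Im (w $ k) *\<^sub>R axis k \<i>) $ l) = Re (w $ l) *\<^sub>R 1 + Im (w $ l) *\<^sub>R \<i>"
    by (subst sum.mono_neutral_right[of UNIV "{l}"]) (auto simp: axis_def)
   thus ?thesis by (simp add: complex_eq_iff)
  qed
  thus ?thesis by (simp add: vec_eq_iff)
 qed
 have lt: "2 * rk_bound + rk i < r" for i using rk_less[of i] assms by simp
 have "(gV i w :: ('n, 'r) lie_matrix) \<in> span (below r)" for i w
  by (subst w, unfold linear_sum[OF linear_gV] linear_add[OF linear_gV] linear_scale[OF linear_gV])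
   (intro span_sum span_add span_scale span_base below_mem lt)
 thus ?thesis unfolding iota_V_sum by (intro span_sum)
qed

lemma gT_below:
 assumes "5 * rk_bound \<le> r"
 shows "(iota T 0 0 0 :: ('n, 'r::finite) lie_matrix) \<in> span (below r)"
proof -
 have "3 * rk_bound + rk i + (rk_bound - rk j) < r" for i j using rk_less[of i] rk_less[of j] assms by simp
 thus ?thesis unfolding iota_T_sum by (intro span_sum span_scale span_base below_mem)
qed

lemma span_gens: "span (snd ` gens) = (gtilde :: ('n, 'r::finite) lie_matrix set)"
proof
 have sk0: "(0 :: complex^'r^'r) \<in> skew_hermitian" and sy0: "(0 :: real^'n^'n) \<in> sym_real"
  using subspace_0[OF subspace_skew_hermitian] subspace_0[OF subspace_sym_real] by blast+
 have sym: "C ** (unit_mat i j + unit_mat j i) ** transpose C \<in> sym_real" for i j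
  by (simp add: sym_real_def matrix_transpose_mul tr_add transpose_unit_mat matrix_mul_assoc add.commute)
 have "snd ` gens \<subseteq> (gtilde :: ('n, 'r) lie_matrix set)"
  using skew_basis(1) sk0 sy0 sym by (auto simp: gens_def gU_def gV_def gT_def intro!: iota_gtilde)
 thus "span (snd ` gens) \<subseteq> (gtilde :: ('n, 'r) lie_matrix set)" using subspace_gtilde by (rule span_minimal)
 show "(gtilde :: ('n, 'r) lie_matrix set) \<subseteq> span (snd ` gens)"
 proof
  fix X :: "('n, 'r) lie_matrix" assume "X \<in> gtilde"
  then obtain T K V U where X: "X = iota T K V U" and K: "K \<in> skew_hermitian" and U: "U \<in> sym_real"
   by (auto simp: gtilde_def)
  have sub: "span (below r) \<subseteq> span (snd ` gens :: ('n, 'r) lie_matrix set)" for r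
   by (rule span_mono) (force simp: below_def)
  have "(\<lambda>K. iota 0 K 0 0 :: ('n, 'r) lie_matrix) ` span skew_basis \<subseteq> span (snd ` gens)"
   unfolding linear_span_image[OF linear_iotas(4), symmetric]
   by (rule span_mono) (auto intro: rev_image_eqI[OF gens_mem(5)])
  hence "(iota 0 K 0 0 :: ('n, 'r) lie_matrix) \<in> span (snd ` gens)" using K skew_basis(3) by blast
  moreover have "(iota T 0 0 0 :: ('n, 'r) lie_matrix) \<in> span (snd ` gens)"
   using gT_below[OF order_refl] sub by blast
  moreover have "(iota 0 0 V 0 :: ('n, 'r) lie_matrix) \<in> span (snd ` gens)"
   using gV_below[OF order_refl] sub by blast
  moreover have "(iota 0 0 0 U :: ('n, 'r) lie_matrix) \<in> span (snd ` gens)"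
   using gU_below[OF order_refl U] sub by blast
  ultimately have "iota 0 K 0 0 + iota T 0 0 0 + iota 0 0 V 0 + iota 0 0 0 U \<in> span (snd ` gens :: ('n, 'r) lie_matrix set)"
   by (intro span_add)
  thus "X \<in> span (snd ` gens)" by (simp add: X iota_add)
 qed
qed

text \<open>A nonzero entry of an upper triangular matrix has \<open>rk k \<le> rk i\<close>, and
  since \<open>rk\<close> is injective equality of ranks means \<open>k = i\<close>.\<close>

lemma upper_term:
 assumes "upper rk M" and "rk k < rk i ==> x \<in> S" and "k = i ==> x = y"
 shows "M $ k $ i *\<^sub>R x \<in> span (insert y S)"
proof (cases "rk i < rk k")
 case True
 thus ?thesis using assms(1) by (simp add: upper_def span_0)
next
 case False
 then consider "rk k < rk i" | "k = i" using rk by (metis injD linorder_neqE_nat)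
 thus ?thesis using assms(2,3) by cases (simp_all add: span_scale span_base)
qed

text \<open>An upper triangular matrix lowers the row index of a generator. For type
  \<open>U\<close> both indices are rows, so their ranks are added. For type \<open>T\<close>
  multiplication from the right raises the column index, so its rank is subtracted from
  \<open>rk_bound\<close>. For type \<open>K\<close> only \<open>V K\<close> remains, because the
  elements of \<open>borel\<close> have no unitary part.\<close>

lemma borel_gens:
 fixes X x :: "('n, 'r::finite) lie_matrix"
 assumes X: "X \<in> borel rk C Ci" and x: "(r, x) \<in> gens"
 shows "lie_bracket X x \<in> span (insert x (below r))"
proof -
 obtain T V U where Xe: "X = iota T 0 V U" and U: "U \<in> sym_real" and up: "upper rk (Ci ** T ** C)"
  using X by (auto simp: borel_def)
 define M where "M = Ci ** T ** C"
 have up: "upper rk M" using up by (simp add: M_def)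
 have T: "T = C ** M ** Ci" by (simp add: M_def matrix_mul_assoc C) (simp add: matrix_mul_assoc[symmetric] C)
 have sub: "span (below r) \<subseteq> span (insert x (below r))" by (rule span_mono) auto
 from x consider (U) i j where "r = rk i + rk j" "x = gU i j"
  | (V) i w where "r = 2 * rk_bound + rk i" "x = gV i w" "w \<in> range (\<lambda>k. axis k 1) \<union> range (\<lambda>k. axis k \<i>)"
  | (T) i j where "r = 3 * rk_bound + rk i + (rk_bound - rk j)" "x = gT i j"
  | (K) K where "r = 5 * rk_bound" "x = iota 0 K 0 0" unfolding gens_def by auto
 thus ?thesis
 proof cases
  case (U i j)
  have gU_commute: "gU a b = (gU b a :: ('n, 'r) lie_matrix)" for a b by (simp add: gU_def add.commute)
  have tC: "transpose Ci ** transpose C = mat 1" "transpose C ** transpose Ci = mat 1"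
   by (simp_all add: C Ci flip: matrix_transpose_mul)
  let ?E = "unit_mat i j + unit_mat j i"
  have ME: "M ** ?E + ?E ** transpose M
    = (\<Sum>k\<in>UNIV. M $ k $ i *\<^sub>R (unit_mat k j + unit_mat j k)) + (\<Sum>k\<in>UNIV. M $ k $ j *\<^sub>R (unit_mat k i + unit_mat i k))"
   by (simp add: mm.add_left mm.add_right mult_unit_mat unit_mat_mult scaleR_add_right sum.distrib)
    (simp add: transpose_def algebra_simps)
  have "T ** (C ** ?E ** transpose C) + (C ** ?E ** transpose C) ** transpose T
    = C ** (M ** ?E + ?E ** transpose M) ** transpose C"
  proof -
   have 1: "T ** (C ** ?E ** transpose C) = C ** (M ** ?E) ** transpose C"
    by (simp add: T matrix_mul_assoc[symmetric])
   have 2: "(C ** ?E ** transpose C) ** transpose T = C ** (?E ** transpose M) ** transpose C"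
   proof -
    have "transpose C ** transpose T = transpose M ** transpose C"
    proof -
     have "T ** C = C ** M" by (simp add: T matrix_mul_assoc[symmetric] Ci)
     thus ?thesis by (metis matrix_transpose_mul)
    qed
    thus ?thesis by (simp add: matrix_mul_assoc[symmetric])
   qed
   show ?thesis unfolding 1 2 by (simp only: mm.add_left mm.add_right)
  qed
  hence "lie_bracket X x = iota 0 0 0 (C ** (M ** ?E + ?E ** transpose M) ** transpose C)"
   by (simp add: Xe U(2) gU_def lie_bracket_iota mm.zero_left mm.zero_right cm_zero tr_zero Q.zero_right Im_matrix_zero)
  also have "\<dots> = (\<Sum>k\<in>UNIV. M $ k $ i *\<^sub>R gU k j) + (\<Sum>k\<in>UNIV. M $ k $ j *\<^sub>R gU k i)" unfolding ME gU_def
   by (simp only: linear_add[OF linear_conj] linear_sum[OF linear_conj] linear_scale[OF linear_conj]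
     linear_add[OF linear_iotas(1)] linear_sum[OF linear_iotas(1)] linear_scale[OF linear_iotas(1)])
  also have "\<dots> \<in> span (insert x (below r))" unfolding U(1,2)
   by (intro span_add span_sum upper_term[OF up] below_mem) (simp_all add: gU_commute)
  finally show ?thesis .
 next
  case (V i w)
  let ?v = "\<chi> a k. complex_of_real (C $ a $ i) * w $ k"
  have TC: "T ** C = C ** M" by (simp add: T matrix_mul_assoc[symmetric] Ci)
  have "cmat T ** ?v = (\<chi> a k. complex_of_real ((T ** C) $ a $ i) * w $ k)"
   by (simp add: vec_eq_iff matrix_matrix_mult_def sum_distrib_right mult.assoc)
  also have "\<dots> = (\<Sum>l\<in>UNIV. M $ l $ i *\<^sub>R (\<chi> a k. complex_of_real (C $ a $ l) * w $ k))" unfolding TC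
   by (simp add: vec_eq_iff matrix_matrix_mult_def sum_distrib_right) (simp add: scaleR_conv_of_real mult_ac)
  finally have Tv: "cmat T ** ?v = (\<Sum>l\<in>UNIV. M $ l $ i *\<^sub>R (\<chi> a k. complex_of_real (C $ a $ l) * w $ k))" .
  have sy: "4 *\<^sub>R map_matrix Im (Q V ?v) \<in> sym_real"
   using transpose_Q[of V ?v] by (simp add: sym_real_def tr_scaleR vec_eq_iff transpose_def)
  have "lie_bracket X x = iota 0 0 (cmat T ** ?v) 0 + iota 0 0 0 (4 *\<^sub>R map_matrix Im (Q V ?v))"
   by (simp add: Xe V(2) gV_def lie_bracket_iota iota_add mm.zero_left mm.zero_right cm_zero tr_zero)
  also have "iota 0 0 (cmat T ** ?v) 0 = (\<Sum>l\<in>UNIV. M $ l $ i *\<^sub>R (gV l w :: ('n, 'r) lie_matrix))"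
   unfolding Tv gV_def by (simp only: linear_sum[OF linear_iotas(2)] linear_scale[OF linear_iotas(2)])
  also have "(\<Sum>l\<in>UNIV. M $ l $ i *\<^sub>R gV l w) + iota 0 0 0 (4 *\<^sub>R map_matrix Im (Q V ?v)) \<in> span (insert x (below r))"
  proof (intro span_add span_sum upper_term[OF up])
   show "gV l w \<in> below r" if "rk l < rk i" for l using V(1,3) that by (auto intro: below_mem(2,3))
   show "iota 0 0 0 (4 *\<^sub>R map_matrix Im (Q V ?v)) \<in> span (insert x (below r))"
    using gU_below[OF _ sy, of r] V(1) sub by auto
  qed (simp add: V(2))
  finally show ?thesis .
 next
  case (T i j)
  let ?t = "C ** unit_mat i j ** Ci"
  have "T ** ?t - ?t ** T = C ** (M ** unit_mat i j - unit_mat i j ** M) ** Ci"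
  proof -
   have 1: "T ** ?t = C ** (M ** unit_mat i j) ** Ci"
    by (simp add: \<open>T = C ** M ** Ci\<close> matrix_mul_assoc[symmetric])
   have 2: "?t ** T = C ** (unit_mat i j ** M) ** Ci"
    by (simp add: \<open>T = C ** M ** Ci\<close> matrix_mul_assoc[symmetric])
   show ?thesis unfolding 1 2 by (simp add: mm.diff_left mm.diff_right)
  qed
  hence Tt: "T ** ?t - ?t ** T = C ** ((\<Sum>k\<in>UNIV. M $ k $ i *\<^sub>R unit_mat k j) - (\<Sum>k\<in>UNIV. M $ j $ k *\<^sub>R unit_mat i k)) ** Ci"
   by (simp add: mult_unit_mat unit_mat_mult)
  have sy: "- (?t ** U + U ** transpose ?t) \<in> sym_real"
   using U by (simp add: sym_real_def tr_add tr_neg matrix_transpose_mul matrix_mul_assoc add.commute tr_diff)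
  have "lie_bracket X x = iota (T ** ?t - ?t ** T) 0 0 0 + iota 0 0 (- (cmat ?t ** V)) 0 + iota 0 0 0 (- (?t ** U + U ** transpose ?t))"
   by (simp add: Xe T(2) gT_def lie_bracket_iota iota_add mm.zero_left mm.zero_right cm_zero tr_zero Q.zero_right Im_matrix_zero)
  also have "iota (T ** ?t - ?t ** T) 0 0 0 = (\<Sum>k\<in>UNIV. M $ k $ i *\<^sub>R (gT k j :: ('n, 'r) lie_matrix)) - (\<Sum>k\<in>UNIV. M $ j $ k *\<^sub>R gT i k)"
   unfolding Tt gT_def by (simp only: linear_diff[OF linear_conj] linear_sum[OF linear_conj] linear_scale[OF linear_conj]
     linear_diff[OF linear_iotas(3)] linear_sum[OF linear_iotas(3)] linear_scale[OF linear_iotas(3)])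
  also have "(\<Sum>k\<in>UNIV. M $ k $ i *\<^sub>R gT k j) - (\<Sum>k\<in>UNIV. M $ j $ k *\<^sub>R gT i k)
    + iota 0 0 (- (cmat ?t ** V)) 0 + iota 0 0 0 (- (?t ** U + U ** transpose ?t)) \<in> span (insert x (below r))"
  proof (intro span_add span_diff span_sum)
   show "M $ k $ i *\<^sub>R gT k j \<in> span (insert x (below r))" for k
    by (rule upper_term[OF up]) (auto simp: T intro: below_mem)
   show "M $ j $ k *\<^sub>R gT i k \<in> span (insert x (below r))" for k
    by (rule upper_term[OF up]) (use rk_less[of k] in \<open>auto simp: T intro!: below_mem\<close>)
   show "iota 0 0 (- (cmat ?t ** V)) 0 \<in> span (insert x (below r))"
    using gV_below[of r "- (cmat ?t ** V)"] T(1) sub by auto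
   show "iota 0 0 0 (- (?t ** U + U ** transpose ?t)) \<in> span (insert x (below r))"
    using gU_below[OF _ sy, of r] T(1) sub by auto
  qed
  finally show ?thesis .
 next
  case (K K)
  have "lie_bracket X x = iota 0 0 (V ** K) 0"
   by (simp add: Xe K(2) lie_bracket_iota mm.zero_left mm.zero_right cm_zero tr_zero Q.zero_right Im_matrix_zero)
  thus ?thesis using gV_below[of r "V ** K"] K(1) sub by auto
 qed
qed

end

section \<open>The group generated by the Borel algebra\<close>

context siegel_cover
begin

text \<open>Subspaces invariant under all brackets are invariant under \<open>exp (ad X)\<close>,
  hence under conjugation by exponentials, their inverses and products. \<open>conj_rel\<close>
  carries this through the induction over generated elements.\<close>

lemma triangular_borel:
 assumes "ordered_basis rk C Ci"
 shows "triangular_subgroup G T p (generate G (Exp ` borel rk C Ci))"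
proof -
 interpret ordered_basis rk C Ci by fact
 let ?Ops = "lie_bracket ` (borel rk C Ci :: ('n, 'r) lie_matrix set)"
 obtain bs where bs: "distinct bs" "independent (set bs)" "span (set bs) = span (snd ` (gens :: (nat \<times> ('n, 'r) lie_matrix) set))"
  "\<forall>A\<in>?Ops. \<forall>j<length bs. A (bs ! j) \<in> span (set (take (Suc j) bs))"
  using triangular_basis_of_ranked[OF finite_gens, of ?Ops] borel_gens unfolding below_def by auto
 have spg: "span (set bs) = gtilde" using bs(3) span_gens by simp
 define W where "W j = span (set (take (Suc j) bs))" for j
 have Wg: "X \<in> gtilde" if "X \<in> W j" for X j
  using that span_mono[of "set (take (Suc j) bs)" "set bs"] set_take_subset[of "Suc j" bs] spg unfolding W_def by blast
 have inv: "lie_bracket X Y \<in> W j" if X: "X \<in> borel rk C Ci" and Y: "Y \<in> W j" for X Y j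
  using Y unfolding W_def
 proof (induction rule: span_induct)
  show "subspace {Y. lie_bracket X Y \<in> span (set (take (Suc j) bs))}"
   by (auto simp: subspace_def linear_0[OF linear_lie_bracket] linear_add[OF linear_lie_bracket]
     linear_scale[OF linear_lie_bracket] span_0 span_add span_scale)
  fix Y assume "Y \<in> set (take (Suc j) bs)"
  then obtain i where i: "i < Suc j" "i < length bs" "Y = bs ! i" by (auto simp: in_set_conv_nth)
  have "set (take (Suc i) bs) \<subseteq> set (take (Suc j) bs)" using i(1) by (intro set_take_subset_set_take) auto
  thus "lie_bracket X Y \<in> span (set (take (Suc j) bs))" using bs(4) X i span_mono by blast
 qed
 have expW: "\<exists>Y'\<in>W j. conj_rel (Exp X) Y Y'" if X: "X \<in> borel rk C Ci" and Y: "Y \<in> W j" for X Y j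
 proof -
  have "app (exp (ad X)) Y \<in> W j"
   by (rule exp_app_mem) (use X Y inv in \<open>auto simp: W_def app_ad intro: closed_subspace\<close>)
  thus ?thesis using conj_rel_lie_exp[OF borel_gtilde[OF X] Wg[OF Y]] by blast
 qed
 have main: "\<exists>Y'\<in>W j. conj_rel b Y Y'" if "b \<in> generate G (Exp ` borel rk C Ci)" "Y \<in> W j" for b Y j
  using that
 proof (induction arbitrary: Y rule: generate.induct)
  case one
  thus ?case using conj_rel_one[OF Wg] by blast
 next
  case (incl h)
  thus ?case using expW by blast
 next
  case (inv h)
  then obtain X where X: "X \<in> borel rk C Ci" "h = Exp X" by blast
  have "- X \<in> borel rk C Ci"
   using X(1) lie_subalgebra_borel subspace_neg unfolding lie_subalgebra_def by blast
  moreover have "inv h = Exp (- X)" using lie_exp_minus[OF borel_gtilde[OF X(1)]] X(2) by simp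
  ultimately show ?case using expW inv.prems by metis
 next
  case (eng h1 h2)
  have c: "h1 \<in> carrier G" "h2 \<in> carrier G"
   using eng.hyps generate_lie_exp_mem borel_gtilde by (metis subsetI)+
  obtain Y2 where Y2: "Y2 \<in> W j" "conj_rel h2 Y Y2" using eng.IH(2)[OF eng.prems] by blast
  obtain Y1 where Y1: "Y1 \<in> W j" "conj_rel h1 Y2 Y1" using eng.IH(1)[OF Y2(1)] by blast
  show ?case using conj_rel_mult[OF c Y2(2) Y1(2)] Y1(1) by blast
 qed
 have "Ad G T p b (bs ! j) \<in> span (set (take (Suc j) bs))"
  if b: "b \<in> generate G (Exp ` borel rk C Ci)" and j: "j < length bs" for b j
 proof -
  have "bs ! j \<in> W j" unfolding W_def using j by (auto simp: take_Suc_conv_app_nth intro: span_base)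
  from main[OF b this] show ?thesis using Ad_eqI unfolding W_def by metis
 qed
 thus ?thesis unfolding triangular_subgroup_def connected_lie_subgroup_def
  using bs(1,2) spg lie_subalgebra_borel by blast
qed

text \<open>\<open>B\<close> is contained in the group of some \<open>borel\<close>, and that group
  is itself triangular, so maximality gives equality.\<close>

lemma maximal_triangular_borel:
 assumes B: "maximal_triangular_subgroup G T p B"
 shows "\<exists>rk C Ci. ordered_basis rk C Ci \<and> B = generate G (Exp ` borel rk C Ci)"
proof -
 obtain \<h> rk C Ci where h: "B = generate G (Exp ` \<h>)"
  "inj rk" "C ** Ci = mat 1" "Ci ** C = mat 1" "\<h> \<subseteq> borel rk C Ci"
  using triangular_subset_borel[of B] B unfolding maximal_triangular_subgroup_def by blast
 have ob: "ordered_basis rk C Ci" using h by (simp add: ordered_basis_def)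
 have "B \<subseteq> generate G (Exp ` borel rk C Ci)" unfolding h(1) by (intro mono_generate image_mono h(5))
 hence "generate G (Exp ` borel rk C Ci) = B"
  using B triangular_borel[OF ob] unfolding maximal_triangular_subgroup_def by blast
 thus ?thesis using ob by blast
qed

end

section \<open>Transitivity on the domain\<close>

lemma flow_iota_U: "flow (iota 0 0 0 U) t (Z, V) = (Z + t *\<^sub>R cmat U, V)"
proof -
 have "((\<lambda>t. (Z + t *\<^sub>R cmat U, V)) has_vector_derivative (cmat U, 0)) (at t)" for t
  by (auto intro!: derivative_eq_intros)
 hence "((\<lambda>t. (Z + t *\<^sub>R cmat U, V)) has_vector_derivative field (iota 0 0 0 U) (Z + t *\<^sub>R cmat U, V)) (at t)" for t
  by (simp add: lie_vector_field_def cm_zero mm.zero_left mm.zero_right tr_zero Q.zero_right scaleC.zero_right)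
 from flow_unique[OF this] show ?thesis by simp
qed

lemma flow_iota_V:
 "flow (iota 0 0 V0 0) t (Z, V) = (Z + t *\<^sub>R ((2 * \<i>) *\<^sub>C Q V V0) + t\<^sup>2 *\<^sub>R (\<i> *\<^sub>C Q V0 V0), V + t *\<^sub>R V0)"
proof -
 let ?g = "\<lambda>t. (Z + t *\<^sub>R ((2 * \<i>) *\<^sub>C Q V V0) + t\<^sup>2 *\<^sub>R (\<i> *\<^sub>C Q V0 V0), V + t *\<^sub>R V0)"
 have "(?g has_vector_derivative ((2 * \<i>) *\<^sub>C Q V V0 + (2 * t) *\<^sub>R (\<i> *\<^sub>C Q V0 V0), V0)) (at t)" for t
  by (auto intro!: derivative_eq_intros)
 moreover have "field (iota 0 0 V0 0) (?g t) = ((2 * \<i>) *\<^sub>C Q V V0 + (2 * t) *\<^sub>R (\<i> *\<^sub>C Q V0 V0), V0)" for t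
 proof -
  have "(2 * \<i>) *\<^sub>C Q (V + t *\<^sub>R V0) V0 = (2 * \<i>) *\<^sub>C Q V V0 + (2 * t) *\<^sub>R (\<i> *\<^sub>C Q V0 V0)"
   unfolding Q.add_left Q.scaleR_left scaleC_add_right by (simp add: vec_eq_iff complex_eq_iff)
  thus ?thesis
   unfolding lie_vector_field_def iota_components prod.case cm_zero mm.zero_left mm.zero_right tr_zero by simp
 qed
 ultimately have "(?g has_vector_derivative field (iota 0 0 V0 0) (?g t)) (at t)" for t by (simp only:)
 from flow_unique[OF this] show ?thesis by simp
qed

text \<open>Any path that solves \<open>a' = S a\<close> may be inserted, so for nilpotent and
  diagonal \<open>S\<close> the exponential is available in closed form.\<close>

lemma flow_iota_T:
 fixes a :: "real => real^'n::finite^'n"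
 assumes a: "\<And>t. (a has_vector_derivative S ** a t) (at t)" and a0: "a 0 = mat 1"
 shows "flow (iota S 0 0 0) t (Z, V) = (cmat (a t) ** Z ** transpose (cmat (a t)), cmat (a t) ** V)"
proof -
 have c: "((\<lambda>t. cmat (a t)) has_vector_derivative cmat S ** cmat (a t)) (at t)" for t
  using bounded_linear.has_vector_derivative[OF bounded_linear_cmat a] by (simp add: cmat_mult)
 have ct: "((\<lambda>t. transpose (cmat (a t))) has_vector_derivative transpose (cmat (a t)) ** transpose (cmat S)) (at t)" for t
  using bounded_linear.has_vector_derivative[OF bounded_linear_transpose c] by (simp add: matrix_transpose_mul)
 have cZ: "((\<lambda>t. cmat (a t) ** X) has_vector_derivative cmat S ** cmat (a t) ** X) (at t)" for t and X :: "complex^'c::finite^'n"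
  by (rule bounded_linear.has_vector_derivative[OF mm.bounded_linear_left c])
 let ?g = "\<lambda>t. (cmat (a t) ** Z ** transpose (cmat (a t)), cmat (a t) ** V)"
 have "(?g has_vector_derivative (cmat (a t) ** Z ** (transpose (cmat (a t)) ** transpose (cmat S))
   + cmat S ** cmat (a t) ** Z ** transpose (cmat (a t)), cmat S ** cmat (a t) ** V)) (at t)" for t
  by (intro has_vector_derivative_Pair mm.has_vector_derivative cZ ct)
 hence "(?g has_vector_derivative field (iota S 0 0 0) (?g t)) (at t)" for t
  by (simp add: lie_vector_field_def cm_zero mm.zero_left mm.zero_right Q.zero_right scaleC.zero_right
    matrix_mul_assoc add.commute)
 from flow_unique[OF this] show ?thesis
  by (simp add: a0) (simp add: matrix_matrix_mult_def mat_def transpose_def vec_eq_iff if_distrib if_distribR cong: if_cong)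
qed

lemma mat_1_mult [simp]: "mat 1 ** (A :: real^'b::finite^'a::finite) = A" "A ** mat 1 = A" by simp_all

lemma pos_def_congruence:
 fixes Y a b :: "real^'n::finite^'n"
 assumes Y: "Y \<in> pos_def_matrices" and a: "b ** a = mat 1"
 shows "a ** Y ** transpose a \<in> pos_def_matrices"
proof -
 have Ys: "transpose Y = Y" and Yp: "\<And>x. x \<noteq> 0 ==> x \<bullet> (Y *v x) > 0"
  using Y by (auto simp: pos_def_matrices_def)
 have "x \<bullet> ((a ** Y ** transpose a) *v x) > 0" if "x \<noteq> 0" for x
 proof -
  have "transpose a *v x \<noteq> 0"
  proof
   assume "transpose a *v x = 0"
   hence "transpose b *v (transpose a *v x) = 0" by simp
   moreover have "transpose a ** transpose b = mat 1" using a by (metis matrix_transpose_mul transpose_mat)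
   hence "transpose b ** transpose a = mat 1" by (rule matrix_left_right_inverse[THEN iffD1])
   ultimately show False using that by (simp add: matrix_vector_mul_assoc)
  qed
  moreover have "x \<bullet> ((a ** Y ** transpose a) *v x) = (transpose a *v x) \<bullet> (Y *v (transpose a *v x))"
   by (simp add: matrix_vector_mul_assoc[symmetric] dot_lmul_matrix[symmetric])
    (metis dot_lmul_matrix transpose_matrix_vector)
  ultimately show ?thesis using Yp by simp
 qed
 moreover have "transpose (a ** Y ** transpose a) = a ** Y ** transpose a"
  by (simp add: matrix_transpose_mul Ys matrix_mul_assoc)
 ultimately show ?thesis by (simp add: pos_def_matrices_def)
qed

context ordered_basis
begin

text \<open>Gaussian elimination from the last index on.\<close>

lemma pos_def_elimination:
 fixes S :: "(real^'n^'n) set"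
 assumes mult: "\<And>a b. a \<in> S ==> b \<in> S ==> a ** b \<in> S"
  and elem: "\<And>N. upper rk N ==> N ** N = 0 ==> mat 1 + N \<in> S"
  and diag: "\<And>d. (\<chi> i j. if i = j then exp (d i) else 0) \<in> S" and Y: "Y \<in> pos_def_matrices"
 shows "\<exists>a\<in>S. a ** Y ** transpose a = mat 1"
proof -
 \<comment> \<open>The rows of rank at least \<open>m\<close> are already cleared off the diagonal.
   The induction descends to \<open>m = 0\<close>, where \<open>Y\<close> is diagonal.\<close>
 have "\<exists>a\<in>S. a ** Y ** transpose a = mat 1"
  if "Y \<in> pos_def_matrices" "\<And>i j. i \<noteq> j ==> rk i \<ge> m ==> Y $ i $ j = 0" for m Y using that
 proof (induction m arbitrary: Y)
  case 0
  have pos: "Y $ i $ i > 0" for i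
  proof -
   have "axis i 1 \<bullet> (Y *v axis i 1) > 0" using 0(1) by (auto simp: pos_def_matrices_def)
   thus ?thesis by (simp add: inner_axis' matrix_vector_mult_basis column_def)
  qed
  \<comment> \<open>Scaling by the inverse square roots of the diagonal entries, written as
    exponentials because \<open>diag\<close> provides matrices of that form.\<close>
  define a :: "real^'n^'n" where "a = (\<chi> i j. if i = j then exp (- ln (Y $ i $ i) / 2) else 0)"
  have e: "exp (- ln (Y $ i $ i) / 2) * Y $ i $ i * exp (- ln (Y $ i $ i) / 2) = 1" for i
  proof -
   have "exp (- ln (Y $ i $ i) / 2) * exp (ln (Y $ i $ i)) * exp (- ln (Y $ i $ i) / 2) = 1"
    by (simp flip: exp_add)
   thus ?thesis using pos by simp
  qed
  have "(a ** Y ** transpose a) $ i $ j = mat 1 $ i $ j" for i j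
  proof -
   have "(a ** Y ** transpose a) $ i $ j = exp (- ln (Y $ i $ i) / 2) * Y $ i $ j * exp (- ln (Y $ j $ j) / 2)"
    by (simp add: a_def matrix_matrix_mult_def transpose_def if_distrib if_distribR cong: if_cong)
   thus ?thesis using e[of i] 0(2)[of i j] by (cases "i = j") (auto simp: mat_def)
  qed
  hence "a ** Y ** transpose a = mat 1" by (simp add: vec_eq_iff)
  moreover have "a \<in> S" unfolding a_def by (rule diag)
  ultimately show ?case by blast
 next
  case (Suc m)
  show ?case
  proof (cases "m \<in> range rk")
   case False
   hence "Y $ i $ j = 0" if "i \<noteq> j" "rk i \<ge> m" for i j
    using Suc.prems(2)[OF that(1)] that(2) by (metis Suc_leI le_neq_implies_less rangeI)
   thus ?thesis using Suc.IH[OF Suc.prems(1)] by blast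
  next
   case True
   then obtain j0 where j0: "rk j0 = m" by auto
   have sym: "Y $ i $ j = Y $ j $ i" for i j
    using Suc.prems(1) by (auto simp: pos_def_matrices_def transpose_def vec_eq_iff)
   have pos: "Y $ j0 $ j0 > 0"
   proof -
    have "axis j0 1 \<bullet> (Y *v axis j0 1) > 0" using Suc.prems(1) by (auto simp: pos_def_matrices_def)
    thus ?thesis by (simp add: inner_axis' matrix_vector_mult_basis column_def)
   qed
   \<comment> \<open>The multipliers that clear column \<open>j0\<close> above the pivot. They
     vanish at \<open>j0\<close> itself, so \<open>N\<close> has square 0 and \<open>1 + N\<close>
     is the exponential of \<open>N\<close>.\<close>
   define n where "n i = (if rk i < m then - (Y $ i $ j0 / Y $ j0 $ j0) else 0)" for i
   define N :: "real^'n^'n" where "N = (\<chi> i j. if j = j0 then n i else 0)"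
   have up: "upper rk N" by (auto simp: upper_def N_def n_def j0)
   have NN: "N ** N = 0" by (auto simp: vec_eq_iff matrix_matrix_mult_def N_def n_def j0 intro!: sum.neutral)
   define a where "a = mat 1 + N"
   have aS: "a \<in> S" unfolding a_def by (rule elem[OF up NN])
   have inv: "(mat 1 - N) ** a = mat 1" by (simp add: a_def mm.add_left mm.add_right mm.diff_left NN)
   define Y1 where "Y1 = a ** Y ** transpose a"
   have aX: "(a ** X) $ i $ j = X $ i $ j + n i * X $ j0 $ j" for X :: "real^'n^'n" and i j
    by (simp add: a_def mm.add_left) (simp add: matrix_matrix_mult_def N_def if_distrib if_distribR cong: if_cong)
   have Xa: "(X ** transpose a) $ i $ j = X $ i $ j + n j * X $ i $ j0" for X :: "real^'n^'n" and i j
    by (simp add: a_def mm.add_right tr_add transpose_mat)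
     (simp add: matrix_matrix_mult_def N_def transpose_def if_distrib if_distribR mult.commute cong: if_cong)
   have ent: "Y1 $ i $ j = Y $ i $ j + n i * Y $ j0 $ j + n j * (Y $ i $ j0 + n i * Y $ j0 $ j0)" for i j
    unfolding Y1_def by (simp only: Xa aX)
   have Y1p: "Y1 \<in> pos_def_matrices" unfolding Y1_def by (rule pos_def_congruence[OF Suc.prems(1) inv])
   have "Y1 $ i $ j = 0" if ij: "i \<noteq> j" and rki: "rk i \<ge> m" for i j
   proof (cases "i = j0")
    case True
    have ni: "n i = 0" using rki by (simp add: n_def)
    show ?thesis
    proof (cases "rk j < m")
     case True
     thus ?thesis using pos ent[of i j] ni \<open>i = j0\<close> sym[of j0 j] by (simp add: n_def)
    next
     case False
     hence "rk j \<ge> Suc m" using ij rk j0 \<open>i = j0\<close> by (metis injD le_neq_implies_less not_le Suc_leI)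
     hence "Y $ j $ i = 0" using Suc.prems(2)[of j i] ij by simp
     thus ?thesis using ent[of i j] ni False sym[of j0 j] \<open>i = j0\<close> by (simp add: n_def)
    qed
   next
    case False
    hence "rk i \<ge> Suc m" using rki j0 rk by (metis injD le_neq_implies_less Suc_leI)
    thus ?thesis using ent[of i j] Suc.prems(2)[of i] ij False by (simp add: n_def)
   qed
   from Suc.IH[OF Y1p this] obtain a1 where a1: "a1 \<in> S" "a1 ** Y1 ** transpose a1 = mat 1" by blast
   have "(a1 ** a) ** Y ** transpose (a1 ** a) = mat 1"
    using a1(2) by (simp add: Y1_def matrix_transpose_mul matrix_mul_assoc)
   thus ?thesis using mult[OF a1(1) aS] by blast
  qed
 qed
 from this[OF Y, of rk_bound] show ?thesis using rk_less by (metis not_le)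
qed

end

lemma base_point_siegel: "(base_point :: ('n::finite, 'r::finite) point) \<in> \<D>"
proof -
 have "map_matrix Im (mat \<i>) = (mat 1 :: real^'n^'n)" by (simp add: vec_eq_iff mat_def)
 moreover have "(mat 1 :: real^'n^'n) \<in> pos_def_matrices" by (simp add: pos_def_matrices_def transpose_mat)
 ultimately show ?thesis by (simp add: siegel_domain_def base_point_def Q.zero_right transpose_mat)
qed

lemma siegel_domain_decompose:
 assumes "(Z, V) \<in> \<D>"
 shows "\<exists>Y U. Y \<in> pos_def_matrices \<and> U \<in> sym_real \<and> Z = cmat U + \<i> *\<^sub>C (cmat Y + Q V V)"
proof -
 from assms obtain Y where Y: "Y \<in> pos_def_matrices" "cmat (map_matrix Im Z) - Q V V = cmat Y" and Z: "transpose Z = Z"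
  by (auto simp: siegel_domain_def)
 have "cmat Y + Q V V = cmat (map_matrix Im Z)" using Y(2) by (metis diff_add_cancel)
 hence "Z = cmat (map_matrix Re Z) + \<i> *\<^sub>C (cmat Y + Q V V)" by (simp add: vec_eq_iff complex_eq_iff)
 moreover have "map_matrix Re Z \<in> sym_real" using Z by (simp add: sym_real_def transpose_def vec_eq_iff)
 ultimately show ?thesis using Y(1) by blast
qed

lemma diag_mult: "((\<chi> i j. if i = j then d i else 0) ** X) $ i $ j = d i * (X :: real^'n::finite^'n) $ i $ j"
proof -
 have "((\<chi> i j. if i = j then d i else 0) ** X) $ i $ j = (\<Sum>k\<in>{i}. (if i = k then d i else 0) * X $ k $ j)"
  unfolding matrix_matrix_mult_def vec_lambda_beta by (rule sum.mono_neutral_right) auto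
 thus ?thesis by simp
qed

lemma has_vector_derivative_diag:
 fixes f :: "'n::finite => real => real"
 assumes "\<And>i. (f i has_real_derivative f' i) (at t)"
 shows "((\<lambda>t. (\<chi> i j. if i = j then f i t else 0) :: real^'n^'n) has_vector_derivative
  (\<chi> i j. if i = j then f' i else 0)) (at t)"
proof -
 have e: "(\<chi> i j. if i = j then d i else 0) = (\<Sum>i\<in>UNIV. d i *\<^sub>R (\<chi> a b. if a = i \<and> b = i then 1 else 0 :: real^'n^'n))"
  for d :: "'n => real"
 proof -
  have "(\<Sum>i\<in>UNIV. d i *\<^sub>R (\<chi> a b. if a = i \<and> b = i then 1 else 0 :: real^'n^'n)) $ a $ b
    = (\<Sum>i\<in>{a}. if a = i \<and> b = i then d i else 0)" for a b
   unfolding sum_component by (rule sum.mono_neutral_cong_right) auto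
  thus ?thesis by (auto simp: vec_eq_iff)
 qed
 show ?thesis unfolding e
  by (intro has_vector_derivative_sum has_vector_derivative_scaleR[where g' = 0, simplified] assms) auto
qed

lemma borelI: "U \<in> sym_real ==> upper rk (Ci ** T ** C) ==> iota T 0 V U \<in> borel rk C Ci"
 by (auto simp: borel_def)

context siegel_cover
begin

text \<open>A motion by \<open>- V\<close> removes the second coordinate, a translation by
  \<open>- U\<close> the real part of \<open>Z\<close>, and elimination in the basis
  \<open>C\<close> normalizes the imaginary part. Every point, the base point included, is moved to
  one and the same point \<open>o'\<close>.\<close>

lemma borel_transitive:
 assumes ob: "ordered_basis rk C Ci" and z: "z \<in> \<D>"
 shows "\<exists>b \<in> generate G (Exp ` borel rk C Ci). p b base_point = z"
proof -
 interpret ordered_basis rk C Ci by fact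
 let ?B = "generate G (Exp ` (borel rk C Ci :: ('n, 'r) lie_matrix set))"
 have Bc: "b \<in> carrier G" if "b \<in> ?B" for b using generate_lie_exp_mem[OF _ that] borel_gtilde by blast
 have sy0: "(0 :: real^'n^'n) \<in> sym_real" by (rule subspace_0[OF subspace_sym_real])
 have gen: "Exp X \<in> ?B" if "X \<in> borel rk C Ci" for X using that by (intro generate.incl imageI)
 have inv_B: "inv b \<in> ?B" if "b \<in> ?B" for b
  using that generate_m_inv_closed borel_gtilde lie_exp_mem by (metis (no_types, lifting) image_subsetI)
 \<comment> \<open>The matrices, written in the basis \<open>C\<close>, whose action on the domain
   is realized by an element of the group; the elimination is carried out inside this set.\<close>
 define S where "S = {a. \<exists>b\<in>?B. \<forall>z\<in>\<D>.
  p b z = (cmat (C ** a ** Ci) ** fst z ** transpose (cmat (C ** a ** Ci)), cmat (C ** a ** Ci) ** snd z)}"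
 have S_mult: "a ** a' \<in> S" if "a \<in> S" "a' \<in> S" for a a'
 proof -
  from that obtain b b' where b: "b \<in> ?B" "\<forall>z\<in>\<D>.
    p b z = (cmat (C ** a ** Ci) ** fst z ** transpose (cmat (C ** a ** Ci)), cmat (C ** a ** Ci) ** snd z)"
   and b': "b' \<in> ?B" "\<forall>z\<in>\<D>.
    p b' z = (cmat (C ** a' ** Ci) ** fst z ** transpose (cmat (C ** a' ** Ci)), cmat (C ** a' ** Ci) ** snd z)"
   unfolding S_def by blast
  have e: "C ** (a ** a') ** Ci = (C ** a ** Ci) ** (C ** a' ** Ci)"
   by (simp add: matrix_mul_assoc[symmetric])
  have "p (b \<otimes> b') z = (cmat (C ** (a ** a') ** Ci) ** fst z ** transpose (cmat (C ** (a ** a') ** Ci)),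
    cmat (C ** (a ** a') ** Ci) ** snd z)" if "z \<in> \<D>" for z
  proof -
   have "p (b \<otimes> b') z = p b (p b' z)" using p_mult_apply[OF Bc[OF b(1)] Bc[OF b'(1)] that] .
   also have "\<dots> = (cmat (C ** a ** Ci) ** fst (p b' z) ** transpose (cmat (C ** a ** Ci)), cmat (C ** a ** Ci) ** snd (p b' z))"
    using b(2) p_mem[OF Bc[OF b'(1)] that] by blast
   finally show ?thesis unfolding e using b'(2) that
    by (simp add: cmat_mult matrix_transpose_mul matrix_mul_assoc)
  qed
  thus ?thesis using generate.eng[OF b(1) b'(1)] unfolding S_def by blast
 qed
 have path: "a 1 \<in> S" if up: "upper rk N" and a: "\<And>t. (a has_vector_derivative N ** a t) (at t)" and a0: "a 0 = mat 1" for a N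
 proof -
  have "((\<lambda>t. C ** a t ** Ci) has_vector_derivative C ** (N ** a t) ** Ci) (at t)" for t
   by (rule bounded_linear.has_vector_derivative[OF mm.bounded_linear_left])
    (rule bounded_linear.has_vector_derivative[OF mm.bounded_linear_right a])
  hence d: "((\<lambda>t. C ** a t ** Ci) has_vector_derivative (C ** N ** Ci) ** (C ** a t ** Ci)) (at t)" for t
   by (simp add: matrix_mul_assoc[symmetric])
  have X: "iota (C ** N ** Ci) 0 0 0 \<in> borel rk C Ci"
   using up by (intro borelI sy0) (simp add: matrix_mul_assoc[symmetric] Ci)
  have "p (Exp (iota (C ** N ** Ci) 0 0 0)) z
    = (cmat (C ** a 1 ** Ci) ** fst z ** transpose (cmat (C ** a 1 ** Ci)), cmat (C ** a 1 ** Ci) ** snd z)"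
   if "z \<in> \<D>" for z
   using p_lie_exp[OF borel_gtilde[OF X] that] flow_iota_T[OF d, of 1 "fst z" "snd z"] by (simp add: a0 C)
  thus ?thesis using gen[OF X] unfolding S_def by blast
 qed
 have S_elem: "mat 1 + N \<in> S" if "upper rk N" "N ** N = 0" for N
 proof -
  have "((\<lambda>t. mat 1 + t *\<^sub>R N) has_vector_derivative N) (at t)" for t by (auto intro!: derivative_eq_intros)
  hence "((\<lambda>t. mat 1 + t *\<^sub>R N) has_vector_derivative N ** (mat 1 + t *\<^sub>R N)) (at t)" for t
   by (simp add: mm.add_right mm.scaleR_right that(2))
  from path[OF that(1) this] show ?thesis by simp
 qed
 have S_diag: "(\<chi> i j. if i = j then exp (d i) else 0) \<in> S" for d
 proof -
  let ?N = "\<chi> i j. if i = j then d i else 0" and ?a = "\<lambda>t. \<chi> i j. if i = j then exp (t * d i) else 0"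
  have m: "?N ** ?a t = (\<chi> i j. if i = j then exp (t * d i) * d i else 0)" for t
   by (simp add: vec_eq_iff diag_mult mult.commute)
  have "(?a has_vector_derivative ?N ** ?a t) (at t)" for t unfolding m
   by (intro has_vector_derivative_diag) (auto intro!: derivative_eq_intros)
  moreover have "upper rk ?N" by (auto simp: upper_def)
  ultimately have "?a 1 \<in> S" by (intro path) (auto simp: vec_eq_iff mat_def)
  thus ?thesis by (simp cong: if_cong)
 qed
 \<comment> \<open>The elimination ends with the identity in the basis \<open>C\<close>, which is
   \<open>C\<close> times its transpose in the original coordinates.\<close>
 define o' :: "('n, 'r) point" where "o' = (\<i> *\<^sub>C cmat (C ** transpose C), 0)"
 have reach: "\<exists>b\<in>?B. p b w = o'" if w: "w \<in> \<D>" for w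
 proof -
  obtain Z V where wZ: "w = (Z, V)" by (cases w)
  obtain Y U where Y: "Y \<in> pos_def_matrices" and U: "U \<in> sym_real" and Z: "Z = cmat U + \<i> *\<^sub>C (cmat Y + Q V V)"
   using siegel_domain_decompose w wZ by blast
  let ?XU = "iota 0 0 0 (- U)" and ?XV = "iota 0 0 (- V) 0"
  have up0: "upper rk (0 :: real^'n^'n)" by (simp add: upper_def)
  have Us: "- U \<in> sym_real" using U by (rule subspace_neg[OF subspace_sym_real])
  have XU: "?XU \<in> borel rk C Ci" and XV: "?XV \<in> borel rk C Ci"
   using Us sy0 up0 by (auto simp: mm.zero_left mm.zero_right intro!: borelI)
  let ?bU = "Exp ?XU" and ?bV = "Exp ?XV"
  have 1: "p ?bV w = (cmat U + \<i> *\<^sub>C cmat Y, 0)" unfolding p_lie_exp[OF borel_gtilde[OF XV] w]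
   unfolding wZ flow_iota_V Z by (simp add: Q.minus_left Q.minus_right scaleC_add_right scaleC.minus_right)
    (simp add: vec_eq_iff)
  have w1: "p ?bV w \<in> \<D>" by (rule p_mem[OF Bc[OF gen[OF XV]] w])
  have 2: "p ?bU (p ?bV w) = (\<i> *\<^sub>C cmat Y, 0)" unfolding p_lie_exp[OF borel_gtilde[OF XU] w1]
   unfolding 1 flow_iota_U by (simp add: cm_neg)
  have w2: "p ?bU (p ?bV w) \<in> \<D>" by (rule p_mem[OF Bc[OF gen[OF XU]] w1])
  have "Ci ** Y ** transpose Ci \<in> pos_def_matrices" by (rule pos_def_congruence[OF Y C])
  from pos_def_elimination[OF S_mult S_elem S_diag this]
  obtain a where a: "a \<in> S" "a ** (Ci ** Y ** transpose Ci) ** transpose a = mat 1" by blast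
  then obtain b where b: "b \<in> ?B" "\<And>z. z\<in>\<D> ==>
    p b z = (cmat (C ** a ** Ci) ** fst z ** transpose (cmat (C ** a ** Ci)), cmat (C ** a ** Ci) ** snd z)"
   unfolding S_def by blast
  have CC: "(C ** a ** Ci) ** Y ** transpose (C ** a ** Ci) = C ** transpose C"
  proof -
   have "(C ** a ** Ci) ** Y ** transpose (C ** a ** Ci) = C ** (a ** (Ci ** Y ** transpose Ci) ** transpose a) ** transpose C"
    by (simp add: matrix_transpose_mul matrix_mul_assoc)
   thus ?thesis by (simp add: a(2))
  qed
  have "p b (p ?bU (p ?bV w)) = o'" unfolding b(2)[OF w2] unfolding 2 o'_def CC[symmetric]
   by (simp add: mm_scaleC_left mm_scaleC_right cmat_mult cmat_transpose mm.zero_right)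
  hence "p (b \<otimes> ?bU \<otimes> ?bV) w = o'" using p_mult_apply w1 w Bc b(1) gen[OF XU] gen[OF XV] by simp
  moreover have "b \<otimes> ?bU \<otimes> ?bV \<in> ?B" by (intro generate.eng b(1) gen XU XV)
  ultimately show ?thesis by blast
 qed
 obtain b where b: "b \<in> ?B" "p b z = o'" using reach[OF z] by blast
 obtain b' where b': "b' \<in> ?B" "p b' base_point = o'" using reach[OF base_point_siegel] by blast
 have "p (inv b \<otimes> b') base_point = z"
  using p_mult_apply[OF inv_closed[OF Bc[OF b(1)]] Bc[OF b'(1)] base_point_siegel] b'(2) b(2) p_inv_apply(1)[OF Bc[OF b(1)] z]
  by simp
 moreover have "inv b \<otimes> b' \<in> ?B" by (rule generate.eng[OF inv_B[OF b(1)] b'(1)])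
 ultimately show ?thesis by blast
qed

text \<open>A scalar matrix is upper triangular in every basis. The dilations detect the characters
  where the kernels are constant.\<close>

lemma borel_dilation:
 assumes ob: "ordered_basis rk C Ci"
 shows "Exp (iota (mat s) 0 0 0) \<in> generate G (Exp ` borel rk C Ci)"
proof -
 interpret ordered_basis rk C Ci by fact
 have "mat s = s *\<^sub>R (mat 1 :: real^'n^'n)" by (simp add: vec_eq_iff mat_def)
 hence "Ci ** mat s ** C = mat s" by (simp add: mm.scaleR_left mm.scaleR_right Ci)
 hence "upper rk (Ci ** mat s ** C)" by (simp add: upper_def mat_def)
 hence "(iota (mat s) 0 0 0 :: ('n, 'r) lie_matrix) \<in> borel rk C Ci"
  by (intro borelI subspace_0[OF subspace_sym_real])
 thus ?thesis by (intro generate.incl imageI)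
qed

end

section \<open>Unitary matrices as products of complex reflections\<close>

definition hp :: "complex^'r::finite => complex^'r => complex" where "hp x y = (\<Sum>i\<in>UNIV. x $ i * cnj (y $ i))"

lemma hp_simps:
 "hp (x + y) z = hp x z + hp y z" "hp (x - y) z = hp x z - hp y z" "hp (c *\<^sub>C x) z = c * hp x z"
 "hp x (y + z) = hp x y + hp x z" "hp x (y - z) = hp x y - hp x z" "hp x (c *\<^sub>C z) = cnj c * hp x z"
 by (simp_all add: hp_def algebra_simps sum.distrib sum_subtractf sum_distrib_left)

lemma cnj_hp: "cnj (hp x y) = hp y x" by (simp add: hp_def mult.commute)

lemma hp_self: "hp x x = complex_of_real ((norm x)\<^sup>2)"
 by (simp add: hp_def norm_vec_def L2_set_def sum_nonneg complex_norm_square del: of_real_power)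

lemma hp_adjoint: "hp (A *v x) y = hp x (adj A *v y)"
proof -
 have "hp (A *v x) y = (\<Sum>i\<in>UNIV. \<Sum>j\<in>UNIV. A $ i $ j * x $ j * cnj (y $ i))"
  by (simp add: hp_def matrix_vector_mult_def sum_distrib_right)
 also have "\<dots> = (\<Sum>j\<in>UNIV. \<Sum>i\<in>UNIV. A $ i $ j * x $ j * cnj (y $ i))" by (rule sum.swap)
 also have "\<dots> = hp x (adj A *v y)"
  by (simp add: hp_def matrix_vector_mult_def sum_distrib_left adjoint_matrix_def transpose_def mult_ac)
 finally show ?thesis .
qed

lemma adjoint_mult: "adj (A ** B) = adj B ** adj A"
 by (simp add: adjoint_matrix_def map_cnj_mult matrix_transpose_mul)

lemma adjoint_adjoint [simp]: "adj (adj A) = A" by (simp add: adjoint_matrix_def transpose_def vec_eq_iff)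

lemma adjoint_mat: "adj (mat c) = mat (cnj c)"
 by (simp add: adjoint_matrix_def transpose_def vec_eq_iff mat_def)

lemma adjoint_scaleC: "adj (c *\<^sub>C A) = cnj c *\<^sub>C adj A"
 by (simp add: adjoint_matrix_def transpose_def vec_eq_iff)

lemma adjoint_add: "adj (A + B) = adj A + adj B" by (simp add: adjoint_matrix_def transpose_def vec_eq_iff)

lemma unitary_commute: "adj A ** A = mat 1 ==> A ** adj A = mat 1" for A :: "complex^'r::finite^'r"
 using matrix_left_right_inverse by blast

definition refl_proj :: "complex^'r::finite => complex^'r^'r"
 where "refl_proj v = (\<chi> i j. v $ i * cnj (v $ j))"

text \<open>For a unit vector \<open>v\<close>: multiplication by \<open>l\<close> on the line of
  \<open>v\<close> and the identity on its orthogonal complement.\<close>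

definition complex_refl :: "complex^'r::finite => complex => complex^'r^'r"
 where "complex_refl v l = mat 1 + (l - 1) *\<^sub>C refl_proj v"

lemma refl_proj_square:
 assumes "hp v v = 1"
 shows "refl_proj v ** refl_proj v = refl_proj v"
proof -
 have "(refl_proj v ** refl_proj v) $ i $ j = v $ i * hp v v * cnj (v $ j)" for i j
  by (simp add: refl_proj_def hp_def matrix_matrix_mult_def sum_distrib_left sum_distrib_right mult_ac)
 thus ?thesis by (simp add: vec_eq_iff assms refl_proj_def)
qed

lemma adjoint_refl_proj: "adj (refl_proj v) = refl_proj v"
 by (simp add: refl_proj_def adjoint_matrix_def transpose_def vec_eq_iff mult.commute)

lemma trace_refl_proj: "trace (refl_proj v) = hp v v" by (simp add: trace_def refl_proj_def hp_def)

lemma refl_proj_apply: "refl_proj v *v x = hp x v *\<^sub>C v"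
 by (simp add: refl_proj_def hp_def vec_eq_iff matrix_vector_mult_def sum_distrib_left sum_distrib_right mult_ac)

lemma mat_1_mult_complex [simp]: "mat 1 ** (A :: complex^'b::finite^'a::finite) = A" "A ** mat 1 = A"
 by simp_all

lemma complex_refl_mult:
 assumes "hp v v = 1"
 shows "complex_refl v l ** complex_refl v m = complex_refl v (l * m)"
 by (simp add: complex_refl_def mm.add_left mm.add_right mm_scaleC_left mm_scaleC_right refl_proj_square[OF assms])
  (simp add: vec_eq_iff algebra_simps)

lemma complex_refl_1 [simp]: "complex_refl v 1 = mat 1" by (simp add: complex_refl_def scaleC.zero_left)

lemma adjoint_complex_refl: "adj (complex_refl v l) = complex_refl v (cnj l)"
 by (simp add: complex_refl_def adjoint_add adjoint_mat adjoint_scaleC adjoint_refl_proj)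

lemma complex_refl_apply: "complex_refl v l *v x = x + ((l - 1) * hp x v) *\<^sub>C v"
 by (simp add: complex_refl_def mv.add_left mv_scaleC_left refl_proj_apply scaleC_scaleC)

text \<open>The reflection is taken along \<open>w = A x - x\<close>. A vector fixed by
  \<open>A\<close> has the same product with \<open>A x\<close> and with \<open>x\<close>, so it is
  orthogonal to \<open>w\<close> and stays fixed.\<close>

lemma unitary_reflection_step:
 fixes A :: "complex^'r::finite^'r"
 assumes A: "adj A ** A = mat 1" and ne: "A *v x \<noteq> x"
 obtains u l where "hp u u = 1" "cmod l = 1" "complex_refl u l *v (A *v x) = x"
  "\<And>y. A *v y = y ==> complex_refl u l *v y = y"
proof -
 have iso: "hp (A *v y) (A *v z) = hp y z" for y z by (simp add: hp_adjoint matrix_vector_mul_assoc A)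
 define y where "y = A *v x"
 define w where "w = y - x"
 have w0: "norm w \<noteq> 0" using ne by (simp add: w_def y_def)
 define u where "u = complex_of_real (inverse (norm w)) *\<^sub>C w"
 have u: "hp u u = 1" using w0 unfolding u_def hp_simps hp_self[of w] by (simp add: power2_eq_square field_simps)
 have yy: "hp y y = hp x x" by (simp add: y_def iso)
 have cm: "cmod (hp x w) = cmod (hp y w)"
 proof -
  have "hp y w = - cnj (hp x w)" by (simp add: w_def hp_simps yy cnj_hp)
  thus ?thesis by simp
 qed
 have ww: "hp w w = hp y w - hp x w" by (simp add: w_def hp_simps)
 have yw: "hp y w \<noteq> 0"
 proof
  assume "hp y w = 0"
  hence "hp w w = 0" using cm ww by simp
  thus False using w0 by (simp add: hp_self)
 qed
 \<comment> \<open>Chosen so that the component of \<open>y\<close> along \<open>w\<close> becomes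
   that of \<open>x\<close>. Its modulus is 1 because \<open>x\<close> and \<open>y\<close> have the
   same length.\<close>
 define l where "l = hp x w / hp y w"
 have l: "cmod l = 1" using cm yw by (simp add: l_def norm_divide)
 have "((l - 1) * hp y u) *\<^sub>C u = ((l - 1) * hp y w / hp w w) *\<^sub>C w"
  using w0 unfolding u_def hp_simps hp_self[of w] scaleC_scaleC by (simp add: power2_eq_square field_simps)
 also have "(l - 1) * hp y w / hp w w = - 1"
 proof -
  have "(l - 1) * hp y w = - hp w w" using yw by (simp add: l_def ww field_simps)
  thus ?thesis using w0 by (simp add: hp_self)
 qed
 finally have "complex_refl u l *v y = x" by (simp add: complex_refl_apply w_def scaleC.minus_left)
 hence xy: "complex_refl u l *v (A *v x) = x" by (simp add: y_def)
 have "complex_refl u l *v z = z" if "A *v z = z" for z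
 proof -
  have "hp z w = 0" using iso[of z x] that by (simp add: w_def y_def hp_simps)
  thus ?thesis by (simp add: complex_refl_apply u_def hp_simps scaleC.zero_left)
 qed
 with u l xy show ?thesis by (rule that)
qed

text \<open>An argument of Cartan-Dieudonne type: multiplying by a suitable reflection enlarges the
  space of fixed vectors, so the induction runs over its real codimension.\<close>

lemma unitary_reflections:
 fixes A :: "complex^'r::finite^'r"
 assumes one: "mat 1 \<in> S" and mult: "\<And>a b. a \<in> S ==> b \<in> S ==> a ** b \<in> S"
  and refl: "\<And>v l. hp v v = 1 ==> cmod l = 1 ==> complex_refl v l \<in> S" and A: "adj A ** A = mat 1"
 shows "A \<in> S" using A
proof (induction "DIM(complex^'r) - dim {x. A *v x = x}" arbitrary: A rule: less_induct)
 case less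
 show ?case
 proof (cases "A = mat 1")
  case True
  thus ?thesis using one by simp
 next
  case False
  then obtain x where x: "A *v x \<noteq> x" by (auto simp: matrix_eq)
  from unitary_reflection_step[OF less.prems this]
  obtain u l where u: "hp u u = 1" and l: "cmod l = 1" and Rx: "complex_refl u l *v (A *v x) = x"
   and Rf: "\<And>y. A *v y = y ==> complex_refl u l *v y = y" by blast
  define R where "R = complex_refl u l"
  have ll: "cnj l * l = 1" using l by (metis complex_norm_square mult.commute of_real_1 one_power2)
  have "adj R ** R = mat 1" by (simp add: R_def adjoint_complex_refl complex_refl_mult u ll)
  hence RA: "adj (R ** A) ** (R ** A) = mat 1" by (simp add: adjoint_mult matrix_mul_assoc[symmetric])
    (simp add: matrix_mul_assoc less.prems)
  have sub: "subspace {x. B *v x = x}" for B :: "complex^'r^'r"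
   by (auto simp: subspace_def mv.add_right mv.scaleR_right)
  have "{x. A *v x = x} \<subset> {x. (R ** A) *v x = x}"
   using x Rx Rf by (auto simp: R_def matrix_vector_mul_assoc[symmetric])
  hence "dim {x. A *v x = x} < dim {x. (R ** A) *v x = x}"
   by (intro dim_psubset) (simp add: span_eq_iff[THEN iffD2, OF sub])
  moreover have "dim {x. (R ** A) *v x = x} \<le> DIM(complex^'r)" by (rule dim_subset_UNIV)
  ultimately have "R ** A \<in> S" by (intro less.hyps RA) linarith
  moreover have "complex_refl u (cnj l) \<in> S" by (rule refl[OF u]) (simp add: l)
  ultimately have "complex_refl u (cnj l) ** (R ** A) \<in> S" by (rule mult[rotated])
  thus ?thesis by (simp add: matrix_mul_assoc R_def complex_refl_mult u ll)
 qed
qed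

section \<open>The characters and the projection to the special unitary group\<close>

lemma matrix_ode_unique:
 fixes P R :: "real => complex^'r::finite^'r"
 assumes P: "\<And>t. (P has_vector_derivative D ** P t) (at t)" and R: "\<And>t. (R has_vector_derivative D ** R t) (at t)"
  and 0: "P 0 = R 0"
 shows "P t = R t"
proof -
 have app: "app (endo ((**) D)) M = D ** M" for M :: "complex^'r^'r"
  by (rule app_endo) (rule mm.bounded_linear_right)
 have "P t = app (exp (t *\<^sub>R endo ((**) D))) (P 0)" by (rule linear_ode_unique) (simp add: app P)
 moreover have "R t = app (exp (t *\<^sub>R endo ((**) D))) (R 0)" by (rule linear_ode_unique) (simp add: app R)
 ultimately show ?thesis by (simp add: 0)
qed

lemma adjoint_neg_trace: "K \<in> skew_hermitian ==> trace K = \<i> * complex_of_real (Im (trace K))"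
proof -
 assume "K \<in> skew_hermitian"
 hence "cnj (K $ i $ i) = - K $ i $ i" for i
  by (auto simp: skew_hermitian_def adjoint_matrix_def transpose_def vec_eq_iff)
 hence "cnj (trace K) = - trace K" by (simp add: trace_def sum_negf)
 thus ?thesis by (simp add: complex_eq_iff)
qed

abbreviation E1 :: "real => ('n::finite, 'r::finite) lie_matrix" where "E1 a \<equiv> iota (mat a) 0 0 0"
abbreviation E2 :: "real => ('n::finite, 'r::finite) lie_matrix" where "E2 a \<equiv> iota 0 (mat (\<i> * complex_of_real a)) 0 0"

lemma skew_hermitian_mat: "mat (\<i> * complex_of_real a) \<in> skew_hermitian"
 by (simp add: skew_hermitian_def adjoint_mat) (simp add: vec_eq_iff mat_def)

lemma zero_skew_sym: "0 \<in> skew_hermitian" "0 \<in> sym_real"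
 using subspace_0[OF subspace_skew_hermitian] subspace_0[OF subspace_sym_real] .

lemma E1_gtilde: "E1 a \<in> gtilde" and E2_gtilde: "E2 a \<in> gtilde"
 by (auto intro!: iota_gtilde zero_skew_sym skew_hermitian_mat)

lemma iota_K_gtilde: "K \<in> skew_hermitian ==> iota 0 K 0 0 \<in> gtilde" by (intro iota_gtilde zero_skew_sym)

lemma E1_scaleR: "t *\<^sub>R E1 a = (E1 (t * a) :: ('n::finite, 'r::finite) lie_matrix)"
 and E2_scaleR: "t *\<^sub>R E2 a = (E2 (t * a) :: ('n, 'r) lie_matrix)"
proof -
 have "t *\<^sub>R mat a = (mat (t * a) :: real^'n^'n)" "t *\<^sub>R mat (\<i> * complex_of_real a) = (mat (\<i> * complex_of_real (t * a)) :: complex^'r^'r)"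
  by (simp_all add: vec_eq_iff mat_def complex_eq_iff)
 thus "t *\<^sub>R E1 a = (E1 (t * a) :: ('n::finite, 'r::finite) lie_matrix)" "t *\<^sub>R E2 a = (E2 (t * a) :: ('n, 'r) lie_matrix)"
  by (simp_all only: iota_scaleR scaleR_zero_right)
qed

lemma iota_zero: "iota 0 0 0 0 = 0" using iota_scaleR[of 0 0 0 0 0] by simp

lemma flow_E1:
 fixes Z :: "complex^'n::finite^'n" and V :: "complex^'r::finite^'n"
 shows "flow (E1 a) t (Z, V) = (complex_of_real (exp (2 * t * a)) *\<^sub>C Z, complex_of_real (exp (t * a)) *\<^sub>C V)"
proof -
 have d: "((\<lambda>t. exp (t * a) *\<^sub>R mat 1) has_vector_derivative mat a ** (exp (t * a) *\<^sub>R mat 1 :: real^'n^'n)) (at t)" for t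
 proof -
  have "mat a = a *\<^sub>R (mat 1 :: real^'n^'n)" by (simp add: vec_eq_iff mat_def)
  hence "mat a ** (exp (t * a) *\<^sub>R mat 1 :: real^'n^'n) = (exp (t * a) * a) *\<^sub>R mat 1"
   by (simp add: mm.scaleR_left mm.scaleR_right mult.commute)
  thus ?thesis
   by (simp, intro has_vector_derivative_scaleR[where g' = 0, simplified] derivative_eq_intros refl) auto
 qed
 have "cmat (exp (t * a) *\<^sub>R mat 1 :: real^'n^'n) = complex_of_real (exp (t * a)) *\<^sub>C mat 1"
  by (simp add: vec_eq_iff mat_def)
 thus ?thesis
  by (simp add: flow_iota_T[OF d] mm_scaleC_left mm_scaleC_right transpose_scaleC transpose_mat scaleC_scaleC)
   (simp add: mult_exp_exp mult_ac flip: of_real_mult)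
qed

lemma flow_E2:
 fixes Z :: "complex^'n::finite^'n" and V :: "complex^'r::finite^'n"
 shows "flow (E2 a) t (Z, V) = (Z, exp (t *\<^sub>R (- (\<i> * complex_of_real a))) *\<^sub>C V)"
proof -
 let ?c = "- (\<i> * complex_of_real a)"
 let ?g = "\<lambda>t. (Z, exp (t *\<^sub>R ?c) *\<^sub>C V)"
 have "((\<lambda>t. exp (t *\<^sub>R ?c) *\<^sub>C V) has_vector_derivative (exp (t *\<^sub>R ?c) * ?c) *\<^sub>C V) (at t)" for t
  by (rule bounded_linear.has_vector_derivative[OF scaleC.bounded_linear_left exp_scaleR_has_vector_derivative_right])
 moreover have "(exp (t *\<^sub>R ?c) * ?c) *\<^sub>C V = - ((exp (t *\<^sub>R ?c) *\<^sub>C V) ** mat (\<i> * complex_of_real a))" for t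
 proof -
  have m: "mat (\<i> * complex_of_real a) = ((- ?c) *\<^sub>C mat 1 :: complex^'r^'r)" by (simp add: vec_eq_iff mat_def)
  show ?thesis unfolding m by (simp add: mm_scaleC_left mm_scaleC_right scaleC_scaleC scaleC.minus_left mult.commute)
 qed
 ultimately have "(?g has_vector_derivative (0, - ((exp (t *\<^sub>R ?c) *\<^sub>C V) ** mat (\<i> * complex_of_real a)))) (at t)" for t
  by (intro has_vector_derivative_Pair) auto
 hence "(?g has_vector_derivative field (E2 a) (?g t)) (at t)" for t
  by (simp add: lie_vector_field_def cm_zero mm.zero_left mm.zero_right tr_zero Q.zero_right scaleC.zero_right)
 from flow_unique[OF this] show ?thesis by simp
qed

lemma flow_isotropy: "flow (iota 0 K 0 0) t base_point = (base_point :: ('n::finite, 'r::finite) point)"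
proof -
 have "((\<lambda>t. base_point :: ('n, 'r) point) has_vector_derivative field (iota 0 K 0 0) base_point) (at t)" for t
  by (simp add: base_point_def lie_vector_field_def cm_zero mm.zero_left mm.zero_right tr_zero Q.zero_right scaleC.zero_right
    flip: zero_prod_def)
 from flow_unique[OF this] show ?thesis by metis
qed

locale siegel_projections = siegel_cover G T p for G :: "'g monoid" (structure) and T :: "'g topology"
  and p :: "'g => ('n::finite, 'r::finite) point => ('n, 'r) point" +
 fixes p11 p21 :: "'g => 'g" and p2 :: "'g => complex^'r^'r"
 assumes p11: "is_p11 G T p p11" and p21: "is_p21 G T p p21" and p2: "is_p2 G T p p2"
begin

abbreviation "tau \<equiv> tau_rep G T p p11"
abbreviation "prep \<equiv> pi_rep G T p p11 p21 p2"

lemma p11_mult: "g \<in> carrier G ==> h \<in> carrier G ==> p11 (g \<otimes> h) = p11 g \<otimes> p11 h"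
 and p11_mem: "g \<in> carrier G ==> p11 g \<in> Exp ` z1" using p11 by (auto simp: is_p11_def hom_def)

lemma p21_mult: "g \<in> carrier G ==> h \<in> carrier G ==> p21 (g \<otimes> h) = p21 g \<otimes> p21 h"
 and p21_mem: "g \<in> carrier G ==> p21 g \<in> Exp ` z2" using p21 by (auto simp: is_p21_def hom_def)

lemma p2_mult: "g \<in> carrier G ==> h \<in> carrier G ==> p2 (g \<otimes> h) = p2 g ** p2 h"
 and p2_SU: "g \<in> carrier G ==> p2 g \<in> carrier SU" using p2 by (auto simp: is_p2_def hom_def SU_def)

lemma p11_lie_exp: "K \<in> skew_hermitian ==> U \<in> sym_real ==>
  p11 (Exp (iota S K V U)) = Exp (E1 (trace S / real CARD('n)))" using p11 by (simp add: is_p11_def)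

lemma p21_lie_exp: "K \<in> skew_hermitian ==> U \<in> sym_real ==>
  p21 (Exp (iota S K V U)) = Exp (E2 (Im (trace K) / real CARD('r)))"
proof -
 assume K: "K \<in> skew_hermitian" and U: "U \<in> sym_real"
 have "trace K / of_nat CARD('r) = \<i> * complex_of_real (Im (trace K) / real CARD('r))"
  by (subst adjoint_neg_trace[OF K]) simp
 thus ?thesis using p21 K U by (simp add: is_p21_def)
qed

lemma lie_exp_E1_add: "Exp (E1 (a + b)) = Exp (E1 a) \<otimes> Exp (E1 b)"
 using lie_exp_add[OF E1_gtilde[of 1], of a b] by (simp add: E1_scaleR)

lemma lie_exp_E2_add: "Exp (E2 (a + b)) = Exp (E2 a) \<otimes> Exp (E2 b)"
 using lie_exp_add[OF E2_gtilde[of 1], of a b] unfolding E2_scaleR by simp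

text \<open>Different dilations already act differently on the base point, which they multiply by
  \<open>exp (2 a)\<close>.\<close>

lemma lie_exp_E1_inject: "Exp (E1 a) = Exp (E1 b) \<longleftrightarrow> a = b"
proof
 assume "Exp (E1 a) = Exp (E1 b)"
 hence "flow (E1 a) 1 base_point = (flow (E1 b) 1 base_point :: ('n, 'r) point)"
  using p_lie_exp[OF E1_gtilde base_point_siegel] by metis
 hence "complex_of_real (exp (2 * a)) *\<^sub>C (mat \<i> :: complex^'n^'n) = complex_of_real (exp (2 * b)) *\<^sub>C mat \<i>"
  by (simp add: base_point_def flow_E1)
 hence "(complex_of_real (exp (2 * a)) *\<^sub>C (mat \<i> :: complex^'n^'n)) $ i $ i = (complex_of_real (exp (2 * b)) *\<^sub>C mat \<i>) $ i $ i" for i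
  by simp
 thus "a = b" by (simp add: mat_def)
qed simp

text \<open>A period of the exponential map on \<open>z2\<close> would give a loop in the simply connected group whose
 image under a coordinate of \<open>p \<circ> p21\<close> winds around zero.\<close>

lemma lie_exp_E2_inject: "Exp (E2 a) = Exp (E2 b) \<longleftrightarrow> a = b"
proof
 assume eq: "Exp (E2 a) = Exp (E2 b)"
 define c where "c = a - b"
 have "Exp (E2 c) \<otimes> Exp (E2 b) = \<one> \<otimes> Exp (E2 b)"
  using lie_exp_E2_add[of c b] eq by (simp add: c_def lie_exp_mem E2_gtilde)
 hence c1: "Exp (E2 c) = \<one>" by (simp add: lie_exp_mem E2_gtilde)
 \<comment> \<open>Any matrix with a nonzero entry at the observed position serves.\<close>
 define W :: "complex^'r^'n" where "W = (\<chi> i j. 1)"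
 obtain d where z0: "(mat (\<i> * complex_of_real d), W) \<in> \<D>" using sym_points_scaled_base by blast
 \<comment> \<open>Equal to \<open>exp (- i x)\<close> where \<open>p21 g = Exp (E2 x)\<close>.
   Composition with \<open>p21\<close> makes it nonzero on the whole group, so the homotopy of the
   loop avoids 0.\<close>
 define f where "f g = snd (p (p21 g) (mat (\<i> * complex_of_real d), W)) $ undefined $ undefined" for g
 have fE: "f g = exp (- (\<i> * complex_of_real x))" if "p21 g = Exp (E2 x)" for g x
  unfolding f_def that p_lie_exp[OF E2_gtilde z0] flow_E2 by (simp add: W_def)
 have "continuous_map T T p21" using p21 by (simp add: is_p21_def)
 from continuous_map_compose[OF this continuous_p_apply[OF z0]]
 have "continuous_map T euclidean (\<lambda>g. p (p21 g) (mat (\<i> * complex_of_real d), W))" by (simp add: o_def)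
 moreover have "continuous_map euclidean euclidean (\<lambda>z::('n, 'r) point. snd z $ undefined $ undefined)"
  by (simp add: continuous_map_iff_continuous2) (intro continuous_intros)
 ultimately have cf: "continuous_map T euclidean f" unfolding f_def by (rule continuous_map_compose[unfolded o_def])
 have f0: "f g \<noteq> 0" if g: "g \<in> carrier G" for g
 proof -
  obtain x where "p21 g = Exp (E2 x)" using p21_mem[OF g] by (auto simp: z2_def)
  thus ?thesis by (simp add: fE)
 qed
 have cf0: "continuous_map T (top_of_set (- {0})) f"
  using cf f0 topspace_T by (auto simp: continuous_map_in_subtopology)
 define q where "q = one_param (E2 c)"
 have qE: "q u = Exp (E2 (u * c))" for u
  unfolding q_def using lie_exp_scaleR[OF E2_gtilde, of u c] by (simp only: E2_scaleR)
 have pq: "p21 (q u) = Exp (E2 (u * c))" for u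
  unfolding qE p21_lie_exp[OF skew_hermitian_mat zero_skew_sym(2)] by (simp add: trace_def mat_def)
 have "continuous_map euclideanreal T q" unfolding q_def by (rule one_param_props(1)[OF E2_gtilde])
 hence "pathin T q" by (simp add: pathin_def continuous_map_from_subtopology)
 moreover have "q 0 = q 1" using c1 by (simp add: qE) (simp add: lie_exp_zero iota_zero)
 ultimately obtain g0 where g0: "g0 \<in> carrier G"
  "homotopic_with (\<lambda>h. h 0 = h 1) (top_of_set {0..1::real}) T q (\<lambda>_. g0)"
  using simply_connected topspace_T unfolding simply_connected_space_def by blast
 have "homotopic_loops (- {0}) (f \<circ> q) (f \<circ> (\<lambda>_. g0))" unfolding homotopic_loops_def
  by (rule homotopic_with_compose_continuous_map_left[OF g0(2) cf0]) (simp add: pathfinish_def pathstart_def)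
 hence "winding_number (f \<circ> q) 0 = winding_number (\<lambda>_. f g0) 0"
  using winding_number_homotopic_loops by (simp add: o_def)
 also have "\<dots> = 0" by (rule winding_number_zero_const[OF f0[OF g0(1)]])
 finally have w0: "winding_number (f \<circ> q) 0 = 0" .
 have "f \<circ> q = exp \<circ> (\<lambda>u. - (\<i> * complex_of_real (u * c)))" by (rule ext) (simp add: fE[OF pq])
 moreover have "path (\<lambda>u. - (\<i> * complex_of_real (u * c)))" unfolding path_def by (intro continuous_intros)
 ultimately have "c = 0" using w0 by (simp add: winding_number_compose_exp pathfinish_def pathstart_def)
 thus "a = b" by (simp add: c_def)
qed simp

text \<open>Well defined by the injectivity on \<open>z1\<close> and \<open>z2\<close>. Both are
  additive on the group, so every character in question is the exponential of a combination of
  them.\<close>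

definition x1 :: "'g => real" where "x1 g = (THE x. p11 g = Exp (E1 x))"
definition x2 :: "'g => real" where "x2 g = (THE x. p21 g = Exp (E2 x))"

lemma x1_eqI: "p11 g = Exp (E1 x) ==> x1 g = x" by (simp add: x1_def lie_exp_E1_inject)

lemma x2_eqI: "p21 g = Exp (E2 x) ==> x2 g = x" by (simp add: x2_def lie_exp_E2_inject)

lemma p11_x1: "g \<in> carrier G ==> p11 g = Exp (E1 (x1 g))" using p11_mem[of g] x1_eqI by (auto simp: z1_def)

lemma p21_x2: "g \<in> carrier G ==> p21 g = Exp (E2 (x2 g))" using p21_mem[of g] x2_eqI by (auto simp: z2_def)

lemma x1_mult: "g \<in> carrier G ==> h \<in> carrier G ==> x1 (g \<otimes> h) = x1 g + x1 h"
 by (rule x1_eqI) (simp only: p11_mult p11_x1 lie_exp_E1_add)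

lemma x2_mult: "g \<in> carrier G ==> h \<in> carrier G ==> x2 (g \<otimes> h) = x2 g + x2 h"
 by (rule x2_eqI) (simp only: p21_mult p21_x2 lie_exp_E2_add)

lemma x1_lie_exp: "K \<in> skew_hermitian ==> U \<in> sym_real ==> x1 (Exp (iota S K V U)) = trace S / real CARD('n)"
 by (rule x1_eqI) (rule p11_lie_exp)

lemma x2_lie_exp: "K \<in> skew_hermitian ==> U \<in> sym_real ==>
  x2 (Exp (iota S K V U)) = Im (trace K) / real CARD('r)" by (rule x2_eqI) (rule p21_lie_exp)

lemma cpower_z1:
 assumes c: "c \<in> complex_dual z1" and g: "g \<in> carrier G"
 shows "cpower G T p z1 (p11 g) c = exp (x1 g *\<^sub>R c (E1 1))"
proof -
 have inj: "inj_on (Exp) z1" by (auto simp: inj_on_def z1_def lie_exp_E1_inject)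
 have m: "E1 x \<in> z1" for x by (auto simp: z1_def)
 have "c (x1 g *\<^sub>R E1 1) = x1 g *\<^sub>R c (E1 1)" using c m unfolding complex_dual_def by blast
 thus ?thesis by (simp add: cpower_def p11_x1[OF g] inv_into_f_f[OF inj m] E1_scaleR)
qed

lemma cpower_z2:
 assumes c: "c \<in> complex_dual z2" and g: "g \<in> carrier G"
 shows "cpower G T p z2 (p21 g) c = exp (x2 g *\<^sub>R c (E2 1))"
proof -
 have inj: "inj_on (Exp) z2" unfolding inj_on_def z2_def by (auto simp only: mem_Collect_eq lie_exp_E2_inject)
 have m: "E2 x \<in> z2" for x by (auto simp: z2_def)
 have "c (x2 g *\<^sub>R E2 1) = x2 g *\<^sub>R c (E2 1)" using c m unfolding complex_dual_def by blast
 hence "c (E2 (x2 g)) = x2 g *\<^sub>R c (E2 1)" unfolding E2_scaleR by simp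
 thus ?thesis unfolding cpower_def p21_x2[OF g] inv_into_f_f[OF inj m] by simp
qed

text \<open>The differential is prescribed at 0 only; the homomorphism property carries it to every
  \<open>t\<close>.\<close>

lemma p2_one_parameter:
 fixes S :: "real^'n^'n" and V :: "complex^'r^'n"
 assumes K: "K \<in> skew_hermitian" and U: "U \<in> sym_real" defines "P \<equiv> \<lambda>t. p2 (Exp (t *\<^sub>R iota S K V U))"
 shows "(P has_vector_derivative (K - mat (trace K / of_nat CARD('r))) ** P t) (at t)" and "P 0 = mat 1"
proof -
 have X: "iota S K V U \<in> gtilde" by (rule iota_gtilde[OF K U])
 have add: "P (s + t) = P s ** P t" for s t
  unfolding P_def lie_exp_add[OF X] by (intro p2_mult lie_exp_mem subspace_scale[OF subspace_gtilde X])
 have "((\<lambda>s. s + - t) has_vector_derivative 1) (at t)" by (auto intro!: derivative_eq_intros)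
 moreover have "(P has_vector_derivative (K - mat (trace K / of_nat CARD('r)))) (at (t + - t))"
  using p2 K U by (simp add: is_p2_def P_def)
 ultimately have "((\<lambda>s. P (s + - t)) has_vector_derivative (K - mat (trace K / of_nat CARD('r)))) (at t)"
  by (rule vector_diff_chain_at[unfolded o_def, where f' = 1, simplified])
 hence "((\<lambda>s. P (s + - t) ** P t) has_vector_derivative (K - mat (trace K / of_nat CARD('r))) ** P t) (at t)"
  by (rule bounded_linear.has_vector_derivative[OF mm.bounded_linear_left])
 moreover have "P (s + - t) ** P t = P s" for s unfolding add[symmetric] by simp
 ultimately show "(P has_vector_derivative (K - mat (trace K / of_nat CARD('r))) ** P t) (at t)" by simp
 \<comment> \<open>An idempotent unitary matrix is the identity.\<close>
 have "P 0 ** P 0 = P 0" using add[of 0 0] by simp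
 moreover have "adj (P 0) ** P 0 = mat 1"
  using p2_SU[OF lie_exp_mem[OF subspace_scale[OF subspace_gtilde X]], of 0] by (simp add: P_def SU_def)
 ultimately show "P 0 = mat 1" by (metis matrix_mul_assoc mat_1_mult_complex(1))
qed

text \<open>The right-hand side solves the linear equation of the one-parameter group with the same
  initial value. Its scalar factor \<open>cis (- (t / r))\<close> comes from removing the trace of
  \<open>i\<close> times the projection, and it makes the determinant 1.\<close>

lemma p2_reflection:
 assumes v: "hp v v = 1" defines "X \<equiv> (iota 0 (\<i> *\<^sub>C refl_proj v) 0 0 :: ('n, 'r) lie_matrix)"
 shows "p2 (Exp (t *\<^sub>R X)) = cis (- (t / real CARD('r))) *\<^sub>C complex_refl v (cis t)"
proof -
 let ?r = "of_nat CARD('r) :: complex" and ?P = "refl_proj v"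
 let ?u = "\<lambda>t. exp (t *\<^sub>R (- \<i> / ?r))" and ?v = "\<lambda>t. exp (t *\<^sub>R (\<i> - \<i> / ?r))"
 let ?R = "\<lambda>t. ?u t *\<^sub>C mat 1 + (?v t - ?u t) *\<^sub>C ?P"
 have K: "\<i> *\<^sub>C ?P \<in> skew_hermitian"
  by (simp add: skew_hermitian_def adjoint_scaleC adjoint_refl_proj scaleC.minus_left)
 have tr: "trace (\<i> *\<^sub>C ?P) = \<i>" using trace_refl_proj[of v] v by (simp add: trace_def flip: sum_distrib_left)
 let ?D = "\<i> *\<^sub>C ?P - mat (\<i> / ?r)"
 have D: "?D = \<i> *\<^sub>C ?P - (\<i> / ?r) *\<^sub>C mat 1" by (simp add: vec_eq_iff mat_def)
 have P: "((\<lambda>t. p2 (Exp (t *\<^sub>R X))) has_vector_derivative ?D ** p2 (Exp (t *\<^sub>R X))) (at t)" for t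
  using p2_one_parameter(1)[OF K zero_skew_sym(2), of 0 0] unfolding X_def tr .
 have P0: "p2 (Exp (0 *\<^sub>R X)) = mat 1"
  using p2_one_parameter(2)[OF K zero_skew_sym(2), of 0 0] unfolding X_def .
 have "(?R has_vector_derivative (?u t * (- \<i> / ?r)) *\<^sub>C mat 1
   + (?v t * (\<i> - \<i> / ?r) - ?u t * (- \<i> / ?r)) *\<^sub>C ?P) (at t)" for t
  by (intro has_vector_derivative_add has_vector_derivative_diff exp_scaleR_has_vector_derivative_right
    bounded_linear.has_vector_derivative[OF scaleC.bounded_linear_left])
 moreover have "(?u t * (- \<i> / ?r)) *\<^sub>C mat 1 + (?v t * (\<i> - \<i> / ?r) - ?u t * (- \<i> / ?r)) *\<^sub>C ?P = ?D ** ?R t" for t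
 proof -
  have prod: "(\<i> *\<^sub>C ?P - c *\<^sub>C mat 1) ** (u *\<^sub>C mat 1 + (w - u) *\<^sub>C ?P)
    = (u * - c) *\<^sub>C mat 1 + (w * (\<i> - c) - u * - c) *\<^sub>C ?P" for u w c
   unfolding mm.diff_left mm.add_right mm_scaleC_left mm_scaleC_right refl_proj_square[OF v] mat_1_mult_complex
   by (simp add: vec_eq_iff algebra_simps)
  show ?thesis unfolding D prod by simp
 qed
 ultimately have R: "(?R has_vector_derivative ?D ** ?R t) (at t)" for t by (simp only:)
 have "p2 (Exp (t *\<^sub>R X)) = ?R t"
  by (rule matrix_ode_unique[OF P R]) (simp add: P0[simplified] scaleC.zero_left)
 also have "?u t = cis (- (t / real CARD('r)))" by (simp add: cis_conv_exp scaleR_conv_of_real mult.commute)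
 also have "?v t = cis (- (t / real CARD('r))) * cis t"
  by (simp add: cis_conv_exp scaleR_conv_of_real algebra_simps flip: exp_add)
 finally show ?thesis by (simp add: complex_refl_def scaleC_add_right scaleC_scaleC algebra_simps)
qed

text \<open>Up to phases the elements at hand include all complex reflections, so every unitary
  matrix is a phase times a member of \<open>S0\<close>. If the determinant is 1, the phase is a
  root of unity of order dividing \<open>r\<close>, and such scalars can be produced as
  well.\<close>

lemma SU_isotropy_generated:
 assumes one: "mat 1 \<in> S" and mult: "\<And>a b. a \<in> S ==> b \<in> S ==> a ** b \<in> S"
  and gen: "\<And>K. K \<in> skew_hermitian ==> p2 (Exp (iota 0 K 0 0)) \<in> S" and A: "A \<in> carrier SU"
 shows "A \<in> S"
proof -
 define S0 where "S0 = S \<inter> carrier SU"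
 have one0: "mat 1 \<in> S0" using one by (simp add: S0_def SU_def adjoint_mat)
 have mult0: "a ** b \<in> S0" if "a \<in> S0" "b \<in> S0" for a b
 proof -
  have "adj (a ** b) ** (a ** b) = adj b ** (adj a ** a) ** b" by (simp add: adjoint_mult matrix_mul_assoc)
  thus ?thesis using that mult by (simp add: S0_def SU_def det_mul)
 qed
 have refl0: "cis (- (t / real CARD('r))) *\<^sub>C complex_refl v (cis t) \<in> S0" if v: "hp v v = 1" for v :: "complex^'r" and t
 proof -
  have "t *\<^sub>R (\<i> *\<^sub>C refl_proj v) \<in> skew_hermitian" by (rule subspace_scale[OF subspace_skew_hermitian])
    (simp add: skew_hermitian_def adjoint_scaleC adjoint_refl_proj scaleC.minus_left)
  note this = gen[OF this] p2_SU[OF lie_exp_mem[OF iota_K_gtilde[OF this]]]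
  thus ?thesis using p2_reflection[OF v, of t] by (simp add: S0_def iota_scaleR)
 qed
 \<comment> \<open>The phases undo the normalization of the determinant, so that the full unitary
   group can be treated.\<close>
 define S1 where "S1 = {c *\<^sub>C a |c a. a \<in> S0 \<and> cmod c = 1}"
 have "A \<in> S1"
 proof (rule unitary_reflections)
  show "mat 1 \<in> S1" unfolding S1_def using one0 by (auto intro!: exI[of _ 1] exI[of _ "mat 1"])
  show "a ** b \<in> S1" if "a \<in> S1" "b \<in> S1" for a b
  proof -
   obtain c a' d b' where "a = c *\<^sub>C a'" "b = d *\<^sub>C b'" "a' \<in> S0" "b' \<in> S0" "cmod c = 1" "cmod d = 1"
    using \<open>a \<in> S1\<close> \<open>b \<in> S1\<close> by (auto simp: S1_def)
   thus ?thesis unfolding S1_def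
    by (auto simp: mm_scaleC_left mm_scaleC_right scaleC_scaleC norm_mult intro!: mult0 exI[of _ "d * c"] exI[of _ "a' ** b'"])
  qed
  show "complex_refl v l \<in> S1" if v: "hp v v = 1" and l: "cmod l = 1" for v l
  proof -
   obtain t where t: "l = cis t" using complex_unimodular_polar[OF l] by (metis cis.code)
   have "complex_refl v l = cis (t / real CARD('r)) *\<^sub>C cis (- (t / real CARD('r))) *\<^sub>C complex_refl v (cis t)"
    by (simp add: t scaleC_scaleC cis_mult)
   thus ?thesis unfolding S1_def using refl0[OF v, of t] norm_cis by blast
  qed
  show "adj A ** A = mat 1" using A by (simp add: SU_def)
 qed
 then obtain c a where A_eq: "A = c *\<^sub>C a" and a: "a \<in> S0" by (auto simp: S1_def)
 have "A = (c *\<^sub>C mat 1) ** a" by (simp add: A_eq mm_scaleC_left)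
 hence "det (c *\<^sub>C mat 1 :: complex^'r^'r) = 1" using A a by (simp add: det_mul S0_def SU_def)
 moreover have "det (c *\<^sub>C mat 1 :: complex^'r^'r) = c ^ CARD('r)"
  by (subst det_diagonal) (auto simp: mat_def)
 ultimately obtain j where c: "c = exp (2 * complex_of_real pi * \<i> * of_nat j / of_nat CARD('r))"
  using complex_roots_unity[of "CARD('r)"] by (auto simp: Suc_le_eq)
 define v :: "complex^'r" where "v = axis undefined 1"
 have v: "hp v v = 1" by (simp add: hp_self v_def)
 \<comment> \<open>After full turns of the parameter the reflection is trivial and only the
   normalizing scalar remains, which is the root of unity \<open>c\<close>.\<close>
 have "c = cis (- (- (2 * pi * real j) / real CARD('r)))" by (simp add: c cis_conv_exp mult_ac)
 moreover have "cis (- (2 * pi * real j)) = 1" using cis_multiple_2pi[of "- real j"] by simp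
 ultimately have "c *\<^sub>C mat 1 \<in> S0" using refl0[OF v, of "- (2 * pi * real j)"] by simp
 from mult0[OF this a] show ?thesis by (simp add: A_eq mm_scaleC_left S0_def)
qed

lemma p_isotropy: "K \<in> skew_hermitian ==> p (Exp (iota 0 K 0 0)) base_point = base_point"
 by (simp add: p_lie_exp[OF iota_K_gtilde base_point_siegel] flow_isotropy)

text \<open>Removing the trace of a scalar matrix leaves 0, so the derivative along the subgroup
  vanishes.\<close>

lemma p2_E2: "p2 (Exp (E2 a)) = mat 1"
proof -
 have tr: "trace (mat (\<i> * complex_of_real a) :: complex^'r^'r) / of_nat CARD('r) = \<i> * complex_of_real a"
  by (simp add: trace_def mat_def)
 have P: "((\<lambda>t. p2 (Exp (t *\<^sub>R E2 a))) has_vector_derivative 0) (at t)" for t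
  using p2_one_parameter(1)[OF skew_hermitian_mat[of a] zero_skew_sym(2), where S = 0 and V = 0] unfolding tr by (simp add: mm.zero_left)
 have "p2 (Exp (1 *\<^sub>R E2 a)) = p2 (Exp (0 *\<^sub>R E2 a))" by (rule constant_of_zero_derivative[OF P])
 also have "\<dots> = mat 1" by (rule p2_one_parameter(2)[OF skew_hermitian_mat zero_skew_sym(2)])
 finally show ?thesis by simp
qed

end

section \<open>Covariant kernels\<close>

lemma holomorphic_map_on_add:
 fixes f h :: "'a::complex_normed_vector => complex"
 assumes "holomorphic_map_on f D" "holomorphic_map_on h D"
 shows "holomorphic_map_on (\<lambda>z. f z + h z) D" unfolding holomorphic_map_on_def
proof
 fix z assume z: "z \<in> D"
 obtain F where F: "(f has_derivative F) (at z within D)" "\<And>c x. F (c *\<^sub>C x) = c *\<^sub>C F x"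
  using assms(1) z unfolding holomorphic_map_on_def by metis
 obtain F' where F': "(h has_derivative F') (at z within D)" "\<And>c x. F' (c *\<^sub>C x) = c *\<^sub>C F' x"
  using assms(2) z unfolding holomorphic_map_on_def by metis
 show "\<exists>F. ((\<lambda>z. f z + h z) has_derivative F) (at z within D) \<and> (\<forall>c x. F (c *\<^sub>C x) = c *\<^sub>C F x)"
  by (rule exI[of _ "\<lambda>x. F x + F' x"]) (auto simp: F(2) F'(2) distrib_left intro!: has_derivative_add F(1) F'(1))
qed

lemma holomorphic_map_on_scale:
 fixes f :: "'a::complex_normed_vector => complex"
 assumes "holomorphic_map_on f D"
 shows "holomorphic_map_on (\<lambda>z. c * f z) D" unfolding holomorphic_map_on_def
proof
 fix z assume z: "z \<in> D"
 obtain F where F: "(f has_derivative F) (at z within D)" "\<And>c x. F (c *\<^sub>C x) = c *\<^sub>C F x"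
  using assms(1) z unfolding holomorphic_map_on_def by metis
 show "\<exists>F. ((\<lambda>z. c * f z) has_derivative F) (at z within D) \<and> (\<forall>c x. F (c *\<^sub>C x) = c *\<^sub>C F x)"
  by (rule exI[of _ "\<lambda>x. c * F x"])
   (auto simp: F(2) intro!: bounded_linear.has_derivative[OF bounded_linear_mult_right] F(1))
qed

lemma holomorphic_map_on_const: "holomorphic_map_on (\<lambda>z. c) D" unfolding holomorphic_map_on_def
 by (intro ballI exI[of _ "\<lambda>_. 0"] conjI has_derivative_const) (simp add: scaleC.zero_right)

text \<open>Bundles the hypotheses of \<open>polarization\<close> other than the vanishing on the
  diagonal. The class is closed under linear combinations, which turns polarization into the
  criterion \<open>sesqui_eqI\<close> for equality of kernels.\<close>

definition sesqui :: "(('n::finite, 'r::finite) point => ('n, 'r) point => complex) => bool" where "sesqui F \<longleftrightarrow>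
  (\<forall>w\<in>\<D>. holomorphic_map_on (\<lambda>z. F z w) \<D>) \<and> (\<forall>z\<in>\<D>. holomorphic_map_on (\<lambda>w. cnj (F z w)) \<D>) \<and>
  (\<forall>K. compact K \<and> K \<subseteq> \<D> \<longrightarrow> (\<exists>M. \<forall>z\<in>K. \<forall>w\<in>K. cmod (F z w) \<le> M))"

lemma sesquiI:
 assumes "\<And>w. w \<in> \<D> ==> holomorphic_map_on (\<lambda>z. F z w) \<D>"
  "\<And>z. z \<in> \<D> ==> holomorphic_map_on (\<lambda>w. cnj (F z w)) \<D>"
  "\<And>K. compact K ==> K \<subseteq> \<D> ==> \<exists>M. \<forall>z\<in>K. \<forall>w\<in>K. cmod (F z w) \<le> M"
 shows "sesqui F" using assms unfolding sesqui_def by blast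

lemma sesquiD:
 assumes "sesqui F"
 shows "w \<in> \<D> ==> holomorphic_map_on (\<lambda>z. F z w) \<D>" "z \<in> \<D> ==> holomorphic_map_on (\<lambda>w. cnj (F z w)) \<D>"
  "compact K ==> K \<subseteq> \<D> ==> \<exists>M. \<forall>z\<in>K. \<forall>w\<in>K. cmod (F z w) \<le> M" using assms unfolding sesqui_def by blast+

lemma sesqui_add:
 assumes F: "sesqui F" and F': "sesqui F'"
 shows "sesqui (\<lambda>z w. F z w + F' z w)"
proof (rule sesquiI)
 fix K :: "('a, 'b) point set" assume K: "compact K" "K \<subseteq> \<D>"
 obtain M where M: "\<forall>z\<in>K. \<forall>w\<in>K. cmod (F z w) \<le> M" using sesquiD(3)[OF F K] ..
 obtain M' where M': "\<forall>z\<in>K. \<forall>w\<in>K. cmod (F' z w) \<le> M'" using sesquiD(3)[OF F' K] ..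
 show "\<exists>M. \<forall>z\<in>K. \<forall>w\<in>K. cmod (F z w + F' z w) \<le> M"
  by (intro exI[of _ "M + M'"] ballI norm_triangle_le add_mono) (use M M' in auto)
qed (auto intro: holomorphic_map_on_add sesquiD[OF F] sesquiD[OF F'])

lemma sesqui_scale:
 assumes F: "sesqui F"
 shows "sesqui (\<lambda>z w. c * F z w)"
proof (rule sesquiI)
 fix K :: "('a, 'b) point set" assume K: "compact K" "K \<subseteq> \<D>"
 obtain M where "\<forall>z\<in>K. \<forall>w\<in>K. cmod (F z w) \<le> M" using sesquiD(3)[OF F K] ..
 thus "\<exists>M. \<forall>z\<in>K. \<forall>w\<in>K. cmod (c * F z w) \<le> M"
  by (intro exI[of _ "cmod c * M"]) (auto simp: norm_mult intro!: mult_left_mono)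
qed (auto intro: holomorphic_map_on_scale sesquiD[OF F])

lemma sesqui_const: "sesqui (\<lambda>_ _. c)" unfolding sesqui_def by (auto intro: holomorphic_map_on_const)

lemma sesqui_diff: "sesqui F ==> sesqui F' ==> sesqui (\<lambda>z w. F z w - F' z w)"
 using sesqui_add[OF _ sesqui_scale[of F' "- 1"], of F] by simp

lemma sesqui_eqI:
 assumes F: "sesqui F" and F': "sesqui F'" and diag: "\<And>z. z \<in> \<D> ==> F z z = F' z z"
  and z: "z \<in> \<D>" and w: "w \<in> \<D>"
 shows "F z w = F' z w"
proof -
 have "F z w - F' z w = 0"
  by (rule polarization) (use sesqui_diff[OF F F'] diag z w in \<open>auto simp: sesqui_def\<close>)
 thus ?thesis by simp
qed

section \<open>Kernels of isometric operators and their covariance\<close>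

locale kernel_isometry = a: reproducing_kernel_space H \<D> co + b: reproducing_kernel_space H' \<D> co'
 for H :: "(('n::finite, 'r::finite) point, 'w::complex_normed_vector) function_space"
  and H' :: "(('n, 'r) point, 'v::complex_normed_vector) function_space"
  and co :: "'i::finite => 'w => complex" and co' :: "'j::finite => 'v => complex" +
 fixes A :: "(('n, 'r) point => 'w) => ('n, 'r) point => 'v"
 assumes bij: "bij_betw A (vecs H) (vecs H')"
  and isometric: "f \<in> vecs H ==> h \<in> vecs H ==> ip H' (A f) (A h) = ip H f h"
begin

text \<open>The kernel of the operator \<open>A\<close>: its columns are the images of the kernel
  functions of \<open>H\<close>. For the identity it is the reproducing kernel.\<close>

definition ker :: "('n, 'r) point => ('n, 'r) point => complex^'i^'j"
 where "ker z w = (\<chi> i j. co' i (A (a.kr w j) z))"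

abbreviation Ai where "Ai \<equiv> inv_into (vecs H) A"

lemma A_mem: "f \<in> vecs H ==> A f \<in> vecs H'" using bij by (auto simp: bij_betw_def)

lemma Ai_mem: "h \<in> vecs H' ==> Ai h \<in> vecs H" and A_Ai: "h \<in> vecs H' ==> A (Ai h) = h"
 using bij by (auto simp: bij_betw_def inv_into_into f_inv_into_f)

lemma ker_ip: "z \<in> \<D> ==> w \<in> \<D> ==> ker z w $ i $ j = ip H' (A (a.kr w j)) (b.kr z i)"
 by (simp add: ker_def b.kr_reproducing A_mem a.kr_mem)

text \<open>In the second variable the kernel is the conjugate of a function of \<open>H\<close>,
  the inverse image of a kernel function of \<open>H'\<close>. This yields antiholomorphy in that
  variable.\<close>

lemma ker_swap: "z \<in> \<D> ==> w \<in> \<D> ==> cnj (ker z w $ i $ j) = co j (Ai (b.kr z i) w)"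
 using isometric[of "Ai (b.kr z i)" "a.kr w j"]
 by (simp add: ker_ip b.ip_commute[of "b.kr z i"] a.kr_reproducing A_mem Ai_mem A_Ai a.kr_mem b.kr_mem)

lemma sesqui_ker: "sesqui (\<lambda>z w. ker z w $ i $ j)" unfolding sesqui_def
proof (intro conjI ballI allI impI)
 fix w :: "('n, 'r) point" assume w: "w \<in> \<D>"
 show "holomorphic_map_on (\<lambda>z. ker z w $ i $ j) \<D>"
  using b.holomorphic_co[OF A_mem[OF a.kr_mem[OF w]]] by (simp add: ker_def)
next
 fix z :: "('n, 'r) point" assume z: "z \<in> \<D>"
 show "holomorphic_map_on (\<lambda>w. cnj (ker z w $ i $ j)) \<D>"
  by (rule holomorphic_map_on_cong[OF _ a.holomorphic_co[OF Ai_mem[OF b.kr_mem[OF z]]]])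
   (simp add: ker_swap z)
next
 fix K :: "('n, 'r) point set" assume K: "compact K \<and> K \<subseteq> \<D>"
 obtain C where C: "\<And>z i. z \<in> K ==> a.nrm (a.kr z i) \<le> C" using a.kr_locally_bounded K by metis
 obtain C' where C': "\<And>z i. z \<in> K ==> b.nrm (b.kr z i) \<le> C'" using b.kr_locally_bounded K by metis
 have "cmod (ker z w $ i $ j) \<le> C * C'" if z: "z \<in> K" and w: "w \<in> K" for z w
 proof -
  have zw: "z \<in> \<D>" "w \<in> \<D>" using z w K by auto
  have "cmod (ker z w $ i $ j) \<le> b.nrm (A (a.kr w j)) * b.nrm (b.kr z i)"
   unfolding ker_ip[OF zw] by (intro b.Cauchy_Schwarz A_mem a.kr_mem b.kr_mem zw)
  also have "b.nrm (A (a.kr w j)) = a.nrm (a.kr w j)" by (simp add: ip_norm_def isometric a.kr_mem zw)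
  also have "a.nrm (a.kr w j) * b.nrm (b.kr z i) \<le> C * C'"
   using C[OF w, of j] C'[OF z, of i] a.nrm_nonneg[OF a.kr_mem[OF zw(2)], of j]
    b.nrm_nonneg[OF b.kr_mem[OF zw(1)], of i] by (intro mult_mono) auto
  finally show ?thesis .
 qed
 thus "\<exists>M. \<forall>z\<in>K. \<forall>w\<in>K. cmod (ker z w $ i $ j) \<le> M" by blast
qed

lemma A_eq_ip: "f \<in> vecs H ==> z \<in> \<D> ==> co' i (A f z) = ip H f (Ai (b.kr z i))"
 using isometric[of f "Ai (b.kr z i)"] by (simp add: b.kr_reproducing A_mem Ai_mem A_Ai b.kr_mem)

end

text \<open>The coordinates of \<open>A f\<close> are inner products of \<open>f\<close> with the
  inverse images of the kernel functions of \<open>H'\<close>, and the values of these are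
  conjugated entries of \<open>ker\<close>.\<close>

lemma kernel_isometry_eqI:
 fixes H :: "(('n::finite, 'r::finite) point, 'w::complex_normed_vector) function_space"
 assumes 1: "kernel_isometry H H' co co' A1" and 2: "kernel_isometry H H' co co' A2"
  and eq: "\<And>z w. z \<in> \<D> ==> w \<in> \<D> ==>
   kernel_isometry.ker H co co' A1 z w = kernel_isometry.ker H co co' A2 z w" and f: "f \<in> vecs H"
 shows "A1 f = A2 f"
proof -
 interpret A1: kernel_isometry H H' co co' A1 by fact
 interpret A2: kernel_isometry H H' co co' A2 by fact
 have "A1.Ai (A1.b.kr z i) = A2.Ai (A1.b.kr z i)" if z: "z \<in> \<D>" for z i
 proof (rule A1.a.vecs_eqI)
  fix w :: "('n, 'r) point" and j assume w: "w \<in> \<D>"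
  show "co j (A1.Ai (A1.b.kr z i) w) = co j (A2.Ai (A1.b.kr z i) w)"
   using A1.ker_swap[OF z w, of i j] A2.ker_swap[OF z w, of i j] eq[OF z w] by simp
 qed (intro A1.Ai_mem A2.Ai_mem A1.b.kr_mem z)+
 thus ?thesis by (intro A1.b.vecs_eqI A1.A_mem A2.A_mem f) (simp add: A1.A_eq_ip A2.A_eq_ip f)
qed

text \<open>In terms of the coordinates \<open>co i\<close> the representation \<open>\<rho>\<close> is given by the matrices \<open>s g\<close>.\<close>

locale covariant_space = siegel_cover G T p + reproducing_kernel_space H \<D> co
 for G :: "'g monoid" (structure) and T :: "'g topology"
  and p :: "'g => ('n::finite, 'r::finite) point => ('n, 'r) point"
  and H :: "(('n, 'r) point, 'w::complex_normed_vector) function_space"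
  and co :: "'i::finite => 'w => complex" +
 fixes \<rho> :: "'g => (('n, 'r) point => 'w) => ('n, 'r) point => 'w" and s :: "'g => complex^'i^'i"
 assumes nontrivial: "vecs H \<noteq> {\<lambda>_. 0}" and rho_mem: "g \<in> carrier G ==> f \<in> vecs H ==> \<rho> g f \<in> vecs H"
  and rho_ip: "g \<in> carrier G ==> f \<in> vecs H ==> h \<in> vecs H ==> ip H (\<rho> g f) (\<rho> g h) = ip H f h"
  and rho_co: "g \<in> carrier G ==> z \<in> \<D> ==> co i (\<rho> g f z) = (\<Sum>j\<in>UNIV. s g $ i $ j * co j (f (p (inv g) z)))"
  and s_mult: "g \<in> carrier G ==> g' \<in> carrier G ==> s (g \<otimes> g') = s g ** s g'" and s_one: "s \<one> = mat 1"
begin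

lemma s_inv: "g \<in> carrier G ==> s g ** s (inv g) = mat 1" "g \<in> carrier G ==> s (inv g) ** s g = mat 1"
 using s_one by (simp_all flip: s_mult)

lemma rho_inv: "g \<in> carrier G ==> f \<in> vecs H ==> \<rho> g (\<rho> (inv g) f) = f"
proof (rule vecs_eqI)
 fix z :: "('n, 'r) point" and i assume g: "g \<in> carrier G" and f: "f \<in> vecs H" and z: "z \<in> \<D>"
 have z': "p (inv g) z \<in> \<D>" by (rule p_mem[OF inv_closed[OF g] z])
 have "co i (\<rho> g (\<rho> (inv g) f) z) = (\<Sum>j\<in>UNIV. s g $ i $ j * (\<Sum>k\<in>UNIV. s (inv g) $ j $ k * co k (f z)))"
  by (simp add: rho_co g z z')
 also have "\<dots> = (\<Sum>k\<in>UNIV. (s g ** s (inv g)) $ i $ k * co k (f z))"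
  by (simp add: matrix_matrix_mult_def sum_distrib_left sum_distrib_right mult.assoc) (rule sum.swap)
 also have "\<dots> = co i (f z)" by (simp add: s_inv g mat_def if_distrib if_distribR cong: if_cong)
 finally show "co i (\<rho> g (\<rho> (inv g) f) z) = co i (f z)" .
qed (auto simp: rho_mem)

lemma bij_rho: "g \<in> carrier G ==> bij_betw (\<rho> g) (vecs H) (vecs H)"
 by (rule bij_betw_byWitness[where f' = "\<rho> (inv g)"]) (use rho_inv[of "inv g"] in \<open>auto simp: rho_inv rho_mem\<close>)

text \<open>Unitarity moves \<open>\<rho> g\<close> to the other side of the inner product as
  \<open>\<rho> (inv g)\<close>, where the reproducing property and the coordinate formula
  apply.\<close>

lemma rho_kr:
 assumes g: "g \<in> carrier G" and w: "w \<in> \<D>"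
 shows "\<rho> g (kr w j) = (\<lambda>z. \<Sum>l\<in>UNIV. cnj (s (inv g) $ j $ l) *\<^sub>C kr (p g w) l z)"
proof -
 have gw: "p g w \<in> \<D>" by (rule p_mem[OF g w])
 let ?k = "\<lambda>z. \<Sum>l\<in>UNIV. cnj (s (inv g) $ j $ l) *\<^sub>C kr (p g w) l z"
 have k: "?k \<in> vecs H" by (intro sum_mem scale_mem kr_mem gw)
 have eq: "ip H f (\<rho> g (kr w j)) = ip H f ?k" if f: "f \<in> vecs H" for f
 proof -
  have "ip H f (\<rho> g (kr w j)) = ip H (\<rho> (inv g) f) (kr w j)"
   using rho_ip[OF g rho_mem[OF inv_closed[OF g] f] kr_mem[OF w]] by (simp add: rho_inv g f)
  also have "\<dots> = co j (\<rho> (inv g) f w)" by (rule kr_reproducing[OF w rho_mem[OF inv_closed[OF g] f]])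
  also have "\<dots> = (\<Sum>l\<in>UNIV. s (inv g) $ j $ l * co l (f (p g w)))"
   by (simp add: rho_co[OF inv_closed[OF g] w] g)
  also have "\<dots> = ip H f ?k" by (simp add: ip_sum_right ip_scale_right scale_mem kr_mem gw f kr_reproducing)
  finally show ?thesis .
 qed
 have rk: "\<rho> g (kr w j) \<in> vecs H" by (rule rho_mem[OF g kr_mem[OF w]])
 let ?d = "\<lambda>z. \<rho> g (kr w j) z - ?k z"
 have d: "?d \<in> vecs H" by (rule diff_mem[OF rk k])
 have "ip H ?d ?d = 0" unfolding ip_diff_right[OF rk k d] eq[OF d] by simp
 hence "?d = (\<lambda>_. 0)" using ip_self_eq_0[OF d] by blast
 from fun_cong[OF this] show ?thesis by (intro ext) simp
qed

end

text \<open>Intertwining is required over a set \<open>S\<close> only: it is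
  \<open>carrier G\<close> for operators between the unitarizations of \<open>\<pi>\<close>, and
  \<open>B\<close> for the given operator between those of \<open>tau\<close>.\<close>

locale covariant_isometry = a: covariant_space G T p H co \<rho> s + b: covariant_space G T p H' co' \<rho>' s' +
  kernel_isometry H H' co co' A for G :: "'g monoid" (structure) and T :: "'g topology"
  and p :: "'g => ('n::finite, 'r::finite) point => ('n, 'r) point"
  and H :: "(('n, 'r) point, 'w::complex_normed_vector) function_space"
  and co :: "'i::finite => 'w => complex"
  and \<rho> :: "'g => (('n, 'r) point => 'w) => ('n, 'r) point => 'w" and s :: "'g => complex^'i^'i"
  and H' :: "(('n, 'r) point, 'v::complex_normed_vector) function_space"
  and co' :: "'j::finite => 'v => complex"
  and \<rho>' :: "'g => (('n, 'r) point => 'v) => ('n, 'r) point => 'v" and s' :: "'g => complex^'j^'j"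
  and A :: "(('n, 'r) point => 'w) => ('n, 'r) point => 'v" +
 fixes S :: "'g set"
 assumes S: "S \<subseteq> carrier G" and A_add: "f \<in> vecs H ==> h \<in> vecs H ==> A (\<lambda>z. f z + h z) = (\<lambda>z. A f z + A h z)"
  and A_scale: "f \<in> vecs H ==> A (\<lambda>z. c *\<^sub>C f z) = (\<lambda>z. c *\<^sub>C A f z)"
  and intertwine: "g \<in> S ==> f \<in> vecs H ==> A (\<rho> g f) = \<rho>' g (A f)"
begin

lemma A_zero: "A (\<lambda>_. 0) = (\<lambda>_. 0)" using A_scale[OF a.zero_mem, of 0] by (simp add: scaleC.zero_left)

lemma A_sum: "(\<And>i. i \<in> I ==> f i \<in> vecs H) ==> A (\<lambda>z. \<Sum>i\<in>I. f i z) = (\<lambda>z. \<Sum>i\<in>I. A (f i) z)"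
 by (induction I rule: infinite_finite_induct) (auto simp: A_zero A_add a.sum_mem)

text \<open>The intertwining relation is evaluated on a kernel function. By \<open>rho_kr\<close>
  this produces a factor with \<open>inv g\<close>, which is then brought to the other side.\<close>

lemma ker_covariant:
 assumes gS: "g \<in> S" and z: "z \<in> \<D>" and w: "w \<in> \<D>"
 shows "ker (p g z) (p g w) = s' g ** ker z w ** adj (s g)"
proof -
 have g: "g \<in> carrier G" using gS S by blast
 have gz: "p g z \<in> \<D>" and gw: "p g w \<in> \<D>" using z w a.p_mem[OF g] by auto
 have co'_sum: "co' i (\<Sum>l\<in>UNIV. x l) = (\<Sum>l\<in>UNIV. co' i (x l))" for i and x :: "'i => 'v"
  by (rule linear_sum[OF bounded_linear.linear[OF b.co_bounded]])
 have "(s' g ** ker z w) $ i $ j = (ker (p g z) (p g w) ** adj (s (inv g))) $ i $ j" for i j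
 proof -
  have "(s' g ** ker z w) $ i $ j = co' i (\<rho>' g (A (a.kr w j)) (p g z))"
   by (simp add: b.rho_co[OF g gz] matrix_matrix_mult_def ker_def g z)
  also have "\<dots> = co' i (A (\<rho> g (a.kr w j)) (p g z))" by (simp add: intertwine[OF gS a.kr_mem[OF w]])
  also have "\<dots> = (\<Sum>l\<in>UNIV. cnj (s (inv g) $ j $ l) * co' i (A (a.kr (p g w) l) (p g z)))"
   unfolding a.rho_kr[OF g w] by (simp add: A_sum A_scale a.scale_mem a.kr_mem gw co'_sum b.co_scale)
  also have "\<dots> = (ker (p g z) (p g w) ** adj (s (inv g))) $ i $ j"
   by (simp add: matrix_matrix_mult_def ker_def adjoint_matrix_def transpose_def mult.commute)
  finally show ?thesis .
 qed
 hence "s' g ** ker z w = ker (p g z) (p g w) ** adj (s (inv g))" by (simp add: vec_eq_iff)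
 hence "s' g ** ker z w ** adj (s g) = ker (p g z) (p g w) ** (adj (s (inv g)) ** adj (s g))"
  by (simp add: matrix_mul_assoc)
 also have "adj (s (inv g)) ** adj (s g) = mat 1" by (simp add: a.s_inv g adjoint_mat flip: adjoint_mult)
 finally show ?thesis by simp
qed

text \<open>By polarization a covariant kernel is determined by its value at the base point.\<close>

lemma ker_base_nonzero:
 assumes trans: "\<And>z. z \<in> \<D> ==> \<exists>g\<in>S. p g base_point = z"
 shows "ker base_point base_point \<noteq> 0"
proof
 assume 0: "ker base_point base_point = 0"
 have diag: "ker z z = 0" if z: "z \<in> \<D>" for z
 proof -
  obtain g where "g \<in> S" "p g base_point = z" using trans[OF z] by blast
  thus ?thesis
   using ker_covariant[OF _ base_point_siegel base_point_siegel, of g] 0 by (simp add: mm.zero_left mm.zero_right)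
 qed
 obtain w j where w: "w \<in> \<D>" "a.kr w j \<noteq> (\<lambda>_. 0)" using a.kr_nonzero[OF a.nontrivial] by blast
 have "A (a.kr w j) = (\<lambda>_. 0)"
 proof (rule b.vecs_eqI[OF A_mem[OF a.kr_mem[OF w(1)]] b.zero_mem])
  fix z :: "('n, 'r) point" and i assume z: "z \<in> \<D>"
  have "ker z w $ i $ j = 0"
   by (rule sesqui_eqI[OF sesqui_ker sesqui_const _ z w(1), of i j 0]) (simp add: diag)
  thus "co' i (A (a.kr w j) z) = co' i 0" by (simp add: ker_def b.co_zero)
 qed
 hence "A (a.kr w j) = A (\<lambda>_. 0)" by (simp add: A_zero)
 hence "a.kr w j = (\<lambda>_. 0)" using bij a.kr_mem[OF w(1)] a.zero_mem by (auto simp: bij_betw_def dest: inj_onD)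
 thus False using w(2) by blast
qed

end

text \<open>Lets the results on kernels of intertwiners apply to the reproducing kernel
  itself.\<close>

lemma (in covariant_space) covariant_isometry_id: "covariant_isometry G T p H co \<rho> s H co \<rho> s (\<lambda>f. f) (carrier G)"
 by (intro covariant_isometry.intro covariant_isometry_axioms.intro kernel_isometry.intro kernel_isometry_axioms.intro
   covariant_space_axioms reproducing_kernel_space_axioms) (simp_all add: bij_betw_def)

section \<open>Unitarizations\<close>

lemma SU_mult: "a \<in> carrier SU ==> b \<in> carrier SU ==> a ** b \<in> carrier SU"
proof -
 assume "a \<in> carrier SU" "b \<in> carrier SU"
 moreover have "adj (a ** b) ** (a ** b) = adj b ** (adj a ** a) ** b"
  by (simp add: adjoint_mult matrix_mul_assoc)
 ultimately show ?thesis by (simp add: SU_def det_mul)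
qed

lemma trace_mat: "trace (mat c :: 'a::semiring_1^'n::finite^'n) = of_nat CARD('n) * c"
 by (simp add: trace_def mat_def)

lemma trace_zero: "trace (0 :: 'a::semiring_1^'n::finite^'n) = 0" by (simp add: trace_def)

lemma SU_one: "mat 1 \<in> carrier SU" by (simp add: SU_def adjoint_mat)

lemma irreducible_mult:
 "irreducible_unitary_rep \<Theta> ==> a \<in> carrier SU ==> b \<in> carrier SU ==> \<Theta> (a ** b) = \<Theta> a ** \<Theta> b"
 and irreducible_unitary: "irreducible_unitary_rep \<Theta> ==> a \<in> carrier SU ==> adj (\<Theta> a) ** \<Theta> a = mat 1"
 by (auto simp: irreducible_unitary_rep_def unitary_matrix_def)

lemma irreducible_one: "irreducible_unitary_rep \<Theta> ==> \<Theta> (mat 1) = mat 1"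
proof -
 assume irr: "irreducible_unitary_rep \<Theta>"
 have "\<Theta> (mat 1) ** \<Theta> (mat 1) = \<Theta> (mat 1)" using irreducible_mult[OF irr SU_one SU_one] by simp
 hence "adj (\<Theta> (mat 1)) ** \<Theta> (mat 1) ** \<Theta> (mat 1) = adj (\<Theta> (mat 1)) ** \<Theta> (mat 1)"
  by (simp flip: matrix_mul_assoc)
 thus ?thesis using irreducible_unitary[OF irr SU_one] by simp
qed

text \<open>Schur's lemma for a Hermitian matrix, whose eigenvector comes from
  \<open>hermitian_eigenvector\<close> unless \<open>X = 0\<close>. The eigenspace is invariant, so
  it is everything. The general case is reduced to this one in
  \<open>schur_equivalence\<close>.\<close>

lemma schur_hermitian:
 fixes X :: "complex^'d::finite^'d"
 assumes irr: "irreducible_unitary_rep \<Theta>" and X: "adj X = X"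
  and comm: "\<And>A. A \<in> carrier SU ==> X ** \<Theta> A = \<Theta> A ** X"
 shows "\<exists>c. X = complex_of_real c *\<^sub>C mat 1"
proof (cases "X = 0")
 case True
 hence "X = complex_of_real 0 *\<^sub>C mat 1" by (simp add: scaleC.zero_left)
 thus ?thesis by blast
next
 case False
 obtain c v where v: "v \<noteq> 0" "X *v v = complex_of_real c *\<^sub>C v"
  using hermitian_eigenvector[OF X False] by blast
 define W where "W = {v. X *v v = complex_of_real c *\<^sub>C v}"
 have "0 \<in> W" "\<forall>x\<in>W. \<forall>y\<in>W. x + y \<in> W"
  by (auto simp: W_def mv.add_right scaleC_add_right mv.zero_right scaleC.zero_right)
 moreover have "\<forall>a. \<forall>x\<in>W. a *\<^sub>C x \<in> W"
 proof -
  have "X *v (a *\<^sub>C x) = a *\<^sub>C (X *v x)" for a x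
   by (simp add: matrix_vector_mult_def vec_eq_iff sum_distrib_left mult_ac)
  thus ?thesis by (simp add: W_def scaleC_scaleC mult.commute)
 qed
 moreover have "\<forall>A\<in>carrier SU. \<forall>x\<in>W. \<Theta> A *v x \<in> W"
 proof -
  have "Y *v (a *\<^sub>C x) = a *\<^sub>C (Y *v x)" for a x and Y :: "complex^'d^'d"
   by (simp add: matrix_vector_mult_def vec_eq_iff sum_distrib_left mult_ac)
  thus ?thesis using comm by (auto simp: W_def matrix_vector_mul_assoc) (simp flip: matrix_vector_mul_assoc)
 qed
 ultimately have "W = {0} \<or> W = UNIV" using irr unfolding irreducible_unitary_rep_def by blast
 hence "W = UNIV" using v by (auto simp: W_def)
 hence "X *v x = (complex_of_real c *\<^sub>C mat 1) *v x" for x by (auto simp: W_def mv_scaleC_left)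
 hence "X = complex_of_real c *\<^sub>C mat 1" by (simp add: matrix_eq)
 thus ?thesis by blast
qed

context covariant_space
begin

definition N :: "('n, 'r) point => ('n, 'r) point => complex^'i^'i" where "N z w = (\<chi> i j. co i (kr w j z))"

lemma N_ker: "kernel_isometry.ker H co co (\<lambda>f. f) = N"
proof -
 interpret id: covariant_isometry G T p H co \<rho> s H co \<rho> s "\<lambda>f. f" "carrier G" by (rule covariant_isometry_id)
 show ?thesis by (intro ext) (simp add: id.ker_def N_def)
qed

lemma sesqui_N: "sesqui (\<lambda>z w. N z w $ i $ j)"
 using kernel_isometry.sesqui_ker[OF covariant_isometry.axioms(3)[OF covariant_isometry_id]] unfolding N_ker .

lemma N_covariant: "g \<in> carrier G ==> z \<in> \<D> ==> w \<in> \<D> ==> N (p g z) (p g w) = s g ** N z w ** adj (s g)"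
 using covariant_isometry.ker_covariant[OF covariant_isometry_id] unfolding N_ker .

lemma N_adjoint: "z \<in> \<D> ==> w \<in> \<D> ==> adj (N z w) = N w z"
 unfolding N_def adjoint_matrix_def transpose_def using kr_swap[of z w] by (simp add: vec_eq_iff)

lemma N_diagonal: "z \<in> \<D> ==> N z z $ i $ i = complex_of_real ((nrm (kr z i))\<^sup>2)"
 by (simp add: N_def kr_diagonal)

end

context siegel_cover
begin

text \<open>The group of \<open>borel\<close> for the standard basis is already transitive.\<close>

lemma G_transitive: "z \<in> \<D> ==> \<exists>g\<in>carrier G. p g base_point = z"
proof -
 assume z: "z \<in> \<D>"
 obtain rk :: "'n => nat" where "inj rk" using finite_imp_inj_to_nat_seg[of "UNIV :: 'n set"] by auto
 hence ob: "ordered_basis rk (mat 1) (mat 1)" by (simp add: ordered_basis_def)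
 then interpret ordered_basis rk "mat 1" "mat 1" .
 obtain b where b: "b \<in> generate G (Exp ` borel rk (mat 1) (mat 1))" "p b base_point = z"
  using borel_transitive[OF ob z] by blast
 moreover have "b \<in> carrier G" using b(1) by (rule generate_lie_exp_mem[rotated]) (auto dest: borel_gtilde)
 ultimately show ?thesis by blast
qed

end

context siegel_projections
begin

definition chi :: "complex => complex => 'g => complex" where "chi \<gamma> \<delta> g = exp (x1 g *\<^sub>R \<gamma> + x2 g *\<^sub>R \<delta>)"

lemma chi_mult: "g \<in> carrier G ==> h \<in> carrier G ==> chi \<gamma> \<delta> (g \<otimes> h) = chi \<gamma> \<delta> g * chi \<gamma> \<delta> h"
 by (simp add: chi_def x1_mult x2_mult scaleR_left_distrib flip: exp_add) (simp add: algebra_simps)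

lemma chi_one: "chi \<gamma> \<delta> \<one> = 1" using x1_mult[of \<one> \<one>] x2_mult[of \<one> \<one>] by (simp add: chi_def)

lemma chi_nonzero [simp]: "chi \<gamma> \<delta> g \<noteq> 0" by (simp add: chi_def)

lemma chi_split: "chi \<gamma> \<delta> g = chi \<gamma> 0 g * chi 0 \<delta> g" by (simp add: chi_def exp_add)

lemma norm_chi: "cmod (chi \<gamma> \<delta> g) = exp (x1 g * Re \<gamma> + x2 g * Re \<delta>)" by (simp add: chi_def)

lemma pi_rep_chi:
 assumes "c1 \<in> complex_dual z1" "c2 \<in> complex_dual z2" "g \<in> carrier G" "z \<in> \<D>"
 shows "prep c1 c2 \<Theta> g f z = chi (c1 (E1 1)) (c2 (iota 0 (mat \<i>) 0 0)) g *\<^sub>C (\<Theta> (p2 g) *v f (p (inv g) z))"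
 using assms by (simp add: pi_rep_def cpower_z1 cpower_z2 chi_def exp_add)

lemma tau_rep_chi:
 assumes "c1 \<in> complex_dual z1" "g \<in> carrier G" "z \<in> \<D>"
 shows "tau c1 g f z = chi (c1 (E1 1)) 0 g * f (p (inv g) z)"
 using assms by (simp add: tau_rep_def cpower_z1 chi_def)

lemma x_dilation: "x1 (Exp (E1 a)) = a" by (simp add: x1_lie_exp zero_skew_sym trace_mat)

lemma x_E2: "x1 (Exp (E2 a)) = 0" "x2 (Exp (E2 a)) = a"
 by (simp_all add: x1_lie_exp x2_lie_exp zero_skew_sym skew_hermitian_mat trace_mat trace_zero)

lemma x1_isotropy: "K \<in> skew_hermitian ==> x1 (Exp (iota 0 K 0 0)) = 0"
 by (simp add: x1_lie_exp zero_skew_sym trace_zero)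

end

text \<open>The coordinates of scalar functions are indexed by the type \<open>unit\<close>.\<close>

locale tau_space = siegel_projections G T p p11 p21 p2 for G :: "'g monoid" (structure) and T :: "'g topology"
  and p :: "'g => ('n::finite, 'r::finite) point => ('n, 'r) point"
  and p11 p21 :: "'g => 'g" and p2 :: "'g => complex^'r^'r" +
 fixes c1 :: "('n, 'r) lie_matrix => complex" and H :: "(('n, 'r) point, complex) function_space"
 assumes c1: "c1 \<in> complex_dual z1" and unitarization: "is_unitarization \<D> G (tau c1) H"
begin

lemma covariant: "covariant_space G T p H (\<lambda>(_::unit) x. x) (tau c1) (\<lambda>g. mat (chi (c1 (E1 1)) 0 g))"
proof (intro covariant_space.intro siegel_cover_axioms reproducing_kernel_space.intro hilbert_functions.intro
  reproducing_kernel_space_axioms.intro covariant_space_axioms.intro)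
 fix g h assume "g \<in> carrier G" "h \<in> carrier G"
 thus "mat (chi (c1 (E1 1)) 0 (g \<otimes> h)) = (mat (chi (c1 (E1 1)) 0 g) ** mat (chi (c1 (E1 1)) 0 h) :: complex^unit^unit)"
  by (simp add: chi_mult vec_eq_iff matrix_matrix_mult_def mat_def)
qed (use unitarization in \<open>auto simp: is_unitarization_def tau_rep_chi[OF c1] chi_one mat_def bounded_linear_ident\<close>)

end

sublocale tau_space \<subseteq> covariant_space G T p H "\<lambda>(_::unit) x. x" "tau c1" "\<lambda>g. mat (chi (c1 (E1 1)) 0 g)"
 by (rule covariant)

locale pi_space = siegel_projections G T p p11 p21 p2 for G :: "'g monoid" (structure) and T :: "'g topology"
  and p :: "'g => ('n::finite, 'r::finite) point => ('n, 'r) point"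
  and p11 p21 :: "'g => 'g" and p2 :: "'g => complex^'r^'r" +
 fixes c1 c2 :: "('n, 'r) lie_matrix => complex" and \<Theta> :: "complex^'r^'r => complex^'d::finite^'d"
  and H :: "(('n, 'r) point, complex^'d) function_space"
 assumes c1: "c1 \<in> complex_dual z1" and c2: "c2 \<in> complex_dual z2" and irr: "irreducible_unitary_rep \<Theta>"
  and unitarization: "is_unitarization \<D> G (prep c1 c2 \<Theta>) H"
begin

lemmas Theta_mult = irreducible_mult[OF irr]
 and Theta_unitary = irreducible_unitary[OF irr] and Theta_one = irreducible_one[OF irr]

lemma p2_one: "p2 \<one> = mat 1" using p2_E2[of 0] lie_exp_zero by (simp add: iota_zero)

lemma covariant: "covariant_space G T p H (\<lambda>i x. x $ i) (prep c1 c2 \<Theta>)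
  (\<lambda>g. chi (c1 (E1 1)) (c2 (iota 0 (mat \<i>) 0 0)) g *\<^sub>C \<Theta> (p2 g))"
proof (intro covariant_space.intro siegel_cover_axioms reproducing_kernel_space.intro hilbert_functions.intro
  reproducing_kernel_space_axioms.intro covariant_space_axioms.intro)
 fix g h assume gh: "g \<in> carrier G" "h \<in> carrier G"
 thus "chi (c1 (E1 1)) (c2 (iota 0 (mat \<i>) 0 0)) (g \<otimes> h) *\<^sub>C \<Theta> (p2 (g \<otimes> h)) =
   chi (c1 (E1 1)) (c2 (iota 0 (mat \<i>) 0 0)) g *\<^sub>C \<Theta> (p2 g) ** chi (c1 (E1 1)) (c2 (iota 0 (mat \<i>) 0 0)) h *\<^sub>C \<Theta> (p2 h)"
  by (simp add: chi_mult p2_mult Theta_mult p2_SU mm_scaleC_left mm_scaleC_right scaleC_scaleC mult.commute)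
next
 fix g i f and z :: "('n, 'r) point" assume "g \<in> carrier G" "z \<in> \<D>"
 thus "prep c1 c2 \<Theta> g f z $ i
   = (\<Sum>j\<in>UNIV. (chi (c1 (E1 1)) (c2 (iota 0 (mat \<i>) 0 0)) g *\<^sub>C \<Theta> (p2 g)) $ i $ j * f (p (inv g) z) $ j)"
  by (simp add: pi_rep_chi[OF c1 c2] matrix_vector_mult_def sum_distrib_left mult.assoc)
qed (use unitarization in \<open>auto simp: is_unitarization_def chi_one p2_one Theta_one bounded_linear_vec_nth vec_eq_iff\<close>)

end

sublocale pi_space \<subseteq> covariant_space G T p H "\<lambda>i x. x $ i" "prep c1 c2 \<Theta>"
  "\<lambda>g. chi (c1 (E1 1)) (c2 (iota 0 (mat \<i>) 0 0)) g *\<^sub>C \<Theta> (p2 g)" by (rule covariant)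

section \<open>Kernels at the base point and Schur's lemma\<close>

context siegel_projections
begin

text \<open>The matrices \<open>A\<close> that satisfy the relation are closed under products and
  contain the images of the isotropy exponentials, which suffices by
  \<open>SU_isotropy_generated\<close>.\<close>

lemma isotropy_intertwiner:
 assumes irr: "irreducible_unitary_rep \<Theta>" and irr': "irreducible_unitary_rep \<Theta>'"
  and X: "\<And>K. K \<in> skew_hermitian ==>
   \<Theta>' (p2 (Exp (iota 0 K 0 0))) ** X ** adj (\<Theta> (p2 (Exp (iota 0 K 0 0)))) = X" and A: "A \<in> carrier SU"
 shows "X ** \<Theta> A = \<Theta>' A ** X"
proof -
 define S where "S = {A \<in> carrier SU. X ** \<Theta> A = \<Theta>' A ** X}"
 have "A \<in> S"
 proof (rule SU_isotropy_generated[OF _ _ _ A])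
  show "mat 1 \<in> S" by (simp add: S_def SU_one irreducible_one irr irr')
  show "a ** b \<in> S" if "a \<in> S" "b \<in> S" for a b
  proof -
   have ab: "X ** \<Theta> a = \<Theta>' a ** X" "X ** \<Theta> b = \<Theta>' b ** X" using that by (simp_all add: S_def)
   have "X ** (\<Theta> a ** \<Theta> b) = \<Theta>' a ** (\<Theta>' b ** X)"
    unfolding matrix_mul_assoc ab(1) by (simp only: matrix_mul_assoc[symmetric] ab(2))
   thus ?thesis
    using that by (simp add: S_def SU_mult irreducible_mult[OF irr] irreducible_mult[OF irr'] matrix_mul_assoc)
  qed
  show "p2 (Exp (iota 0 K 0 0)) \<in> S" if K: "K \<in> skew_hermitian" for K
  proof -
   let ?a = "p2 (Exp (iota 0 K 0 0))"
   have m: "?a \<in> carrier SU" by (rule p2_SU[OF lie_exp_mem[OF iota_K_gtilde[OF K]]])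
   have "X ** \<Theta> ?a = \<Theta>' ?a ** X ** adj (\<Theta> ?a) ** \<Theta> ?a" by (simp only: X[OF K])
   hence "X ** \<Theta> ?a = \<Theta>' ?a ** X ** (adj (\<Theta> ?a) ** \<Theta> ?a)" by (simp only: matrix_mul_assoc)
   thus ?thesis using m by (simp add: S_def irreducible_unitary[OF irr])
  qed
 qed
 thus ?thesis by (simp add: S_def)
qed

end

context covariant_space
begin

lemma N_base_nonzero: "N base_point base_point \<noteq> 0"
 using covariant_isometry.ker_base_nonzero[OF covariant_isometry_id G_transitive] unfolding N_ker .

end

context pi_space
begin

abbreviation "ga \<equiv> c1 (E1 1)"
abbreviation "de \<equiv> c2 (iota 0 (mat \<i>) 0 0)"

lemma N_isotropy:
 assumes "K \<in> skew_hermitian"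
 shows "N base_point base_point = complex_of_real ((cmod (chi ga de (Exp (iota 0 K 0 0))))\<^sup>2) *\<^sub>C
  (\<Theta> (p2 (Exp (iota 0 K 0 0))) ** N base_point base_point ** adj (\<Theta> (p2 (Exp (iota 0 K 0 0)))))"
 using N_covariant[OF lie_exp_mem[OF iota_K_gtilde[OF assms]] base_point_siegel base_point_siegel]
 unfolding p_isotropy[OF assms] complex_norm_square
 by (simp add: adjoint_scaleC mm_scaleC_left mm_scaleC_right scaleC_scaleC mult.commute)

text \<open>The element \<open>Exp (E2 1)\<close> fixes the base point and has trivial image under
  \<open>p2\<close>. Covariance multiplies the nonzero kernel value there by the square of the
  modulus of its character, which is therefore 1.\<close>

lemma de_imaginary: "Re de = 0"
proof -
 have "N base_point base_point = complex_of_real ((cmod (chi ga de (Exp (E2 1))))\<^sup>2) *\<^sub>C N base_point base_point"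
  using N_isotropy[OF skew_hermitian_mat[of 1]] unfolding p2_E2 Theta_one by (simp add: adjoint_mat)
 hence "(1 - complex_of_real ((cmod (chi ga de (Exp (E2 1))))\<^sup>2)) *\<^sub>C N base_point base_point = 0"
  by (simp add: scaleC.diff_left)
 hence "cmod (1 - complex_of_real ((cmod (chi ga de (Exp (E2 1))))\<^sup>2)) = 0"
  using N_base_nonzero norm_scaleC[of "1 - complex_of_real ((cmod (chi ga de (Exp (E2 1))))\<^sup>2)" "N base_point base_point"]
  by simp
 hence "complex_of_real ((cmod (chi ga de (Exp (E2 1))))\<^sup>2) = 1" by simp
 hence "(cmod (chi ga de (Exp (E2 1))))\<^sup>2 = 1" by (metis of_real_eq_1_iff)
 hence "cmod (chi ga de (Exp (E2 1))) = 1" using power2_eq_imp_eq[OF _ norm_ge_zero zero_le_one] by simp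
 thus ?thesis unfolding norm_chi x_E2 by simp
qed

lemma norm_chi_0: "cmod (chi 0 de g) = 1" by (simp add: norm_chi de_imaginary)

lemma N_base_scalar: "\<exists>l. N base_point base_point = l *\<^sub>C mat 1"
proof -
 have "N base_point base_point ** \<Theta> A = \<Theta> A ** N base_point base_point" if A: "A \<in> carrier SU" for A
 proof (rule isotropy_intertwiner[OF irr irr _ A])
  fix K :: "complex^'r^'r" assume K: "K \<in> skew_hermitian"
  have "cmod (chi ga de (Exp (iota 0 K 0 0))) = 1" by (simp add: norm_chi x1_isotropy K de_imaginary)
  thus "\<Theta> (p2 (Exp (iota 0 K 0 0))) ** N base_point base_point ** adj (\<Theta> (p2 (Exp (iota 0 K 0 0))))
    = N base_point base_point" using N_isotropy[OF K] by simp
 qed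
 thus ?thesis using schur_hermitian[OF irr N_adjoint[OF base_point_siegel base_point_siegel]] by blast
qed

text \<open>On the diagonal, covariance transports the scalar matrix from the base point, because
  \<open>\<Theta>\<close> is unitary. Polarization, entry by entry, carries the shape off the
  diagonal.\<close>

lemma N_scalar:
 assumes z: "z \<in> \<D>" and w: "w \<in> \<D>"
 shows "N z w $ i $ j = (if i = j then N z w $ k $ k else 0)"
proof -
 have diag: "\<exists>l. N z z = l *\<^sub>C mat 1" if z: "z \<in> \<D>" for z
 proof -
  obtain g where g: "g \<in> carrier G" "p g base_point = z" using G_transitive[OF z] by blast
  obtain l where l: "N base_point base_point = l *\<^sub>C mat 1" using N_base_scalar by blast
  have "\<Theta> (p2 g) ** adj (\<Theta> (p2 g)) = mat 1" by (rule unitary_commute[OF Theta_unitary[OF p2_SU[OF g(1)]]])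
  hence "N z z = (chi ga de g * (l * cnj (chi ga de g))) *\<^sub>C mat 1"
   using N_covariant[OF g(1) base_point_siegel base_point_siegel] unfolding g(2) l
   by (simp add: adjoint_scaleC mm_scaleC_left mm_scaleC_right scaleC_scaleC mult_ac)
  thus ?thesis by blast
 qed
 show ?thesis
 proof (cases "i = j")
  case True
  have "N z w $ i $ i = N z w $ k $ k"
   by (rule sesqui_eqI[OF sesqui_N sesqui_N _ z w]) (use diag in \<open>force simp: mat_def\<close>)
  thus ?thesis using True by simp
 next
  case False
  have "N z w $ i $ j = 0"
   by (rule sesqui_eqI[OF sesqui_N sesqui_const _ z w]) (use diag False in \<open>force simp: mat_def\<close>)
  thus ?thesis using False by simp
 qed
qed

lemma kr_axis: "w \<in> \<D> ==> kr w j = (\<lambda>z. axis j (kr w j z $ j))"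
proof
 fix z assume w: "w \<in> \<D>"
 show "kr w j z = axis j (kr w j z $ j)"
 proof (cases "z \<in> \<D>")
  case True
  have "kr w j z $ i = axis j (kr w j z $ j) $ i" for i
   using N_scalar[OF True w, of i j j] by (cases "i = j") (simp_all add: N_def axis_def)
  thus ?thesis unfolding vec_eq_iff by blast
 next
  case False
  thus ?thesis using vecs_outside[OF kr_mem[OF w]] by (simp add: axis_def vec_eq_iff)
 qed
qed

text \<open>Projecting \<open>f\<close> to the functions with vanishing component \<open>j\<close>
  leaves a remainder that has only this component: by \<open>kr_axis\<close> the kernel functions
  for all other indices belong to that subspace and are orthogonal to the remainder.\<close>

lemma component_orthogonal:
 assumes f: "f \<in> vecs H"
 shows "(\<lambda>z. axis j (f z $ j)) \<in> vecs H"
  and "h \<in> vecs H ==> (\<And>z. h z $ j = 0) ==> ip H (\<lambda>z. axis j (f z $ j)) h = 0"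
proof -
 define S where "S = {h \<in> vecs H. \<forall>z. h z $ j = 0}"
 have "closed_subspace S" unfolding closed_subspace_def
 proof (intro conjI ballI allI impI)
  fix F f assume F: "(\<forall>n. F n \<in> S) \<and> f \<in> vecs H \<and> (\<lambda>n. nrm (\<lambda>z. F n z - f z)) \<longlonglongrightarrow> 0"
  have "f z $ j = 0" for z
  proof (cases "z \<in> \<D>")
   case True
   have "(\<lambda>n. F n z) \<longlonglongrightarrow> f z" by (rule limit_pointwise) (use F True in \<open>auto simp: S_def\<close>)
   hence "(\<lambda>n. F n z $ j) \<longlonglongrightarrow> f z $ j" by (rule tendsto_vec_nth)
   moreover have "F n z $ j = 0" for n using F unfolding S_def by blast
   ultimately show ?thesis by (simp add: LIMSEQ_const_iff)
  next
   case False
   thus ?thesis using vecs_outside[of f z] F by simp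
  qed
  thus "f \<in> S" using F by (simp add: S_def)
 qed (auto simp: S_def zero_mem add_mem scale_mem)
 from projection[OF this f] obtain h0 where h0: "h0 \<in> S" "\<And>k. k \<in> S ==> ip H (\<lambda>z. f z - h0 z) k = 0" by blast
 have h0H: "h0 \<in> vecs H" and h0j: "h0 z $ j = 0" for z using h0(1) unfolding S_def by blast+
 have d: "(\<lambda>z. f z - h0 z) \<in> vecs H" by (rule diff_mem[OF f h0H])
 have "f z - h0 z = axis j (f z $ j)" for z
 proof (cases "z \<in> \<D>")
  case True
  have "(f z - h0 z) $ l = 0" if "l \<noteq> j" for l
  proof -
   have "kr z l x $ j = 0" for x using that by (subst kr_axis[OF True]) (simp add: axis_def)
   hence "kr z l \<in> S" by (simp add: S_def kr_mem[OF True])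
   thus ?thesis using h0(2) kr_reproducing[OF True d, of l] by simp
  qed
  thus ?thesis using h0j by (auto simp: vec_eq_iff axis_def)
 next
  case False
  thus ?thesis using vecs_outside[OF f] vecs_outside[OF h0H] by (simp add: axis_def vec_eq_iff)
 qed
 hence eq: "(\<lambda>z. axis j (f z $ j)) = (\<lambda>z. f z - h0 z)" by simp
 show "(\<lambda>z. axis j (f z $ j)) \<in> vecs H" unfolding eq by (rule d)
 show "ip H (\<lambda>z. axis j (f z $ j)) h = 0" if "h \<in> vecs H" "\<And>z. h z $ j = 0"
  unfolding eq by (rule h0(2)) (use that in \<open>simp add: S_def del: split_paired_All\<close>)
qed

end

lemma axis_add: "axis i (x + y) = axis i x + (axis i y :: complex^'d::finite)"
 and axis_diff: "axis i (x - y) = axis i x - (axis i y :: complex^'d)"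
 and axis_scaleC: "axis i (c * x) = c *\<^sub>C (axis i x :: complex^'d)"
 and axis_zero: "axis i 0 = (0 :: complex^'d)" by (simp_all add: vec_eq_iff axis_def)

lemma axis_nth_same [simp]: "axis i x $ i = x" by (simp add: axis_def)

lemma inverse_scaleC_cancel: "a \<noteq> 0 ==> inverse a *\<^sub>C (a * x) = (x :: complex)" by simp

section \<open>Splitting the unitarization into scalar components\<close>

context pi_space
begin

text \<open>The component \<open>i\<close> of \<open>H\<close> as a space of scalar functions. It
  turns out to be the same space for all \<open>i\<close> and a unitarization of
  \<open>tau c1\<close>.\<close>

definition comp :: "'d => (('n, 'r) point, complex) function_space"
 where "comp i = \<lparr>vecs = {\<phi>. (\<lambda>z. axis i (\<phi> z)) \<in> vecs H},
  ip = \<lambda>\<phi> \<psi>. ip H (\<lambda>z. axis i (\<phi> z)) (\<lambda>z. axis i (\<psi> z))\<rparr>"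

lemma comp_simps [simp]: "\<phi> \<in> vecs (comp i) \<longleftrightarrow> (\<lambda>z. axis i (\<phi> z)) \<in> vecs H"
 "ip (comp i) \<phi> \<psi> = ip H (\<lambda>z. axis i (\<phi> z)) (\<lambda>z. axis i (\<psi> z))" by (simp_all add: comp_def)

lemma norm_comp: "ip_norm (comp i) \<phi> = nrm (\<lambda>z. axis i (\<phi> z))" by (simp add: ip_norm_def)

lemma comp_hilbert: "hilbert_function_space (comp i)" unfolding hilbert_function_space_def
proof (intro conjI allI ballI impI)
 show "(\<lambda>_. 0) \<in> vecs (comp i)" by (simp add: axis_zero zero_mem)
next
 fix f h assume "f \<in> vecs (comp i)" "h \<in> vecs (comp i)"
 thus "(\<lambda>z. f z + h z) \<in> vecs (comp i)" by (simp add: axis_add add_mem)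
next
 fix c f assume "f \<in> vecs (comp i)"
 thus "(\<lambda>z. c *\<^sub>C f z) \<in> vecs (comp i)" by (simp add: axis_scaleC scale_mem)
next
 fix f h k assume "f \<in> vecs (comp i)" "h \<in> vecs (comp i)" "k \<in> vecs (comp i)"
 thus "ip (comp i) (\<lambda>z. f z + h z) k = ip (comp i) f k + ip (comp i) h k" by (simp add: axis_add ip_add_left)
next
 fix c f h assume "f \<in> vecs (comp i)" "h \<in> vecs (comp i)"
 thus "ip (comp i) (\<lambda>z. c *\<^sub>C f z) h = c * ip (comp i) f h" by (simp add: axis_scaleC ip_scale_left)
next
 fix f h assume "f \<in> vecs (comp i)" "h \<in> vecs (comp i)"
 thus "ip (comp i) h f = cnj (ip (comp i) f h)" by (simp add: ip_commute[of "\<lambda>z. axis i (f z)"])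
next
 fix f assume f: "f \<in> vecs (comp i)" "f \<noteq> (\<lambda>_. 0)"
 have "(\<lambda>z. axis i (f z)) \<noteq> (\<lambda>_. 0)"
 proof
  assume "(\<lambda>z. axis i (f z)) = (\<lambda>_. 0)"
  from fun_cong[OF this] have "axis i (f z) $ i = 0" for z by simp
  thus False using f(2) by auto
 qed
 thus "0 < Re (ip (comp i) f f)" using f(1) by (simp add: ip_pos)
next
 fix F :: "nat => ('n, 'r) point => complex"
 assume F: "(\<forall>n. F n \<in> vecs (comp i)) \<and> (\<forall>e>0. \<exists>N. \<forall>m\<ge>N. \<forall>n\<ge>N. ip_norm (comp i) (\<lambda>z. F m z - F n z) < e)"
 have Fm: "(\<lambda>z. axis i (F n z)) \<in> vecs H" for n using F by simp
 have "\<exists>N. \<forall>m\<ge>N. \<forall>n\<ge>N. nrm (\<lambda>z. axis i (F m z) - axis i (F n z)) < e" if "e > 0" for e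
  using F that by (simp add: norm_comp axis_diff)
 from complete[OF Fm this] obtain f where f: "f \<in> vecs H" "(\<lambda>n. nrm (\<lambda>z. axis i (F n z) - f z)) \<longlonglongrightarrow> 0" by blast
 have "f z = axis i (f z $ i)" for z
 proof (cases "z \<in> \<D>")
  case True
  have "f z $ l = axis i (f z $ i) $ l" for l
  proof (cases "l = i")
   case False
   have "(\<lambda>n. axis i (F n z) $ l) \<longlonglongrightarrow> f z $ l" by (intro tendsto_vec_nth limit_pointwise[OF Fm f True])
   thus ?thesis using False by (simp add: axis_def LIMSEQ_const_iff)
  qed simp
  thus ?thesis unfolding vec_eq_iff by blast
 next
  case False
  thus ?thesis using vecs_outside[OF f(1)] by (simp add: axis_zero)
 qed
 hence eq: "(\<lambda>z. axis i (f z $ i)) = f" by (intro ext) simp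
 have "(\<lambda>z. f z $ i) \<in> vecs (comp i)" using f(1) by (simp add: eq)
 moreover have "(\<lambda>n. ip_norm (comp i) (\<lambda>z. F n z - f z $ i)) \<longlonglongrightarrow> 0"
  using f(2) fun_cong[OF eq] by (simp add: norm_comp axis_diff)
 ultimately show "\<exists>f\<in>vecs (comp i). (\<lambda>n. ip_norm (comp i) (\<lambda>z. F n z - f z)) \<longlonglongrightarrow> 0"
  by (intro bexI[of _ "\<lambda>z. f z $ i"])
qed

lemma comp_holomorphic: "vecs (comp i) \<subseteq> holomorphic_functions \<D>"
proof
 fix \<phi> assume "\<phi> \<in> vecs (comp i)"
 hence m: "(\<lambda>z. axis i (\<phi> z)) \<in> vecs H" by simp
 have "\<phi> z = 0" if "z \<notin> \<D>" for z using vecs_outside[OF m that] by (metis axis_nth_same zero_index)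
 thus "\<phi> \<in> holomorphic_functions \<D>" using holomorphic_co[OF m, of i] by (simp add: holomorphic_functions_def)
qed

lemma comp_embedded: "continuously_embedded \<D> (comp i)" unfolding continuously_embedded_def
proof (intro allI impI)
 fix F f and K :: "('n, 'r) point set"
 assume F: "(\<forall>n. F n \<in> vecs (comp i)) \<and> f \<in> vecs (comp i) \<and> (\<lambda>n. ip_norm (comp i) (\<lambda>z. F n z - f z)) \<longlonglongrightarrow> 0"
  and K: "compact K \<and> K \<subseteq> \<D>"
 have "uniform_limit K (\<lambda>n z. axis i (F n z)) (\<lambda>z. axis i (f z)) sequentially"
  using embedded[unfolded continuously_embedded_def, THEN spec, THEN spec, THEN mp,
    of "\<lambda>n z. axis i (F n z)" "\<lambda>z. axis i (f z)"] F K by (simp add: norm_comp axis_diff)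
 from bounded_linear.uniform_limit[OF bounded_linear_vec_nth[of i] this]
 show "uniform_limit K F f sequentially" by simp
qed

lemma comp_rks: "reproducing_kernel_space (comp i) \<D> (\<lambda>(_::unit) x. x)"
 by (intro reproducing_kernel_space.intro hilbert_functions.intro reproducing_kernel_space_axioms.intro
   comp_hilbert comp_embedded comp_holomorphic) (simp_all add: bounded_linear_ident)

lemma comp_kr:
 assumes w: "w \<in> \<D>"
 shows "reproducing_kernel_space.kr (comp i) (\<lambda>(_::unit) x. x) w u = (\<lambda>z. kr w i z $ i)"
proof -
 interpret c: reproducing_kernel_space "comp i" \<D> "\<lambda>(_::unit) x. x" by (rule comp_rks)
 have eq: "(\<lambda>z. axis i (kr w i z $ i)) = kr w i" using kr_axis[OF w, of i] by simp
 show ?thesis by (rule c.kr_unique[OF w, symmetric]) (simp_all add: eq kr_mem[OF w] kr_reproducing[OF w])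
qed

text \<open>By \<open>N_scalar\<close> the diagonal entries of the kernel agree, so the component
  spaces have equal kernels and coincide together with their inner products.\<close>

lemma comp_indep:
 shows "vecs (comp i) = vecs (comp j)"
  and "\<phi> \<in> vecs (comp i) ==> \<psi> \<in> vecs (comp i) ==> ip (comp j) \<phi> \<psi> = ip (comp i) \<phi> \<psi>"
proof -
 have eq: "reproducing_kernel_space.kr (comp i) (\<lambda>(_::unit) x. x) w u
   = (\<lambda>z. complex_of_real 1 *\<^sub>C reproducing_kernel_space.kr (comp j) (\<lambda>(_::unit) x. x) w u z)"
  if w: "w \<in> \<D>" for w u and i j :: 'd
 proof
  fix z
  show "reproducing_kernel_space.kr (comp i) (\<lambda>(_::unit) x. x) w u z
   = complex_of_real 1 *\<^sub>C reproducing_kernel_space.kr (comp j) (\<lambda>(_::unit) x. x) w u z"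
  proof (cases "z \<in> \<D>")
   case True
   thus ?thesis using N_scalar[OF True w, of i i j] by (simp add: comp_kr[OF w] N_def)
  next
   case False
   thus ?thesis using vecs_outside[OF kr_mem[OF w]] by (simp add: comp_kr[OF w])
  qed
 qed
 show "vecs (comp i) = vecs (comp j)"
  using kernel_determines_space(1)[OF comp_rks comp_rks zero_less_one eq, of i j]
   kernel_determines_space(1)[OF comp_rks comp_rks zero_less_one eq, of j i] by (rule equalityI)
 show "\<phi> \<in> vecs (comp i) ==> \<psi> \<in> vecs (comp i) ==> ip (comp j) \<phi> \<psi> = ip (comp i) \<phi> \<psi>"
  using kernel_determines_space(2)[OF comp_rks comp_rks zero_less_one eq, of \<phi> i \<psi> j] by simp
qed

lemma axis_mem: "(\<lambda>z. axis i (\<phi> z)) \<in> vecs H ==> (\<lambda>z. axis j (\<phi> z)) \<in> vecs H"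
 using comp_indep(1)[of i j] by (metis comp_simps(1))

lemma vec_axis_sum: "x = (\<Sum>i\<in>UNIV. axis i (x $ i) :: complex^'d)"
proof -
 have "(\<Sum>i\<in>UNIV. axis i (x $ i) :: complex^'d) $ l = x $ l" for l
  by (simp add: axis_def if_distrib if_distribR cong: if_cong)
 thus ?thesis by (simp add: vec_eq_iff)
qed

lemma mem_iff_comp: "f \<in> vecs H \<longleftrightarrow> (\<forall>i. (\<lambda>z. f z $ i) \<in> vecs (comp k))"
proof
 assume "f \<in> vecs H"
 thus "\<forall>i. (\<lambda>z. f z $ i) \<in> vecs (comp k)"
  unfolding comp_simps by (intro allI axis_mem[OF component_orthogonal(1)])
next
 assume f: "\<forall>i. (\<lambda>z. f z $ i) \<in> vecs (comp k)"
 have "(\<lambda>z. axis i (f z $ i)) \<in> vecs H" for i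
  by (rule axis_mem[of k "\<lambda>z. f z $ i"]) (rule f[unfolded comp_simps, THEN spec])
 hence "(\<lambda>z. \<Sum>i\<in>UNIV. axis i (f z $ i)) \<in> vecs H" by (intro sum_mem)
 thus "f \<in> vecs H" by (simp flip: vec_axis_sum)
qed

text \<open>Different components are orthogonal and all component spaces are the same. Together with
  \<open>mem_iff_comp\<close> this exhibits \<open>H\<close> as the tensor product of
  \<open>comp k\<close> with the space of \<open>\<Theta>\<close>.\<close>

lemma ip_comp:
 assumes f: "f \<in> vecs H" and h: "h \<in> vecs H"
 shows "ip H f h = (\<Sum>i\<in>UNIV. ip (comp k) (\<lambda>z. f z $ i) (\<lambda>z. h z $ i))"
proof -
 have fi: "(\<lambda>z. axis i (f z $ i)) \<in> vecs H" for i by (rule component_orthogonal(1)[OF f])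
 have hi: "(\<lambda>z. axis i (h z $ i)) \<in> vecs H" for i by (rule component_orthogonal(1)[OF h])
 have "ip H f h = ip H (\<lambda>z. \<Sum>i\<in>UNIV. axis i (f z $ i)) h" by (simp flip: vec_axis_sum)
 also have "\<dots> = (\<Sum>i\<in>UNIV. ip H (\<lambda>z. axis i (f z $ i)) h)" by (rule ip_sum_left[OF fi h])
 also have "\<dots> = (\<Sum>i\<in>UNIV. ip H (\<lambda>z. axis i (f z $ i)) (\<lambda>z. axis i (h z $ i)))"
 proof (rule sum.cong[OF refl])
  fix i
  have "ip H (\<lambda>z. axis i (f z $ i)) (\<lambda>z. h z - axis i (h z $ i)) = 0"
   by (rule component_orthogonal(2)[OF f diff_mem[OF h hi]]) simp
  thus "ip H (\<lambda>z. axis i (f z $ i)) h = ip H (\<lambda>z. axis i (f z $ i)) (\<lambda>z. axis i (h z $ i))"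
   by (simp add: ip_diff_right[OF h hi fi])
 qed
 also have "\<dots> = (\<Sum>i\<in>UNIV. ip (comp k) (\<lambda>z. f z $ i) (\<lambda>z. h z $ i))"
 proof (rule sum.cong[OF refl])
  fix i
  show "ip H (\<lambda>z. axis i (f z $ i)) (\<lambda>z. axis i (h z $ i)) = ip (comp k) (\<lambda>z. f z $ i) (\<lambda>z. h z $ i)"
   using comp_indep(2)[of "\<lambda>z. f z $ i" i "\<lambda>z. h z $ i" k] fi hi by simp
 qed
 finally show ?thesis .
qed

lemma pi_rep_axis:
 assumes g: "g \<in> carrier G"
 shows "prep c1 c2 \<Theta> g (\<lambda>z. axis i (\<phi> z)) z $ j = chi 0 de g * \<Theta> (p2 g) $ j $ i * tau c1 g \<phi> z"
proof (cases "z \<in> \<D>")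
 case True
 have "(\<Theta> (p2 g) *v axis i x) $ j = \<Theta> (p2 g) $ j $ i * x" for x
  by (simp add: matrix_vector_mult_def axis_def if_distrib cong: if_cong)
 thus ?thesis using True by (simp add: pi_rep_chi[OF c1 c2 g] tau_rep_chi[OF c1 g] chi_split[of ga de])
qed (simp add: pi_rep_def tau_rep_def)

lemma unitary_column:
 assumes "adj A ** A = mat 1"
 shows "(\<Sum>j\<in>UNIV. cnj (A $ j $ i) * A $ j $ i) = 1"
proof -
 have "(adj A ** A) $ i $ i = 1" by (simp add: assms mat_def)
 thus ?thesis by (simp add: matrix_matrix_mult_def adjoint_matrix_def transpose_def)
qed

lemma unitary_column_nonzero:
 assumes "adj A ** A = mat 1"
 shows "\<exists>j. A $ j $ i \<noteq> 0"
 using unitary_column[OF assms, of i] by (metis (no_types, lifting) mult_zero_right sum.neutral zero_neq_one)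

text \<open>Applied to a function with one component, \<open>\<pi>\<close> yields multiples of
  \<open>tau c1 g \<phi>\<close> in all components. The coefficients form a column of a unitary
  matrix up to a nonzero character, so one of them can be divided out.\<close>

lemma tau_rep_comp:
 assumes g: "g \<in> carrier G" and \<phi>: "\<phi> \<in> vecs (comp i)"
 shows "tau c1 g \<phi> \<in> vecs (comp i)"
proof -
 interpret c: reproducing_kernel_space "comp i" \<D> "\<lambda>(_::unit) x. x" by (rule comp_rks)
 obtain j where j: "\<Theta> (p2 g) $ j $ i \<noteq> 0"
  using unitary_column_nonzero[OF Theta_unitary[OF p2_SU[OF g]]] by blast
 have "prep c1 c2 \<Theta> g (\<lambda>z. axis i (\<phi> z)) \<in> vecs H" using \<phi> by (intro rho_mem[OF g]) simp
 hence "(\<lambda>z. prep c1 c2 \<Theta> g (\<lambda>z. axis i (\<phi> z)) z $ j) \<in> vecs (comp i)" unfolding mem_iff_comp[of _ i] by blast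
 hence "(\<lambda>z. inverse (chi 0 de g * \<Theta> (p2 g) $ j $ i) *\<^sub>C
   (prep c1 c2 \<Theta> g (\<lambda>z. axis i (\<phi> z)) z $ j)) \<in> vecs (comp i)" by (rule c.scale_mem)
 moreover have "inverse (chi 0 de g * \<Theta> (p2 g) $ j $ i) *\<^sub>C
   (prep c1 c2 \<Theta> g (\<lambda>z. axis i (\<phi> z)) z $ j) = tau c1 g \<phi> z" for z
 proof -
  have ne: "chi 0 de g * \<Theta> (p2 g) $ j $ i \<noteq> 0" by (rule no_zero_divisors[OF chi_nonzero j])
  show ?thesis by (subst pi_rep_axis[OF g]) (rule inverse_scaleC_cancel[OF ne])
 qed
 ultimately show ?thesis by (simp only:)
qed

text \<open>Invariance of the inner product holds since the squared moduli of a column of a unitary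
  matrix sum to 1 and the character of the second projection is unimodular by
  \<open>norm_chi_0\<close>.\<close>

lemma tau_unitarization: "is_unitarization \<D> G (tau c1) (comp i)" unfolding is_unitarization_def
proof (intro conjI ballI comp_hilbert comp_holomorphic comp_embedded)
 interpret c: reproducing_kernel_space "comp i" \<D> "\<lambda>(_::unit) x. x" by (rule comp_rks)
 show "vecs (comp i) \<noteq> {\<lambda>_. 0}"
 proof
  assume 0: "vecs (comp i) = {\<lambda>_. 0}"
  have "f = (\<lambda>_. 0)" if f: "f \<in> vecs H" for f
  proof (rule vecs_eqI[OF f zero_mem])
   fix z j
   have "(\<lambda>z. f z $ j) \<in> {\<lambda>_. 0}" using mem_iff_comp[of f i] f unfolding 0 by blast
   hence "(\<lambda>z. f z $ j) = (\<lambda>_. 0)" by (rule singletonD)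
   from fun_cong[OF this, of z] show "f z $ j = 0 $ j" by simp
  qed
  hence "vecs H = {\<lambda>_. 0}" using zero_mem by blast
  thus False using nontrivial by blast
 qed
 show "tau c1 g f \<in> vecs (comp i)" if "g \<in> carrier G" "f \<in> vecs (comp i)" for g f
  by (rule tau_rep_comp[OF that])
 show "ip (comp i) (tau c1 g f) (tau c1 g h) = ip (comp i) f h"
  if g: "g \<in> carrier G" and f: "f \<in> vecs (comp i)" and h: "h \<in> vecs (comp i)" for g f h
 proof -
  let ?t = "tau c1 g" and ?\<pi> = "\<lambda>f. prep c1 c2 \<Theta> g (\<lambda>z. axis i (f z))"
  have tf: "?t f \<in> vecs (comp i)" and th: "?t h \<in> vecs (comp i)" by (rule tau_rep_comp[OF g f] tau_rep_comp[OF g h])+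
  have fH: "(\<lambda>z. axis i (f z)) \<in> vecs H" and hH: "(\<lambda>z. axis i (h z)) \<in> vecs H" using f h by simp_all
  let ?a = "\<lambda>j. chi 0 de g * \<Theta> (p2 g) $ j $ i"
  have "ip (comp i) f h = ip H (?\<pi> f) (?\<pi> h)" by (simp add: rho_ip[OF g fH hH])
  also have "\<dots> = (\<Sum>j\<in>UNIV. ip (comp i) (\<lambda>z. ?a j * ?t f z) (\<lambda>z. ?a j * ?t h z))"
   unfolding ip_comp[OF rho_mem[OF g fH] rho_mem[OF g hH], of i] pi_rep_axis[OF g] ..
  also have "\<dots> = (\<Sum>j\<in>UNIV. ?a j * (cnj (?a j) * ip (comp i) (?t f) (?t h)))"
  proof (rule sum.cong[OF refl])
   fix j
   have "ip (comp i) (\<lambda>z. ?a j *\<^sub>C ?t f z) (\<lambda>z. ?a j *\<^sub>C ?t h z) = ?a j * (cnj (?a j) * ip (comp i) (?t f) (?t h))"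
    by (simp only: c.ip_scale_left[OF tf c.scale_mem[OF th]] c.ip_scale_right[OF th tf])
   thus "ip (comp i) (\<lambda>z. ?a j * ?t f z) (\<lambda>z. ?a j * ?t h z) = ?a j * (cnj (?a j) * ip (comp i) (?t f) (?t h))"
    by (simp del: comp_simps)
  qed
  also have "\<dots> = (chi 0 de g * cnj (chi 0 de g)) * (\<Sum>j\<in>UNIV. cnj (\<Theta> (p2 g) $ j $ i) * \<Theta> (p2 g) $ j $ i) * ip (comp i) (?t f) (?t h)"
   by (simp add: sum_distrib_left sum_distrib_right mult_ac del: comp_simps)
  also have "\<dots> = ip (comp i) (?t f) (?t h)"
   unfolding unitary_column[OF Theta_unitary[OF p2_SU[OF g]]] complex_norm_square[symmetric] norm_chi_0 by simp
  finally show ?thesis by simp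
 qed
qed

end

section \<open>Intertwining operators\<close>

lemma unit_matrix_conjugate:
 "(mat x ** X ** adj (mat y)) $ () $ () = x * cnj y * (X :: complex^unit^unit) $ () $ ()"
 unfolding adjoint_mat by (simp add: matrix_matrix_mult_def UNIV_unit mat_def)

lemma exp_scaleR_add_cnj: "exp (t *\<^sub>R (a + cnj b)) = exp (t *\<^sub>R a) * cnj (exp (t *\<^sub>R b))"
 by (simp add: scaleR_conv_of_real distrib_left exp_add exp_cnj)

lemma exp_scaleR_eq_1:
 fixes c :: complex
 assumes "\<And>t. exp (t *\<^sub>R c) = 1"
 shows "c = 0"
proof -
 have "((\<lambda>t. exp (t *\<^sub>R c)) has_vector_derivative exp (0 *\<^sub>R c) * c) (at 0)"
  by (rule exp_scaleR_has_vector_derivative_right)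
 hence "((\<lambda>t::real. 1 :: complex) has_vector_derivative c) (at 0)" by (simp add: assms)
 from vector_derivative_unique_at[OF this has_vector_derivative_const] show ?thesis .
qed

lemma complex_dual_z2_eqI:
 assumes c: "c \<in> complex_dual z2" and c': "c' \<in> complex_dual z2"
  and eq: "c (iota 0 (mat \<i>) 0 0) = (c' (iota 0 (mat \<i>) 0 0) :: complex)"
 shows "c = (c' :: ('n::finite, 'r::finite) lie_matrix => complex)"
proof (rule extensionalityI[where A = z2])
 show "c \<in> extensional z2" "c' \<in> extensional z2" using c c' by (simp_all add: complex_dual_def)
 fix x :: "('n, 'r) lie_matrix" assume "x \<in> z2"
 then obtain a where x: "x = E2 a" by (auto simp: z2_def)
 have m: "(E2 1 :: ('n, 'r) lie_matrix) \<in> z2" unfolding z2_def by blast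
 have "c (a *\<^sub>R E2 1) = a *\<^sub>R c (E2 1)" "c' (a *\<^sub>R E2 1) = a *\<^sub>R c' (E2 1)"
  using c c' m unfolding complex_dual_def by blast+
 thus "c x = c' x" using eq unfolding x E2_scaleR by simp
qed

text \<open>Both products of \<open>X\<close> with its adjoint are scalar by
  \<open>schur_hermitian\<close>, with the same positive scalar; dividing \<open>X\<close> by the
  square root of it gives a unitary matrix.\<close>

lemma schur_equivalence:
 fixes X :: "complex^'d::finite^'e::finite"
 assumes irr: "irreducible_unitary_rep \<Theta>" and irr': "irreducible_unitary_rep \<Theta>'" and X: "X \<noteq> 0"
  and comm: "\<And>A. A \<in> carrier SU ==> X ** \<Theta> A = \<Theta>' A ** X"
 obtains m L where "X = m *\<^sub>C L" "adj L ** L = mat 1" "L ** adj L = mat 1"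
  "\<And>A. A \<in> carrier SU ==> L ** \<Theta> A = \<Theta>' A ** L"
proof -
 have un: "adj (\<Theta> A) ** \<Theta> A = mat 1" "\<Theta> A ** adj (\<Theta> A) = mat 1" if "A \<in> carrier SU" for A
  using irr that by (auto simp: irreducible_unitary_rep_def unitary_matrix_def intro: unitary_commute)
 have un': "adj (\<Theta>' A) ** \<Theta>' A = mat 1" "\<Theta>' A ** adj (\<Theta>' A) = mat 1" if "A \<in> carrier SU" for A
  using irr' that by (auto simp: irreducible_unitary_rep_def unitary_matrix_def intro: unitary_commute)
 let ?Y = "adj X"
 have comm': "?Y ** \<Theta>' A = \<Theta> A ** ?Y" if A: "A \<in> carrier SU" for A
 proof -
  have "adj (\<Theta> A) ** ?Y = ?Y ** adj (\<Theta>' A)" using arg_cong[OF comm[OF A], of adj] by (simp add: adjoint_mult)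
  hence "\<Theta> A ** (adj (\<Theta> A) ** ?Y) ** \<Theta>' A = \<Theta> A ** (?Y ** adj (\<Theta>' A)) ** \<Theta>' A" by simp
  hence "(\<Theta> A ** adj (\<Theta> A)) ** ?Y ** \<Theta>' A = \<Theta> A ** ?Y ** (adj (\<Theta>' A) ** \<Theta>' A)"
   by (simp only: matrix_mul_assoc)
  thus ?thesis by (simp add: un(2)[OF A] un'(1)[OF A])
 qed
 have "?Y ** X ** \<Theta> A = \<Theta> A ** (?Y ** X)" if A: "A \<in> carrier SU" for A
 proof -
  have "?Y ** X ** \<Theta> A = ?Y ** (X ** \<Theta> A)" by (simp add: matrix_mul_assoc)
  also have "\<dots> = ?Y ** \<Theta>' A ** X" by (simp only: comm[OF A] matrix_mul_assoc)
  also have "\<dots> = \<Theta> A ** (?Y ** X)" by (simp only: comm'[OF A] matrix_mul_assoc)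
  finally show ?thesis .
 qed
 then obtain a where a: "?Y ** X = complex_of_real a *\<^sub>C mat 1"
  using schur_hermitian[OF irr, of "?Y ** X"] by (auto simp: adjoint_mult)
 have "X ** ?Y ** \<Theta>' A = \<Theta>' A ** (X ** ?Y)" if A: "A \<in> carrier SU" for A
 proof -
  have "X ** ?Y ** \<Theta>' A = X ** (?Y ** \<Theta>' A)" by (simp add: matrix_mul_assoc)
  also have "\<dots> = X ** \<Theta> A ** ?Y" by (simp only: comm'[OF A] matrix_mul_assoc)
  also have "\<dots> = \<Theta>' A ** (X ** ?Y)" by (simp only: comm[OF A] matrix_mul_assoc)
  finally show ?thesis .
 qed
 then obtain b where b: "X ** ?Y = complex_of_real b *\<^sub>C mat 1"
  using schur_hermitian[OF irr', of "X ** ?Y"] by (auto simp: adjoint_mult)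
 have "complex_of_real a *\<^sub>C X = complex_of_real b *\<^sub>C X"
 proof -
  have "X ** (?Y ** X) = (X ** ?Y) ** X" by (rule matrix_mul_assoc)
  thus ?thesis by (simp add: a b mm_scaleC_left mm_scaleC_right)
 qed
 hence "complex_of_real (a - b) *\<^sub>C X = 0" by (simp add: scaleC.diff_left)
 hence ab: "a = b" using X norm_scaleC[of "complex_of_real (a - b)" X] by (simp del: of_real_diff)
 obtain v where v: "X *v v \<noteq> 0" using X by (metis matrix_eq matrix_vector_mult_0)
 have "complex_of_real (norm (X *v v) ^ 2) = hp v ((?Y ** X) *v v)"
  unfolding hp_self[symmetric] hp_adjoint matrix_vector_mul_assoc ..
 also have "\<dots> = complex_of_real (a * (norm v)\<^sup>2)" unfolding a mv_scaleC_left hp_simps by (simp add: hp_self)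
 finally have "norm (X *v v) ^ 2 = a * (norm v)\<^sup>2" using of_real_eq_iff by blast
 hence "0 < a * (norm v)\<^sup>2" using v by (metis zero_less_norm_iff zero_less_power)
 hence a0: "a > 0" by (simp add: zero_less_mult_iff)
 define s where "s = complex_of_real (inverse (sqrt a))"
 have ss: "s * (s * complex_of_real a) = 1"
 proof -
  have "inverse (sqrt a) * (inverse (sqrt a) * a) = 1" using a0 by (simp add: field_simps)
  thus ?thesis by (simp only: s_def of_real_mult[symmetric] of_real_1)
 qed
 have cs: "cnj s = s" by (simp add: s_def)
 have s0: "s \<noteq> 0" using a0 by (simp add: s_def)
 show ?thesis
 proof (rule that[of "inverse s" "s *\<^sub>C X"])
  show "X = inverse s *\<^sub>C s *\<^sub>C X" using s0 by (simp add: scaleC_scaleC)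
  show "adj (s *\<^sub>C X) ** (s *\<^sub>C X) = mat 1" "(s *\<^sub>C X) ** adj (s *\<^sub>C X) = mat 1"
   using ss by (simp_all add: adjoint_scaleC mm_scaleC_left mm_scaleC_right cs a b scaleC_scaleC ab mult.assoc)
  show "(s *\<^sub>C X) ** \<Theta> A = \<Theta>' A ** (s *\<^sub>C X)" if "A \<in> carrier SU" for A
   by (simp add: mm_scaleC_left mm_scaleC_right comm that)
 qed
qed

context siegel_cover
begin

lemma borel_transitive_pair:
 assumes ob: "ordered_basis rk C Ci" and z: "z \<in> \<D>" and w: "w \<in> \<D>"
 shows "\<exists>b \<in> generate G (Exp ` borel rk C Ci). p b z = w"
proof -
 interpret ordered_basis rk C Ci by fact
 let ?B = "generate G (Exp ` (borel rk C Ci :: ('n, 'r) lie_matrix set))"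
 have Bc: "b \<in> carrier G" if "b \<in> ?B" for b
  using that by (rule generate_lie_exp_mem[rotated]) (auto dest: borel_gtilde)
 obtain b1 where b1: "b1 \<in> ?B" "p b1 base_point = z" using borel_transitive[OF ob z] by blast
 obtain b2 where b2: "b2 \<in> ?B" "p b2 base_point = w" using borel_transitive[OF ob w] by blast
 have "inv b1 \<in> ?B" using b1(1) by (intro generate_m_inv_closed) (auto dest: borel_gtilde intro: lie_exp_mem)
 hence "b2 \<otimes> inv b1 \<in> ?B" by (rule generate.eng[OF b2(1)])
 moreover have "p (b2 \<otimes> inv b1) z = w"
  using p_mult_apply[OF Bc[OF b2(1)] inv_closed[OF Bc[OF b1(1)]] z] p_inv_apply(1)[OF Bc[OF b1(1)] base_point_siegel]
  by (simp add: b1(2) b2(2))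
 ultimately show ?thesis by blast
qed

end

section \<open>Kernels of the scalar unitarizations\<close>

context tau_space
begin

abbreviation "ga \<equiv> c1 (E1 1)"

lemma kr_covariant:
 assumes g: "g \<in> carrier G" and z: "z \<in> \<D>"
 shows "kr (p g z) () (p g z) = complex_of_real ((cmod (chi ga 0 g))\<^sup>2) * kr z () z"
proof -
 have "N (p g z) (p g z) $ () $ () = (mat (chi ga 0 g) ** N z z ** adj (mat (chi ga 0 g))) $ () $ ()"
  by (simp only: N_covariant[OF g z z])
 also have "\<dots> = chi ga 0 g * cnj (chi ga 0 g) * N z z $ () $ ()" by (rule unit_matrix_conjugate)
 finally show ?thesis unfolding complex_norm_square by (simp add: N_def)
qed

lemma kr_base_pos: "\<exists>l>0. kr base_point () base_point = complex_of_real l"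
proof -
 have "kr base_point () base_point \<noteq> 0"
 proof
  assume "kr base_point () base_point = 0"
  hence "N base_point base_point = 0" by (simp add: N_def vec_eq_iff)
  thus False using N_base_nonzero by blast
 qed
 thus ?thesis using N_diagonal[OF base_point_siegel, of "()"] by (intro exI[of _ "(nrm (kr base_point ()))\<^sup>2"]) (auto simp: N_def)
qed

lemma kr_diag_nonzero: "z \<in> \<D> ==> kr z () z \<noteq> 0"
proof -
 assume z: "z \<in> \<D>"
 obtain g where g: "g \<in> carrier G" "p g base_point = z" using G_transitive[OF z] by blast
 thus ?thesis using kr_covariant[OF g(1) base_point_siegel] kr_base_pos by auto
qed

lemma sesqui_kr: "sesqui (\<lambda>z w. kr w () z)" using sesqui_N[of "()" "()"] by (simp add: N_def)

text \<open>On the diagonal, \<open>g\<close> multiplies the nonzero kernel by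
  \<open>exp (2 x1 Re ga)\<close>, from which \<open>x1\<close> can be recovered when the real part
  is not zero.\<close>

lemma x1_determined:
 assumes "Re ga \<noteq> 0" "g \<in> carrier G" "h \<in> carrier G" "z \<in> \<D>" "p g z = p h z"
 shows "x1 g = x1 h"
proof -
 have "complex_of_real ((cmod (chi ga 0 g))\<^sup>2) * kr z () z = complex_of_real ((cmod (chi ga 0 h))\<^sup>2) * kr z () z"
  using kr_covariant[OF assms(2,4)] kr_covariant[OF assms(3,4)] assms(5) by metis
 hence "(cmod (chi ga 0 g))\<^sup>2 = (cmod (chi ga 0 h))\<^sup>2"
  unfolding mult_cancel_right of_real_eq_iff using kr_diag_nonzero[OF assms(4)] by blast
 hence "cmod (chi ga 0 g) = cmod (chi ga 0 h)" by (rule power2_eq_imp_eq) simp_all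
 thus ?thesis using assms(1) by (simp add: norm_chi)
qed

text \<open>The characters are unimodular here, so transitivity makes the kernel constant on the
  diagonal, and polarization makes it constant everywhere.\<close>

lemma kr_constant:
 assumes "Re ga = 0" "w \<in> \<D>"
 shows "kr w () = kr base_point ()"
proof
 fix z
 have diag: "kr z () z = kr base_point () base_point" if z: "z \<in> \<D>" for z
 proof -
  obtain g where g: "g \<in> carrier G" "p g base_point = z" using G_transitive[OF z] by blast
  thus ?thesis using kr_covariant[OF g(1) base_point_siegel] assms(1) by (simp add: norm_chi)
 qed
 show "kr w () z = kr base_point () z"
 proof (cases "z \<in> \<D>")
  case True
  show ?thesis
   using sesqui_eqI[OF sesqui_kr sesqui_const[of "kr base_point () base_point"] diag True assms(2)]
    sesqui_eqI[OF sesqui_kr sesqui_const[of "kr base_point () base_point"] diag True base_point_siegel] by simp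
 next
  case False
  thus ?thesis using vecs_outside kr_mem assms(2) base_point_siegel by metis
 qed
qed

end

context siegel_projections
begin

text \<open>Two kernels with the same covariance are proportional on the diagonal by transitivity,
  hence everywhere; the factor is read off at the base point. This is needed because the
  unitarization in the statement is an arbitrary choice.\<close>

lemma tau_unique:
 assumes c1: "c1 \<in> complex_dual z1" and 1: "is_unitarization \<D> G (tau c1) H1"
  and 2: "is_unitarization \<D> G (tau c1) H2"
 shows "vecs H1 = vecs H2 \<and> (\<exists>\<kappa>>0. \<forall>f\<in>vecs H1. \<forall>h\<in>vecs H1. ip H2 f h = complex_of_real \<kappa> * ip H1 f h)"
proof -
 have ex: "\<exists>\<kappa>>0. vecs H1 \<subseteq> vecs H2 \<and> (\<forall>f\<in>vecs H1. \<forall>h\<in>vecs H1. ip H2 f h = complex_of_real \<kappa> * ip H1 f h)"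
  if "is_unitarization \<D> G (tau c1) H1" "is_unitarization \<D> G (tau c1) H2" for H1 H2
 proof -
  interpret t1: tau_space G T p p11 p21 p2 c1 H1 by unfold_locales (fact c1 that(1))+
  interpret t2: tau_space G T p p11 p21 p2 c1 H2 by unfold_locales (fact c1 that(2))+
  obtain l1 where l1: "l1 > 0" "t1.kr base_point () base_point = complex_of_real l1" using t1.kr_base_pos by blast
  obtain l2 where l2: "l2 > 0" "t2.kr base_point () base_point = complex_of_real l2" using t2.kr_base_pos by blast
  define \<kappa> where "\<kappa> = l1 / l2"
  have \<kappa>: "\<kappa> > 0" using l1 l2 by (simp add: \<kappa>_def)
  have diag: "t1.kr z () z = complex_of_real \<kappa> * t2.kr z () z" if z: "z \<in> \<D>" for z
  proof -
   obtain g where g: "g \<in> carrier G" "p g base_point = z" using G_transitive[OF z] by blast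
   thus ?thesis
    using t1.kr_covariant[OF g(1) base_point_siegel] t2.kr_covariant[OF g(1) base_point_siegel] l1 l2
    by (simp add: \<kappa>_def)
  qed
  have eq: "t1.kr w i = (\<lambda>z. complex_of_real \<kappa> *\<^sub>C t2.kr w i z)" if w: "w \<in> \<D>" for w i
  proof
   fix z
   show "t1.kr w i z = complex_of_real \<kappa> *\<^sub>C t2.kr w i z"
   proof (cases "z \<in> \<D>")
    case True
    thus ?thesis using sesqui_eqI[OF t1.sesqui_kr sesqui_scale[OF t2.sesqui_kr] diag True w] by simp
   next
    case False
    thus ?thesis using t1.vecs_outside[OF t1.kr_mem[OF w]] t2.vecs_outside[OF t2.kr_mem[OF w]] by simp
   qed
  qed
  note kd = kernel_determines_space[OF t1.reproducing_kernel_space_axioms t2.reproducing_kernel_space_axioms \<kappa> eq]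
  show ?thesis using kd \<kappa> by blast
 qed
 from ex[OF 1 2] ex[OF 2 1] show ?thesis by blast
qed

text \<open>The component space of \<open>H\<close> is one unitarization of \<open>tau c1\<close>;
  \<open>tau_unique\<close> replaces it by the given one at the price of the factor
  \<open>\<kappa>\<close>.\<close>

lemma pi_structure:
 fixes \<Theta> :: "complex^'r^'r => complex^'d::finite^'d"
 assumes c1: "c1 \<in> complex_dual z1" and c2: "c2 \<in> complex_dual z2" and irr: "irreducible_unitary_rep \<Theta>"
  and H: "is_unitarization \<D> G (prep c1 c2 \<Theta>) H" and Ht: "is_unitarization \<D> G (tau c1) Ht"
 obtains \<kappa> where "\<kappa> > 0" "\<And>f. f \<in> vecs H \<longleftrightarrow> (\<forall>i. (\<lambda>z. f z $ i) \<in> vecs Ht)" "\<And>f h. f \<in> vecs H ==> h \<in> vecs H ==>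
   ip H f h = complex_of_real \<kappa> * (\<Sum>i\<in>UNIV. ip Ht (\<lambda>z. f z $ i) (\<lambda>z. h z $ i))"
proof -
 interpret pi_space G T p p11 p21 p2 c1 c2 \<Theta> H by unfold_locales (fact assms)+
 have k: "vecs Ht = vecs (comp undefined)"
  and "\<exists>\<kappa>>0. \<forall>f\<in>vecs Ht. \<forall>h\<in>vecs Ht. ip (comp undefined) f h = complex_of_real \<kappa> * ip Ht f h"
  using tau_unique[OF c1 Ht tau_unitarization[of undefined]] by blast+
 then obtain \<kappa> where \<kappa>: "\<kappa> > 0" "\<And>f h. f \<in> vecs Ht ==> h \<in> vecs Ht ==> ip (comp undefined) f h = complex_of_real \<kappa> * ip Ht f h"
  by blast
 have mem: "f \<in> vecs H \<longleftrightarrow> (\<forall>i. (\<lambda>z. f z $ i) \<in> vecs Ht)" for f unfolding k by (rule mem_iff_comp)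
 show ?thesis
 proof (rule that[OF \<kappa>(1) mem])
  fix f h assume f: "f \<in> vecs H" and h: "h \<in> vecs H"
  have "ip (comp undefined) (\<lambda>z. f z $ i) (\<lambda>z. h z $ i) = complex_of_real \<kappa> * ip Ht (\<lambda>z. f z $ i) (\<lambda>z. h z $ i)" for i
   using mem[of f] mem[of h] f h by (intro \<kappa>(2)) blast+
  thus "ip H f h = complex_of_real \<kappa> * (\<Sum>i\<in>UNIV. ip Ht (\<lambda>z. f z $ i) (\<lambda>z. h z $ i))"
   unfolding ip_comp[OF f h, of undefined] sum_distrib_left by (simp only:)
 qed
qed

lemma pi_rep_component:
 assumes c1: "c1 \<in> complex_dual z1" and c2: "c2 \<in> complex_dual z2" and g: "g \<in> carrier G"
 shows "prep c1 c2 \<Theta> g f z $ k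
  = chi 0 (c2 (iota 0 (mat \<i>) 0 0)) g * (\<Sum>l\<in>UNIV. \<Theta> (p2 g) $ k $ l * tau c1 g (\<lambda>z. f z $ l) z)"
proof (cases "z \<in> \<D>")
 case True
 thus ?thesis
  by (simp add: pi_rep_chi[OF c1 c2 g] tau_rep_chi[OF c1 g] chi_split[of "c1 (E1 1)" "c2 (iota 0 (mat \<i>) 0 0)"]
    matrix_vector_mult_def sum_distrib_left mult_ac)
qed (simp add: pi_rep_def tau_rep_def)

text \<open>If one of the two kernels is not constant on the diagonal, then it shows that the exponent \<open>x1\<close> of
 an element of \<open>G\<close> is that of any element of \<open>B\<close> with the same action on a point. So the diagonal of
 the kernel of an intertwiner of \<open>B\<close> transforms under all of \<open>G\<close>.\<close>

lemma tau_intertwiner_extends: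
 fixes B :: "'g set"
 assumes ob: "ordered_basis rk C Ci" and B: "B = generate G (Exp ` borel rk C Ci)"
  and c1: "c1 \<in> complex_dual z1" and c1': "c1' \<in> complex_dual z1" and H: "is_unitarization \<D> G (tau c1) H"
  and H': "is_unitarization \<D> G (tau c1') H'" and bij: "bij_betw A (vecs H) (vecs H')"
  and add: "\<And>f h. f \<in> vecs H ==> h \<in> vecs H ==> A (\<lambda>z. f z + h z) = (\<lambda>z. A f z + A h z)"
  and scale: "\<And>c f. f \<in> vecs H ==> A (\<lambda>z. c *\<^sub>C f z) = (\<lambda>z. c *\<^sub>C A f z)"
  and ip: "\<And>f h. f \<in> vecs H ==> h \<in> vecs H ==> ip H' (A f) (A h) = ip H f h"
  and int: "\<And>g f. g \<in> B ==> f \<in> vecs H ==> A (tau c1 g f) = tau c1' g (A f)"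
  and g: "g \<in> carrier G" and f: "f \<in> vecs H"
 shows "A (tau c1 g f) = tau c1' g (A f)"
proof -
 interpret t: tau_space G T p p11 p21 p2 c1 H by unfold_locales (fact c1 H)+
 interpret t': tau_space G T p p11 p21 p2 c1' H' by unfold_locales (fact c1' H')+
 interpret ordered_basis rk C Ci by fact
 let ?co = "\<lambda>(_::unit) (x::complex). x"
 let ?t = "tau c1" and ?t' = "tau c1'"
 have Bc: "b \<in> carrier G" if "b \<in> B" for b
  using that unfolding B by (rule generate_lie_exp_mem[rotated]) (auto dest: borel_gtilde)
 have K: "kernel_isometry H H' ?co ?co A"
  by (intro kernel_isometry.intro kernel_isometry_axioms.intro t.reproducing_kernel_space_axioms
    t'.reproducing_kernel_space_axioms bij ip)
 interpret A: covariant_isometry G T p H ?co ?t "\<lambda>g. mat (chi (c1 (E1 1)) 0 g)" H' ?co ?t'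
   "\<lambda>g. mat (chi (c1' (E1 1)) 0 g)" A B
  by (intro covariant_isometry.intro covariant_isometry_axioms.intro t.covariant_space_axioms
    t'.covariant_space_axioms K subsetI Bc add scale int)
 define m where "m z w = A (t.kr w ()) z" for z w
 have m_ker: "A.ker z w $ i $ j = m z w" for z w i j by (simp add: A.ker_def m_def)
 have m_cov: "m (p b z) (p b z) = chi (c1' (E1 1)) 0 b * cnj (chi (c1 (E1 1)) 0 b) * m z z"
  if "b \<in> B" "z \<in> \<D>" for b z
 proof -
  have "A.ker (p b z) (p b z) $ () $ ()
    = (mat (chi (c1' (E1 1)) 0 b) ** A.ker z z ** adj (mat (chi (c1 (E1 1)) 0 b))) $ () $ ()"
   by (simp only: A.ker_covariant[OF that(1) that(2) that(2)])
  also have "\<dots> = chi (c1' (E1 1)) 0 b * cnj (chi (c1 (E1 1)) 0 b) * A.ker z z $ () $ ()"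
   by (rule unit_matrix_conjugate)
  finally show ?thesis by (simp add: m_ker)
 qed
 have diag: "m (p g z) (p g z) = chi (c1' (E1 1)) 0 g * cnj (chi (c1 (E1 1)) 0 g) * m z z"
  if g: "g \<in> carrier G" and z: "z \<in> \<D>" for g z
 proof (cases "Re (c1 (E1 1)) = 0 \<and> Re (c1' (E1 1)) = 0")
  case False
  obtain b where b: "b \<in> B" "p b z = p g z" using borel_transitive_pair[OF ob z p_mem[OF g z]] unfolding B by blast
  have "x1 b = x1 g"
   using False t.x1_determined[OF _ Bc[OF b(1)] g z b(2)] t'.x1_determined[OF _ Bc[OF b(1)] g z b(2)] by blast
  hence "chi c 0 b = chi c 0 g" for c by (simp add: chi_def)
  thus ?thesis using m_cov[OF b(1) z] b(2) by simp
 next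
  case True
  \<comment> \<open>Both kernels are constant by \<open>kr_constant\<close>: replacing first one and
    then the other point by the base point shows that \<open>m\<close> is constant on the
    diagonal.\<close>
  have const: "m z z = m base_point base_point" if z: "z \<in> \<D>" for z
  proof -
   have "m z z = A (t.kr base_point ()) z" using t.kr_constant[OF _ z] True by (simp add: m_def)
   also have "\<dots> = ip H' (A (t.kr base_point ())) (t'.kr z ())"
    using t'.kr_reproducing[OF z A.A_mem[OF t.kr_mem[OF base_point_siegel]], of "()" "()"] by simp
   also have "\<dots> = ip H' (A (t.kr base_point ())) (t'.kr base_point ())" using t'.kr_constant[OF _ z] True by simp
   also have "\<dots> = m base_point base_point"
    using t'.kr_reproducing[OF base_point_siegel A.A_mem[OF t.kr_mem[OF base_point_siegel]], of "()" "()"]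
    by (simp add: m_def)
   finally show ?thesis .
  qed
  have m0: "m base_point base_point \<noteq> 0"
  proof
   assume "m base_point base_point = 0"
   hence "A.ker base_point base_point = 0" by (simp add: vec_eq_iff m_ker)
   moreover have "A.ker base_point base_point \<noteq> 0"
    by (rule A.ker_base_nonzero) (use borel_transitive[OF ob] B in blast)
   ultimately show False by blast
  qed
  \<comment> \<open>The dilation belongs to \<open>B\<close> and multiplies the nonzero constant
    \<open>m\<close> by this exponential, which therefore is 1. Consequently the product of the two
    characters is trivial on all of \<open>G\<close>.\<close>
  have "exp (s *\<^sub>R (c1' (E1 1) + cnj (c1 (E1 1)))) = 1" for s
  proof -
   let ?b = "Exp (E1 s)"
   have b: "?b \<in> B" unfolding B by (rule borel_dilation[OF ob])
   have "chi (c1' (E1 1)) 0 ?b * cnj (chi (c1 (E1 1)) 0 ?b) = 1"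
    using m_cov[OF b base_point_siegel] const[OF p_mem[OF Bc[OF b] base_point_siegel]] m0 by simp
   thus ?thesis unfolding exp_scaleR_add_cnj by (simp add: chi_def x_dilation)
  qed
  hence e: "c1' (E1 1) + cnj (c1 (E1 1)) = 0" by (rule exp_scaleR_eq_1)
  have "chi (c1' (E1 1)) 0 g * cnj (chi (c1 (E1 1)) 0 g) = exp (x1 g *\<^sub>R (c1' (E1 1) + cnj (c1 (E1 1))))"
   unfolding exp_scaleR_add_cnj by (simp add: chi_def)
  thus ?thesis using const[OF p_mem[OF g z]] const[OF z] by (simp add: e)
 qed
 \<comment> \<open>Commuting with \<open>g\<close> means that conjugating \<open>A\<close> by
   \<open>g\<close> does not change it. By \<open>diag\<close> both operators have the same kernel
   on the diagonal, and polarization identifies them.\<close>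
 define A2 where "A2 f = ?t' (inv g) (A (?t g f))" for f
 have K2: "kernel_isometry H H' ?co ?co A2"
 proof (intro kernel_isometry.intro kernel_isometry_axioms.intro t.reproducing_kernel_space_axioms t'.reproducing_kernel_space_axioms)
  show "bij_betw A2 (vecs H) (vecs H')" unfolding A2_def
   using bij_betw_trans[OF bij_betw_trans[OF t.bij_rho[OF g] bij] t'.bij_rho[OF inv_closed[OF g]]] by (simp add: o_def)
  show "ip H' (A2 f) (A2 h) = ip H f h" if "f \<in> vecs H" "h \<in> vecs H" for f h
   using that g by (simp add: A2_def t'.rho_ip ip t.rho_ip t.rho_mem A.A_mem)
 qed
 interpret A2: kernel_isometry H H' ?co ?co A2 by (rule K2)
 have gi: "chi c 0 (inv g) * chi c 0 g = 1" for c
  using chi_mult[OF inv_closed[OF g] g, of c 0] g by (simp add: chi_one)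
 have ker2: "A2.ker z z = A.ker z z" if z: "z \<in> \<D>" for z
 proof -
  have "A2.ker z z $ i $ j = A.ker z z $ i $ j" for i j
  proof -
   have gz: "p g z \<in> \<D>" by (rule p_mem[OF g z])
   have kg: "?t g (t.kr z ()) = (\<lambda>w. cnj (chi (c1 (E1 1)) 0 (inv g)) *\<^sub>C t.kr (p g z) () w)"
    unfolding t.rho_kr[OF g z] by (simp add: UNIV_unit mat_def)
   have "A2.ker z z $ i $ j = A2 (t.kr z ()) z" by (simp add: A2.ker_def)
   also have "\<dots> = chi (c1' (E1 1)) 0 (inv g) * A (?t g (t.kr z ())) (p g z)"
    by (simp add: A2_def tau_rep_chi[OF c1' inv_closed[OF g] z] g)
   also have "\<dots> = chi (c1' (E1 1)) 0 (inv g) * (cnj (chi (c1 (E1 1)) 0 (inv g)) * m (p g z) (p g z))"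
    unfolding kg scale[OF t.kr_mem[OF gz]] by (simp add: m_def)
   also have "\<dots> = (chi (c1' (E1 1)) 0 (inv g) * chi (c1' (E1 1)) 0 g)
     * cnj (chi (c1 (E1 1)) 0 (inv g) * chi (c1 (E1 1)) 0 g) * m z z"
    unfolding diag[OF g z] by (simp add: mult_ac)
   finally show ?thesis by (simp add: gi m_ker)
  qed
  thus ?thesis by (simp add: vec_eq_iff)
 qed
 have "A2 f = A f"
 proof (rule kernel_isometry_eqI[OF K2 K _ f])
  fix z w :: "('n, 'r) point" assume z: "z \<in> \<D>" and w: "w \<in> \<D>"
  have "A2.ker z w $ i $ j = A.ker z w $ i $ j" for i j
   by (rule sesqui_eqI[OF A2.sesqui_ker A.sesqui_ker _ z w]) (simp add: ker2)
  thus "A2.ker z w = A.ker z w" by (simp add: vec_eq_iff)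
 qed
 hence "?t' g (?t' (inv g) (A (?t g f))) = ?t' g (A f)" by (simp add: A2_def)
 thus ?thesis by (simp add: t'.rho_inv[OF g A.A_mem[OF t.rho_mem[OF g f]]])
qed

end

section \<open>Operators between tensor products\<close>

lemma mv_scaleC_right: "A *v (c *\<^sub>C x) = c *\<^sub>C (A *v (x :: complex^'b::finite))"
 by (simp add: matrix_vector_mult_def vec_eq_iff sum_distrib_left mult_ac)

lemma unitary_orthogonal:
 fixes U :: "complex^'i::finite^'k::finite"
 assumes "adj U ** U = mat 1"
 shows "(\<Sum>k\<in>UNIV. cnj (U $ k $ j) * U $ k $ i) = (if j = i then 1 else 0)"
proof -
 have "(adj U ** U) $ j $ i = (if j = i then 1 else 0)" by (simp add: assms mat_def)
 thus ?thesis by (simp add: matrix_matrix_mult_def adjoint_matrix_def transpose_def)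
qed

text \<open>Mixing coordinates by an isometric matrix preserves the sum of the inner products, since
  the columns of \<open>U\<close> are orthonormal.\<close>

lemma (in hilbert_functions) ip_unitary_mix:
 fixes U :: "complex^'i::finite^'k::finite"
 assumes U: "adj U ** U = mat 1" and x: "\<And>i. x i \<in> vecs H" and y: "\<And>i. y i \<in> vecs H"
 shows "(\<Sum>k\<in>UNIV. ip H (\<lambda>z. \<Sum>i\<in>UNIV. U $ k $ i *\<^sub>C x i z) (\<lambda>z. \<Sum>i\<in>UNIV. U $ k $ i *\<^sub>C y i z))
  = (\<Sum>i\<in>UNIV. ip H (x i) (y i))"
proof -
 have s: "(\<lambda>z. \<Sum>i\<in>UNIV. U $ k $ i *\<^sub>C y i z) \<in> vecs H" for k by (intro sum_mem scale_mem y)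
 have "ip H (\<lambda>z. \<Sum>i\<in>UNIV. U $ k $ i *\<^sub>C x i z) (\<lambda>z. \<Sum>i\<in>UNIV. U $ k $ i *\<^sub>C y i z)
   = (\<Sum>i\<in>UNIV. \<Sum>j\<in>UNIV. cnj (U $ k $ j) * U $ k $ i * ip H (x i) (y j))" for k
  by (simp add: ip_sum_left ip_sum_right ip_scale_left ip_scale_right scale_mem x y s sum_distrib_left mult_ac)
 hence "(\<Sum>k\<in>UNIV. ip H (\<lambda>z. \<Sum>i\<in>UNIV. U $ k $ i *\<^sub>C x i z) (\<lambda>z. \<Sum>i\<in>UNIV. U $ k $ i *\<^sub>C y i z))
   = (\<Sum>k\<in>UNIV. \<Sum>i\<in>UNIV. \<Sum>j\<in>UNIV. cnj (U $ k $ j) * U $ k $ i * ip H (x i) (y j))" by (simp only:)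
 also have "\<dots> = (\<Sum>i\<in>UNIV. \<Sum>k\<in>UNIV. \<Sum>j\<in>UNIV. cnj (U $ k $ j) * U $ k $ i * ip H (x i) (y j))"
  by (rule sum.swap)
 also have "\<dots> = (\<Sum>i\<in>UNIV. \<Sum>j\<in>UNIV. \<Sum>k\<in>UNIV. cnj (U $ k $ j) * U $ k $ i * ip H (x i) (y j))"
  by (intro sum.cong[OF refl] sum.swap)
 also have "\<dots> = (\<Sum>i\<in>UNIV. \<Sum>j\<in>UNIV. (if j = i then 1 else 0) * ip H (x i) (y j))"
  by (simp only: unitary_orthogonal[OF U] flip: sum_distrib_right)
 also have "\<dots> = (\<Sum>i\<in>UNIV. ip H (x i) (y i))" by (simp add: if_distrib if_distribR cong: if_cong)
 finally show ?thesis .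
qed

text \<open>Injectivity comes for free: an isometric linear map has trivial kernel.\<close>

lemma unitarily_equivalentI:
 assumes H: "hilbert_function_space H" and H': "hilbert_function_space H'" and im: "A ` vecs H = vecs H'"
  and add: "\<And>f h. f \<in> vecs H ==> h \<in> vecs H ==> A (\<lambda>z. f z + h z) = (\<lambda>z. A f z + A h z)"
  and scale: "\<And>c f. f \<in> vecs H ==> A (\<lambda>z. c *\<^sub>C f z) = (\<lambda>z. c *\<^sub>C A f z)"
  and iso: "\<And>f h. f \<in> vecs H ==> h \<in> vecs H ==> ip H' (A f) (A h) = ip H f h"
  and int: "\<And>g f. g \<in> S ==> f \<in> vecs H ==> A (\<rho> g f) = \<rho>' g (A f)"
 shows "unitarily_equivalent S \<rho> H \<rho>' H'"
proof -
 interpret H: hilbert_functions H by unfold_locales (fact H)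
 interpret H': hilbert_functions H' by unfold_locales (fact H')
 have "inj_on A (vecs H)"
 proof (rule inj_onI)
  fix f h assume f: "f \<in> vecs H" and h: "h \<in> vecs H" and eq: "A f = A h"
  let ?d = "\<lambda>z. f z + (- 1) *\<^sub>C h z"
  have d: "?d \<in> vecs H" by (intro H.add_mem H.scale_mem f h)
  have "A ?d = (\<lambda>_. 0)" unfolding add[OF f H.scale_mem[OF h]] scale[OF h] eq by (simp add: scaleC.minus_left)
  hence "ip H ?d ?d = 0" using iso[OF d d] H'.ip_zero_left[OF H'.zero_mem] by simp
  hence "?d = (\<lambda>_. 0)" using H.ip_self_eq_0[OF d] by blast
  from fun_cong[OF this] show "f = h" by (intro ext) (simp add: scaleC.minus_left)
 qed
 hence "bij_betw A (vecs H) (vecs H')" using im by (simp add: bij_betw_def)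
 thus ?thesis unfolding unitarily_equivalent_def by (intro exI[of _ A] conjI allI ballI add scale iso int)
qed

lemma unitarily_equivalentE:
 assumes "unitarily_equivalent S \<rho> H \<rho>' H'"
 obtains A where "bij_betw A (vecs H) (vecs H')"
  "\<And>f h. f \<in> vecs H ==> h \<in> vecs H ==> A (\<lambda>z. f z + h z) = (\<lambda>z. A f z + A h z)"
  "\<And>c f. f \<in> vecs H ==> A (\<lambda>z. c *\<^sub>C f z) = (\<lambda>z. c *\<^sub>C A f z)"
  "\<And>f h. f \<in> vecs H ==> h \<in> vecs H ==> ip H' (A f) (A h) = ip H f h"
  "\<And>g f. g \<in> S ==> f \<in> vecs H ==> A (\<rho> g f) = \<rho>' g (A f)"
proof -
 from assms[unfolded unitarily_equivalent_def] obtain A where A: "bij_betw A (vecs H) (vecs H')"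
  "\<forall>f\<in>vecs H. \<forall>h\<in>vecs H. A (\<lambda>z. f z + h z) = (\<lambda>z. A f z + A h z)"
  "\<forall>c. \<forall>f\<in>vecs H. A (\<lambda>z. c *\<^sub>C f z) = (\<lambda>z. c *\<^sub>C A f z)" "\<forall>f\<in>vecs H. \<forall>h\<in>vecs H. ip H' (A f) (A h) = ip H f h"
  "\<forall>g\<in>S. \<forall>f\<in>vecs H. A (\<rho> g f) = \<rho>' g (A f)" by (elim exE conjE)
 show thesis by (rule that[OF A(1) A(2)[rule_format] A(3)[rule_format] A(4)[rule_format] A(5)[rule_format]])
qed

lemma (in hilbert_functions) additive_sum:
 assumes "\<And>f h. f \<in> vecs H ==> h \<in> vecs H ==> A (\<lambda>z. f z + h z) = (\<lambda>z. A f z + A h z)"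
  and "\<And>c f. f \<in> vecs H ==> A (\<lambda>z. c *\<^sub>C f z) = (\<lambda>z. c *\<^sub>C A f z)" and "\<And>i. f i \<in> vecs H"
 shows "A (\<lambda>z. \<Sum>i\<in>I. c i *\<^sub>C f i z) = (\<lambda>z. \<Sum>i\<in>I. c i *\<^sub>C (A (f i) z))"
proof -
 have 0: "A (\<lambda>_. 0) = (\<lambda>_. 0)" using assms(2)[OF zero_mem, of 0] by (simp add: scaleC.zero_left)
 show ?thesis
 proof (induction I rule: infinite_finite_induct)
  case (insert x I)
  have "A (\<lambda>z. c x *\<^sub>C f x z + (\<Sum>i\<in>I. c i *\<^sub>C f i z)) = (\<lambda>z. A (\<lambda>z. c x *\<^sub>C f x z) z + A (\<lambda>z. \<Sum>i\<in>I. c i *\<^sub>C f i z) z)"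
   by (intro assms(1) scale_mem sum_mem assms(3))
  thus ?case using insert by (simp add: assms(2)[OF assms(3)])
 qed (simp_all add: 0)
qed

text \<open>The data shared by both directions: \<open>H\<close> and \<open>H'\<close> consist of
  vectors over \<open>Ht\<close> and \<open>Ht'\<close>, up to the factors \<open>\<kappa>\<close>
  and \<open>\<kappa>'\<close> of the inner products, and \<open>L\<close> is a unitary intertwiner
  of \<open>\<Theta>\<close> and \<open>\<Theta>'\<close>.\<close>

locale pi_pair = siegel_projections G T p p11 p21 p2 for G :: "'g monoid" (structure) and T :: "'g topology"
  and p :: "'g => ('n::finite, 'r::finite) point => ('n, 'r) point"
  and p11 p21 :: "'g => 'g" and p2 :: "'g => complex^'r^'r" +
 fixes c1 c1' c2 :: "('n, 'r) lie_matrix => complex"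
  and \<Theta> :: "complex^'r^'r => complex^'d::finite^'d" and \<Theta>' :: "complex^'r^'r => complex^'e::finite^'e"
  and H :: "(('n, 'r) point, complex^'d) function_space" and H' :: "(('n, 'r) point, complex^'e) function_space"
  and Ht Ht' :: "(('n, 'r) point, complex) function_space" and \<kappa> \<kappa>' :: real and L :: "complex^'d^'e"
 assumes c1: "c1 \<in> complex_dual z1" and c1': "c1' \<in> complex_dual z1" and c2: "c2 \<in> complex_dual z2"
  and irr: "irreducible_unitary_rep \<Theta>" and \<kappa>: "\<kappa> > 0" "\<kappa>' > 0"
  and mem: "f \<in> vecs H \<longleftrightarrow> (\<forall>i. (\<lambda>z. f z $ i) \<in> vecs Ht)"
  and mem': "f' \<in> vecs H' \<longleftrightarrow> (\<forall>i. (\<lambda>z. f' z $ i) \<in> vecs Ht')" and ip: "f \<in> vecs H ==> h \<in> vecs H ==>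
   ip H f h = complex_of_real \<kappa> * (\<Sum>i\<in>UNIV. ip Ht (\<lambda>z. f z $ i) (\<lambda>z. h z $ i))"
  and ip': "f' \<in> vecs H' ==> h' \<in> vecs H' ==>
   ip H' f' h' = complex_of_real \<kappa>' * (\<Sum>i\<in>UNIV. ip Ht' (\<lambda>z. f' z $ i) (\<lambda>z. h' z $ i))"
  and Ht: "is_unitarization \<D> G (tau c1) Ht" and Ht': "is_unitarization \<D> G (tau c1') Ht'"
  and L: "adj L ** L = mat 1" "L ** adj L = mat 1" and L_comm: "a \<in> carrier SU ==> L ** \<Theta> a = \<Theta>' a ** L"
  and H: "hilbert_function_space H" and H': "hilbert_function_space H'"
begin

sublocale t: tau_space G T p p11 p21 p2 c1 Ht by unfold_locales (fact c1 Ht)+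
sublocale t': tau_space G T p p11 p21 p2 c1' Ht' by unfold_locales (fact c1' Ht')+

abbreviation "\<pi> \<equiv> prep c1 c2 \<Theta>"
abbreviation "\<pi>' \<equiv> prep c1' c2 \<Theta>'"
abbreviation "\<tau> \<equiv> tau c1"
abbreviation "\<tau>' \<equiv> tau c1'"
abbreviation "ch g \<equiv> chi 0 (c2 (iota 0 (mat \<i>) 0 0)) g"

lemma pi_vec: "g \<in> carrier G ==> \<pi> g f z = ch g *\<^sub>C (\<Theta> (p2 g) *v (\<chi> l. \<tau> g (\<lambda>z. f z $ l) z))"
 by (simp add: vec_eq_iff pi_rep_component[OF c1 c2] matrix_vector_mult_def)

lemma pi_vec': "g \<in> carrier G ==> \<pi>' g f z = ch g *\<^sub>C (\<Theta>' (p2 g) *v (\<chi> l. \<tau>' g (\<lambda>z. f z $ l) z))"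
 by (simp add: vec_eq_iff pi_rep_component[OF c1' c2] matrix_vector_mult_def)

lemma tau'_sum: "\<tau>' g (\<lambda>z. \<Sum>i\<in>I. c i * f i z) z = (\<Sum>i\<in>I. c i * \<tau>' g (f i) z)"
 by (simp add: tau_rep_def sum_distrib_left mult_ac)

lemma adjoint_L_cancel: "adj L *v (L *v x) = x" "L *v (adj L *v y) = y"
 by (simp_all add: matrix_vector_mul_assoc L)

lemma mix_mem':
 assumes "\<And>i. a i \<in> vecs Ht'"
 shows "(\<lambda>z. L *v (\<chi> i. a i z)) \<in> vecs H'" unfolding mem'
proof
 fix k
 have "(\<lambda>z. \<Sum>i\<in>UNIV. L $ k $ i *\<^sub>C a i z) \<in> vecs Ht'" by (intro t'.sum_mem t'.scale_mem assms)
 thus "(\<lambda>z. (L *v (\<chi> i. a i z)) $ k) \<in> vecs Ht'" by (simp add: matrix_vector_mult_def)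
qed

lemma mix_ip':
 assumes a: "\<And>i. a i \<in> vecs Ht'" and b: "\<And>i. b i \<in> vecs Ht'"
 shows "ip H' (\<lambda>z. L *v (\<chi> i. a i z)) (\<lambda>z. L *v (\<chi> i. b i z)) = complex_of_real \<kappa>' * (\<Sum>i\<in>UNIV. ip Ht' (a i) (b i))"
proof -
 have "(L *v (\<chi> i. a i z)) $ k = (\<Sum>i\<in>UNIV. L $ k $ i *\<^sub>C a i z)" for k z and a :: "'d => ('n, 'r) point => complex"
  by (simp add: matrix_vector_mult_def)
 thus ?thesis unfolding ip'[OF mix_mem'[OF a] mix_mem'[OF b]] by (simp only: t'.ip_unitary_mix[OF L(1) a b])
qed

text \<open>The operator is the tensor product of \<open>a\<close> with \<open>L\<close>: it applies
  \<open>a\<close> to every coordinate and mixes the coordinates by \<open>L\<close>. The constant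
  \<open>c\<close> compensates the factors \<open>\<kappa>\<close> and \<open>\<kappa>'\<close> of
  the two inner products.\<close>

lemma lift_equivalence:
 assumes "unitarily_equivalent (carrier G) \<tau> Ht \<tau>' Ht'"
 shows "unitarily_equivalent (carrier G) \<pi> H \<pi>' H'"
proof -
 obtain a where bij: "bij_betw a (vecs Ht) (vecs Ht')"
  and add: "\<And>f h. f \<in> vecs Ht ==> h \<in> vecs Ht ==> a (\<lambda>z. f z + h z) = (\<lambda>z. a f z + a h z)"
  and scale: "\<And>c f. f \<in> vecs Ht ==> a (\<lambda>z. c *\<^sub>C f z) = (\<lambda>z. c *\<^sub>C a f z)"
  and iso: "\<And>f h. f \<in> vecs Ht ==> h \<in> vecs Ht ==> ip Ht' (a f) (a h) = ip Ht f h"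
  and int: "\<And>g f. g \<in> carrier G ==> f \<in> vecs Ht ==> a (\<tau> g f) = \<tau>' g (a f)"
  using unitarily_equivalentE[OF assms] by blast
 define c where "c = complex_of_real (sqrt (\<kappa> / \<kappa>'))"
 have c0: "c \<noteq> 0" using \<kappa> by (simp add: c_def)
 have "\<kappa>' * (cmod c)\<^sup>2 = \<kappa>" using \<kappa> by (simp add: c_def)
 hence cc: "complex_of_real \<kappa>' * (c * cnj c) = complex_of_real \<kappa>"
  by (simp only: complex_norm_square[symmetric] of_real_mult[symmetric])
 have am: "a f \<in> vecs Ht'" if "f \<in> vecs Ht" for f using bij that by (auto simp: bij_betw_def)
 define A where "A f = (\<lambda>z. L *v (\<chi> i. c *\<^sub>C a (\<lambda>z. f z $ i) z))" for f
 have fm: "(\<lambda>z. f z $ i) \<in> vecs Ht" if "f \<in> vecs H" for f i using that unfolding mem by blast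
 have cm: "(\<lambda>z. c *\<^sub>C a (\<lambda>z. f z $ i) z) \<in> vecs Ht'" if "f \<in> vecs H" for f i
  by (intro t'.scale_mem am fm that)
 show ?thesis
 proof (rule unitarily_equivalentI[OF H H', of A])
  show "A ` vecs H = vecs H'"
  proof
   show "A ` vecs H \<subseteq> vecs H'" unfolding A_def by (intro image_subsetI mix_mem' cm)
   show "vecs H' \<subseteq> A ` vecs H"
   proof
    fix f' assume f': "f' \<in> vecs H'"
    define b where "b i = (\<lambda>z. inverse c *\<^sub>C ((adj L *v f' z) $ i))" for i
    have bm: "b i \<in> vecs Ht'" for i
    proof -
     have "(\<lambda>z. f' z $ k) \<in> vecs Ht'" for k using f' unfolding mem' by blast
     hence "(\<lambda>z. \<Sum>k\<in>UNIV. adj L $ i $ k *\<^sub>C f' z $ k) \<in> vecs Ht'" by (intro t'.sum_mem t'.scale_mem)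
     from t'.scale_mem[OF this, of "inverse c"] show ?thesis by (simp add: b_def matrix_vector_mult_def)
    qed
    have "\<exists>f. f \<in> vecs Ht \<and> a f = b i" for i using bij bm[of i] unfolding bij_betw_def by (metis imageE)
    then obtain f where f: "\<And>i. f i \<in> vecs Ht" "\<And>i. a (f i) = b i" by metis
    have "(\<lambda>z. \<chi> i. f i z) \<in> vecs H" unfolding mem by (simp add: f(1))
    moreover have "A (\<lambda>z. \<chi> i. f i z) = f'"
    proof
     fix z
     have "A (\<lambda>z. \<chi> i. f i z) z = L *v (\<chi> i. c *\<^sub>C b i z)" by (simp add: A_def f(2))
     also have "(\<chi> i. c *\<^sub>C b i z) = adj L *v f' z" using c0 by (simp add: vec_eq_iff b_def)
     finally show "A (\<lambda>z. \<chi> i. f i z) z = f' z" by (simp add: adjoint_L_cancel)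
    qed
    ultimately show "f' \<in> A ` vecs H" by blast
   qed
  qed
  show "A (\<lambda>z. f z + h z) = (\<lambda>z. A f z + A h z)" if "f \<in> vecs H" "h \<in> vecs H" for f h
  proof -
   have "(\<chi> i. c *\<^sub>C a (\<lambda>z. f z $ i + h z $ i) z) = (\<chi> i. c *\<^sub>C a (\<lambda>z. f z $ i) z) + (\<chi> i. c *\<^sub>C a (\<lambda>z. h z $ i) z)" for z
    by (simp add: add[OF fm[OF that(1)] fm[OF that(2)]] vec_eq_iff distrib_left)
   thus ?thesis by (simp add: A_def mv.add_right)
  qed
  show "A (\<lambda>z. d *\<^sub>C f z) = (\<lambda>z. d *\<^sub>C A f z)" if "f \<in> vecs H" for d f
  proof
   fix z
   have "(\<chi> i. c *\<^sub>C a (\<lambda>z. d *\<^sub>C f z $ i) z) = d *\<^sub>C (\<chi> i. c *\<^sub>C a (\<lambda>z. f z $ i) z)"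
    using scale[OF fm[OF that]] by (simp add: vec_eq_iff)
   thus "A (\<lambda>z. d *\<^sub>C f z) z = d *\<^sub>C A f z" by (simp add: A_def mv_scaleC_right)
  qed
  show "ip H' (A f) (A h) = ip H f h" if f: "f \<in> vecs H" and h: "h \<in> vecs H" for f h
  proof -
   have "ip H' (A f) (A h) = complex_of_real \<kappa>' * (\<Sum>i\<in>UNIV.
     ip Ht' (\<lambda>z. c *\<^sub>C a (\<lambda>z. f z $ i) z) (\<lambda>z. c *\<^sub>C a (\<lambda>z. h z $ i) z))"
    unfolding A_def by (rule mix_ip'[OF cm[OF f] cm[OF h]])
   also have "(\<Sum>i\<in>UNIV. ip Ht' (\<lambda>z. c *\<^sub>C a (\<lambda>z. f z $ i) z) (\<lambda>z. c *\<^sub>C a (\<lambda>z. h z $ i) z))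
     = (\<Sum>i\<in>UNIV. c * (cnj c * ip Ht (\<lambda>z. f z $ i) (\<lambda>z. h z $ i)))"
    by (intro sum.cong[OF refl]) (simp only: t'.ip_scale_left[OF am[OF fm[OF f]] t'.scale_mem[OF am[OF fm[OF h]]]]
     t'.ip_scale_right[OF am[OF fm[OF h]] am[OF fm[OF f]]] iso[OF fm[OF f] fm[OF h]])
   also have "complex_of_real \<kappa>' * \<dots> = (complex_of_real \<kappa>' * (c * cnj c)) * (\<Sum>i\<in>UNIV. ip Ht (\<lambda>z. f z $ i) (\<lambda>z. h z $ i))"
    by (simp only: sum_distrib_left mult.assoc)
   finally show ?thesis unfolding cc ip[OF f h] .
  qed
  show "A (\<pi> g f) = \<pi>' g (A f)" if g: "g \<in> carrier G" and f: "f \<in> vecs H" for g f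
  proof
   fix z
   define t where "t = (\<chi> l. \<tau>' g (a (\<lambda>z. f z $ l)) z)"
   have tm: "\<tau> g (\<lambda>z. f z $ l) \<in> vecs Ht" for l by (rule t.rho_mem[OF g fm[OF f]])
   have "a (\<lambda>z. \<pi> g f z $ i) z = ch g * (\<Theta> (p2 g) *v t) $ i" for i
   proof -
    have "(\<lambda>z. \<pi> g f z $ i) = (\<lambda>z. \<Sum>l\<in>UNIV. (ch g * \<Theta> (p2 g) $ i $ l) *\<^sub>C \<tau> g (\<lambda>z. f z $ l) z)"
     by (simp add: pi_rep_component[OF c1 c2 g] sum_distrib_left mult.assoc)
    hence "a (\<lambda>z. \<pi> g f z $ i) = (\<lambda>z. \<Sum>l\<in>UNIV. (ch g * \<Theta> (p2 g) $ i $ l) *\<^sub>C (a (\<tau> g (\<lambda>z. f z $ l)) z))"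
     by (simp only: t.additive_sum[of a, OF add scale tm])
    thus ?thesis by (simp add: int[OF g fm[OF f]] t_def matrix_vector_mult_def sum_distrib_left mult.assoc)
   qed
   hence "A (\<pi> g f) z = L *v ((c * ch g) *\<^sub>C (\<Theta> (p2 g) *v t))" by (simp add: A_def scaleC_vec_def mult.assoc)
   also have "\<dots> = (c * ch g) *\<^sub>C ((L ** \<Theta> (p2 g)) *v t)"
    by (simp only: mv_scaleC_right matrix_vector_mul_assoc)
   also have "\<dots> = ch g *\<^sub>C (\<Theta>' (p2 g) *v (c *\<^sub>C (L *v t)))" unfolding L_comm[OF p2_SU[OF g]]
    by (simp add: mv_scaleC_right matrix_vector_mul_assoc[symmetric] scaleC_scaleC mult.commute)
   also have "c *\<^sub>C (L *v t) = (\<chi> l. \<tau>' g (\<lambda>z. A f z $ l) z)"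
   proof -
    have "\<tau>' g (\<lambda>z. A f z $ l) z = (\<Sum>i\<in>UNIV. (L $ l $ i * c) * \<tau>' g (a (\<lambda>z. f z $ i)) z)" for l
     unfolding tau'_sum[symmetric] by (simp add: A_def matrix_vector_mult_def mult.assoc)
    thus ?thesis by (simp add: vec_eq_iff t_def matrix_vector_mult_def sum_distrib_left mult_ac)
   qed
   finally show "A (\<pi> g f) z = \<pi>' g (A f) z" unfolding pi_vec'[OF g] .
  qed
 qed
qed

text \<open>The last hypothesis says that \<open>A\<close> is a tensor product of \<open>a\<close>
  with \<open>L\<close>. Scalar functions are placed in an arbitrary fixed component
  \<open>e\<close>; linearity, isometry and intertwining of \<open>a\<close> are then those of
  \<open>A\<close>, with \<open>L\<close> undone by its adjoint. The constant \<open>c\<close> is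
  the reciprocal of the one in \<open>lift_equivalence\<close>.\<close>

lemma descend_equivalence:
 assumes bij: "bij_betw A (vecs H) (vecs H')"
  and add: "\<And>f h. f \<in> vecs H ==> h \<in> vecs H ==> A (\<lambda>z. f z + h z) = (\<lambda>z. A f z + A h z)"
  and scale: "\<And>c f. f \<in> vecs H ==> A (\<lambda>z. c *\<^sub>C f z) = (\<lambda>z. c *\<^sub>C A f z)"
  and iso: "\<And>f h. f \<in> vecs H ==> h \<in> vecs H ==> ip H' (A f) (A h) = ip H f h"
  and int: "\<And>g f. g \<in> carrier G ==> f \<in> vecs H ==> A (\<pi> g f) = \<pi>' g (A f)"
  and a: "\<And>f z. f \<in> vecs H ==> A f z = L *v (\<chi> i. a (\<lambda>z. f z $ i) z)"
 shows "unitarily_equivalent (carrier G) \<tau> Ht \<tau>' Ht'"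
proof -
 define c where "c = complex_of_real (sqrt (\<kappa>' / \<kappa>))"
 have c0: "c \<noteq> 0" using \<kappa> by (simp add: c_def)
 have "\<kappa> * (cmod c)\<^sup>2 = \<kappa>'" using \<kappa> by (simp add: c_def)
 hence cc: "complex_of_real \<kappa> * (c * cnj c) = complex_of_real \<kappa>'"
  by (simp only: complex_norm_square[symmetric] of_real_mult[symmetric])
 have Am: "A f \<in> vecs H'" if "f \<in> vecs H" for f using bij that by (auto simp: bij_betw_def)
 define e :: 'd where "e = undefined"
 have ax: "(\<lambda>z. axis e (\<phi> z)) \<in> vecs H" if \<phi>: "\<phi> \<in> vecs Ht" for \<phi> unfolding mem
 proof
  fix i
  show "(\<lambda>z. axis e (\<phi> z) $ i) \<in> vecs Ht" using \<phi> t.zero_mem by (cases "i = e") (simp_all add: axis_def)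
 qed
 have inv: "(\<chi> i. a (\<lambda>z. f z $ i) z) = adj L *v A f z" if "f \<in> vecs H" for f z
  by (simp add: a[OF that] adjoint_L_cancel)
 have aeq: "a (\<lambda>z. f z $ i) z = (\<Sum>k\<in>UNIV. adj L $ i $ k * A f z $ k)" if "f \<in> vecs H" for f z i
  using arg_cong[OF inv[OF that, of z], of "\<lambda>v. v $ i"] by (simp add: matrix_vector_mult_def)
 have am': "a (\<lambda>z. f z $ i) \<in> vecs Ht'" if f: "f \<in> vecs H" for f i
 proof -
  have "(\<lambda>z. A f z $ k) \<in> vecs Ht'" for k using Am[OF f] unfolding mem' by blast
  hence "(\<lambda>z. \<Sum>k\<in>UNIV. adj L $ i $ k *\<^sub>C A f z $ k) \<in> vecs Ht'" by (intro t'.sum_mem t'.scale_mem)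
  moreover have "a (\<lambda>z. f z $ i) = (\<lambda>z. \<Sum>k\<in>UNIV. adj L $ i $ k *\<^sub>C A f z $ k)"
   unfolding scaleC_complex_eq by (rule ext) (rule aeq[OF f])
  ultimately show ?thesis by (simp only:)
 qed
 have am: "a \<phi> \<in> vecs Ht'" if "\<phi> \<in> vecs Ht" for \<phi> using am'[OF ax[OF that], of e] by simp
 have aax: "a \<phi> z = (\<Sum>k\<in>UNIV. adj L $ e $ k * A (\<lambda>z. axis e (\<phi> z)) z $ k)" if "\<phi> \<in> vecs Ht" for \<phi> z
 proof -
  have "a (\<lambda>z. axis e (\<phi> z) $ e) z = (\<Sum>k\<in>UNIV. adj L $ e $ k * A (\<lambda>z. axis e (\<phi> z)) z $ k)"
   by (rule aeq[OF ax[OF that]])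
  thus ?thesis by simp
 qed
 have a_scale: "a (\<lambda>z. d * \<phi> z) = (\<lambda>z. d * a \<phi> z)" if \<phi>: "\<phi> \<in> vecs Ht" for d \<phi>
 proof
  fix z
  have d: "(\<lambda>z. d * \<phi> z) \<in> vecs Ht" using t.scale_mem[OF \<phi>, of d] by simp
  show "a (\<lambda>z. d * \<phi> z) z = d * a \<phi> z"
   unfolding aax[OF d] aax[OF \<phi>] axis_scaleC scale[OF ax[OF \<phi>]] by (simp add: sum_distrib_left mult_ac)
 qed
 have a0: "a (\<lambda>z. 0) = (\<lambda>z. 0)" using a_scale[OF t.zero_mem, of 0] by simp
 have Aax: "A (\<lambda>z. axis e (\<phi> z)) z = L *v axis e (a \<phi> z)" if "\<phi> \<in> vecs Ht" for \<phi> z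
 proof -
  have "(\<chi> i. a (\<lambda>z. axis e (\<phi> z) $ i) z) = axis e (a \<phi> z)" using a0 by (auto simp: vec_eq_iff axis_def)
  thus ?thesis using a[OF ax[OF that], of z] by simp
 qed
 define a' where "a' \<phi> = (\<lambda>z. c *\<^sub>C a \<phi> z)" for \<phi>
 show ?thesis
 proof (rule unitarily_equivalentI[OF t.hilbert t'.hilbert, of a'])
  show "a' ` vecs Ht = vecs Ht'"
  proof
   show "a' ` vecs Ht \<subseteq> vecs Ht'" unfolding a'_def by (intro image_subsetI t'.scale_mem am)
   show "vecs Ht' \<subseteq> a' ` vecs Ht"
   proof
    fix \<psi> assume \<psi>: "\<psi> \<in> vecs Ht'"
    have fm: "(\<lambda>z. L *v (\<chi> i. if i = e then inverse c *\<^sub>C \<psi> z else 0)) \<in> vecs H'"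
    proof (rule mix_mem')
     show "(\<lambda>z. if i = e then inverse c *\<^sub>C \<psi> z else 0) \<in> vecs Ht'" for i
      using t'.scale_mem[OF \<psi>, of "inverse c"] t'.zero_mem by (cases "i = e") simp_all
    qed
    have "A ` vecs H = vecs H'" using bij by (simp add: bij_betw_def)
    with fm obtain f where f: "f \<in> vecs H" "A f = (\<lambda>z. L *v (\<chi> i. if i = e then inverse c *\<^sub>C \<psi> z else 0))"
     by (metis (no_types, lifting) imageE)
    have "a (\<lambda>z. f z $ e) z = inverse c *\<^sub>C \<psi> z" for z
     using arg_cong[OF inv[OF f(1), of z], of "\<lambda>v. v $ e"] by (simp add: f(2) adjoint_L_cancel)
    hence "a' (\<lambda>z. f z $ e) = \<psi>" using c0 by (intro ext) (simp add: a'_def)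
    moreover have "(\<lambda>z. f z $ e) \<in> vecs Ht" using f(1) unfolding mem by blast
    ultimately show "\<psi> \<in> a' ` vecs Ht" by blast
   qed
  qed
  show "a' (\<lambda>z. f z + h z) = (\<lambda>z. a' f z + a' h z)" if f: "f \<in> vecs Ht" and h: "h \<in> vecs Ht" for f h
   by (rule ext) (simp add: a'_def aax[OF t.add_mem[OF f h]] aax[OF f] aax[OF h] axis_add add[OF ax[OF f] ax[OF h]]
     distrib_left sum.distrib)
  show "a' (\<lambda>z. d *\<^sub>C f z) = (\<lambda>z. d *\<^sub>C a' f z)" if "f \<in> vecs Ht" for d f
   by (rule ext) (simp add: a'_def a_scale[OF that])
  show "ip Ht' (a' f) (a' h) = ip Ht f h" if f: "f \<in> vecs Ht" and h: "h \<in> vecs Ht" for f h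
  proof -
   let ?x = "\<lambda>f i. if i = e then a f else (\<lambda>_. 0)"
   have s: "(\<Sum>i\<in>UNIV. ip Ht (\<lambda>z. axis e (f z) $ i) (\<lambda>z. axis e (h z) $ i)) = ip Ht f h"
   proof -
    have "(\<Sum>i\<in>UNIV. ip Ht (\<lambda>z. axis e (f z) $ i) (\<lambda>z. axis e (h z) $ i))
      = (\<Sum>i\<in>{e}. ip Ht (\<lambda>z. axis e (f z) $ i) (\<lambda>z. axis e (h z) $ i))"
     by (rule sum.mono_neutral_right) (auto simp: axis_def t.ip_zero_left t.zero_mem)
    thus ?thesis by simp
   qed
   have "complex_of_real \<kappa> * ip Ht f h = ip H (\<lambda>z. axis e (f z)) (\<lambda>z. axis e (h z))"
    unfolding ip[OF ax[OF f] ax[OF h]] s ..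
   also have "\<dots> = ip H' (A (\<lambda>z. axis e (f z))) (A (\<lambda>z. axis e (h z)))"
    by (rule iso[OF ax[OF f] ax[OF h], symmetric])
   also have "\<dots> = ip H' (\<lambda>z. L *v (\<chi> i. ?x f i z)) (\<lambda>z. L *v (\<chi> i. ?x h i z))"
   proof -
    have "A (\<lambda>z. axis e (f z)) = (\<lambda>z. L *v (\<chi> i. ?x f i z))" if "f \<in> vecs Ht" for f
     using that by (intro ext) (simp add: Aax, intro arg_cong[of _ _ "(*v) L"], simp add: vec_eq_iff axis_def)
    thus ?thesis using f h by simp
   qed
   also have "\<dots> = complex_of_real \<kappa>' * (\<Sum>i\<in>UNIV. ip Ht' (?x f i) (?x h i))"
    by (rule mix_ip') (use am f h t'.zero_mem in auto)
   also have "(\<Sum>i\<in>UNIV. ip Ht' (?x f i) (?x h i)) = (\<Sum>i\<in>{e}. ip Ht' (?x f i) (?x h i))"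
    by (rule sum.mono_neutral_right) (auto simp: t'.ip_zero_left t'.zero_mem)
   finally have e: "complex_of_real \<kappa> * ip Ht f h = complex_of_real \<kappa>' * ip Ht' (a f) (a h)" by simp
   have "ip Ht' (a' f) (a' h) = c * (cnj c * ip Ht' (a f) (a h))"
    unfolding a'_def by (simp only: t'.ip_scale_left[OF am[OF f] t'.scale_mem[OF am[OF h]]] t'.ip_scale_right[OF am[OF h] am[OF f]])
   hence "complex_of_real \<kappa> * ip Ht' (a' f) (a' h) = complex_of_real \<kappa> * ip Ht f h"
    unfolding e cc[symmetric] by (simp add: mult_ac)
   thus ?thesis using \<kappa> by simp
  qed
  show "a' (\<tau> g \<phi>) = \<tau>' g (a' \<phi>)" if g: "g \<in> carrier G" and \<phi>: "\<phi> \<in> vecs Ht" for g \<phi>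
  proof
   fix z
   have t\<phi>: "\<tau> g \<phi> \<in> vecs Ht" by (rule t.rho_mem[OF g \<phi>])
   have un: "adj (\<Theta> (p2 g)) ** \<Theta> (p2 g) = mat 1"
    using irr p2_SU[OF g] by (simp add: irreducible_unitary_rep_def unitary_matrix_def)
   have tax: "(\<chi> l. \<tau>'' (\<lambda>z. axis e (\<phi> z) $ l)) = axis e (\<tau>'' \<phi>)"
    if "\<tau>'' (\<lambda>_. 0) = 0" for \<tau>'' :: "(('n, 'r) point => complex) => complex"
    using that by (simp add: vec_eq_iff axis_def)
   have "A (\<pi> g (\<lambda>z. axis e (\<phi> z))) z = L *v (ch g *\<^sub>C (\<Theta> (p2 g) *v axis e (a (\<tau> g \<phi>) z)))"
   proof -
    have comp: "(\<lambda>z. \<pi> g (\<lambda>z. axis e (\<phi> z)) z $ i) = (\<lambda>z. (ch g * \<Theta> (p2 g) $ i $ e) * \<tau> g \<phi> z)" for i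
    proof
     fix z
     have "(\<chi> l. \<tau> g (\<lambda>z. axis e (\<phi> z) $ l) z) = axis e (\<tau> g \<phi> z)"
      by (rule tax[of "\<lambda>f. \<tau> g f z"]) (simp add: tau_rep_def)
     thus "\<pi> g (\<lambda>z. axis e (\<phi> z)) z $ i = (ch g * \<Theta> (p2 g) $ i $ e) * \<tau> g \<phi> z"
      unfolding pi_vec[OF g] by (simp add: matrix_vector_mult_def axis_def if_distrib cong: if_cong)
    qed
    have pm: "\<pi> g (\<lambda>z. axis e (\<phi> z)) \<in> vecs H" unfolding mem comp using t.scale_mem[OF t\<phi>] by simp
    have "a (\<lambda>z. \<pi> g (\<lambda>z. axis e (\<phi> z)) z $ i) z = (ch g *\<^sub>C (\<Theta> (p2 g) *v axis e (a (\<tau> g \<phi>) z))) $ i" for i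
     unfolding comp a_scale[OF t\<phi>] by (simp add: matrix_vector_mult_def axis_def if_distrib cong: if_cong)
    hence "(\<chi> i. a (\<lambda>z. \<pi> g (\<lambda>z. axis e (\<phi> z)) z $ i) z) = ch g *\<^sub>C (\<Theta> (p2 g) *v axis e (a (\<tau> g \<phi>) z))"
     by (simp only: vec_nth_inverse)
    thus ?thesis unfolding a[OF pm] by (simp only:)
   qed
   moreover have "\<pi>' g (A (\<lambda>z. axis e (\<phi> z))) z = ch g *\<^sub>C (\<Theta>' (p2 g) *v (L *v axis e (\<tau>' g (a \<phi>) z)))"
   proof -
    have "\<tau>' g (\<lambda>z. A (\<lambda>z. axis e (\<phi> z)) z $ l) z = (L *v axis e (\<tau>' g (a \<phi>) z)) $ l" for l
     unfolding Aax[OF \<phi>] by (simp add: matrix_vector_mult_def axis_def tau_rep_def if_distrib cong: if_cong)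
    thus ?thesis unfolding pi_vec'[OF g] by simp
   qed
   ultimately have "L *v (ch g *\<^sub>C (\<Theta> (p2 g) *v axis e (a (\<tau> g \<phi>) z)))
     = ch g *\<^sub>C (\<Theta>' (p2 g) *v (L *v axis e (\<tau>' g (a \<phi>) z)))" using int[OF g ax[OF \<phi>]] by simp
   also have "\<dots> = L *v (ch g *\<^sub>C (\<Theta> (p2 g) *v axis e (\<tau>' g (a \<phi>) z)))"
   proof -
    have "\<Theta>' (p2 g) *v (L *v x) = L *v (\<Theta> (p2 g) *v x)" for x
     by (simp add: matrix_vector_mul_assoc L_comm[OF p2_SU[OF g]])
    thus ?thesis by (simp add: mv_scaleC_right)
   qed
   finally have "adj L *v (L *v (ch g *\<^sub>C (\<Theta> (p2 g) *v axis e (a (\<tau> g \<phi>) z))))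
     = adj L *v (L *v (ch g *\<^sub>C (\<Theta> (p2 g) *v axis e (\<tau>' g (a \<phi>) z))))" by simp
   hence "inverse (ch g) *\<^sub>C (ch g *\<^sub>C (\<Theta> (p2 g) *v axis e (a (\<tau> g \<phi>) z)))
     = inverse (ch g) *\<^sub>C (ch g *\<^sub>C (\<Theta> (p2 g) *v axis e (\<tau>' g (a \<phi>) z)))" unfolding adjoint_L_cancel by simp
   hence "\<Theta> (p2 g) *v axis e (a (\<tau> g \<phi>) z) = \<Theta> (p2 g) *v axis e (\<tau>' g (a \<phi>) z)" by (simp add: scaleC_scaleC)
   hence "adj (\<Theta> (p2 g)) *v (\<Theta> (p2 g) *v axis e (a (\<tau> g \<phi>) z))
     = adj (\<Theta> (p2 g)) *v (\<Theta> (p2 g) *v axis e (\<tau>' g (a \<phi>) z))" by simp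
   hence "axis e (a (\<tau> g \<phi>) z) $ e = axis e (\<tau>' g (a \<phi>) z) $ e" unfolding matrix_vector_mul_assoc un by simp
   hence "a (\<tau> g \<phi>) z = \<tau>' g (a \<phi>) z" by simp
   thus "a' (\<tau> g \<phi>) z = \<tau>' g (a' \<phi>) z" by (simp add: a'_def tau_rep_def)
  qed
 qed
qed

end

section \<open>The two implications\<close>

context siegel_projections
begin

text \<open>The kernel of an intertwiner is shown to be a scalar kernel \<open>m\<close> times a
  fixed unitary matrix \<open>L\<close>. So the intertwiner itself is a tensor product, and its
  scalar factor \<open>a\<close> descends to the unitarizations of \<open>tau\<close>.\<close>

lemma pi_equivalence_imp:
 fixes \<Theta> :: "complex^'r^'r => complex^'d::finite^'d" and \<Theta>' :: "complex^'r^'r => complex^'e::finite^'e"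
 assumes P: "pi_space G T p p11 p21 p2 c1 c2 \<Theta> H" and P': "pi_space G T p p11 p21 p2 c1' c2' \<Theta>' H'"
  and Ht: "is_unitarization \<D> G (tau c1) Ht" and Ht': "is_unitarization \<D> G (tau c1') Ht'"
  and equiv: "unitarily_equivalent (carrier G) (prep c1 c2 \<Theta>) H (prep c1' c2' \<Theta>') H'"
 shows "c2 = c2'" "SU_rep_equiv \<Theta> \<Theta>'" "unitarily_equivalent (carrier G) (tau c1) Ht (tau c1') Ht'"
proof -
 interpret P: pi_space G T p p11 p21 p2 c1 c2 \<Theta> H by fact
 interpret P': pi_space G T p p11 p21 p2 c1' c2' \<Theta>' H' by fact
 let ?\<pi> = "prep c1 c2 \<Theta>" and ?\<pi>' = "prep c1' c2' \<Theta>'"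
 let ?co = "\<lambda>i x. x $ i" and ?o = "base_point :: ('n, 'r) point"
 obtain A where bij: "bij_betw A (vecs H) (vecs H')"
  and add: "\<And>f h. f \<in> vecs H ==> h \<in> vecs H ==> A (\<lambda>z. f z + h z) = (\<lambda>z. A f z + A h z)"
  and scale: "\<And>c f. f \<in> vecs H ==> A (\<lambda>z. c *\<^sub>C f z) = (\<lambda>z. c *\<^sub>C A f z)"
  and iso: "\<And>f h. f \<in> vecs H ==> h \<in> vecs H ==> ip H' (A f) (A h) = ip H f h"
  and int: "\<And>g f. g \<in> carrier G ==> f \<in> vecs H ==> A (?\<pi> g f) = ?\<pi>' g (A f)"
  using unitarily_equivalentE[OF equiv] by blast
 interpret A: covariant_isometry G T p H ?co ?\<pi> "\<lambda>g. chi P.ga P.de g *\<^sub>C \<Theta> (p2 g)" H' ?co ?\<pi>'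
   "\<lambda>g. chi P'.ga P'.de g *\<^sub>C \<Theta>' (p2 g)" A "carrier G"
  by (intro covariant_isometry.intro covariant_isometry_axioms.intro P.covariant_space_axioms
    P'.covariant_space_axioms kernel_isometry.intro kernel_isometry_axioms.intro P.reproducing_kernel_space_axioms
    P'.reproducing_kernel_space_axioms subset_refl bij add scale iso int)
 define M where "M = A.ker ?o ?o"
 have M0: "M \<noteq> 0" unfolding M_def by (rule A.ker_base_nonzero[OF G_transitive])
 have cov: "A.ker (p g ?o) (p g ?o) = (chi P'.ga P'.de g * cnj (chi P.ga P.de g)) *\<^sub>C
   (\<Theta>' (p2 g) ** M ** adj (\<Theta> (p2 g)))" if g: "g \<in> carrier G" for g
  unfolding A.ker_covariant[OF g base_point_siegel base_point_siegel] M_def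
  by (simp add: adjoint_scaleC mm_scaleC_left mm_scaleC_right scaleC_scaleC mult.commute)
 have iso_cov: "M = (chi P'.ga P'.de (Exp (iota 0 K 0 0)) * cnj (chi P.ga P.de (Exp (iota 0 K 0 0)))) *\<^sub>C
   (\<Theta>' (p2 (Exp (iota 0 K 0 0))) ** M ** adj (\<Theta> (p2 (Exp (iota 0 K 0 0)))))" if K: "K \<in> skew_hermitian" for K
  using cov[OF lie_exp_mem[OF iota_K_gtilde[OF K]]] unfolding p_isotropy[OF K] M_def[symmetric] .
 \<comment> \<open>The elements of \<open>exp z2\<close> fix the base point and are trivial under
   \<open>p2\<close>, so they only multiply the nonzero matrix \<open>M\<close> by a product of
   characters.\<close>
 have "exp (t *\<^sub>R (P'.de + cnj P.de)) = 1" for t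
 proof -
  let ?e = "exp (t *\<^sub>R P'.de) * cnj (exp (t *\<^sub>R P.de))"
  have "M = ?e *\<^sub>C M" using iso_cov[OF skew_hermitian_mat[of t]] unfolding p2_E2 P.Theta_one P'.Theta_one
   by (simp only: adjoint_mat complex_cnj_one mat_1_mult_complex chi_def x_E2 scaleR_zero_left add_0)
  hence "(1 - ?e) *\<^sub>C M = 0" by (simp add: scaleC.diff_left)
  hence "cmod (1 - ?e) * norm M = 0" by (metis norm_scaleC norm_zero)
  hence "cmod (1 - ?e) = 0" using M0 by simp
  thus ?thesis unfolding exp_scaleR_add_cnj by simp
 qed
 hence "P'.de + cnj P.de = 0" by (rule exp_scaleR_eq_1)
 hence de: "P.de = P'.de" using P.de_imaginary by (simp add: complex_eq_iff)
 show c2_eq: "c2 = c2'" by (rule complex_dual_z2_eqI[OF P.c2 P'.c2 de])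
 have comm: "M ** \<Theta> a = \<Theta>' a ** M" if a: "a \<in> carrier SU" for a
 proof (rule isotropy_intertwiner[OF P.irr P'.irr _ a])
  fix K :: "complex^'r^'r" assume K: "K \<in> skew_hermitian"
  let ?g = "Exp (iota 0 K 0 0)"
  have "chi P'.ga P'.de ?g = chi P.ga P.de ?g" by (simp add: chi_def x1_isotropy K de)
  moreover have "cmod (chi P.ga P.de ?g) = 1" by (simp add: norm_chi x1_isotropy K P.de_imaginary)
  ultimately have "chi P'.ga P'.de ?g * cnj (chi P.ga P.de ?g) = 1"
   by (simp only: complex_norm_square[symmetric]) simp
  thus "\<Theta>' (p2 ?g) ** M ** adj (\<Theta> (p2 ?g)) = M" using iso_cov[OF K] by simp
 qed
 obtain m0 L where M_eq: "M = m0 *\<^sub>C L" and L: "adj L ** L = mat 1" "L ** adj L = mat 1"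
  and L_comm: "\<And>a. a \<in> carrier SU ==> L ** \<Theta> a = \<Theta>' a ** L"
  using schur_equivalence[OF P.irr P'.irr M0 comm] by metis
 show "SU_rep_equiv \<Theta> \<Theta>'" unfolding SU_rep_equiv_def using L L_comm by blast
 have diag: "\<exists>m. A.ker z z = m *\<^sub>C L" if z: "z \<in> \<D>" for z
 proof -
  obtain g where g: "g \<in> carrier G" "p g ?o = z" using G_transitive[OF z] by blast
  have "\<Theta>' (p2 g) ** L ** adj (\<Theta> (p2 g)) = L ** (\<Theta> (p2 g) ** adj (\<Theta> (p2 g)))"
   by (simp add: L_comm[OF p2_SU[OF g(1)], symmetric] matrix_mul_assoc)
  also have "\<dots> = L" by (simp add: unitary_commute[OF P.Theta_unitary[OF p2_SU[OF g(1)]]])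
  finally have "A.ker z z = (chi P'.ga P'.de g * cnj (chi P.ga P.de g) * m0) *\<^sub>C L"
   using cov[OF g(1)] unfolding g(2) M_eq by (simp add: mm_scaleC_left mm_scaleC_right scaleC_scaleC)
  thus ?thesis by blast
 qed
 have "L \<noteq> 0" using M0 M_eq by (auto simp: scaleC.zero_right)
 then obtain k l where kl: "L $ k $ l \<noteq> 0" by (auto simp: vec_eq_iff)
 \<comment> \<open>The scalar factor of the kernel is normalized at an entry where \<open>L\<close>
   does not vanish.\<close>
 define m where "m z w = A.ker z w $ k $ l / L $ k $ l" for z w
 have ker: "A.ker z w $ i $ j = m z w * L $ i $ j" if z: "z \<in> \<D>" and w: "w \<in> \<D>" for z w i j
 proof -
  have "A.ker z w $ i $ j = (L $ i $ j / L $ k $ l) * A.ker z w $ k $ l"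
  proof (rule sesqui_eqI[OF A.sesqui_ker sesqui_scale[OF A.sesqui_ker] _ z w])
   fix z :: "('n, 'r) point" assume "z \<in> \<D>"
   then obtain x where "A.ker z z = x *\<^sub>C L" using diag by blast
   thus "A.ker z z $ i $ j = L $ i $ j / L $ k $ l * A.ker z z $ k $ l" using kl by simp
  qed
  thus ?thesis by (simp add: m_def)
 qed
 obtain \<kappa> where ka: "\<kappa> > 0" "\<And>f. f \<in> vecs H \<longleftrightarrow> (\<forall>i. (\<lambda>z. f z $ i) \<in> vecs Ht)"
  "\<And>f h. f \<in> vecs H ==> h \<in> vecs H ==>
   ip H f h = complex_of_real \<kappa> * (\<Sum>i\<in>UNIV. ip Ht (\<lambda>z. f z $ i) (\<lambda>z. h z $ i))"
  by (rule pi_structure[OF P.c1 P.c2 P.irr P.unitarization Ht]) (rule that)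
 obtain \<kappa>' where kb: "\<kappa>' > 0" "\<And>f. f \<in> vecs H' \<longleftrightarrow> (\<forall>i. (\<lambda>z. f z $ i) \<in> vecs Ht')"
  "\<And>f h. f \<in> vecs H' ==> h \<in> vecs H' ==>
   ip H' f h = complex_of_real \<kappa>' * (\<Sum>i\<in>UNIV. ip Ht' (\<lambda>z. f z $ i) (\<lambda>z. h z $ i))"
  by (rule pi_structure[OF P'.c1 P'.c2 P'.irr P'.unitarization Ht']) (rule that)
 interpret pi_pair G T p p11 p21 p2 c1 c1' c2 \<Theta> \<Theta>' H H' Ht Ht' \<kappa> \<kappa>' L
  by unfold_locales (fact P.c1 P'.c1 P.c2 P.irr ka kb Ht Ht' L L_comm P.hilbert P'.hilbert)+
 \<comment> \<open>\<open>a\<close> is the operator with kernel \<open>m\<close>, written as an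
   inner product with \<open>u z\<close>; the factor \<open>\<kappa>\<close> converts the inner
   product of \<open>Ht\<close> into that of \<open>H\<close>.\<close>
 define u where "u z = (\<lambda>w. if w \<in> \<D> then cnj (m z w) else 0)" for z
 define a where "a \<phi> = (\<lambda>z. if z \<in> \<D> then complex_of_real \<kappa> * ip Ht \<phi> (u z) else 0)" for \<phi>
 \<comment> \<open>Orthonormality of the columns of \<open>L\<close> isolates the coordinate
   \<open>i\<close> of the inverse images of kernel functions.\<close>
 have Ai: "(\<lambda>w. \<Sum>k\<in>UNIV. L $ k $ i *\<^sub>C A.Ai (P'.kr z k) w) = (\<lambda>w. axis i (u z w))" if z: "z \<in> \<D>" for z i
 proof
  fix w
  show "(\<Sum>k\<in>UNIV. L $ k $ i *\<^sub>C A.Ai (P'.kr z k) w) = axis i (u z w)"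
  proof (cases "w \<in> \<D>")
   case True
   have "(\<Sum>k\<in>UNIV. L $ k $ i *\<^sub>C A.Ai (P'.kr z k) w) $ j = axis i (u z w) $ j" for j
   proof -
    have "(\<Sum>k\<in>UNIV. L $ k $ i *\<^sub>C A.Ai (P'.kr z k) w) $ j = (\<Sum>k\<in>UNIV. L $ k $ i * cnj (m z w * L $ k $ j))"
     unfolding ker[OF z True, symmetric] A.ker_swap[OF z True] by simp
    also have "\<dots> = cnj (m z w) * (\<Sum>k\<in>UNIV. cnj (L $ k $ j) * L $ k $ i)"
     by (simp add: sum_distrib_left mult_ac)
    also have "\<dots> = axis i (u z w) $ j" using True by (simp add: unitary_orthogonal[OF L(1)] u_def axis_def)
    finally show ?thesis .
   qed
   thus ?thesis unfolding vec_eq_iff by blast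
  next
   case False
   thus ?thesis using P.vecs_outside[OF A.Ai_mem[OF P'.kr_mem[OF z]] False]
    by (simp add: u_def scaleC.zero_right vec_eq_iff axis_def)
  qed
 qed
 have uH: "(\<lambda>w. axis i (u z w)) \<in> vecs H" if z: "z \<in> \<D>" for z i
  unfolding Ai[OF z, symmetric] by (intro P.sum_mem P.scale_mem A.Ai_mem P'.kr_mem z)
 have uHt: "u z \<in> vecs Ht" if z: "z \<in> \<D>" for z
  using uH[OF z, of undefined, unfolded ka(2), THEN spec, of undefined] by simp
 have Aa: "A f z = L *v (\<chi> i. a (\<lambda>z. f z $ i) z)" if f: "f \<in> vecs H" for f z
 proof (cases "z \<in> \<D>")
  case True
  have "(adj L *v A f z) $ i = a (\<lambda>z. f z $ i) z" for i
  proof -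
   have "(adj L *v A f z) $ i = (\<Sum>k\<in>UNIV. cnj (L $ k $ i) * A f z $ k)"
    by (simp add: matrix_vector_mult_def adjoint_matrix_def transpose_def)
   also have "\<dots> = (\<Sum>k\<in>UNIV. cnj (L $ k $ i) * ip H f (A.Ai (P'.kr z k)))" by (simp only: A.A_eq_ip[OF f True])
   also have "\<dots> = ip H f (\<lambda>w. \<Sum>k\<in>UNIV. L $ k $ i *\<^sub>C A.Ai (P'.kr z k) w)"
    by (simp add: P.ip_sum_right P.ip_scale_right P.scale_mem A.Ai_mem P'.kr_mem True f)
   also have "\<dots> = complex_of_real \<kappa> * (\<Sum>j\<in>UNIV. ip Ht (\<lambda>w. f w $ j) (\<lambda>w. axis i (u z w) $ j))"
    unfolding Ai[OF True] by (rule ka(3)[OF f uH[OF True]])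
   also have "(\<Sum>j\<in>UNIV. ip Ht (\<lambda>w. f w $ j) (\<lambda>w. axis i (u z w) $ j))
     = (\<Sum>j\<in>{i}. ip Ht (\<lambda>w. f w $ j) (\<lambda>w. axis i (u z w) $ j))"
   proof (rule sum.mono_neutral_right)
    show "\<forall>j\<in>UNIV - {i}. ip Ht (\<lambda>w. f w $ j) (\<lambda>w. axis i (u z w) $ j) = 0"
    proof
     fix j assume "j \<in> UNIV - {i}"
     moreover have "(\<lambda>w. f w $ j) \<in> vecs Ht" using f unfolding ka(2) by blast
     ultimately show "ip Ht (\<lambda>w. f w $ j) (\<lambda>w. axis i (u z w) $ j) = 0"
      by (simp add: axis_def t.ip_zero_right)
    qed
   qed auto
   finally show ?thesis using True by (simp add: a_def)
  qed
  hence "(\<chi> i. a (\<lambda>z. f z $ i) z) = adj L *v A f z" unfolding vec_eq_iff by simp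
  thus ?thesis by (simp only: adjoint_L_cancel)
 next
  case False
  thus ?thesis using P'.vecs_outside[OF A.A_mem[OF f] False]
   by (simp add: a_def matrix_vector_mult_def vec_eq_iff)
 qed
 show "unitarily_equivalent (carrier G) (tau c1) Ht (tau c1') Ht'"
  by (rule descend_equivalence[OF bij add scale iso int[folded c2_eq] Aa])
qed

text \<open>The intertwiner over \<open>B\<close> extends to one over \<open>G\<close> by
  \<open>tau_intertwiner_extends\<close>, and is then tensored with the equivalence of
  \<open>\<Theta>\<close> and \<open>\<Theta>'\<close>.\<close>

lemma tau_equivalence_imp:
 fixes \<Theta> :: "complex^'r^'r => complex^'d::finite^'d" and \<Theta>' :: "complex^'r^'r => complex^'e::finite^'e"
 assumes P: "pi_space G T p p11 p21 p2 c1 c2 \<Theta> H" and P': "pi_space G T p p11 p21 p2 c1' c2 \<Theta>' H'"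
  and Ht: "is_unitarization \<D> G (tau c1) Ht" and Ht': "is_unitarization \<D> G (tau c1') Ht'"
  and ob: "ordered_basis rk C Ci" and B: "B = generate G (Exp ` borel rk C Ci)"
  and equiv: "unitarily_equivalent B (tau c1) Ht (tau c1') Ht'" and SU: "SU_rep_equiv \<Theta> \<Theta>'"
 shows "unitarily_equivalent (carrier G) (prep c1 c2 \<Theta>) H (prep c1' c2 \<Theta>') H'"
proof -
 interpret P: pi_space G T p p11 p21 p2 c1 c2 \<Theta> H by fact
 interpret P': pi_space G T p p11 p21 p2 c1' c2 \<Theta>' H' by fact
 obtain L where L: "adj L ** L = mat 1" "L ** adj L = mat 1"
  and L_comm: "\<And>a. a \<in> carrier SU ==> L ** \<Theta> a = \<Theta>' a ** L" using SU unfolding SU_rep_equiv_def by blast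
 obtain \<kappa> where ka: "\<kappa> > 0" "\<And>f. f \<in> vecs H \<longleftrightarrow> (\<forall>i. (\<lambda>z. f z $ i) \<in> vecs Ht)"
  "\<And>f h. f \<in> vecs H ==> h \<in> vecs H ==>
   ip H f h = complex_of_real \<kappa> * (\<Sum>i\<in>UNIV. ip Ht (\<lambda>z. f z $ i) (\<lambda>z. h z $ i))"
  by (rule pi_structure[OF P.c1 P.c2 P.irr P.unitarization Ht]) (rule that)
 obtain \<kappa>' where kb: "\<kappa>' > 0" "\<And>f. f \<in> vecs H' \<longleftrightarrow> (\<forall>i. (\<lambda>z. f z $ i) \<in> vecs Ht')"
  "\<And>f h. f \<in> vecs H' ==> h \<in> vecs H' ==>
   ip H' f h = complex_of_real \<kappa>' * (\<Sum>i\<in>UNIV. ip Ht' (\<lambda>z. f z $ i) (\<lambda>z. h z $ i))"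
  by (rule pi_structure[OF P'.c1 P'.c2 P'.irr P'.unitarization Ht']) (rule that)
 interpret pi_pair G T p p11 p21 p2 c1 c1' c2 \<Theta> \<Theta>' H H' Ht Ht' \<kappa> \<kappa>' L
  by unfold_locales (fact P.c1 P'.c1 P.c2 P.irr ka kb Ht Ht' L L_comm P.hilbert P'.hilbert)+
 obtain A where A: "bij_betw A (vecs Ht) (vecs Ht')"
  "\<And>f h. f \<in> vecs Ht ==> h \<in> vecs Ht ==> A (\<lambda>z. f z + h z) = (\<lambda>z. A f z + A h z)"
  "\<And>c f. f \<in> vecs Ht ==> A (\<lambda>z. c *\<^sub>C f z) = (\<lambda>z. c *\<^sub>C A f z)"
  "\<And>f h. f \<in> vecs Ht ==> h \<in> vecs Ht ==> ip Ht' (A f) (A h) = ip Ht f h"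
  "\<And>g f. g \<in> B ==> f \<in> vecs Ht ==> A (tau c1 g f) = tau c1' g (A f)"
  using unitarily_equivalentE[OF equiv] by blast
 have ext: "A (tau c1 g f) = tau c1' g (A f)" if "g \<in> carrier G" "f \<in> vecs Ht" for g f
  by (rule tau_intertwiner_extends[where A = A and g = g and f = f, OF ob B P.c1 P'.c1 Ht Ht']) (fact A that)+
 have "unitarily_equivalent (carrier G) (tau c1) Ht (tau c1') Ht'"
 proof (rule unitarily_equivalentI[OF t.hilbert t'.hilbert])
  show "A ` vecs Ht = vecs Ht'" using A(1) by (simp add: bij_betw_def)
  show "A (\<lambda>z. f z + h z) = (\<lambda>z. A f z + A h z)" if "f \<in> vecs Ht" "h \<in> vecs Ht" for f h
   by (rule A(2)[OF that])
  show "A (\<lambda>z. c *\<^sub>C f z) = (\<lambda>z. c *\<^sub>C A f z)" if "f \<in> vecs Ht" for c f by (rule A(3)[OF that])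
  show "ip Ht' (A f) (A h) = ip Ht f h" if "f \<in> vecs Ht" "h \<in> vecs Ht" for f h by (rule A(4)[OF that])
  show "A (tau c1 g f) = tau c1' g (A f)" if "g \<in> carrier G" "f \<in> vecs Ht" for g f by (rule ext[OF that])
 qed
 thus ?thesis by (rule lift_equivalence)
qed

end

lemma unitarily_equivalent_mono:
 assumes "unitarily_equivalent S \<rho> H \<rho>' H'" and S': "S' \<subseteq> S"
 shows "unitarily_equivalent S' \<rho> H \<rho>' H'"
proof -
 from assms(1)[unfolded unitarily_equivalent_def] obtain A where A: "bij_betw A (vecs H) (vecs H')"
  "\<forall>f\<in>vecs H. \<forall>h\<in>vecs H. A (\<lambda>z. f z + h z) = (\<lambda>z. A f z + A h z)"
  "\<forall>c. \<forall>f\<in>vecs H. A (\<lambda>z. c *\<^sub>C f z) = (\<lambda>z. c *\<^sub>C A f z)" "\<forall>f\<in>vecs H. \<forall>h\<in>vecs H. ip H' (A f) (A h) = ip H f h"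
  and int: "\<forall>g\<in>S. \<forall>f\<in>vecs H. A (\<rho> g f) = \<rho>' g (A f)" by (elim exE conjE)
 have "\<forall>g\<in>S'. \<forall>f\<in>vecs H. A (\<rho> g f) = \<rho>' g (A f)" using int S' by (simp add: subset_iff)
 with A show ?thesis unfolding unitarily_equivalent_def by (intro exI[of _ A] conjI)
qed

theorem theorem2:
  fixes G :: "'g monoid" and T :: "'g topology"
    and p :: "'g \<Rightarrow> ('n::finite, 'r::finite) point \<Rightarrow> ('n, 'r) point"
    and p11 p21 :: "'g \<Rightarrow> 'g" and p2 :: "'g \<Rightarrow> complex^'r^'r"
    and B :: "'g set"
    and c1 c1' c2 c2' :: "('n, 'r) lie_matrix \<Rightarrow> complex"
    and \<Theta> :: "complex^'r^'r \<Rightarrow> complex^'d::finite^'d"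
    and \<Theta>' :: "complex^'r^'r \<Rightarrow> complex^'e::finite^'e"
  assumes "CARD('n) \<ge> 3" and "CARD('r) \<ge> 2"
    and "universal_covering_of_Aut siegel_domain G T p"
    and "is_p11 G T p p11" and "is_p21 G T p p21" and "is_p2 G T p p2"
    and "maximal_triangular_subgroup G T p B"
    and "c1 \<in> complex_dual z1" and "c1' \<in> complex_dual z1"
    and "c2 \<in> complex_dual z2" and "c2' \<in> complex_dual z2"
    and "irreducible_unitary_rep \<Theta>" and "irreducible_unitary_rep \<Theta>'"
    and "unitarizable siegel_domain G (pi_rep G T p p11 p21 p2 c1 c2 \<Theta>)"
    and "unitarizable siegel_domain G (pi_rep G T p p11 p21 p2 c1' c2' \<Theta>')"
  shows "unitarizations_equivalent_on (carrier G) siegel_domain G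
           (pi_rep G T p p11 p21 p2 c1 c2 \<Theta>) (pi_rep G T p p11 p21 p2 c1' c2' \<Theta>')
      \<longleftrightarrow>
         unitarizations_equivalent_on B siegel_domain G
           (tau_rep G T p p11 c1) (tau_rep G T p p11 c1')
         \<and> c2 = c2' \<and> SU_rep_equiv \<Theta> \<Theta>'"
proof -
 interpret siegel_projections G T p p11 p21 p2
  using assms(3-6) by (simp add: siegel_projections_def siegel_cover_def siegel_projections_axioms_def)
 have un: "is_unitarization \<D> G \<rho> (unitarization \<D> G \<rho>)" if "is_unitarization \<D> G \<rho> H"
  for \<rho> :: "'g => (('n, 'r) point => 'w::complex_normed_vector) => ('n, 'r) point => 'w" and H
  unfolding unitarization_def using that by (rule someI)
 let ?H = "unitarization \<D> G (pi_rep G T p p11 p21 p2 c1 c2 \<Theta>)"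
  and ?H' = "unitarization \<D> G (pi_rep G T p p11 p21 p2 c1' c2' \<Theta>')"
 have H: "is_unitarization \<D> G (pi_rep G T p p11 p21 p2 c1 c2 \<Theta>) ?H"
  and H': "is_unitarization \<D> G (pi_rep G T p p11 p21 p2 c1' c2' \<Theta>') ?H'"
  using assms(14,15) un unfolding unitarizable_def by blast+
 interpret P: pi_space G T p p11 p21 p2 c1 c2 \<Theta> ?H by unfold_locales (fact assms H)+
 interpret P': pi_space G T p p11 p21 p2 c1' c2' \<Theta>' ?H' by unfold_locales (fact assms H')+
 \<comment> \<open>That \<open>tau\<close> has unitarizations at all comes from the components of
   those of \<open>\<pi>\<close>; the chosen ones are then unitarizations too.\<close>
 note Ht = un[OF P.tau_unitarization] and Ht' = un[OF P'.tau_unitarization]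
 obtain rk C Ci where B: "ordered_basis rk C Ci" "B = generate G (lie_exp G T p ` borel rk C Ci)"
  using maximal_triangular_borel[OF assms(7)] by blast
 have BG: "B \<subseteq> carrier G"
  unfolding B(2) using generate_lie_exp_mem ordered_basis.borel_gtilde[OF B(1)] by blast
 show ?thesis unfolding unitarizations_equivalent_on_def
 proof (intro iffI conjI)
  assume eq: "unitarily_equivalent (carrier G) (pi_rep G T p p11 p21 p2 c1 c2 \<Theta>) ?H
   (pi_rep G T p p11 p21 p2 c1' c2' \<Theta>') ?H'"
  note imp = pi_equivalence_imp[OF P.pi_space_axioms P'.pi_space_axioms Ht Ht' eq]
  show "unitarily_equivalent B (tau_rep G T p p11 c1) (unitarization \<D> G (tau_rep G T p p11 c1))
    (tau_rep G T p p11 c1') (unitarization \<D> G (tau_rep G T p p11 c1'))"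
   by (rule unitarily_equivalent_mono[OF imp(3) BG])
  show "c2 = c2'" "SU_rep_equiv \<Theta> \<Theta>'" by (fact imp)+
 next
  assume "unitarily_equivalent B (tau_rep G T p p11 c1) (unitarization \<D> G (tau_rep G T p p11 c1))
    (tau_rep G T p p11 c1') (unitarization \<D> G (tau_rep G T p p11 c1')) \<and> c2 = c2' \<and> SU_rep_equiv \<Theta> \<Theta>'"
  thus "unitarily_equivalent (carrier G) (pi_rep G T p p11 p21 p2 c1 c2 \<Theta>) ?H
   (pi_rep G T p p11 p21 p2 c1' c2' \<Theta>') ?H'"
   using tau_equivalence_imp[OF P.pi_space_axioms _ Ht Ht' B] P'.pi_space_axioms by blast
 qed
qed

end
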